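(* Let $\mathcal C$ be the tensor category of finite-dimensional modules over Sweedler's four-dimensional Hopf algebra $S$ over $\mathbb C$. Up to equivalence of left $\mathcal C$-module categories, the only indecomposable relatively projective left $\mathcal C$-module categories are the separable module categories $\mathcal C=\mathcal V_0$ and $\mathcal D=\mathcal S_0$. In particular, these are the only indecomposable separable left $\mathcal C$-module categories.
   Context: Sweedler's Hopf algebra over $\mathbb C$: $S=\mathbb C\langle x,g\mid x^2=0,\ g^2=1,\ gx=-xg\rangle$ with $\Delta(x)=x\otimes 1+g\otimes x$, $\Delta(g)=g\otimes g$, $\varepsilon(x)=0$, $\varepsilon(g)=1$, antipode $g\mapsto g$, $x\mapsto xg$. $\mathcal V_0=\mathcal C$ is the regular left $\mathcal C$-module category. $\mathcal S_0=\mathcal D$ is the category of finite-dimensional modules over the left coideal subalgebra $D=\mathbb C[x]/(x^2)\subset S$ generated by $x$, with $\mathcal C$-action $W\triangleright V=W\otimes V$ on which $a\in D$ acts through $\Delta(a)\in S\otimes D$. Left $\mathcal C$-module categories are finite (equivalent to finite-dimensional modules over a finite-dimensional $\mathbb C$-algebra). For an algebra $A$ in $\mathcal C$, $\mathbf{mod}_{\mathcal C}\text{-}A$ denotes right $A$-modules in $\mathcal C$ with left action $X\triangleright V=X\otimes V$. An algebra $A$ in $\mathcal C$ is relatively projective as a bimodule if the regular $A$-bimodule $A$ is a direct summand, as an $A$-bimodule in $\mathcal C$, of $A\otimes X\otimes A$ for some $X\in\mathcal C$; it is separable if its multiplication $A\otimes A\to A$ has a section as a morphism of $A$-bimodules in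 $\mathcal C$. A left $\mathcal C$-module category is relatively projective (resp. separable) if it is equivalent as a $\mathcal C$-module category to $\mathbf{mod}_{\mathcal C}\text{-}A$ for some algebra $A$ that is relatively projective as a bimodule (resp. separable). *)

theory Defs
  imports Complex_Main "Jordan_Normal_Form.Matrix"
begin

section \<open>Complex-linear categories, functors and equivalences\<close>

text \<open>Every arrow determines its domain and codomain, so the hom-sets are pairwise disjoint.\<close>

record ('o, 'a) category =
  Obj :: "'o set"
  Arr :: "'a set"
  Dom :: "'a \<Rightarrow> 'o"
  Cod :: "'a \<Rightarrow> 'o"
  Id :: "'o \<Rightarrow> 'a"
  Comp :: "'a \<Rightarrow> 'a \<Rightarrow> 'a" (infixl "\<cdot>\<index>" 70)

record ('o, 'a) lincat = "('o, 'a) category" +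
  Zero :: "'o \<Rightarrow> 'o \<Rightarrow> 'a"
  Add :: "'a \<Rightarrow> 'a \<Rightarrow> 'a"
  Smult :: "complex \<Rightarrow> 'a \<Rightarrow> 'a"

definition Hom :: "('o, 'a, 'z) category_scheme \<Rightarrow> 'o \<Rightarrow> 'o \<Rightarrow> 'a set"
  where "Hom C X Y = {f \<in> Arr C. Dom C f = X \<and> Cod C f = Y}"

locale category =
  fixes C :: "('o, 'a, 'z) category_scheme" (structure)
  assumes Dom_Obj: "f \<in> Arr C \<Longrightarrow> Dom C f \<in> Obj C"
    and Cod_Obj: "f \<in> Arr C \<Longrightarrow> Cod C f \<in> Obj C"
    and Id_Hom: "X \<in> Obj C \<Longrightarrow> Id C X \<in> Hom C X X"
    and Comp_Hom: "\<lbrakk>f \<in> Hom C X Y; g \<in> Hom C Y Z\<rbrakk> \<Longrightarrow> g \<cdot> f \<in> Hom C X Z"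
    and Id_left: "f \<in> Hom C X Y \<Longrightarrow> Id C Y \<cdot> f = f"
    and Id_right: "f \<in> Hom C X Y \<Longrightarrow> f \<cdot> Id C X = f"
    and Comp_assoc:
      "\<lbrakk>f \<in> Hom C W X; g \<in> Hom C X Y; h \<in> Hom C Y Z\<rbrakk> \<Longrightarrow> h \<cdot> g \<cdot> f = h \<cdot> (g \<cdot> f)"

locale linear_category = category C
  for C :: "('o, 'a, 'z) lincat_scheme" (structure) +
  assumes Zero_Hom: "\<lbrakk>X \<in> Obj C; Y \<in> Obj C\<rbrakk> \<Longrightarrow> Zero C X Y \<in> Hom C X Y"
    and Add_Hom: "\<lbrakk>f \<in> Hom C X Y; g \<in> Hom C X Y\<rbrakk> \<Longrightarrow> Add C f g \<in> Hom C X Y"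
    and Smult_Hom: "f \<in> Hom C X Y \<Longrightarrow> Smult C c f \<in> Hom C X Y"
    and Add_assoc: "\<lbrakk>f \<in> Hom C X Y; g \<in> Hom C X Y; h \<in> Hom C X Y\<rbrakk>
      \<Longrightarrow> Add C (Add C f g) h = Add C f (Add C g h)"
    and Add_commute: "\<lbrakk>f \<in> Hom C X Y; g \<in> Hom C X Y\<rbrakk> \<Longrightarrow> Add C f g = Add C g f"
    and Add_Zero: "f \<in> Hom C X Y \<Longrightarrow> Add C f (Zero C X Y) = f"
    and Add_inverse: "f \<in> Hom C X Y \<Longrightarrow> Add C f (Smult C (- 1) f) = Zero C X Y"
    and Smult_one: "f \<in> Hom C X Y \<Longrightarrow> Smult C 1 f = f"
    and Smult_Smult: "f \<in> Hom C X Y \<Longrightarrow> Smult C c (Smult C d f) = Smult C (c * d) f"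
    and Smult_Add_left:
      "f \<in> Hom C X Y \<Longrightarrow> Smult C (c + d) f = Add C (Smult C c f) (Smult C d f)"
    and Smult_Add_right: "\<lbrakk>f \<in> Hom C X Y; g \<in> Hom C X Y\<rbrakk>
      \<Longrightarrow> Smult C c (Add C f g) = Add C (Smult C c f) (Smult C c g)"
    and Comp_Add_left: "\<lbrakk>f \<in> Hom C X Y; g \<in> Hom C Y Z; h \<in> Hom C Y Z\<rbrakk>
      \<Longrightarrow> Add C g h \<cdot> f = Add C (g \<cdot> f) (h \<cdot> f)"
    and Comp_Add_right: "\<lbrakk>f \<in> Hom C X Y; g \<in> Hom C X Y; h \<in> Hom C Y Z\<rbrakk>
      \<Longrightarrow> h \<cdot> Add C f g = Add C (h \<cdot> f) (h \<cdot> g)"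
    and Comp_Smult_left: "\<lbrakk>f \<in> Hom C X Y; g \<in> Hom C Y Z\<rbrakk>
      \<Longrightarrow> Smult C c g \<cdot> f = Smult C c (g \<cdot> f)"
    and Comp_Smult_right: "\<lbrakk>f \<in> Hom C X Y; g \<in> Hom C Y Z\<rbrakk>
      \<Longrightarrow> g \<cdot> Smult C c f = Smult C c (g \<cdot> f)"

definition iso_arr :: "('o, 'a, 'z) category_scheme \<Rightarrow> 'o \<Rightarrow> 'o \<Rightarrow> 'a \<Rightarrow> bool"
  where "iso_arr C X Y f \<longleftrightarrow> f \<in> Hom C X Y \<and>
    (\<exists>g \<in> Hom C Y X. Comp C g f = Id C X \<and> Comp C f g = Id C Y)"

definition linear_functor ::
  "('o, 'a, 'z) lincat_scheme \<Rightarrow> ('p, 'b, 'y) lincat_scheme \<Rightarrow> ('o \<Rightarrow> 'p) \<Rightarrow> ('a \<Rightarrow> 'b) \<Rightarrow> bool"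
  where "linear_functor C D Fo Fa \<longleftrightarrow>
    (\<forall>X \<in> Obj C. Fo X \<in> Obj D \<and> Fa (Id C X) = Id D (Fo X)) \<and>
    (\<forall>X \<in> Obj C. \<forall>Y \<in> Obj C. \<forall>f \<in> Hom C X Y. Fa f \<in> Hom D (Fo X) (Fo Y)) \<and>
    (\<forall>X \<in> Obj C. \<forall>Y \<in> Obj C. \<forall>Z \<in> Obj C. \<forall>f \<in> Hom C X Y. \<forall>g \<in> Hom C Y Z.
      Fa (Comp C g f) = Comp D (Fa g) (Fa f)) \<and>
    (\<forall>X \<in> Obj C. \<forall>Y \<in> Obj C. \<forall>f \<in> Hom C X Y. \<forall>g \<in> Hom C X Y.
      Fa (Add C f g) = Add D (Fa f) (Fa g)) \<and>
    (\<forall>X \<in> Obj C. \<forall>Y \<in> Obj C. \<forall>f \<in> Hom C X Y. \<forall>c. Fa (Smult C c f) = Smult D c (Fa f))"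

definition natural_iso ::
  "('o, 'a, 'z) lincat_scheme \<Rightarrow> ('p, 'b, 'y) lincat_scheme \<Rightarrow>
    ('o \<Rightarrow> 'p) \<Rightarrow> ('a \<Rightarrow> 'b) \<Rightarrow> ('o \<Rightarrow> 'p) \<Rightarrow> ('a \<Rightarrow> 'b) \<Rightarrow> ('o \<Rightarrow> 'b) \<Rightarrow> bool"
  where "natural_iso C D Fo Fa Go Ga \<eta> \<longleftrightarrow>
    (\<forall>X \<in> Obj C. iso_arr D (Fo X) (Go X) (\<eta> X)) \<and>
    (\<forall>X \<in> Obj C. \<forall>Y \<in> Obj C. \<forall>f \<in> Hom C X Y.
      Comp D (\<eta> Y) (Fa f) = Comp D (Ga f) (\<eta> X))"

definition is_equivalence ::
  "('o, 'a, 'z) lincat_scheme \<Rightarrow> ('p, 'b, 'y) lincat_scheme \<Rightarrow> ('o \<Rightarrow> 'p) \<Rightarrow> ('a \<Rightarrow> 'b) \<Rightarrow> bool"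
  where "is_equivalence C D Fo Fa \<longleftrightarrow> linear_functor C D Fo Fa \<and>
    (\<exists>Go Ga \<eta> \<epsilon>. linear_functor D C Go Ga \<and>
      natural_iso C C id id (Go \<circ> Fo) (Ga \<circ> Fa) \<eta> \<and>
      natural_iso D D (Fo \<circ> Go) (Fa \<circ> Ga) id id \<epsilon>)"

definition linear_equivalent ::
  "('o, 'a, 'z) lincat_scheme \<Rightarrow> ('p, 'b, 'y) lincat_scheme \<Rightarrow> bool"
  where "linear_equivalent C D \<longleftrightarrow> (\<exists>Fo Fa. is_equivalence C D Fo Fa)"


section \<open>Strict monoidal linear categories\<close>

text \<open>The monoidal categories used below live on the spaces \<open>\<complex>\<^sup>n\<close> and have strictly associative
  and unital Kronecker products, so associators and unitors of the monoidal category are left out.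
  Module categories and module functors keep their coherence isomorphisms.\<close>

record ('o, 'a) moncat = "('o, 'a) lincat" +
  TensO :: "'o \<Rightarrow> 'o \<Rightarrow> 'o" (infixr "\<otimes>\<index>" 75)
  TensA :: "'a \<Rightarrow> 'a \<Rightarrow> 'a" (infixr "\<boxtimes>\<index>" 75)
  Unit :: "'o" ("\<one>\<index>")

locale strict_monoidal_category = linear_category C
  for C :: "('o, 'a, 'z) moncat_scheme" (structure) +
  assumes Unit_Obj: "\<one> \<in> Obj C"
    and TensO_Obj: "\<lbrakk>X \<in> Obj C; Y \<in> Obj C\<rbrakk> \<Longrightarrow> X \<otimes> Y \<in> Obj C"
    and TensA_Hom: "\<lbrakk>f \<in> Hom C X Y; g \<in> Hom C X' Y'\<rbrakk> \<Longrightarrow> f \<boxtimes> g \<in> Hom C (X \<otimes> X') (Y \<otimes> Y')"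
    and TensA_Id: "\<lbrakk>X \<in> Obj C; Y \<in> Obj C\<rbrakk> \<Longrightarrow> Id C X \<boxtimes> Id C Y = Id C (X \<otimes> Y)"
    and TensA_Comp:
      "\<lbrakk>f \<in> Hom C X Y; g \<in> Hom C Y Z; f' \<in> Hom C X' Y'; g' \<in> Hom C Y' Z'\<rbrakk>
        \<Longrightarrow> (g \<cdot> f) \<boxtimes> (g' \<cdot> f') = (g \<boxtimes> g') \<cdot> (f \<boxtimes> f')"
    and TensA_Add_left: "\<lbrakk>f \<in> Hom C X Y; g \<in> Hom C X Y; h \<in> Hom C X' Y'\<rbrakk>
      \<Longrightarrow> Add C f g \<boxtimes> h = Add C (f \<boxtimes> h) (g \<boxtimes> h)"
    and TensA_Add_right: "\<lbrakk>f \<in> Hom C X' Y'; g \<in> Hom C X Y; h \<in> Hom C X Y\<rbrakk>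
      \<Longrightarrow> f \<boxtimes> Add C g h = Add C (f \<boxtimes> g) (f \<boxtimes> h)"
    and TensA_Smult_left: "\<lbrakk>f \<in> Hom C X Y; g \<in> Hom C X' Y'\<rbrakk>
      \<Longrightarrow> Smult C c f \<boxtimes> g = Smult C c (f \<boxtimes> g)"
    and TensA_Smult_right: "\<lbrakk>f \<in> Hom C X Y; g \<in> Hom C X' Y'\<rbrakk>
      \<Longrightarrow> f \<boxtimes> Smult C c g = Smult C c (f \<boxtimes> g)"
    and TensO_assoc: "\<lbrakk>X \<in> Obj C; Y \<in> Obj C; Z \<in> Obj C\<rbrakk> \<Longrightarrow> (X \<otimes> Y) \<otimes> Z = X \<otimes> (Y \<otimes> Z)"
    and TensA_assoc: "\<lbrakk>f \<in> Arr C; g \<in> Arr C; h \<in> Arr C\<rbrakk> \<Longrightarrow> (f \<boxtimes> g) \<boxtimes> h = f \<boxtimes> (g \<boxtimes> h)"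
    and Unit_TensO: "X \<in> Obj C \<Longrightarrow> \<one> \<otimes> X = X"
    and TensO_Unit: "X \<in> Obj C \<Longrightarrow> X \<otimes> \<one> = X"
    and Unit_TensA: "f \<in> Arr C \<Longrightarrow> Id C \<one> \<boxtimes> f = f"
    and TensA_Unit: "f \<in> Arr C \<Longrightarrow> f \<boxtimes> Id C \<one> = f"


section \<open>Algebras, modules and bimodules in a monoidal category\<close>

record ('o, 'a) alg =
  AObj :: "'o"
  AMult :: "'a"
  AUnit :: "'a"

definition algebra_in :: "('o, 'a, 'z) moncat_scheme \<Rightarrow> ('o, 'a) alg \<Rightarrow> bool"
  where "algebra_in C A \<longleftrightarrow>
    (let V = AObj A; m = AMult A; u = AUnit A; v = Id C V in
      V \<in> Obj C \<and> m \<in> Hom C (V \<otimes>\<^bsub>C\<^esub> V) V \<and> u \<in> Hom C \<one>\<^bsub>C\<^esub> V \<and>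
      m \<cdot>\<^bsub>C\<^esub> (m \<boxtimes>\<^bsub>C\<^esub> v) = m \<cdot>\<^bsub>C\<^esub> (v \<boxtimes>\<^bsub>C\<^esub> m) \<and>
      m \<cdot>\<^bsub>C\<^esub> (u \<boxtimes>\<^bsub>C\<^esub> v) = v \<and> m \<cdot>\<^bsub>C\<^esub> (v \<boxtimes>\<^bsub>C\<^esub> u) = v)"

definition right_module :: "('o, 'a, 'z) moncat_scheme \<Rightarrow> ('o, 'a) alg \<Rightarrow> 'o \<Rightarrow> 'a \<Rightarrow> bool"
  where "right_module C A V r \<longleftrightarrow>
    V \<in> Obj C \<and> r \<in> Hom C (V \<otimes>\<^bsub>C\<^esub> AObj A) V \<and>
    r \<cdot>\<^bsub>C\<^esub> (r \<boxtimes>\<^bsub>C\<^esub> Id C (AObj A)) = r \<cdot>\<^bsub>C\<^esub> (Id C V \<boxtimes>\<^bsub>C\<^esub> AMult A) \<and>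
    r \<cdot>\<^bsub>C\<^esub> (Id C V \<boxtimes>\<^bsub>C\<^esub> AUnit A) = Id C V"

definition left_module :: "('o, 'a, 'z) moncat_scheme \<Rightarrow> ('o, 'a) alg \<Rightarrow> 'o \<Rightarrow> 'a \<Rightarrow> bool"
  where "left_module C A V l \<longleftrightarrow>
    V \<in> Obj C \<and> l \<in> Hom C (AObj A \<otimes>\<^bsub>C\<^esub> V) V \<and>
    l \<cdot>\<^bsub>C\<^esub> (Id C (AObj A) \<boxtimes>\<^bsub>C\<^esub> l) = l \<cdot>\<^bsub>C\<^esub> (AMult A \<boxtimes>\<^bsub>C\<^esub> Id C V) \<and>
    l \<cdot>\<^bsub>C\<^esub> (AUnit A \<boxtimes>\<^bsub>C\<^esub> Id C V) = Id C V"

record ('o, 'a) bimod =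
  BObj :: "'o"
  BLeft :: "'a"
  BRight :: "'a"

definition bimodule :: "('o, 'a, 'z) moncat_scheme \<Rightarrow> ('o, 'a) alg \<Rightarrow> ('o, 'a) bimod \<Rightarrow> bool"
  where "bimodule C A B \<longleftrightarrow>
    left_module C A (BObj B) (BLeft B) \<and> right_module C A (BObj B) (BRight B) \<and>
    BRight B \<cdot>\<^bsub>C\<^esub> (BLeft B \<boxtimes>\<^bsub>C\<^esub> Id C (AObj A)) = BLeft B \<cdot>\<^bsub>C\<^esub> (Id C (AObj A) \<boxtimes>\<^bsub>C\<^esub> BRight B)"

definition bimodule_hom ::
  "('o, 'a, 'z) moncat_scheme \<Rightarrow> ('o, 'a) alg \<Rightarrow> ('o, 'a) bimod \<Rightarrow> ('o, 'a) bimod \<Rightarrow> 'a set"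
  where "bimodule_hom C A B B' = {f \<in> Hom C (BObj B) (BObj B').
    f \<cdot>\<^bsub>C\<^esub> BLeft B = BLeft B' \<cdot>\<^bsub>C\<^esub> (Id C (AObj A) \<boxtimes>\<^bsub>C\<^esub> f) \<and>
    f \<cdot>\<^bsub>C\<^esub> BRight B = BRight B' \<cdot>\<^bsub>C\<^esub> (f \<boxtimes>\<^bsub>C\<^esub> Id C (AObj A))}"

definition regular_bimodule :: "('o, 'a) alg \<Rightarrow> ('o, 'a) bimod"
  where "regular_bimodule A = \<lparr>BObj = AObj A, BLeft = AMult A, BRight = AMult A\<rparr>"

definition free_bimodule ::
  "('o, 'a, 'z) moncat_scheme \<Rightarrow> ('o, 'a) alg \<Rightarrow> 'o \<Rightarrow> ('o, 'a) bimod"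
  where "free_bimodule C A X =
    \<lparr>BObj = AObj A \<otimes>\<^bsub>C\<^esub> X \<otimes>\<^bsub>C\<^esub> AObj A,
     BLeft = AMult A \<boxtimes>\<^bsub>C\<^esub> Id C (X \<otimes>\<^bsub>C\<^esub> AObj A),
     BRight = Id C (AObj A \<otimes>\<^bsub>C\<^esub> X) \<boxtimes>\<^bsub>C\<^esub> AMult A\<rparr>"

text \<open>\<open>P\<close> is a direct summand of \<open>Q\<close>: there are a complementary bimodule \<open>R\<close> and bimodule morphisms
  exhibiting \<open>Q\<close> as the biproduct of \<open>P\<close> and \<open>R\<close>. (The mixed composites \<open>p \<cdot> j\<close> and \<open>q \<cdot> i\<close> vanish as
  a consequence of the three equations.)\<close>

definition bimodule_summand ::
  "('o, 'a, 'z) moncat_scheme \<Rightarrow> ('o, 'a) alg \<Rightarrow> ('o, 'a) bimod \<Rightarrow> ('o, 'a) bimod \<Rightarrow> bool"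
  where "bimodule_summand C A P Q \<longleftrightarrow>
    (\<exists>R i p j q. bimodule C A R \<and>
      i \<in> bimodule_hom C A P Q \<and> p \<in> bimodule_hom C A Q P \<and>
      j \<in> bimodule_hom C A R Q \<and> q \<in> bimodule_hom C A Q R \<and>
      p \<cdot>\<^bsub>C\<^esub> i = Id C (BObj P) \<and> q \<cdot>\<^bsub>C\<^esub> j = Id C (BObj R) \<and>
      Add C (i \<cdot>\<^bsub>C\<^esub> p) (j \<cdot>\<^bsub>C\<^esub> q) = Id C (BObj Q))"

definition relatively_projective_algebra :: "('o, 'a, 'z) moncat_scheme \<Rightarrow> ('o, 'a) alg \<Rightarrow> bool"
  where "relatively_projective_algebra C A \<longleftrightarrow>
    (\<exists>X \<in> Obj C. bimodule_summand C A (regular_bimodule A) (free_bimodule C A X))"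

definition separable_algebra :: "('o, 'a, 'z) moncat_scheme \<Rightarrow> ('o, 'a) alg \<Rightarrow> bool"
  where "separable_algebra C A \<longleftrightarrow>
    (\<exists>s \<in> bimodule_hom C A (regular_bimodule A)
        \<lparr>BObj = AObj A \<otimes>\<^bsub>C\<^esub> AObj A,
         BLeft = AMult A \<boxtimes>\<^bsub>C\<^esub> Id C (AObj A),
         BRight = Id C (AObj A) \<boxtimes>\<^bsub>C\<^esub> AMult A\<rparr>.
      AMult A \<cdot>\<^bsub>C\<^esub> s = Id C (AObj A))"

text \<open>An arrow of the category of right modules is a triple (domain, codomain, underlying arrow).\<close>

definition mod_lincat :: "('o, 'a, 'z) moncat_scheme \<Rightarrow> ('o, 'a) alg
    \<Rightarrow> ('o \<times> 'a, ('o \<times> 'a) \<times> ('o \<times> 'a) \<times> 'a) lincat"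
  where "mod_lincat C A =
    \<lparr>Obj = {(V, r). right_module C A V r},
     Arr = {((V, r), (W, s), f). right_module C A V r \<and> right_module C A W s \<and>
       f \<in> Hom C V W \<and> f \<cdot>\<^bsub>C\<^esub> r = s \<cdot>\<^bsub>C\<^esub> (f \<boxtimes>\<^bsub>C\<^esub> Id C (AObj A))},
     Dom = (\<lambda>(M, N, f). M),
     Cod = (\<lambda>(M, N, f). N),
     Id = (\<lambda>M. (M, M, Id C (fst M))),
     Comp = (\<lambda>(M', N', g) (M, N, f). (M, N', g \<cdot>\<^bsub>C\<^esub> f)),
     Zero = (\<lambda>M N. (M, N, Zero C (fst M) (fst N))),
     Add = (\<lambda>(M, N, f) (M', N', g). (M, N, Add C f g)),
     Smult = (\<lambda>c (M, N, f). (M, N, Smult C c f))\<rparr>"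


section \<open>Matrices and finite linear categories\<close>

text \<open>Kronecker product. With this row-major indexing it is strictly associative, and the
  \<open>1 \<times> 1\<close> identity matrix is a strict unit.\<close>

definition kron :: "complex mat \<Rightarrow> complex mat \<Rightarrow> complex mat"
  where "kron A B = mat (dim_row A * dim_row B) (dim_col A * dim_col B)
    (\<lambda>(i, j). A $$ (i div dim_row B, j div dim_col B) * B $$ (i mod dim_row B, j mod dim_col B))"

text \<open>A category of spaces \<open>\<complex>\<^sup>n\<close> with extra structure: \<open>d X\<close> is the dimension of the space underlying
  the object \<open>X\<close>, and \<open>P X Y f\<close> says that the linear map \<open>f\<close> from \<open>X\<close> to \<open>Y\<close> is compatible with
  the structure.\<close>

definition mat_lincat :: "'o set \<Rightarrow> ('o \<Rightarrow> nat) \<Rightarrow> ('o \<Rightarrow> 'o \<Rightarrow> complex mat \<Rightarrow> bool)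
    \<Rightarrow> ('o, 'o \<times> 'o \<times> complex mat) lincat"
  where "mat_lincat Ob d P =
    \<lparr>Obj = Ob,
     Arr = {(X, Y, f). X \<in> Ob \<and> Y \<in> Ob \<and> f \<in> carrier_mat (d Y) (d X) \<and> P X Y f},
     Dom = (\<lambda>(X, Y, f). X),
     Cod = (\<lambda>(X, Y, f). Y),
     Id = (\<lambda>X. (X, X, 1\<^sub>m (d X))),
     Comp = (\<lambda>(X', Y', g) (X, Y, f). (X, Y', g * f)),
     Zero = (\<lambda>X Y. (X, Y, 0\<^sub>m (d Y) (d X))),
     Add = (\<lambda>(X, Y, f) (X', Y', g). (X, Y, f + g)),
     Smult = (\<lambda>c (X, Y, f). (X, Y, c \<cdot>\<^sub>m f))\<rparr>"

definition vect_cat :: "(nat, nat \<times> nat \<times> complex mat) moncat"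
  where "vect_cat = lincat.extend (mat_lincat UNIV id (\<lambda>_ _ _. True))
    (moncat.fields (*) (\<lambda>(m, n, f) (m', n', g). (m * m', n * n', kron f g)) 1)"

text \<open>An algebra in \<^const>\<open>vect_cat\<close> is a finite-dimensional complex algebra \<open>R\<close>, and
  \<^const>\<open>mod_lincat\<close> then gives its finite-dimensional (right) modules. Passing to the opposite
  algebra, left modules give the same notion of finiteness.\<close>

definition finite_linear_category :: "('o, 'a, 'z) lincat_scheme \<Rightarrow> bool"
  where "finite_linear_category M \<longleftrightarrow> linear_category M \<and>
    (\<exists>R. algebra_in vect_cat R \<and> linear_equivalent M (mod_lincat vect_cat R))"


section \<open>Left module categories\<close>

text \<open>\<open>'x\<close> and \<open>'f\<close> are the types of objects and arrows of the acting monoidal category.\<close>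

record ('x, 'f, 'o, 'a) modcat = "('o, 'a) lincat" +
  ActO :: "'x \<Rightarrow> 'o \<Rightarrow> 'o" (infixr "\<rhd>\<index>" 75)
  ActA :: "'f \<Rightarrow> 'a \<Rightarrow> 'a" (infixr "\<unrhd>\<index>" 75)
  Assoc :: "'x \<Rightarrow> 'x \<Rightarrow> 'o \<Rightarrow> 'a"
  Lunit :: "'o \<Rightarrow> 'a"

locale left_module_category = linear_category M
  for C :: "('x, 'f) moncat" and M :: "('x, 'f, 'o, 'a) modcat" (structure) +
  assumes finite_linear_category: "finite_linear_category M"
    and ActO_Obj: "\<lbrakk>X \<in> Obj C; m \<in> Obj M\<rbrakk> \<Longrightarrow> X \<rhd> m \<in> Obj M"
    and ActA_Hom: "\<lbrakk>f \<in> Hom C X Y; h \<in> Hom M m n\<rbrakk> \<Longrightarrow> f \<unrhd> h \<in> Hom M (X \<rhd> m) (Y \<rhd> n)"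
    and ActA_Id: "\<lbrakk>X \<in> Obj C; m \<in> Obj M\<rbrakk> \<Longrightarrow> Id C X \<unrhd> Id M m = Id M (X \<rhd> m)"
    and ActA_Comp: "\<lbrakk>f \<in> Hom C X Y; g \<in> Hom C Y Z; h \<in> Hom M m n; k \<in> Hom M n p\<rbrakk>
      \<Longrightarrow> (g \<cdot>\<^bsub>C\<^esub> f) \<unrhd> (k \<cdot> h) = (g \<unrhd> k) \<cdot> (f \<unrhd> h)"
    and ActA_Add_left: "\<lbrakk>f \<in> Hom C X Y; g \<in> Hom C X Y; h \<in> Hom M m n\<rbrakk>
      \<Longrightarrow> Add C f g \<unrhd> h = Add M (f \<unrhd> h) (g \<unrhd> h)"
    and ActA_Add_right: "\<lbrakk>f \<in> Hom C X Y; h \<in> Hom M m n; k \<in> Hom M m n\<rbrakk>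
      \<Longrightarrow> f \<unrhd> Add M h k = Add M (f \<unrhd> h) (f \<unrhd> k)"
    and ActA_Smult_left: "\<lbrakk>f \<in> Hom C X Y; h \<in> Hom M m n\<rbrakk>
      \<Longrightarrow> Smult C c f \<unrhd> h = Smult M c (f \<unrhd> h)"
    and ActA_Smult_right: "\<lbrakk>f \<in> Hom C X Y; h \<in> Hom M m n\<rbrakk>
      \<Longrightarrow> f \<unrhd> Smult M c h = Smult M c (f \<unrhd> h)"
    and Assoc_iso: "\<lbrakk>X \<in> Obj C; Y \<in> Obj C; m \<in> Obj M\<rbrakk>
      \<Longrightarrow> iso_arr M ((X \<otimes>\<^bsub>C\<^esub> Y) \<rhd> m) (X \<rhd> (Y \<rhd> m)) (Assoc M X Y m)"
    and Assoc_natural: "\<lbrakk>f \<in> Hom C X X'; g \<in> Hom C Y Y'; h \<in> Hom M m m'\<rbrakk>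
      \<Longrightarrow> Assoc M X' Y' m' \<cdot> ((f \<boxtimes>\<^bsub>C\<^esub> g) \<unrhd> h) = (f \<unrhd> (g \<unrhd> h)) \<cdot> Assoc M X Y m"
    and Lunit_iso: "m \<in> Obj M \<Longrightarrow> iso_arr M (\<one>\<^bsub>C\<^esub> \<rhd> m) m (Lunit M m)"
    and Lunit_natural: "h \<in> Hom M m m' \<Longrightarrow> Lunit M m' \<cdot> (Id C \<one>\<^bsub>C\<^esub> \<unrhd> h) = h \<cdot> Lunit M m"
    and pentagon: "\<lbrakk>X \<in> Obj C; Y \<in> Obj C; Z \<in> Obj C; m \<in> Obj M\<rbrakk>
      \<Longrightarrow> Assoc M X Y (Z \<rhd> m) \<cdot> Assoc M (X \<otimes>\<^bsub>C\<^esub> Y) Z m =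
          (Id C X \<unrhd> Assoc M Y Z m) \<cdot> Assoc M X (Y \<otimes>\<^bsub>C\<^esub> Z) m"
    and triangle: "\<lbrakk>X \<in> Obj C; m \<in> Obj M\<rbrakk>
      \<Longrightarrow> (Id C X \<unrhd> Lunit M m) \<cdot> Assoc M X \<one>\<^bsub>C\<^esub> m = Id M (X \<rhd> m)"

text \<open>A module functor: a linear functor \<open>F\<close> with a natural isomorphism \<open>s\<close> from \<open>F (X \<rhd> m)\<close> to
  \<open>X \<rhd> F m\<close> that is compatible with associativity and unit constraints.\<close>

definition module_functor ::
  "('x, 'f) moncat \<Rightarrow> ('x, 'f, 'o, 'a) modcat \<Rightarrow> ('x, 'f, 'p, 'b) modcat \<Rightarrow>
    ('o \<Rightarrow> 'p) \<Rightarrow> ('a \<Rightarrow> 'b) \<Rightarrow> ('x \<Rightarrow> 'o \<Rightarrow> 'b) \<Rightarrow> bool"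
  where "module_functor C M N Fo Fa s \<longleftrightarrow> linear_functor M N Fo Fa \<and>
    (\<forall>X \<in> Obj C. \<forall>m \<in> Obj M. iso_arr N (Fo (X \<rhd>\<^bsub>M\<^esub> m)) (X \<rhd>\<^bsub>N\<^esub> Fo m) (s X m)) \<and>
    (\<forall>X \<in> Obj C. \<forall>Y \<in> Obj C. \<forall>m \<in> Obj M. \<forall>n \<in> Obj M. \<forall>f \<in> Hom C X Y. \<forall>h \<in> Hom M m n.
      s Y n \<cdot>\<^bsub>N\<^esub> Fa (f \<unrhd>\<^bsub>M\<^esub> h) = (f \<unrhd>\<^bsub>N\<^esub> Fa h) \<cdot>\<^bsub>N\<^esub> s X m) \<and>
    (\<forall>X \<in> Obj C. \<forall>Y \<in> Obj C. \<forall>m \<in> Obj M.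
      Assoc N X Y (Fo m) \<cdot>\<^bsub>N\<^esub> s (X \<otimes>\<^bsub>C\<^esub> Y) m =
      (Id C X \<unrhd>\<^bsub>N\<^esub> s Y m) \<cdot>\<^bsub>N\<^esub> s X (Y \<rhd>\<^bsub>M\<^esub> m) \<cdot>\<^bsub>N\<^esub> Fa (Assoc M X Y m)) \<and>
    (\<forall>m \<in> Obj M. Lunit N (Fo m) \<cdot>\<^bsub>N\<^esub> s \<one>\<^bsub>C\<^esub> m = Fa (Lunit M m))"

definition module_equivalent ::
  "('x, 'f) moncat \<Rightarrow> ('x, 'f, 'o, 'a) modcat \<Rightarrow> ('x, 'f, 'p, 'b) modcat \<Rightarrow> bool"
  where "module_equivalent C M N \<longleftrightarrow>
    (\<exists>Fo Fa s. module_functor C M N Fo Fa s \<and> is_equivalence M N Fo Fa)"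

definition nonzero_category :: "('o, 'a, 'z) lincat_scheme \<Rightarrow> bool"
  where "nonzero_category M \<longleftrightarrow> (\<exists>m \<in> Obj M. Id M m \<noteq> Zero M m m)"

definition direct_sum :: "('x, 'f, 'o, 'a) modcat \<Rightarrow> ('x, 'f, 'p, 'b) modcat
    \<Rightarrow> ('x, 'f, 'o \<times> 'p, 'a \<times> 'b) modcat"
  where "direct_sum M N =
    \<lparr>Obj = Obj M \<times> Obj N,
     Arr = Arr M \<times> Arr N,
     Dom = map_prod (Dom M) (Dom N),
     Cod = map_prod (Cod M) (Cod N),
     Id = map_prod (Id M) (Id N),
     Comp = (\<lambda>(g, g') (f, f'). (g \<cdot>\<^bsub>M\<^esub> f, g' \<cdot>\<^bsub>N\<^esub> f')),
     Zero = (\<lambda>(m, m') (n, n'). (Zero M m n, Zero N m' n')),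
     Add = (\<lambda>(f, f') (g, g'). (Add M f g, Add N f' g')),
     Smult = (\<lambda>c. map_prod (Smult M c) (Smult N c)),
     ActO = (\<lambda>X. map_prod (ActO M X) (ActO N X)),
     ActA = (\<lambda>f. map_prod (ActA M f) (ActA N f)),
     Assoc = (\<lambda>X Y (m, n). (Assoc M X Y m, Assoc N X Y n)),
     Lunit = map_prod (Lunit M) (Lunit N)\<rparr>"

text \<open>The summands range over the types of \<open>M\<close> itself. This is no restriction: if \<open>M\<close> is equivalent to
  a direct sum, both summands are equivalent to full subcategories of \<open>M\<close> with transported action.\<close>

definition indecomposable :: "('x, 'f) moncat \<Rightarrow> ('x, 'f, 'o, 'a) modcat \<Rightarrow> bool"
  where "indecomposable C M \<longleftrightarrow> nonzero_category M \<and>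
    \<not> (\<exists>(M\<^sub>1 :: ('x, 'f, 'o, 'a) modcat) (M\<^sub>2 :: ('x, 'f, 'o, 'a) modcat).
      left_module_category C M\<^sub>1 \<and> left_module_category C M\<^sub>2 \<and>
      nonzero_category M\<^sub>1 \<and> nonzero_category M\<^sub>2 \<and>
      module_equivalent C M (direct_sum M\<^sub>1 M\<^sub>2))"

definition mod_cat :: "('x, 'f) moncat \<Rightarrow> ('x, 'f) alg
    \<Rightarrow> ('x, 'f, 'x \<times> 'f, ('x \<times> 'f) \<times> ('x \<times> 'f) \<times> 'f) modcat"
  where "mod_cat C A = lincat.extend (mod_lincat C A)
    (modcat.fields
      (\<lambda>X (V, r). (X \<otimes>\<^bsub>C\<^esub> V, Id C X \<boxtimes>\<^bsub>C\<^esub> r))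
      (\<lambda>f ((V, r), (W, s), h).
        ((Dom C f \<otimes>\<^bsub>C\<^esub> V, Id C (Dom C f) \<boxtimes>\<^bsub>C\<^esub> r),
         (Cod C f \<otimes>\<^bsub>C\<^esub> W, Id C (Cod C f) \<boxtimes>\<^bsub>C\<^esub> s), f \<boxtimes>\<^bsub>C\<^esub> h))
      (\<lambda>X Y (V, r). let M = (X \<otimes>\<^bsub>C\<^esub> Y \<otimes>\<^bsub>C\<^esub> V, Id C (X \<otimes>\<^bsub>C\<^esub> Y) \<boxtimes>\<^bsub>C\<^esub> r) in
        (M, M, Id C (fst M)))
      (\<lambda>M. (M, M, Id C (fst M))))"

definition relatively_projective :: "('x, 'f) moncat \<Rightarrow> ('x, 'f, 'o, 'a) modcat \<Rightarrow> bool"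
  where "relatively_projective C M \<longleftrightarrow>
    (\<exists>A. algebra_in C A \<and> relatively_projective_algebra C A \<and> module_equivalent C M (mod_cat C A))"

definition separable :: "('x, 'f) moncat \<Rightarrow> ('x, 'f, 'o, 'a) modcat \<Rightarrow> bool"
  where "separable C M \<longleftrightarrow>
    (\<exists>A. algebra_in C A \<and> separable_algebra C A \<and> module_equivalent C M (mod_cat C A))"

definition regular_modcat :: "('x, 'f) moncat \<Rightarrow> ('x, 'f, 'x, 'f) modcat"
  where "regular_modcat C = lincat.extend (lincat.truncate C)
    (modcat.fields (TensO C) (TensA C) (\<lambda>X Y Z. Id C (X \<otimes>\<^bsub>C\<^esub> Y \<otimes>\<^bsub>C\<^esub> Z)) (Id C))"


section \<open>Sweedler's Hopf algebra\<close>

text \<open>A finite-dimensional module over Sweedler's algebra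
  \<open>S = \<complex>\<langle>x, g | x\<^sup>2 = 0, g\<^sup>2 = 1, g x = - x g\<rangle>\<close> is given by the matrices \<open>(X, G)\<close> through which the
  generators \<open>x\<close> and \<open>g\<close> act on \<open>\<complex>\<^sup>n\<close>. The generators act on a tensor product through
  \<open>\<Delta> x = x \<otimes> 1 + g \<otimes> x\<close> and \<open>\<Delta> g = g \<otimes> g\<close>, and on the unit object through \<open>\<epsilon> x = 0\<close> and \<open>\<epsilon> g = 1\<close>.\<close>

type_synonym smod = "complex mat \<times> complex mat"
type_synonym sarr = "smod \<times> smod \<times> complex mat"

definition sweedler_modules :: "smod set"
  where "sweedler_modules = {(X, G). \<exists>n. X \<in> carrier_mat n n \<and> G \<in> carrier_mat n n \<and>
    X * X = 0\<^sub>m n n \<and> G * G = 1\<^sub>m n \<and> G * X = - (X * G)}"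

definition sdim :: "smod \<Rightarrow> nat"
  where "sdim V = dim_row (fst V)"

definition sweedler_tensor :: "smod \<Rightarrow> smod \<Rightarrow> smod"
  where "sweedler_tensor V W =
    (kron (fst V) (1\<^sub>m (sdim W)) + kron (snd V) (fst W), kron (snd V) (snd W))"

definition sweedler_cat :: "(smod, sarr) moncat"
  where "sweedler_cat = lincat.extend
    (mat_lincat sweedler_modules sdim
      (\<lambda>V W f. f * fst V = fst W * f \<and> f * snd V = snd W * f))
    (moncat.fields sweedler_tensor
      (\<lambda>(V, W, f) (V', W', g). (sweedler_tensor V V', sweedler_tensor W W', kron f g))
      (0\<^sub>m 1 1, 1\<^sub>m 1))"

definition V0 :: "(smod, sarr, smod, sarr) modcat"
  where "V0 = regular_modcat sweedler_cat"

text \<open>A finite-dimensional module over the left coideal subalgebra \<open>D = \<complex>[x]/(x\<^sup>2)\<close> is a square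
  matrix of square zero; \<open>x\<close> acts on \<open>W \<rhd> V\<close> through \<open>\<Delta> x = x \<otimes> 1 + g \<otimes> x \<in> S \<otimes> D\<close>.\<close>

definition coideal_modules :: "complex mat set"
  where "coideal_modules = {X. \<exists>n. X \<in> carrier_mat n n \<and> X * X = 0\<^sub>m n n}"

definition coideal_act :: "smod \<Rightarrow> complex mat \<Rightarrow> complex mat"
  where "coideal_act W X = kron (fst W) (1\<^sub>m (dim_row X)) + kron (snd W) X"

definition S0 :: "(smod, sarr, complex mat, complex mat \<times> complex mat \<times> complex mat) modcat"
  where "S0 = lincat.extend
    (mat_lincat coideal_modules dim_row (\<lambda>X Y f. f * X = Y * f))
    (modcat.fields coideal_act
      (\<lambda>(V, W, f) (X, Y, h). (coideal_act V X, coideal_act W Y, kron f h))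
      (\<lambda>V W X. let Z = coideal_act V (coideal_act W X) in (Z, Z, 1\<^sub>m (dim_row Z)))
      (\<lambda>X. (X, X, 1\<^sub>m (dim_row X))))"

end

theory Submission
 imports Defs "Jordan_Normal_Form.Spectral_Radius"
begin

text \<open>Restricting a bimodule retraction to the middle factor shows that relatively projective algebras \<open>A\<close> are
 separable. The underlying algebra is then separable, hence has a simple module \<open>U\<close>, and Schur's lemma applies.
 Averaging over the separability element turns maps into module maps and provides the action of \<open>x\<close>. The projection
 of a module in the category to its isotypic part for \<open>U\<close> and its parity twist is a natural idempotent that is
 compatible with the action, so in the indecomposable case it is the identity: every module is a multiple of a
 single object \<open>W\<close>. If \<open>U\<close> is isomorphic to its twist, then \<open>W = U\<close> has only scalar endomorphisms, and acting on
 \<open>W\<close> is an equivalence from \<open>V0\<close>. Otherwise \<open>W\<close> is the sum of \<open>U\<close> and its twist, its endomorphism algebra is the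
 Clifford algebra generated by an odd \<open>H\<close> with \<open>H\<^sup>2 = 1\<close>, and tensoring with \<open>W\<close> is an equivalence from \<open>S0\<close>.
 Conversely \<open>V0\<close> and \<open>S0\<close> come from the trivial and from the Clifford algebra.\<close>

text \<open>Supplying the action of x is the crux. The separability element \<open>c\<close>,
  written as a sum of terms c1 \<otimes> c2, is fixed by g and killed by x, being the image of 1
  under a morphism of the category. On a graded module the formula D(v) = G(v c1) x(c2) satisfies
  the Leibniz rule that x must satisfy, but D squares to a module map with no evident reason to
  vanish. The average z(v) = D(v c1) c2 is a module map with D z + z D = 2 D^2. It is odd, so
  Schur's lemma leaves only z = 0 in the scalar case and a multiple of H in the Clifford case, where
  D is first corrected by a multiple of H so as to anticommute with H. Either way D z + z D = 0,
  hence D^2 = 0. The same Leibniz rule is an obstacle for the isotypic projection E: x is not a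
  module map, so naturality of E over module maps says nothing about x. The corners (1 - E) x E and
  E x (1 - E) are module maps, however, and naturality forces them to vanish.\<close>

hide_const (open) Relation.Id

abbreviation I :: "nat => complex mat" where "I \<equiv> one_mat"

notation smult_mat (infixl "*s" 70)

abbreviation "nr \<equiv> dim_row"
abbreviation "nc \<equiv> dim_col"
abbreviation "SC \<equiv> sweedler_cat"
abbreviation "SM \<equiv> sweedler_modules"
abbreviation "CM \<equiv> coideal_modules"

section \<open>Matrices and Kronecker products\<close>

text \<open>Matrices of varying size form no ring type, so the laws are restated with equations
  between dimensions in place of \<open>carrier_mat\<close> premises. The simplifier discharges
  these from facts about \<open>nr\<close> and \<open>nc\<close>.\<close>

lemma assoc_mult_mat_dim:
 "nc A = nr B ==> nc B = nr C ==> A * B * C = A * (B * (C :: complex mat))"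
 by (rule assoc_mult_mat[of _ "nr A" "nc A" _ "nc B" _ "nc C"]) auto

lemma add_mult_mat_dim:
 "nr A = nr B ==> nc A = nc B ==> nc B = nr C ==>
  (A + B) * C = A * C + B * (C :: complex mat)" by (rule add_mult_distrib_mat[of _ "nr A" "nc A" _ _ "nc C"]) auto

lemma mult_add_mat_dim:
 "nr B = nr C ==> nc B = nc C ==> nc A = nr B ==>
  A * (B + C) = A * B + A * (C :: complex mat)" by (rule mult_add_distrib_mat[of _ "nr A" "nc A" _ "nc C"]) auto

lemma mult_smult_mat_dim:
 "nc A = nr B ==> A * (k *s B) = k *s (A * (B :: complex mat))"
 by (rule mult_smult_distrib[of _ "nr A" "nc A" _ "nc B"]) auto

lemma smult_mult_mat_dim:
 "nc A = nr B ==> (k *s A) * B = k *s (A * (B :: complex mat))"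
 by (rule mult_smult_assoc_mat[of _ "nr A" "nc A" _ "nc B"]) auto

lemma zero_mult_mat_dim: "n = nr A ==> 0\<^sub>m m n * (A :: complex mat) = 0\<^sub>m m (nc A)"
 by (rule left_mult_zero_mat) auto

lemma mult_zero_mat_dim: "n = nc A ==> (A :: complex mat) * 0\<^sub>m n m = 0\<^sub>m (nr A) m"
 by (rule right_mult_zero_mat) auto

lemma mult_one_mat_dim: "n = nc A ==> (A :: complex mat) * I n = A" by (rule right_mult_one_mat) auto

lemma one_mult_mat_dim: "n = nr A ==> I n * (A :: complex mat) = A" by (rule left_mult_one_mat) auto

lemma add_zero_mat_dim: "m = nr A ==> n = nc A ==> (A :: complex mat) + 0\<^sub>m m n = A" by auto

lemma zero_add_mat_dim: "m = nr A ==> n = nc A ==> 0\<^sub>m m n + (A :: complex mat) = A" by auto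

lemma add_assoc_mat_dim:
 "nr A = nr B ==> nc A = nc B ==> nr B = nr C ==>
  nc B = nc C ==> A + B + C = A + (B + (C :: complex mat))" by (intro eq_matI) auto

lemma add_commute_mat_dim:
 "nr A = nr B ==> nc A = nc B ==> A + B = B + (A :: complex mat)" by (intro eq_matI) auto

lemma add_left_commute_mat_dim:
 "nr A = nr B ==> nc A = nc B ==> nr B = nr C ==>
  nc B = nc C ==> A + (B + C) = B + (A + (C :: complex mat))" by (intro eq_matI) auto

lemma smult_add_mat_dim:
 "nr A = nr B ==> nc A = nc B ==> k *s (A + B) = k *s A + k *s (B :: complex mat)"
 by (intro eq_matI) (auto simp: algebra_simps)

lemma uminus_eq_smult: "- A = (- 1) *s (A :: complex mat)" by (intro eq_matI) auto

lemma smult_smult_mat: "k *s (l *s A) = (k * l) *s (A :: complex mat)" by (intro eq_matI) (auto simp: algebra_simps)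

lemma one_smult_mat: "1 *s A = (A :: complex mat)" by (intro eq_matI) auto

lemma zero_smult_mat: "0 *s A = 0\<^sub>m (nr A) (nc (A :: complex mat))" by (intro eq_matI) auto

lemma add_smult_self: "(k *s A) + (l *s A) = (k + l) *s (A :: complex mat)"
 by (intro eq_matI) (auto simp: algebra_simps)

lemma add_self_smult: "A + (l *s A) = (1 + l) *s (A :: complex mat)"
 "(l *s A) + A = (1 + l) *s (A :: complex mat)" "A + A = 2 *s A" by (intro eq_matI; auto simp: algebra_simps)+

lemma dim_kron [simp]:
 "nr (kron A B) = nr A * nr B" "nc (kron A B) = nc A * nc B" by (simp_all add: kron_def)

lemma index_kron [simp]:
 "i < nr A * nr B ==> j < nc A * nc B ==>
  kron A B $$ (i, j) = A $$ (i div nr B, j div nc B) * B $$ (i mod nr B, j mod nc B)" by (simp add: kron_def)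

lemma div_mod_less: "(i :: nat) < m * n ==> i div n < m" "i < m * n ==> i mod n < n"
 by (auto simp: less_mult_imp_div_less) (metis gr_zeroI less_nat_zero_code mod_less_divisor mult_0_right)

lemma sum_prod_aux: "m * n \<le> a ==> a < m * n + n ==> a div n = m \<and> a mod n = a - m * (n :: nat)"
 by (metis add.commute add_diff_cancel_left' div_nat_eqI le_add_diff_inverse minus_mult_div_eq_mod mult.commute mult_Suc)

text \<open>The bijection between k < m * n and pairs (i, j) behind the row-major indexing of
  \<open>kron\<close>.\<close>

lemma sum_prod_index: "(\<Sum>k<m * n. f (k div n) (k mod n)) = (\<Sum>i<m. \<Sum>j<n. f i (j::nat))"
proof (induction m)
 case (Suc m)
 have "(\<Sum>k<Suc m * n. f (k div n) (k mod n)) =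
   (\<Sum>k<m * n. f (k div n) (k mod n)) + (\<Sum>k=m*n..<m*n+n. f (k div n) (k mod n))"
  using sum.atLeastLessThan_concat[of 0 "m*n" "m*n+n" "\<lambda>k. f (k div n) (k mod n)"]
  by (simp add: atLeast0LessThan add.commute)
 also have "(\<Sum>k=m*n..<m*n+n. f (k div n) (k mod n)) = (\<Sum>j<n. f m j)"
  by (rule sum.reindex_bij_witness[of _ "\<lambda>j. m * n + j" "\<lambda>k. k - m * n"])
   (auto simp: sum_prod_aux)
 finally show ?case using Suc by simp
qed simp

lemma index_mult_mat_sum:
 "i < nr A ==> j < nc B ==> (A * B) $$ (i, j) = (\<Sum>k<nr B. A $$ (i, k) * B $$ (k, j))"
 if "nc A = nr B" for A B :: "complex mat" using that by (simp add: scalar_prod_def atLeast0LessThan)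

lemma kron_mult: assumes "nc A = nr C" "nc B = nr D" shows "kron A B * kron C D = kron (A * C) (B * D)"
proof (rule eq_matI)
 fix i j assume "i < nr (kron (A * C) (B * D))" "j < nc (kron (A * C) (B * D))"
 hence ij: "i < nr A * nr B" "j < nc C * nc D" by auto
 have "(kron A B * kron C D) $$ (i, j) = (\<Sum>k<nr C * nr D. kron A B $$ (i, k) * kron C D $$ (k, j))"
  using ij assms by (subst index_mult_mat_sum) auto
 also have "... = (\<Sum>k<nr C * nr D.
   (\<lambda>p q. A $$ (i div nr B, p) * C $$ (p, j div nc D) * (B $$ (i mod nr B, q) * D $$ (q, j mod nc D)))
    (k div nr D) (k mod nr D))" using ij assms by (intro sum.cong) auto
 also have "... = (\<Sum>p<nr C. \<Sum>q<nr D. A $$ (i div nr B, p) * C $$ (p, j div nc D) *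
   (B $$ (i mod nr B, q) * D $$ (q, j mod nc D)))" by (rule sum_prod_index)
 also have "... = (A * C) $$ (i div nr B, j div nc D) * (B * D) $$ (i mod nr B, j mod nc D)"
  unfolding index_mult_mat_sum[OF assms(1) div_mod_less(1)[OF ij(1)] div_mod_less(1)[OF ij(2)]]
   index_mult_mat_sum[OF assms(2) div_mod_less(2)[OF ij(1)] div_mod_less(2)[OF ij(2)]]
  by (rule sum_product[symmetric])
 also have "... = kron (A * C) (B * D) $$ (i, j)" using ij by (subst index_kron) simp_all
 finally show "(kron A B * kron C D) $$ (i, j) = kron (A * C) (B * D) $$ (i, j)" .
qed auto

text \<open>\<open>mat_ring\<close> nests products to the right, which hides the left-hand side of
  \<open>kron_mult\<close>; this version applies there.\<close>

lemma kron_mult_assoc: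
 "nc A = nr C ==> nc B = nr D ==> nc C * nc D = nr E ==>
  kron A B * (kron C D * E) = kron (A * C) (B * D) * E"
 using assoc_mult_mat_dim[of "kron A B" "kron C D" E] by (simp add: kron_mult)

lemma kron_assoc: "kron (kron A B) C = kron A (kron B C)"
proof (rule eq_matI)
 fix i j assume "i < nr (kron A (kron B C))" "j < nc (kron A (kron B C))"
 hence ij: "i < nr A * (nr B * nr C)" "j < nc A * (nc B * nc C)" by auto
 have e: "i mod (q * p) div p = i div p mod q" "i mod (q * p) mod p = i mod p" for i p q :: nat
  by (simp_all add: mult.commute[of q p] mod_mult2_eq)
    (cases "p = 0"; simp)
 have "i < nr A * nr B * nr C" "j < nc A * nc B * nc C" using ij by (simp_all add: mult.assoc)
 moreover note div_mod_less(1)[OF this(1)] div_mod_less(1)[OF this(2)] div_mod_less[OF ij(1)] div_mod_less[OF ij(2)]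
 ultimately show "kron (kron A B) C $$ (i, j) = kron A (kron B C) $$ (i, j)"
  using ij by (simp add: e) (simp add: div_mult2_eq mult.commute[of "nr B"] mult.commute[of "nc B"])
qed (simp_all add: mult.assoc)

lemma kron_one: "kron (I m) (I n) = I (m * n)"
proof (rule eq_matI)
 have e: "i div n = j div n \<and> i mod n = j mod n \<longleftrightarrow> i = j" for i j by (metis div_mod_decomp)
 fix i j assume "i < nr (I (m * n) :: complex mat)" "j < nc (I (m * n) :: complex mat)"
 thus "kron (I m) (I n) $$ (i, j) = I (m * n) $$ (i, j)" using e[of i j] by (auto simp: div_mod_less)
qed auto

lemma kron_one_left: "kron (I (Suc 0)) A = A" and kron_one_right: "kron A (I (Suc 0)) = A" by (rule eq_matI; auto)+

lemma kron_zero_left: "kron (0\<^sub>m m n) A = 0\<^sub>m (m * nr A) (n * nc A)"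
 and kron_zero_right: "kron A (0\<^sub>m m n) = 0\<^sub>m (nr A * m) (nc A * n)"
 by (rule eq_matI; auto simp: div_mod_less)+

lemma kron_add_left:
 "nr A = nr B ==> nc A = nc B ==> kron (A + B) C = kron A C + kron B C" and kron_add_right:
 "nr A = nr B ==> nc A = nc B ==> kron C (A + B) = kron C A + kron C B"
 by (rule eq_matI; auto simp: div_mod_less distrib_left distrib_right)+

lemma kron_smult_left: "kron (k *s A) B = k *s kron A B" and kron_smult_right: "kron A (k *s B) = k *s kron A B"
 by (rule eq_matI; auto simp: div_mod_less algebra_simps)+

section \<open>Block coordinates: unit vectors, inclusions and projections of direct sums\<close>

definition ecol :: "nat => nat => complex mat" where
 "ecol n i = mat n 1 (\<lambda>(r, c). if r = i then 1 else 0)"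

definition erow :: "nat => nat => complex mat" where
 "erow n i = mat 1 n (\<lambda>(r, c). if c = i then 1 else 0)"

definition inl_mat :: "nat => nat => complex mat" where
 "inl_mat a b = mat (a + b) a (\<lambda>(i, j). if i = j then 1 else 0)"

definition inr_mat :: "nat => nat => complex mat" where
 "inr_mat a b = mat (a + b) b (\<lambda>(i, j). if i = a + j then 1 else 0)"

definition prl_mat :: "nat => nat => complex mat" where
 "prl_mat a b = mat a (a + b) (\<lambda>(i, j). if i = j then 1 else 0)"

definition prr_mat :: "nat => nat => complex mat" where
 "prr_mat a b = mat b (a + b) (\<lambda>(i, j). if j = a + i then 1 else 0)"

lemma dim_units [simp]:
 "nr (ecol n i) = n" "nc (ecol n i) = Suc 0" "nr (erow n i) = Suc 0" "nc (erow n i) = n"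
 "nr (inl_mat a b) = a + b" "nc (inl_mat a b) = a"
 "nr (inr_mat a b) = a + b" "nc (inr_mat a b) = b"
 "nr (prl_mat a b) = a" "nc (prl_mat a b) = a + b"
 "nr (prr_mat a b) = b" "nc (prr_mat a b) = a + b"
 by (simp_all add: ecol_def erow_def inl_mat_def inr_mat_def prl_mat_def prr_mat_def)

lemma mult_add_less: "i < a ==> p < b ==> i * b + p < a * (b :: nat)" using mult_le_mono1[of "Suc i" a b] by simp

lemma eq_mult_add_iff: "s < n ==> p = i * n + s \<longleftrightarrow> p div n = i \<and> p mod n = (s :: nat)" by auto

lemma if_mult: "(if P then x else 0) * y = (if P then x * y else (0::complex))"
 "y * (if P then x else 0) = (if P then y * x else (0::complex))" by auto

lemma biproduct_mat [simp]:
 "prl_mat a b * inl_mat a b = I a" "prr_mat a b * inr_mat a b = I b"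
 "prl_mat a b * inr_mat a b = 0\<^sub>m a b" "prr_mat a b * inl_mat a b = 0\<^sub>m b a"
 "inl_mat a b * prl_mat a b + inr_mat a b * prr_mat a b = I (a + b)"
proof -
 show "inl_mat a b * prl_mat a b + inr_mat a b * prr_mat a b = I (a + b)"
 proof (rule eq_matI)
  fix i j assume "i < nr (I (a + b) :: complex mat)" "j < nc (I (a + b) :: complex mat)"
  hence ij: "i < a + b" "j < a + b" by auto
  have "(inl_mat a b * prl_mat a b) $$ (i, j) = (\<Sum>k<a. if k = i then if i = j then 1 else 0 else 0)"
   using ij by (intro trans[OF index_mult_mat_sum] sum.cong) (auto simp: inl_mat_def prl_mat_def)
  moreover have "(inr_mat a b * prr_mat a b) $$ (i, j) =
    (\<Sum>k<b. if k = i - a then if i = j \<and> a \<le> i then 1 else 0 else 0)"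
   using ij by (intro trans[OF index_mult_mat_sum] sum.cong) (auto simp: inr_mat_def prr_mat_def)
  ultimately show "(inl_mat a b * prl_mat a b + inr_mat a b * prr_mat a b) $$ (i, j) = I (a + b) $$ (i, j)"
   using ij by (auto simp del: index_mult_mat(1))
 qed auto
qed (rule eq_matI; auto simp: index_mult_mat_sum inl_mat_def inr_mat_def prl_mat_def prr_mat_def
   if_mult simp del: index_mult_mat(1))+

lemma index_mult_ecol [simp]: assumes "i < n" "nc A = n" "r < nr A" shows "(A * ecol n i) $$ (r, 0) = A $$ (r, i)"
 using assms by (simp add: index_mult_mat_sum ecol_def if_mult del: index_mult_mat(1))

lemma index_erow_mult [simp]: assumes "i < n" "nr A = n" "c < nc A" shows "(erow n i * A) $$ (0, c) = A $$ (i, c)"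
 using assms by (simp add: index_mult_mat_sum erow_def if_mult del: index_mult_mat(1))

text \<open>Multiplying by \<open>kron (ecol k i) (I n)\<close> on the right selects the i-th block
  of n consecutive columns.\<close>

lemma index_mult_kron_ecol: assumes "i < k" "nc A = k * n" "r < nr A" "s < n"
 shows "(A * kron (ecol k i) (I n)) $$ (r, s) = A $$ (r, i * n + s)"
proof -
 have l: "i * n + s < k * n" using assms by (intro mult_add_less)
 have "(A * kron (ecol k i) (I n)) $$ (r, s) = (\<Sum>p<k * n. A $$ (r, p) * kron (ecol k i) (I n) $$ (p, s))"
  using assms by (subst index_mult_mat_sum) auto
 also have "... = (\<Sum>p<k * n. if p = i * n + s then A $$ (r, p) else 0)"
 proof (rule sum.cong)
  fix p assume p: "p : {..<k * n}"
  have "p = i * n + s \<longleftrightarrow> p div n = i \<and> p mod n = s" using assms(4) by (rule eq_mult_add_iff)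
  thus "A $$ (r, p) * kron (ecol k i) (I n) $$ (p, s) = (if p = i * n + s then A $$ (r, p) else 0)"
   using p assms div_mod_less[of p k n] by (auto simp: ecol_def)
 qed simp
 also have "... = A $$ (r, i * n + s)" using l by simp
 finally show ?thesis .
qed

lemma index_kron_erow_mult: assumes "i < k" "nr A = k * n" "r < nc A" "s < n"
 shows "(kron (erow k i) (I n) * A) $$ (s, r) = A $$ (i * n + s, r)"
proof -
 have l: "i * n + s < k * n" using assms by (intro mult_add_less)
 have "(kron (erow k i) (I n) * A) $$ (s, r) = (\<Sum>p<k * n. kron (erow k i) (I n) $$ (s, p) * A $$ (p, r))"
  using assms by (subst index_mult_mat_sum) auto
 also have "... = (\<Sum>p<k * n. if p = i * n + s then A $$ (p, r) else 0)"
 proof (rule sum.cong)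
  fix p assume p: "p : {..<k * n}"
  have "p = i * n + s \<longleftrightarrow> p div n = i \<and> p mod n = s" using assms(4) by (rule eq_mult_add_iff)
  thus "kron (erow k i) (I n) $$ (s, p) * A $$ (p, r) = (if p = i * n + s then A $$ (p, r) else 0)"
   using p assms div_mod_less[of p k n] by (auto simp: erow_def)
 qed simp
 also have "... = A $$ (i * n + s, r)" using l by simp
 finally show ?thesis .
qed

text \<open>Together with the row version this reduces equations between maps of multiples of a
  module to their blocks.\<close>

lemma eq_mat_by_blocks_col: assumes "nr A = nr B" "nc A = k * n" "nc B = k * n"
  and "\<And>i. i < k ==> A * kron (ecol k i) (I n) = B * kron (ecol k i) (I n)" shows "A = B"
proof (rule eq_matI)
 fix r j assume r: "r < nr B" and "j < nc B"
 hence j: "j div n < k" "j mod n < n" using assms(3) div_mod_less[of j k n] by auto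
 have "A $$ (r, j div n * n + j mod n) = B $$ (r, j div n * n + j mod n)"
  using assms r j index_mult_kron_ecol[OF j(1) _ _ j(2)] by metis
 thus "A $$ (r, j) = B $$ (r, j)" by simp
qed (use assms in auto)

lemma eq_mat_by_blocks_row: assumes "nc A = nc B" "nr A = k * n" "nr B = k * n"
  and "\<And>i. i < k ==> kron (erow k i) (I n) * A = kron (erow k i) (I n) * B" shows "A = B"
proof (rule eq_matI)
 fix j r assume r: "r < nc B" and "j < nr B"
 hence j: "j div n < k" "j mod n < n" using assms(3) div_mod_less[of j k n] by auto
 have "A $$ (j div n * n + j mod n, r) = B $$ (j div n * n + j mod n, r)"
  using assms r j index_kron_erow_mult[OF j(1) _ _ j(2)] by metis
 thus "A $$ (j, r) = B $$ (j, r)" by simp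
qed (use assms in auto)

lemma erow_mult_ecol: "i < nr A ==> j < nc A ==>
  erow (nr A) i * A * ecol (nc A) j = (A $$ (i, j)) *s I (Suc 0)" by (rule eq_matI) (simp_all del: index_mult_mat(1))

text \<open>At a nonzero entry (p, q) of \<open>C\<close>, the entries of \<open>kron A C\<close>
  with remainders (p, q) are those of \<open>A\<close> up to that scalar.\<close>

lemma kron_cancel_right: assumes "kron A C = kron B C" "nr A = nr B" "nc A = nc B"
  "C \<noteq> 0\<^sub>m (nr C) (nc C)" shows "A = B"
proof (rule eq_matI)
 obtain p q where pq: "p < nr C" "q < nc C" "C $$ (p, q) \<noteq> 0" using assms(4) by (metis eq_matI index_zero_mat)
 fix i j assume ij: "i < nr B" "j < nc B"
 have l: "i * b + p < a * b" if "i < a" "p < b" for i p a b :: nat using that by (rule mult_add_less)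
 have "kron A C $$ (i * nr C + p, j * nc C + q) = kron B C $$ (i * nr C + p, j * nc C + q)" using assms(1) by simp
 thus "A $$ (i, j) = B $$ (i, j)" using pq ij assms(2,3) l[OF ij(1) pq(1)] l[OF ij(2) pq(2)] by simp
qed (use assms(2,3) in auto)

lemma one_mat_neq_zero: "0 < n ==> I n \<noteq> (0\<^sub>m n n :: complex mat)"
proof
 assume "0 < n" "I n = (0\<^sub>m n n :: complex mat)"
 hence "(I n :: complex mat) $$ (0, 0) = 0" by simp
 thus False using \<open>0 < n\<close> by simp
qed

text \<open>An injective map cannot lower the dimension. The argument rests on the fact that
  one-sided inverses of square matrices are two-sided.\<close>

lemma left_inverse_dim: assumes "L * J = (I k :: complex mat)" "nc L = m" "nr J = m" shows "k \<le> m"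
proof (rule ccontr)
 assume "\<not> k \<le> m"
 then obtain d where k: "k = m + d" and d: "0 < d" by (metis less_imp_add_positive not_le)
 have dl: "nr L = k" "nc J = k" using arg_cong[OF assms(1), of nr] arg_cong[OF assms(1), of nc] by simp_all
 \<comment> \<open>If k = m + d, padding by zero blocks makes both factors square. Then
   \<open>?J * ?L\<close> is the identity as well, although the last d rows of \<open>?J\<close>
   vanish.\<close>
 let ?L = "L * prl_mat m d" and ?J = "inl_mat m d * J"
 have "?L * ?J = L * ((prl_mat m d * inl_mat m d) * J)"
  using assms(2,3) dl by (simp add: assoc_mult_mat_dim del: biproduct_mat)
 hence e: "?L * ?J = I k" using assms by (simp add: one_mult_mat_dim)
 have r: "?J * ?L = I k"
  by (rule mat_mult_left_right_inverse[OF carrier_matI carrier_matI e]) (simp_all add: dl k[symmetric])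
 have "(prr_mat m d * inl_mat m d) * (J * ?L) = prr_mat m d * (?J * ?L)"
  using assms(2,3) dl by (simp add: assoc_mult_mat_dim del: biproduct_mat)
 hence "0\<^sub>m d k = prr_mat m d" using r assms dl k by (simp add: zero_mult_mat_dim mult_one_mat_dim)
 hence "0\<^sub>m d k * inr_mat m d = I d" by simp
 thus False using d one_mat_neq_zero[of d] k by (simp add: zero_mult_mat_dim)
qed

lemma square_left_inverse:
 "L * J = I k ==> nc L = k ==> nr J = k ==> J * L = (I k :: complex mat)"
 by (rule mat_mult_left_right_inverse[OF carrier_matI carrier_matI])
  (auto dest: arg_cong[of _ _ nr] arg_cong[of _ _ nc])

lemmas mat_ring = assoc_mult_mat_dim add_mult_mat_dim mult_add_mat_dim mult_smult_mat_dim
 smult_mult_mat_dim zero_mult_mat_dim mult_zero_mat_dim mult_one_mat_dim one_mult_mat_dim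
 add_zero_mat_dim zero_add_mat_dim smult_smult_mat one_smult_mat smult_add_mat_dim

lemmas mat_kron = kron_mult kron_mult_assoc kron_assoc kron_one kron_one_left kron_one_right
 kron_zero_left kron_zero_right kron_add_left kron_add_right kron_smult_left kron_smult_right

lemmas kron_ring = mat_ring kron_mult

lemma biproduct_mat_assoc [simp]:
 "nr A = a ==> prl_mat a b * (inl_mat a b * A) = A"
 "nr B = b ==> prr_mat a b * (inr_mat a b * B) = B"
 "nr B = b ==> prl_mat a b * (inr_mat a b * B) = 0\<^sub>m a (nc B)"
 "nr A = a ==> prr_mat a b * (inl_mat a b * A) = 0\<^sub>m b (nc A)"
 by (simp_all add: assoc_mult_mat_dim[symmetric] mat_ring(6,9))

text \<open>Turns an equation for a product into a rule for that product inside a right-nested one;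
  instances \<open>mult_eq_assoc[OF eq]\<close> drive most calculations below.\<close>

lemma mult_eq_assoc:
 "A * B = C ==> nc A = nr B ==> nc B = nr X ==> A * (B * X) = C * (X :: complex mat)"
 by (simp add: assoc_mult_mat_dim[symmetric])

lemma biproduct_sum_assoc:
 "nr X = a + b ==> inl_mat a b * (prl_mat a b * X) + inr_mat a b * (prr_mat a b * X) = X"
 using biproduct_mat(5)[of a b] by (simp add: mat_ring flip: add_mult_mat_dim assoc_mult_mat_dim)

text \<open>Recording one-sided inverses \<open>L\<close> and \<open>R\<close> of the two factors
  replaces arguments with bases of images. Elimination with a pivot a splits off the rank one matrix
  (column)(row)/a and leaves a matrix with fewer nonzero rows, which is the induction
  measure.\<close>

lemma rank_factorization:
 fixes f :: "complex mat"
 obtains k J P L R where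
  "nr J = nr f" "nc J = k" "nr P = k" "nc P = nc f"
  "nr L = k" "nc L = nr f" "nr R = nc f" "nc R = k"
  "f = J * P" "L * J = I k" "P * R = I k"
proof -
 define nz :: "complex mat => nat set"
  where "nz f = {i. i < nr f \<and> (\<exists>j<nc f. f $$ (i, j) \<noteq> 0)}" for f
 have "\<exists>k J P L R. nr J = nr f \<and> nc J = k \<and> nr P = k \<and> nc P = nc f \<and>
  nr L = k \<and> nc L = nr f \<and> nr R = nc f \<and> nc R = k \<and>
  f = J * P \<and> L * J = I k \<and> P * R = I k"
 proof (induction "card (nz f)" arbitrary: f rule: less_induct)
  case less
  define m n where "m = nr f" and "n = nc f"
  note [simp] = m_def[symmetric] n_def[symmetric]
  show ?case
  proof (cases "nz f = {}")
   case True
   hence "f = 0\<^sub>m m n" unfolding nz_def by (intro eq_matI) auto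
   hence "f = 0\<^sub>m m 0 * 0\<^sub>m 0 n" by (simp add: mat_ring)
   moreover have "0\<^sub>m 0 m * 0\<^sub>m m 0 = (I 0 :: complex mat)" "0\<^sub>m 0 n * 0\<^sub>m n 0 = (I 0 :: complex mat)"
    by (intro eq_matI; simp)+
   ultimately show ?thesis
    by (intro exI[of _ 0] exI[of _ "0\<^sub>m m 0"] exI[of _ "0\<^sub>m 0 n"] exI[of _ "0\<^sub>m 0 m"] exI[of _ "0\<^sub>m n 0"])
     simp
  next
   case False
   then obtain i j where ij: "i < m" "j < n" "f $$ (i, j) \<noteq> 0" unfolding nz_def by auto
   define a where "a = f $$ (i, j)"
   have a: "a \<noteq> 0" using ij by (simp add: a_def)
   define e d where "e = erow m i" and "d = ecol n j"
   define c r where "c = f * d" and "r = e * f"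
   have dims [simp]: "nr e = 1" "nc e = m" "nr d = n" "nc d = 1"
    "nr c = m" "nc c = 1" "nr r = 1" "nc r = n" by (simp_all add: e_def d_def c_def r_def)
   have efd: "e * c = a *s I 1" "r * d = a *s I 1"
    using erow_mult_ecol[of i f j] ij by (simp_all add: a_def e_def d_def c_def r_def assoc_mult_mat_dim)
   define f' where "f' = f + (- 1 / a) *s (c * r)"
   have dims' [simp]: "nr f' = m" "nc f' = n" by (simp_all add: f'_def)
   have idx: "f' $$ (s, t) = f $$ (s, t) - f $$ (s, j) * f $$ (i, t) / a" if "s < m" "t < n" for s t
   proof -
    have "(c * r) $$ (s, t) = c $$ (s, 0) * r $$ (0, t)" using that by (subst index_mult_mat_sum) auto
    also have "c $$ (s, 0) = f $$ (s, j)" using that ij by (simp add: c_def d_def del: index_mult_mat(1))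
    also have "r $$ (0, t) = f $$ (i, t)" using that ij by (simp add: r_def e_def del: index_mult_mat(1))
    finally show ?thesis using that by (simp add: f'_def del: index_mult_mat(1))
   qed
   have "nz f' \<subseteq> nz f - {i}"
   proof
    fix x assume "x : nz f'"
    then obtain t where xt: "x < m" "t < n" "f' $$ (x, t) \<noteq> 0" by (auto simp: nz_def)
    hence "f $$ (x, t) \<noteq> 0 \<or> f $$ (x, j) \<noteq> 0" and "x \<noteq> i"
     using idx[of x t] ij a by (auto simp: a_def)
    thus "x : nz f - {i}" using xt ij unfolding nz_def by auto
   qed
   moreover have "i : nz f" using ij by (auto simp: nz_def)
   moreover have "finite (nz f)" by (simp add: nz_def)
   ultimately have "card (nz f') < card (nz f)" by (intro psubset_card_mono) auto
   from less[OF this] obtain k J P L R where IH [simp]: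
    "nr J = m" "nc J = k" "nr P = k" "nc P = n"
    "nr L = k" "nc L = m" "nr R = n" "nc R = k" and IH': "f' = J * P" "L * J = I k" "P * R = I k" by auto
   have "e * f' = 0\<^sub>m 1 n" using efd a by (simp add: f'_def mat_ring add_self_smult zero_smult_mat flip: r_def;
     simp add: assoc_mult_mat_dim[symmetric] efd mat_ring add_self_smult zero_smult_mat)
   moreover have "e * J = e * f' * R" using IH' by (simp add: mat_ring)
   ultimately have eJ: "e * J = 0\<^sub>m 1 k" by (simp add: mat_ring)
   have "f' * d = 0\<^sub>m m 1"
    using efd a by (simp add: f'_def mat_ring efd add_self_smult zero_smult_mat flip: c_def)
   moreover have "P * d = L * (f' * d)" using IH' by (simp add: assoc_mult_mat_dim[symmetric]; simp add: mat_ring IH')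
   ultimately have Pd: "P * d = 0\<^sub>m k 1" by (simp add: mat_ring)
   \<comment> \<open>The pivot column and row become the first coordinate of the factorization. The
     inverses are corrected by the projections 1 - c e / a and 1 - d r / a, because \<open>L\<close>
     need not annihilate \<open>c\<close>, nor \<open>r\<close> annihilate \<open>R\<close>.\<close>
   define J' where "J' = c * prl_mat 1 k + J * prr_mat 1 k"
   define P' where "P' = (1 / a) *s (inl_mat 1 k * r) + inr_mat 1 k * P"
   define L' where "L' = (1 / a) *s (inl_mat 1 k * e) + inr_mat 1 k * L * (I m + (- 1 / a) *s (c * e))"
   define R' where "R' = d * prl_mat 1 k + (I n + (- 1 / a) *s (d * r)) * R * prr_mat 1 k"
   have 1: "f = J' * P'" by (simp add: J'_def P'_def mat_ring flip: IH'(1);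
     simp add: f'_def add_left_commute_mat_dim add_smult_self zero_smult_mat mat_ring)
   have 2: "L' * J' = I (1 + k)" using a biproduct_mat(5)[of 1 k]
    by (simp add: J'_def L'_def mat_ring mult_eq_assoc[OF efd(1)] mult_eq_assoc[OF eJ] mult_eq_assoc[OF IH'(2)]
      add_self_smult zero_smult_mat)
   have "P' * R' = inl_mat 1 k * prl_mat 1 k + inr_mat 1 k * prr_mat 1 k"
    using a by (simp del: biproduct_mat(5) add: P'_def R'_def mat_ring mult_eq_assoc[OF efd(2)]
       mult_eq_assoc[OF Pd] mult_eq_assoc[OF IH'(3)])
      (rule eq_matI; simp del: index_mult_mat(1) biproduct_mat(5))
   hence 3: "P' * R' = I (1 + k)" by (simp only: biproduct_mat)
   show ?thesis
    by (rule exI[of _ "1 + k"], rule exI[of _ J'], rule exI[of _ P'], rule exI[of _ L'], rule exI[of _ R'])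
     (simp add: 2 3 flip: 1, simp add: J'_def P'_def L'_def R'_def)
  qed
 qed
 thus thesis using that by metis
qed

lemma kron_comp_left: "nc A = nr B ==> kron (A * B) (I n) = kron A (I n) * kron B (I n)" by (simp add: kron_mult)

lemma kron_comp_right: "nc A = nr B ==> kron (I n) (A * B) = kron (I n) A * kron (I n) B" by (simp add: kron_mult)

lemma kron_slide: "nc A = k ==> nr B = l ==> kron A (I l) * kron (I k) B = kron A B"
 "nr A = k ==> nc B = l ==> kron (I k) B * kron A (I l) = kron A B" by (simp_all add: kron_ring)

lemma kron_col_slide: "nc c = Suc 0 ==> nr A = n ==> kron (I n) c * A = kron A c"
 using kron_mult[of "I n" A c "I (Suc 0)"] by (simp add: mat_ring kron_one_right)

lemma kron_one_prod: "kron (I (m * n)) A = kron (I m) (kron (I n) A)" by (simp add: kron_one[symmetric] kron_assoc)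

lemma left_cancel_mat: assumes "J * A = J * B" "L * J = I k" "nc L = nr J" "nr A = k" "nr B = k" "nc J = k"
 shows "A = (B :: complex mat)"
proof -
 have "L * (J * A) = L * (J * B)" using assms(1) by simp
 thus ?thesis using assms(3-6) by (simp add: mult_eq_assoc[OF assms(2)] mat_ring)
qed

lemma right_cancel_mat: assumes "A * P = B * P" "P * R = I k" "nc P = nr R" "nc A = k" "nc B = k" "nr P = k"
 shows "A = (B :: complex mat)"
proof -
 have "A * P * R = B * P * R" using assms(1) by simp
 thus ?thesis using assms(3-6) by (simp add: assms(2) mat_ring)
qed

text \<open>\<open>J\<close> is left cancellable and \<open>P\<close> right cancellable, so J P J P
  = J P reduces to P J = 1.\<close>

lemma idem_factors: assumes "(J * P) * (J * P) = J * P" "L * J = I k" "P * R = I k"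
  "nr P = k" "nc J = k" "nc P = nr J" "nc L = nr J" "nr R = nr J"
 shows "P * J = I k"
proof -
 have "J * (P * J * P) = J * P" using assms by (simp add: mat_ring)
 hence "P * J * P = P" by (rule left_cancel_mat[OF _ assms(2)]) (simp_all add: assms)
 hence "P * J * P = I k * P" by (simp add: mat_ring assms)
 thus ?thesis by (rule right_cancel_mat[OF _ assms(3)]) (simp_all add: assms)
qed

lemma mat_split_idem:
 fixes e :: "complex mat" assumes ee: "e * e = e" and de: "nr e = n" "nc e = n"
 obtains k J P where "nr J = n" "nc J = k" "nr P = k" "nc P = n" "e = J * P" "P * J = I k"
proof -
 obtain k J P L R where d [simp]: "nr J = n" "nc J = k" "nr P = k" "nc P = n"
   "nr L = k" "nc L = n" "nr R = n" "nc R = k"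
   and e: "e = J * P" and LJ: "L * J = I k" and PR: "P * R = I k" by (rule rank_factorization[of e, unfolded de])
 have "P * J = I k" using idem_factors[OF ee[unfolded e] LJ PR] by simp
 thus thesis using d e by (intro that[of J k P])
qed

section \<open>Modules over a separable algebra\<close>

text \<open>A finite-dimensional algebra in coordinates: \<open>m\<close> is the matrix of the
  multiplication A \<otimes> A \<rightarrow> A, and the column \<open>u\<close> is the unit.\<close>

locale mat_algebra =
 fixes a :: nat and m u :: "complex mat" assumes dim_alg [simp]: "nr m = a" "nc m = a * a" "nr u = a" "nc u = Suc 0"
  and alg_assoc: "m * kron m (I a) = m * kron (I a) m" and alg_unit_left: "m * kron u (I a) = I a"
  and alg_unit_right: "m * kron (I a) u = I a"
begin

text \<open>A right module of dimension \<open>n\<close> is the \<open>n \<times> n a\<close> matrix \<open>r\<close> of its action; \<open>kron (I k) r\<close> is its \<open>k\<close>-fold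
 direct sum.\<close>

definition umod :: "nat => complex mat => bool" where
 "umod n r \<longleftrightarrow> nr r = n \<and> nc r = n * a \<and>
  r * kron r (I a) = r * kron (I n) m \<and> r * kron (I n) u = I n"

definition ulin :: "nat => complex mat => nat => complex mat => complex mat => bool" where
 "ulin n r n' r' f \<longleftrightarrow> nr f = n' \<and> nc f = n \<and> f * r = r' * kron f (I a)"

lemma umodD: assumes "umod n r"
 shows "nr r = n" "nc r = n * a" "r * kron r (I a) = r * kron (I n) m" "r * kron (I n) u = I n"
 using assms by (simp_all add: umod_def)

lemma ulinD: assumes "ulin n r n' r' f" shows "nr f = n'" "nc f = n" "f * r = r' * kron f (I a)"
 using assms by (simp_all add: ulin_def)

lemma umod_regular: "umod a m" by (simp add: umod_def alg_assoc alg_unit_right)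

lemma ulin_id: "umod n r ==> ulin n r n r (I n)" by (simp add: ulin_def umod_def mat_ring mat_kron)

lemma ulin_comp:
 assumes "ulin n r n' r' f" "ulin n' r' n'' r'' g" "nr r = n" "nc r' = n' * a" "nr r' = n'" "nc r'' = n'' * a"
 shows "ulin n r n'' r'' (g * f)"
proof -
 note [simp] = ulinD(1,2)[OF assms(1)] ulinD(1,2)[OF assms(2)] assms(3-)
 have "g * f * r = g * (r' * kron f (I a))" using ulinD(3)[OF assms(1)] by (simp add: mat_ring)
 also have "... = (g * r') * kron f (I a)" by (simp add: mat_ring)
 also have "... = r'' * kron (g * f) (I a)" by (simp add: ulinD(3)[OF assms(2)] mat_ring mat_kron)
 finally show ?thesis by (simp add: ulin_def)
qed

lemma ulin_add: assumes "ulin n r n' r' f" "ulin n r n' r' g" "nr r = n" "nc r' = n' * a"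
 shows "ulin n r n' r' (f + g)" using assms by (simp add: ulin_def mat_ring kron_add_left)

lemma ulin_smult: assumes "ulin n r n' r' f" "nr r = n" "nc r' = n' * a" shows "ulin n r n' r' (k *s f)"
 using assms by (simp add: ulin_def mat_ring kron_smult_left)

text \<open>The module axioms descend along a left cancellable intertwiner: a matrix
  \<open>r\<close> is an action as soon as \<open>J\<close> embeds it into one.\<close>

lemma umod_of_mono: assumes "umod n' r'" "nr r = k" "nc r = k * a" "nr J = n'" "nc J = k"
  "L * J = I k" "nc L = n'" "J * r = r' * kron J (I a)" shows "umod k r"
proof -
 note [simp] = umodD(1,2)[OF assms(1)] assms(2-5,7)
 have "J * (r * kron r (I a)) = (r' * kron J (I a)) * kron r (I a)" by (simp add: mat_ring flip: assms(8))
 also have "... = r' * kron (J * r) (I a)" by (simp add: mat_ring mat_kron)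
 also have "... = r' * kron r' (I a) * kron (kron J (I a)) (I a)" by (simp add: assms(8) kron_ring)
 also have "... = r' * kron J m" by (simp add: umodD(3)[OF assms(1)] mat_ring mat_kron)
 also have "... = (r' * kron J (I a)) * kron (I k) m" by (simp add: mat_ring mat_kron)
 also have "... = J * (r * kron (I k) m)" by (simp add: mat_ring flip: assms(8))
 finally have 1: "r * kron r (I a) = r * kron (I k) m" by (rule left_cancel_mat[OF _ assms(6)]) simp_all
 have "J * (r * kron (I k) u) = (r' * kron J (I a)) * kron (I k) u" by (simp add: mat_ring flip: assms(8))
 also have "... = r' * (kron (I n') u * J)" by (simp add: kron_col_slide mat_ring mat_kron)
 also have "... = J * I k" by (simp add: mult_eq_assoc[OF umodD(4)[OF assms(1)]] mat_ring)
 finally have "r * kron (I k) u = I k" by (rule left_cancel_mat[OF _ assms(6)]) simp_all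
 with 1 show ?thesis by (simp add: umod_def)
qed

text \<open>The image of a module map is a module. With f = J P, its action is that of the source
  pulled back along the linear section \<open>R\<close> of \<open>P\<close>. \<open>R\<close> is no
  module map, but J s = r' (J \<otimes> 1) shows that this does no harm.\<close>

lemma ulin_image: assumes "umod n r" "umod n' r'" "ulin n r n' r' f"
 obtains k s J P L R where "umod k s" "ulin n r k s P" "ulin k s n' r' J" "f = J * P"
  "nr L = k" "nc L = n'" "nr R = n" "nc R = k"
  "L * J = I k" "P * R = I k"
proof -
 note [simp] = umodD(1,2)[OF assms(1)] umodD(1,2)[OF assms(2)] ulinD(1,2)[OF assms(3)]
 obtain k J P L R where [simp]: "nr J = n'" "nc J = k" "nr P = k" "nc P = n"
  "nr L = k" "nc L = n'" "nr R = n" "nc R = k" and f: "f = J * P" and LJ: "L * J = I k" and PR: "P * R = I k"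
  by (rule rank_factorization[of f, unfolded ulinD(1)[OF assms(3)] ulinD(2)[OF assms(3)]])
 define s where "s = P * r * kron R (I a)"
 have [simp]: "nr s = k" "nc s = k * a" by (simp_all add: s_def)
 have fr: "J * (P * r) = r' * kron (J * P) (I a)" using ulinD(3)[OF assms(3)] by (simp add: f mat_ring)
 have "J * s = (J * (P * r)) * kron R (I a)" by (simp add: s_def mat_ring)
 also have "... = r' * kron J (I a)" unfolding fr by (simp add: kron_ring PR)
 finally have Js: "J * s = r' * kron J (I a)" .
 have "J * (s * kron P (I a)) = (J * s) * kron P (I a)" by (simp add: mat_ring)
 also have "... = r' * kron (J * P) (I a)" by (simp add: Js kron_ring)
 also have "... = J * (P * r)" by (simp add: fr)
 finally have "s * kron P (I a) = P * r" by (rule left_cancel_mat[OF _ LJ]) simp_all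
 hence "ulin n r k s P" by (simp add: ulin_def)
 moreover have "ulin k s n' r' J" by (simp add: ulin_def Js)
 moreover have "umod k s" by (rule umod_of_mono[OF assms(2) _ _ _ _ LJ _ Js]) simp_all
 ultimately show thesis by (intro that[of k s P J L R] f LJ PR) simp_all
qed

text \<open>Minimal dimension instead of absence of submodules: existence follows from
  \<open>LEAST\<close>, and the image of a nonzero map from or to such a module already has its
  dimension.\<close>

definition usimple :: "nat => complex mat => bool" where
 "usimple n r \<longleftrightarrow> umod n r \<and> 0 < n \<and> (\<forall>n' r'. umod n' r' \<and> 0 < n' \<longrightarrow> n \<le> n')"

lemma usimple_exists: assumes "0 < a" obtains n r where "usimple n r"
proof -
 let ?P = "\<lambda>n. \<exists>r. umod n r \<and> 0 < n"
 have "?P a" using umod_regular assms by auto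
 hence "?P (LEAST n. ?P n)" by (rule LeastI)
 then obtain r where "umod (LEAST n. ?P n) r" "0 < (LEAST n. ?P n)" by blast
 hence "usimple (LEAST n. ?P n) r" by (auto simp: usimple_def intro!: Least_le)
 thus thesis by (rule that)
qed

text \<open>The image is a nonzero module of dimension at most n, hence of dimension n by
  minimality. The left inverse \<open>L\<close> is only linear; averaging turns it into a module map
  later.\<close>

lemma schur_mono: assumes "usimple n r" "umod n' r'" "ulin n r n' r' f" "f \<noteq> 0\<^sub>m n' n"
 obtains L where "nr L = n" "nc L = n'" "L * f = I n"
proof -
 have U: "umod n r" using assms(1) by (simp add: usimple_def)
 obtain k s J P L R where *: "umod k s" "ulin n r k s P" "ulin k s n' r' J" "f = J * P"
  "nr L = k" "nc L = n'" "nr R = n" "nc R = k" "L * J = I k" "P * R = I k" using ulin_image[OF U assms(2,3)] .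
 note [simp] = *(5-8) ulinD(1,2)[OF *(2)] ulinD(1,2)[OF *(3)]
 have "k \<noteq> 0"
 proof
  assume "k = 0"
  hence "f = 0\<^sub>m n' n" unfolding *(4) by (intro eq_matI) (simp_all add: scalar_prod_def)
  thus False using assms(4) by simp
 qed
 hence "n \<le> k" using assms(1) *(1) by (auto simp: usimple_def)
 moreover have "k \<le> n" by (rule left_inverse_dim[OF *(10)]) simp_all
 ultimately have k: "k = n" by simp
 have "R * P = I k" by (rule square_left_inverse[OF *(10)]) (simp_all add: k)
 hence "R * L * f = I n" unfolding *(4) by (simp add: mat_ring mult_eq_assoc[OF *(9)] k)
 thus thesis by (intro that[of "R * L"]) simp_all
qed

lemma schur_epi: assumes "usimple n r" "umod n' r'" "ulin n' r' n r f" "f \<noteq> 0\<^sub>m n n'"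
 obtains R where "nr R = n'" "nc R = n" "f * R = I n"
proof -
 have U: "umod n r" using assms(1) by (simp add: usimple_def)
 obtain k s J P L R where *: "umod k s" "ulin n' r' k s P" "ulin k s n r J" "f = J * P"
  "nr L = k" "nc L = n" "nr R = n'" "nc R = k" "L * J = I k" "P * R = I k" using ulin_image[OF assms(2) U assms(3)] .
 note [simp] = *(5-8) ulinD(1,2)[OF *(2)] ulinD(1,2)[OF *(3)]
 have "k \<noteq> 0"
 proof
  assume "k = 0"
  hence "f = 0\<^sub>m n n'" unfolding *(4) by (intro eq_matI) (simp_all add: scalar_prod_def)
  thus False using assms(4) by simp
 qed
 hence "n \<le> k" using assms(1) *(1) by (auto simp: usimple_def)
 moreover have "k \<le> n" by (rule left_inverse_dim[OF *(9)]) simp_all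
 ultimately have k: "k = n" by simp
 have "J * L = I k" by (rule square_left_inverse[OF *(9)]) (simp_all add: k)
 hence "f * (R * L) = I n" unfolding *(4) by (simp add: mat_ring mult_eq_assoc[OF *(10)] k)
 thus thesis by (intro that[of "R * L"]) simp_all
qed

text \<open>For an eigenvalue k the module map f - k annihilates an eigenvector, so by
  \<open>schur_mono\<close> it is zero.\<close>

lemma schur_scalar: assumes "usimple n r" "ulin n r n r f"
 obtains k where "f = k *s I n"
proof -
 have U: "umod n r" and n: "0 < n" using assms(1) by (simp_all add: usimple_def)
 note [simp] = umodD(1,2)[OF U] ulinD(1,2)[OF assms(2)]
 have f: "f : carrier_mat n n" by auto
 obtain k where "eigenvalue f k" using spectrum_non_empty[OF f] n by (auto simp: spectrum_def)
 then obtain v where v: "v : carrier_vec n" "v \<noteq> 0\<^sub>v n" "f *\<^sub>v v = k \<cdot>\<^sub>v v"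
  by (auto simp: eigenvalue_def eigenvector_def)
 define g where "g = f + (- k) *s I n"
 have g [simp]: "g : carrier_mat n n" "nr g = n" "nc g = n" by (auto simp: g_def)
 have lin: "ulin n r n r g" unfolding g_def by (intro ulin_add ulin_smult ulin_id assms U) simp_all
 have gv: "g *\<^sub>v v = 0\<^sub>v n"
 proof -
  have "g *\<^sub>v v = f *\<^sub>v v + ((- k) *s I n) *\<^sub>v v"
   unfolding g_def by (rule add_mult_distrib_mat_vec[OF f _ v(1)]) auto
  also have "((- k) *s I n) *\<^sub>v v = (- k) \<cdot>\<^sub>v v"
   using v(1) by (intro eq_vecI) (auto simp: scalar_prod_def if_mult sum.delta row_def)
  finally show ?thesis using v by (intro eq_vecI) auto
 qed
 have "g = 0\<^sub>m n n"
 proof (rule ccontr)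
  assume "g \<noteq> 0\<^sub>m n n"
  then obtain L where L: "nr L = n" "nc L = n" "L * g = I n" using schur_mono[OF assms(1) U lin] by auto
  hence "v = (L * g) *\<^sub>v v" using v by simp
  also have "... = L *\<^sub>v (g *\<^sub>v v)" using L v by (intro assoc_mult_mat_vec[of _ n n _ n]) auto
  also have "... = 0\<^sub>v n" unfolding gv using L by (intro eq_vecI) (auto simp: scalar_prod_def)
  finally show False using v by simp
 qed
 hence "g + k *s I n = k *s I n" by (simp add: mat_ring)
 moreover have "g + k *s I n = f" unfolding g_def by (intro eq_matI) auto
 ultimately show thesis using that by metis
qed

end

text \<open>\<open>c\<close> is a separability element: for c a sum of terms c1 \<otimes> c2, the
  axioms say c1 c2 = 1 and b c1 \<otimes> c2 = c1 \<otimes> c2 b.\<close>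

locale separable_mat_algebra = mat_algebra +
 fixes c :: "complex mat" assumes dim_cas [simp]: "nr c = a * a" "nc c = Suc 0" and mult_cas: "m * c = u"
  and cas_central: "kron m (I a) * kron (I a) c = kron (I a) m * kron c (I a)"
begin

text \<open>The averaging operator of Maschke's theorem, v \<mapsto> f(v c1) c2.\<close>

definition avg :: "complex mat => complex mat => complex mat => complex mat" where
 "avg r r' f = r' * kron (f * r) (I a) * kron (I (nc f)) c"

lemma dim_avg [simp]: "nr (avg r r' f) = nr r'" "nc (avg r r' f) = nc f" by (simp_all add: avg_def)

text \<open>f(v b c1) c2 = f(v c1) c2 b by centrality of \<open>c\<close>. The calculation slides
  tensor factors past each other until \<open>cas_central\<close> applies.\<close>

lemma avg_lin: assumes "umod n r" "umod n' r'" "nr f = n'" "nc f = n" shows "ulin n r n' r' (avg r r' f)"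
proof -
 note [simp] = umodD(1,2)[OF assms(1)] umodD(1,2)[OF assms(2)] assms(3,4)
 have "avg r r' f * r = r' * kron (f * r) (I a) * (kron (I n) c * r)" by (simp add: avg_def mat_ring)
 also have "kron (I n) c * r = kron r (I (a * a)) * kron (I (n * a)) c"
  by (simp add: kron_col_slide mat_ring mat_kron)
 also have "r' * kron (f * r) (I a) * ... = r' * (kron (f * r) (I a) * kron (kron r (I a)) (I a)) * kron (I (n * a)) c"
  by (simp add: kron_assoc kron_one mat_ring)
 also have "... = r' * kron (f * (r * kron r (I a))) (I a) * kron (I (n * a)) c" by (simp add: kron_ring)
 also have "... = r' * (kron (f * r) (I a) * kron (kron (I n) m) (I a)) * kron (I (n * a)) c"
  by (simp add: umodD(3)[OF assms(1)] kron_ring)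
 also have "... = r' * kron (f * r) (I a) * kron (I n) (kron m (I a) * kron (I a) c)"
  by (simp add: kron_mult kron_assoc kron_one_prod mat_ring)
 also have "... = r' * (kron (f * r) (I a) * kron (I n) (kron (I a) m)) * kron (I n) (kron c (I a))"
  by (simp add: cas_central kron_comp_right mat_ring)
 also have "kron (f * r) (I a) * kron (I n) (kron (I a) m) = kron (f * r) m"
  using kron_slide(1)[of "f * r" "n * a" m a] by (simp add: kron_one_prod)
 also have "... = kron (I n') m * kron (f * r) (I (a * a))" by (simp add: kron_slide(2))
 also have "r' * ... * kron (I n) (kron c (I a)) =
   (r' * kron (I n') m) * (kron (f * r) (I (a * a)) * kron (I n) (kron c (I a)))" by (simp add: mat_ring)
 also have "... = r' * kron r' (I a) * (kron (kron (f * r) (I a)) (I a) * kron (kron (I n) c) (I a))"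
  by (simp add: umodD(3)[OF assms(2)] kron_assoc kron_one)
 also have "... = r' * kron (avg r r' f) (I a)" by (simp add: avg_def kron_ring)
 finally show ?thesis by (simp add: ulin_def)
qed

lemma avg_comp_left: assumes "umod n r" "umod n' r'" "umod n'' r''" "nr f = n'" "nc f = n" "ulin n' r' n'' r'' g"
 shows "avg r r'' (g * f) = g * avg r r' f"
proof -
 note [simp] = umodD(1,2)[OF assms(1)] umodD(1,2)[OF assms(2)] umodD(1,2)[OF assms(3)] assms(4,5)
  ulinD(1,2)[OF assms(6)]
 have "avg r r'' (g * f) = (r'' * kron g (I a)) * kron (f * r) (I a) * kron (I n) c"
  by (simp add: avg_def kron_ring)
 thus ?thesis by (simp add: avg_def mat_ring flip: ulinD(3)[OF assms(6)])
qed

lemma avg_comp_right: assumes "umod n r" "umod n' r'" "umod n'' r''" "nr f = n''" "nc f = n'" "ulin n r n' r' h"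
 shows "avg r r'' (f * h) = avg r' r'' f * h"
proof -
 note [simp] = umodD(1,2)[OF assms(1)] umodD(1,2)[OF assms(2)] umodD(1,2)[OF assms(3)] assms(4,5)
  ulinD(1,2)[OF assms(6)]
 have "avg r r'' (f * h) = r'' * kron (f * (h * r)) (I a) * kron (I n) c" by (simp add: avg_def mat_ring)
 also have "... = r'' * (kron (f * r') (I a) * kron (kron h (I a)) (I a)) * kron (I n) c"
  by (simp add: ulinD(3)[OF assms(6)] kron_ring)
 also have "... = r'' * kron (f * r') (I a) * (kron h (I (a * a)) * kron (I n) c)"
  by (simp add: kron_assoc kron_one mat_ring)
 also have "kron h (I (a * a)) * kron (I n) c = kron (I n') c * h" by (simp add: kron_slide kron_col_slide)
 finally show ?thesis by (simp add: avg_def mat_ring)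
qed

text \<open>Because c1 c2 = 1. Together with \<open>avg_comp_left\<close> this says that averaging
  fixes every module map.\<close>

lemma avg_one: assumes "umod n r" shows "avg r r (I n) = I n"
proof -
 note [simp] = umodD(1,2)[OF assms]
 have "avg r r (I n) = r * kron r (I a) * kron (I n) c" by (simp add: avg_def mat_ring)
 also have "... = r * kron (I n) (m * c)" by (simp add: umodD(3)[OF assms] kron_ring)
 finally show ?thesis by (simp add: mult_cas umodD(4)[OF assms])
qed

text \<open>Maschke's theorem: a linear retraction of a module map averages to a module
  retraction.\<close>

lemma avg_retraction: assumes "umod n r" "umod n' r'" "ulin n r n' r' f" "L * f = I n" "nr L = n" "nc L = n'"
 shows "ulin n' r' n r (avg r' r L)" "avg r' r L * f = I n"
 using avg_lin[OF assms(2,1,5,6)] avg_comp_right[OF assms(1,2,1,5,6,3)] avg_one[OF assms(1)] assms(4) by simp_all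

lemma avg_section: assumes "umod n r" "umod n' r'" "ulin n r n' r' f" "f * R = I n'" "nr R = n" "nc R = n'"
 shows "ulin n' r' n r (avg r' r R)" "f * avg r' r R = I n'"
 using avg_lin[OF assms(2,1,5,6)] avg_comp_left[OF assms(2,1,2,5,6,3)] avg_one[OF assms(2)] assms(4) by simp_all

end

section \<open>Multiples of a module and isotypic projections\<close>

context mat_algebra
begin

lemma umod_free: assumes "umod n r" shows "umod (k * n) (kron (I k) r)"
proof -
 note [simp] = umodD(1,2)[OF assms]
 have "kron (I k) r * kron (kron (I k) r) (I a) = kron (I k) (r * kron r (I a))"
  by (simp add: kron_assoc kron_ring)
 also have "... = kron (I k) r * kron (I (k * n)) m"
  by (simp add: umodD(3)[OF assms] kron_one_prod kron_ring)
 finally have 1: "kron (I k) r * kron (kron (I k) r) (I a) = kron (I k) r * kron (I (k * n)) m" .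
 have "kron (I k) r * kron (I (k * n)) u = kron (I k) (r * kron (I n) u)"
  by (simp add: kron_one_prod kron_ring)
 thus ?thesis using 1 umodD(4)[OF assms] by (simp add: umod_def kron_one)
qed

lemma ulin_free: assumes "umod n r" "nr F = l" "nc F = k"
 shows "ulin (k * n) (kron (I k) r) (l * n) (kron (I l) r) (kron F (I n))"
proof -
 note [simp] = umodD(1,2)[OF assms(1)] assms(2,3)
 show ?thesis by (simp add: ulin_def kron_mult kron_assoc kron_one mat_ring)
qed

lemma ulin_block_col: assumes "umod n r" shows "ulin n r (k * n) (kron (I k) r) (kron (ecol k i) (I n))"
 using ulin_free[OF assms, of "ecol k i" k 1] by (simp add: kron_one_left)

lemma ulin_block_row: assumes "umod n r" shows "ulin (k * n) (kron (I k) r) n r (kron (erow k i) (I n))"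
 using ulin_free[OF assms, of "erow k i" 1 k] by (simp add: kron_one_left)

lemma ulin_kron: assumes "umod n r" "umod n' r'" "ulin n r n' r' f"
 shows "ulin (k * n) (kron (I k) r) (k * n') (kron (I k) r') (kron (I k) f)"
proof -
 note [simp] = umodD(1,2)[OF assms(1)] umodD(1,2)[OF assms(2)] ulinD(1,2)[OF assms(3)]
 show ?thesis by (simp add: ulin_def kron_mult kron_assoc mat_ring ulinD(3)[OF assms(3)])
qed

lemma ulin_compI: assumes "umod n r" "umod n' r'" "umod n'' r''" "ulin n' r' n'' r'' g" "ulin n r n' r' f"
 shows "ulin n r n'' r'' (g * f)" using assms by (intro ulin_comp[OF assms(5,4)]) (simp_all add: umodD)

text \<open>Each block of \<open>f\<close> is a module map between single copies; this and the next
  lemma thus determine the maps between multiples.\<close>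

lemma ulin_free_zero: assumes "umod n r" "umod n' r'" "\<And>f. ulin n r n' r' f ==> f = 0\<^sub>m n' n"
  "ulin (k * n) (kron (I k) r) (l * n') (kron (I l) r') f" shows "f = 0\<^sub>m (l * n') (k * n)"
proof -
 note [simp] = umodD(1,2)[OF assms(1)] umodD(1,2)[OF assms(2)] ulinD(1,2)[OF assms(4)]
 have *: "kron (erow l j) (I n') * (f * kron (ecol k i) (I n)) = 0\<^sub>m n' n" for i j
  by (intro assms(3) ulin_compI[OF _ _ _ ulin_block_row ulin_compI[OF _ _ _ assms(4) ulin_block_col]]
    umod_free assms(1,2))
 show ?thesis by (rule eq_mat_by_blocks_col[of _ _ k n]; (rule eq_mat_by_blocks_row[of _ _ l n'])?)
   (simp_all add: * mat_ring)
qed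

lemma ulin_free_scalar: assumes "umod n r" "\<And>f. ulin n r n r f ==> \<exists>x. f = x *s I n"
  "ulin (k * n) (kron (I k) r) (l * n) (kron (I l) r) f"
 obtains F where "nr F = l" "nc F = k" "f = kron F (I n)"
proof -
 note [simp] = umodD(1,2)[OF assms(1)] ulinD(1,2)[OF assms(3)]
 have "\<exists>x. kron (erow l j) (I n) * (f * kron (ecol k i) (I n)) = x *s I n" for i j
  by (intro assms(2) ulin_compI[OF _ _ _ ulin_block_row ulin_compI[OF _ _ _ assms(3) ulin_block_col]]
    umod_free assms(1))
 then obtain x where x: "kron (erow l j) (I n) * (f * kron (ecol k i) (I n)) = x j i *s I n" for i j by metis
 define F where "F = mat l k (\<lambda>(j, i). x j i)"
 have [simp]: "nr F = l" "nc F = k" by (simp_all add: F_def)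
 have F: "erow l j * (F * ecol k i) = x j i *s I (Suc 0)" if "j < l" "i < k" for i j
  using erow_mult_ecol[of j F i] that by (simp add: F_def assoc_mult_mat_dim)
 have "f = kron F (I n)" by (rule eq_mat_by_blocks_col[of _ _ k n]; (rule eq_mat_by_blocks_row[of _ _ l n])?)
   (simp_all add: x kron_ring F kron_smult_left kron_one)
 thus thesis by (intro that[of F]) simp_all
qed

text \<open>The projection to the isotypic component of a simple module \<open>r0\<close>: it splits
  through a multiple of \<open>r0\<close> and fixes every map from and to \<open>r0\<close>. These
  clauses make it natural, by \<open>isoproj_natural\<close>, and therefore unique.\<close>

definition isoproj :: "nat => complex mat => nat => complex mat => complex mat => bool" where
 "isoproj n0 r0 n r e \<longleftrightarrow>
  (\<exists>k \<alpha> \<beta>. ulin (k * n0) (kron (I k) r0) n r \<alpha> \<and> ulin n r (k * n0) (kron (I k) r0) \<beta> \<and>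
   \<beta> * \<alpha> = I (k * n0) \<and> e = \<alpha> * \<beta>) \<and>
  (\<forall>\<gamma>. ulin n0 r0 n r \<gamma> \<longrightarrow> e * \<gamma> = \<gamma>) \<and> (\<forall>\<delta>. ulin n r n0 r0 \<delta> \<longrightarrow> \<delta> * e = \<delta>)"

lemma isoprojE: assumes "isoproj n0 r0 n r e"
 obtains k \<alpha> \<beta> where "ulin (k * n0) (kron (I k) r0) n r \<alpha>" "ulin n r (k * n0) (kron (I k) r0) \<beta>"
  "\<beta> * \<alpha> = I (k * n0)" "e = \<alpha> * \<beta>" using assms unfolding isoproj_def by blast

lemma isoproj_fix:
 "isoproj n0 r0 n r e ==> ulin n0 r0 n r \<gamma> ==> e * \<gamma> = \<gamma>"
 "isoproj n0 r0 n r e ==> ulin n r n0 r0 \<delta> ==> \<delta> * e = \<delta>" unfolding isoproj_def by blast+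

lemma isoproj_ulin: assumes "umod n0 r0" "umod n r" "isoproj n0 r0 n r e" shows "ulin n r n r e" "e * e = e"
proof -
 obtain k \<alpha> \<beta> where *: "ulin (k * n0) (kron (I k) r0) n r \<alpha>" "ulin n r (k * n0) (kron (I k) r0) \<beta>"
  "\<beta> * \<alpha> = I (k * n0)" "e = \<alpha> * \<beta>" using assms(3) by (rule isoprojE)
 show "ulin n r n r e" unfolding *(4) by (rule ulin_compI[OF assms(2) umod_free[OF assms(1)] assms(2) *(1,2)])
 note [simp] = ulinD(1,2)[OF *(1)] ulinD(1,2)[OF *(2)]
 show "e * e = e" by (simp add: *(4) mat_ring mult_eq_assoc[OF *(3)])
qed

text \<open>f \<alpha> consists of maps from the simple module into the target and is fixed by
  \<open>e'\<close>; \<beta>' f consists of maps into the simple module and is fixed by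
  \<open>e\<close>. So f e and e' f both equal e' f e.\<close>

lemma isoproj_natural: assumes U: "umod n0 r0" and M: "umod n r" and N: "umod n' r'"
  and e: "isoproj n0 r0 n r e" and e': "isoproj n0 r0 n' r' e'" and f: "ulin n r n' r' f" shows "f * e = e' * f"
proof -
 obtain k \<alpha> \<beta> where *: "ulin (k * n0) (kron (I k) r0) n r \<alpha>" "ulin n r (k * n0) (kron (I k) r0) \<beta>"
  "\<beta> * \<alpha> = I (k * n0)" "e = \<alpha> * \<beta>" using e by (rule isoprojE)
 obtain k' \<alpha>' \<beta>' where **: "ulin (k' * n0) (kron (I k') r0) n' r' \<alpha>'" "ulin n' r' (k' * n0) (kron (I k') r0) \<beta>'"
  "\<beta>' * \<alpha>' = I (k' * n0)" "e' = \<alpha>' * \<beta>'" using e' by (rule isoprojE)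
 note [simp] = ulinD(1,2)[OF *(1)] ulinD(1,2)[OF *(2)] ulinD(1,2)[OF **(1)] ulinD(1,2)[OF **(2)]
  ulinD(1,2)[OF f] umodD(1,2)[OF U] umodD(1,2)[OF M] umodD(1,2)[OF N]
 have de [simp]: "nr e = n" "nc e = n" "nr e' = n'" "nc e' = n'" by (simp_all add: *(4) **(4))
 have fa: "e' * (f * \<alpha>) = f * \<alpha>"
 proof (rule eq_mat_by_blocks_col[of _ _ k n0])
  fix i assume "i < k"
  have "ulin n0 r0 n' r' (f * (\<alpha> * kron (ecol k i) (I n0)))"
   by (intro ulin_compI[OF U M N f] ulin_compI[OF U umod_free[OF U] M *(1)] ulin_block_col U)
  from isoproj_fix(1)[OF e' this]
  show "e' * (f * \<alpha>) * kron (ecol k i) (I n0) = f * \<alpha> * kron (ecol k i) (I n0)" by (simp add: mat_ring)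
 qed simp_all
 have bf: "(\<beta>' * f) * e = \<beta>' * f"
 proof (rule eq_mat_by_blocks_row[of _ _ k' n0])
  fix i assume "i < k'"
  have "ulin n r n0 r0 (kron (erow k' i) (I n0) * (\<beta>' * f))"
   by (intro ulin_compI[OF M umod_free[OF U] U ulin_block_row] ulin_compI[OF M N umod_free[OF U] **(2) f] U)
  from isoproj_fix(2)[OF e this]
  show "kron (erow k' i) (I n0) * (\<beta>' * f * e) = kron (erow k' i) (I n0) * (\<beta>' * f)"
   by (simp add: mat_ring)
 qed simp_all
 have "f * e = e' * (f * \<alpha>) * \<beta>" by (simp add: fa *(4) mat_ring)
 also have "... = \<alpha>' * ((\<beta>' * f) * e)" by (simp add: *(4) **(4) mat_ring)
 also have "... = e' * f" by (simp add: bf, simp add: **(4) mat_ring)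
 finally show ?thesis .
qed

end

context separable_mat_algebra
begin

text \<open>Take the largest multiple of the simple module that embeds; the dimension bounds it. A
  map from the simple module that leaves this multiple would, by Schur's lemma, enlarge it.\<close>

lemma isoproj_exists: assumes S: "usimple n0 r0" and M: "umod n r"
 obtains e where "isoproj n0 r0 n r e"
proof -
 have U: "umod n0 r0" and n0: "0 < n0" using S by (simp_all add: usimple_def)
 note [simp] = umodD(1,2)[OF U] umodD(1,2)[OF M]
 define Q where "Q k \<longleftrightarrow> (\<exists>\<alpha> L. ulin (k * n0) (kron (I k) r0) n r \<alpha> \<and> nr L = k * n0 \<and> nc L = n \<and>
  L * \<alpha> = I (k * n0))" for k
 have "Q 0" unfolding Q_def by (rule exI[of _ "0\<^sub>m n 0"], rule exI[of _ "0\<^sub>m 0 n"])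
   (simp add: ulin_def mat_ring kron_zero_left, intro eq_matI, simp_all)
 moreover have bound: "k \<le> n" if "Q k" for k
 proof -
  obtain \<alpha> L where "ulin (k * n0) (kron (I k) r0) n r \<alpha>" "nr L = k * n0" "nc L = n" "L * \<alpha> = I (k * n0)"
   using \<open>Q k\<close> unfolding Q_def by blast
  hence "k * n0 \<le> n" by (intro left_inverse_dim[of L \<alpha>]) (simp_all add: ulin_def)
  thus ?thesis using n0 by (metis One_nat_def Suc_leI dual_order.trans mult.right_neutral mult_le_mono2)
 qed
 ultimately obtain k where k: "Q k" and max: "\<And>l. Q l ==> l \<le> k" by (metis GreatestI_nat Greatest_le_nat)
 obtain \<alpha> L where \<alpha>: "ulin (k * n0) (kron (I k) r0) n r \<alpha>" and L: "nr L = k * n0" "nc L = n" "L * \<alpha> = I (k * n0)"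
  using k unfolding Q_def by blast
 note Uk = umod_free[OF U, of k]
 \<comment> \<open>Averaging the linear left inverse gives a module retraction, so that
   \<open>e\<close> and its complement \<open>f\<close> are module maps.\<close>
 define \<beta> where "\<beta> = avg r (kron (I k) r0) L"
 have \<beta>: "ulin n r (k * n0) (kron (I k) r0) \<beta>" and ba: "\<beta> * \<alpha> = I (k * n0)"
  unfolding \<beta>_def using avg_retraction[OF Uk M \<alpha> L(3,1,2)] by simp_all
 note [simp] = ulinD(1,2)[OF \<alpha>] ulinD(1,2)[OF \<beta>]
 define e where "e = \<alpha> * \<beta>"
 define f where "f = I n + (- 1) *s e"
 have [simp]: "nr e = n" "nc e = n" "nr f = n" "nc f = n" by (simp_all add: e_def f_def)
 have elin: "ulin n r n r e" unfolding e_def by (rule ulin_compI[OF M Uk M \<alpha> \<beta>])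
 hence flin: "ulin n r n r f" unfolding f_def by (intro ulin_add ulin_smult ulin_id M) simp_all
 have ee: "e * e = e" by (simp add: e_def mat_ring mult_eq_assoc[OF ba])
 have ff: "f * f = f"  by (simp add: f_def mat_ring ee) (intro eq_matI; simp del: index_mult_mat(1))
 have fa: "f * \<alpha> = 0\<^sub>m n (k * n0)" by (simp add: f_def e_def mat_ring ba add_self_smult zero_smult_mat)
 have bf: "\<beta> * f = 0\<^sub>m (k * n0) n"
  by (simp add: f_def e_def mat_ring mult_eq_assoc[OF ba] add_self_smult zero_smult_mat)
 have f0: "f * \<gamma> = 0\<^sub>m n n0" if \<gamma>: "ulin n0 r0 n r \<gamma>" for \<gamma>
 proof (rule ccontr)
  assume nz: "f * \<gamma> \<noteq> 0\<^sub>m n n0"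
  note [simp] = ulinD(1,2)[OF \<gamma>]
  have lin: "ulin n0 r0 n r (f * \<gamma>)" by (rule ulin_compI[OF U M M flin \<gamma>])
  from schur_mono[OF S M this nz] obtain K where [simp]: "nr K = n0" "nc K = n" and K: "K * (f * \<gamma>) = I n0" .
  have KX: "K * (f * (\<gamma> * X)) = X" if "nr X = n0" for X
   using mult_eq_assoc[OF K, of X] that by (simp add: mat_ring)
  let ?p = "kron (prl_mat k 1) (I n0)" and ?q = "kron (prr_mat k 1) (I n0)"
  let ?i = "kron (inl_mat k 1) (I n0)" and ?j = "kron (inr_mat k 1) (I n0)"
  \<comment> \<open>\<open>\<alpha>\<close> and \<open>f * \<gamma>\<close> together embed k + 1
    copies, against the maximality of k: f \<alpha> = 0 and \<beta> f = 0 make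
    \<open>L' * \<alpha>'\<close> block diagonal.\<close>
  define \<alpha>' where "\<alpha>' = \<alpha> * ?p + f * \<gamma> * ?q"
  define L' where "L' = ?i * \<beta> + ?j * (K * f)"
  have p: "ulin ((k + 1) * n0) (kron (I (k + 1)) r0) (k * n0) (kron (I k) r0) ?p" by (rule ulin_free[OF U]) simp_all
  have q: "ulin ((k + 1) * n0) (kron (I (k + 1)) r0) n0 r0 ?q"
   using ulin_free[OF U, of "prr_mat k 1" 1 "k + 1"] by (simp add: kron_one_left)
  have "ulin ((k + 1) * n0) (kron (I (k + 1)) r0) n r \<alpha>'" unfolding \<alpha>'_def
   by (intro ulin_add ulin_compI[OF umod_free[OF U] Uk M \<alpha> p] ulin_compI[OF umod_free[OF U] U M lin q]) simp_all
  moreover have "L' * \<alpha>' = kron (inl_mat k 1 * prl_mat k 1 + inr_mat k 1 * prr_mat k 1) (I n0)"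
   by (simp del: biproduct_mat(5) add: L'_def \<alpha>'_def kron_ring kron_add_left
     mult_eq_assoc[OF ba] mult_eq_assoc[OF ff] mult_eq_assoc[OF fa] mult_eq_assoc[OF bf] KX)
  moreover have "... = I ((k + 1) * n0)" by (simp only: biproduct_mat kron_one)
  moreover have "nr L' = (k + 1) * n0" "nc L' = n" by (simp_all add: L'_def)
  ultimately have "Q (k + 1)" unfolding Q_def by metis
  thus False using max[of "k + 1"] by simp
 qed
 have e1: "e * \<gamma> = \<gamma>" if \<gamma>: "ulin n0 r0 n r \<gamma>" for \<gamma>
 proof -
  note [simp] = ulinD(1,2)[OF \<gamma>]
  have "\<gamma> = e * \<gamma> + f * \<gamma>" by (simp add: f_def mat_ring, intro eq_matI; simp del: index_mult_mat(1))
  also have "... = e * \<gamma>" by (simp add: f0[OF \<gamma>] mat_ring)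
  finally show ?thesis by simp
 qed
 have e2: "\<delta> * e = \<delta>" if \<delta>: "ulin n r n0 r0 \<delta>" for \<delta>
 proof -
  note [simp] = ulinD(1,2)[OF \<delta>]
  have "\<delta> * f = 0\<^sub>m n0 n"
  proof (rule ccontr)
   assume nz: "\<delta> * f \<noteq> 0\<^sub>m n0 n"
   have lin: "ulin n r n0 r0 (\<delta> * f)" by (rule ulin_compI[OF M M U \<delta> flin])
   from schur_epi[OF S M this nz] obtain R where R: "nr R = n" "nc R = n0" "\<delta> * f * R = I n0" .
   \<comment> \<open>A nonzero map from the complement to the simple module would have a module
     section \<sigma>, but f \<sigma> = 0 was just shown for every map from the simple
     module.\<close>
   define \<sigma> where "\<sigma> = avg r0 r R"
   have \<sigma>: "ulin n0 r0 n r \<sigma>" and d\<sigma>: "\<delta> * f * \<sigma> = I n0"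
    using avg_section[OF M U lin R(3,1,2)] by (simp_all add: \<sigma>_def)
   note [simp] = ulinD(1,2)[OF \<sigma>]
   have "\<delta> * (f * \<sigma>) = 0\<^sub>m n0 n0" using f0[OF \<sigma>] by (simp add: mat_ring)
   thus False using d\<sigma> one_mat_neq_zero[OF n0] by (simp add: mat_ring)
  qed
  moreover have "\<delta> = \<delta> * e + \<delta> * f" by (simp add: f_def mat_ring, intro eq_matI; simp del: index_mult_mat(1))
  ultimately show ?thesis by (simp add: mat_ring)
 qed
 have "isoproj n0 r0 n r e" unfolding isoproj_def using \<alpha> \<beta> ba e_def e1 e2 by blast
 thus thesis by (rule that)
qed

end

section \<open>Graded modules with a differential\<close>

text \<open>A separable algebra in \<open>sweedler_cat\<close> as matrices: g acts by an
  automorphism and x by a skew derivation. The last two axioms say that \<open>c\<close> is fixed by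
  g and killed by x, as the image of 1 under a morphism must be.\<close>

locale sweedler_algebra = separable_mat_algebra +
 fixes XA GA :: "complex mat" assumes dim_sw [simp]: "nr XA = a" "nc XA = a" "nr GA = a" "nc GA = a"
  and GA_GA: "GA * GA = I a" and XA_XA: "XA * XA = 0\<^sub>m a a" and GA_XA: "GA * XA = (- 1) *s (XA * GA)"
  and GA_mult: "GA * m = m * kron GA GA" and GA_unit: "GA * u = u"
  and XA_mult: "XA * m = m * (kron XA (I a) + kron GA XA)" and GA_cas: "kron GA GA * c = c"
  and XA_cas: "(kron XA (I a) + kron GA XA) * c = 0\<^sub>m (a * a) 1"
begin

text \<open>Only g acts here, since the action of x has to be constructed.\<close>

definition gmod :: "nat => complex mat => complex mat => bool" where
 "gmod n r G \<longleftrightarrow> umod n r \<and> nr G = n \<and> nc G = n \<and> G * G = I n \<and> G * r = r * kron G GA"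

text \<open>The right modules over the algebra inside \<open>sweedler_cat\<close>, see
  \<open>sweedler_right_module\<close>. The last clause is the Leibniz rule x(v b) = x(v) b + g(v)
  x(b).\<close>

definition dgmod :: "nat => complex mat => complex mat => complex mat => bool" where
 "dgmod n r X G \<longleftrightarrow> gmod n r G \<and> nr X = n \<and> nc X = n \<and> X * X = 0\<^sub>m n n \<and>
  G * X = (- 1) *s (X * G) \<and> X * r = r * (kron X (I a) + kron G XA)"

text \<open>The parity twist: the action pulled back along the automorphism
  \<open>GA\<close>.\<close>

definition tw :: "nat => complex mat => complex mat" where
 "tw n r = r * kron (I n) GA"

lemma gmodD: assumes "gmod n r G" shows "umod n r" "nr G = n" "nc G = n" "G * G = I n" "G * r = r * kron G GA"
  "nr r = n" "nc r = n * a" using assms by (auto simp: gmod_def umod_def)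

lemma dim_tw [simp]: "nr (tw n r) = nr r" "nc (tw n r) = n * a" by (simp_all add: tw_def)

lemma tw_tw: "umod n r ==> tw n (tw n r) = r" by (simp add: tw_def umod_def mat_ring mat_kron GA_GA)

lemma umod_tw: assumes "umod n r" shows "umod n (tw n r)"
proof -
 note [simp] = umodD(1,2)[OF assms]
 have "tw n r * kron (tw n r) (I a) = r * (kron (I n) GA * kron r (I a)) * kron (kron (I n) GA) (I a)"
  by (simp add: tw_def kron_comp_left mat_ring)
 also have "kron (I n) GA * kron r (I a) = kron r (I a) * kron (I (n * a)) GA" by (simp add: kron_slide)
 also have "r * ... * kron (kron (I n) GA) (I a) = (r * kron r (I a)) * kron (I n) (kron GA GA)"
  by (simp add: mat_ring kron_one_prod kron_assoc kron_mult)
 also have "... = r * kron (I n) (m * kron GA GA)" by (simp add: umodD(3)[OF assms] kron_ring)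
 also have "... = tw n r * kron (I n) m" by (simp add: tw_def kron_ring flip: GA_mult)
 finally have 1: "tw n r * kron (tw n r) (I a) = tw n r * kron (I n) m" .
 have "tw n r * kron (I n) u = r * kron (I n) (GA * u)" by (simp add: tw_def kron_ring)
 thus ?thesis using 1 by (simp add: umod_def GA_unit umodD(4)[OF assms])
qed

lemma ulin_tw: assumes "umod n r" "umod n' r'" "ulin n r n' r' f" shows "ulin n (tw n r) n' (tw n' r') f"
proof -
 note [simp] = umodD(1,2)[OF assms(1)] umodD(1,2)[OF assms(2)] ulinD(1,2)[OF assms(3)]
 have "f * tw n r = (f * r) * kron (I n) GA" by (simp add: tw_def mat_ring)
 also have "... = tw n' r' * kron f (I a)" by (simp add: ulinD(3)[OF assms(3)] tw_def kron_ring)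
 finally show ?thesis by (simp add: ulin_def)
qed

text \<open>A grading of a module is the same as an involutive isomorphism to its twist; this lemma
  and \<open>ulin_grading'\<close> allow naturality to be applied to gradings.\<close>

lemma ulin_grading: assumes "gmod n r G" shows "ulin n r n (tw n r) G"
 using gmodD[OF assms] by (simp add: ulin_def tw_def kron_ring)

lemma ulin_grading': assumes "gmod n r G" shows "ulin n (tw n r) n r G"
 using ulin_tw[OF gmodD(1)[OF assms] umod_tw[OF gmodD(1)[OF assms]] ulin_grading[OF assms]]
 by (simp add: tw_tw[OF gmodD(1)[OF assms]])

lemma tw_free: assumes "umod n r" shows "tw (k * n) (kron (I k) r) = kron (I k) (tw n r)"
 using umodD[OF assms] by (simp add: tw_def kron_one_prod kron_ring)

lemma gmod_tensor: assumes "gmod n r G" "nr H = d" "nc H = d" "H * H = I d"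
 shows "gmod (d * n) (kron (I d) r) (kron H G)"
 using gmodD[OF assms(1)] assms(2-4) umod_free[OF gmodD(1)[OF assms(1)], of d]
 by (simp add: gmod_def kron_mult kron_assoc kron_one mat_ring)

lemma gmod_regular: "gmod a m GA" by (simp add: gmod_def umod_regular GA_GA GA_mult)

text \<open>Isomorphic to its own parity twist: for simple modules a nonzero map suffices, by
  Schur's lemma. No dual space is involved.\<close>

definition selfdual :: "nat => complex mat => bool" where
 "selfdual n0 r0 \<longleftrightarrow> (\<exists>g. ulin n0 r0 n0 (tw n0 r0) g \<and> g \<noteq> 0\<^sub>m n0 n0)"

text \<open>The square of an isomorphism g to the twist is a nonzero scalar by Schur's lemma;
  dividing g by a square root of this scalar gives a grading.\<close>

lemma selfdualE: assumes S: "usimple n0 r0" and "selfdual n0 r0"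
 obtains G where "gmod n0 r0 G"
proof -
 have U: "umod n0 r0" and n0: "0 < n0" using S by (simp_all add: usimple_def)
 obtain g where g: "ulin n0 r0 n0 (tw n0 r0) g" "g \<noteq> 0\<^sub>m n0 n0" using assms(2) by (auto simp: selfdual_def)
 note [simp] = ulinD(1,2)[OF g(1)] umodD(1,2)[OF U]
 have g': "ulin n0 (tw n0 r0) n0 r0 g" using ulin_tw[OF U umod_tw[OF U] g(1)] by (simp add: tw_tw[OF U])
 have "ulin n0 r0 n0 r0 (g * g)" by (rule ulin_compI[OF U umod_tw[OF U] U g' g(1)])
 from schur_scalar[OF S this] obtain x where x: "g * g = x *s I n0" .
 from schur_mono[OF S umod_tw[OF U] g] obtain L where [simp]: "nr L = n0" "nc L = n0" and L: "L * g = I n0" .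
 have "x \<noteq> 0"
 proof
  assume "x = 0"
  hence "L * (L * (g * g)) = 0\<^sub>m n0 n0" by (simp add: x zero_smult_mat mat_ring)
  thus False using one_mat_neq_zero[OF n0] by (simp add: mult_eq_assoc[OF L] mat_ring L)
 qed
 define y where "y = 1 / csqrt x"
 have "y * (y * x) = x / (csqrt x)\<^sup>2" by (simp add: y_def power2_eq_square)
 hence y: "y * (y * x) = 1" using \<open>x \<noteq> 0\<close> by (simp add: power2_csqrt)
 have "gmod n0 r0 (y *s g)" using ulin_smult[OF g(1), of y] U y
  by (simp add: gmod_def mat_ring x kron_smult_left) (simp add: ulin_def tw_def kron_ring kron_smult_left)
 thus thesis by (rule that)
qed

text \<open>The projection to the isotypic part of U and its twist. In the second case
  \<open>G * e * G\<close> projects to the part of the twist; in the first case it equals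
  \<open>e\<close> and must not be counted twice.\<close>

definition sproj :: "nat => complex mat => nat => complex mat => complex mat => complex mat => bool" where
 "sproj n0 r0 n r G E \<longleftrightarrow> (if selfdual n0 r0 then isoproj n0 r0 n r E
   else \<exists>e. isoproj n0 r0 n r e \<and> E = e + G * e * G)"

lemma sproj_exists: assumes "usimple n0 r0" "gmod n r G" obtains E where "sproj n0 r0 n r G E"
 using isoproj_exists[OF assms(1) gmodD(1)[OF assms(2)]] unfolding sproj_def by metis

text \<open>\<beta> G \<alpha> maps copies of U to copies of its twist, and there is no such nonzero
  map. So \<open>e\<close> and \<open>G * e * G\<close> are orthogonal.\<close>

lemma isoproj_twisted_zero:
 assumes S: "usimple n0 r0" and M: "gmod n r G" and e: "isoproj n0 r0 n r e" and nsd: "\<not> selfdual n0 r0"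
 shows "e * (G * e) = 0\<^sub>m n n"
proof -
 have U: "umod n0 r0" using S by (simp add: usimple_def)
 note um = gmodD(1)[OF M]
 note Ug = umod_tw[OF U]
 obtain k \<alpha> \<beta> where *: "ulin (k * n0) (kron (I k) r0) n r \<alpha>" "ulin n r (k * n0) (kron (I k) r0) \<beta>"
  "\<beta> * \<alpha> = I (k * n0)" "e = \<alpha> * \<beta>" using e by (rule isoprojE)
 note [simp] = ulinD(1,2)[OF *(1)] ulinD(1,2)[OF *(2)] gmodD(2,3,6,7)[OF M]
 have b: "ulin n (tw n r) (k * n0) (kron (I k) (tw n0 r0)) \<beta>"
  using ulin_tw[OF um umod_free[OF U] *(2)] by (simp add: tw_free[OF U])
 have h: "ulin (k * n0) (kron (I k) r0) (k * n0) (kron (I k) (tw n0 r0)) (\<beta> * (G * \<alpha>))"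
  by (rule ulin_compI[OF umod_free[OF U] umod_tw[OF um] umod_free[OF Ug] b
     ulin_compI[OF umod_free[OF U] um umod_tw[OF um] ulin_grading[OF M] *(1)]])
 have z: "\<beta> * (G * \<alpha>) = 0\<^sub>m (k * n0) (k * n0)"
  by (rule ulin_free_zero[OF U Ug _ h]) (use nsd selfdual_def in blast)
 have "e * (G * e) = \<alpha> * ((\<beta> * (G * \<alpha>)) * \<beta>)" by (simp add: *(4) mat_ring)
 thus ?thesis by (simp add: z mat_ring)
qed

text \<open>Composing the splitting with k copies of a grading of U turns it into a splitting for
  the twisted module. Naturality then makes \<open>e\<close> commute with the grading of the
  module.\<close>

lemma isoproj_tw: assumes S: "usimple n0 r0" and M: "umod n r" and e: "isoproj n0 r0 n r e" and "selfdual n0 r0"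
 shows "isoproj n0 r0 n (tw n r) e"
proof -
 have U: "umod n0 r0" using S by (simp add: usimple_def)
 obtain G where G: "gmod n0 r0 G" using selfdualE[OF S assms(4)] .
 note Ug = umod_tw[OF U] and Mg = umod_tw[OF M]
 note g = ulin_grading[OF G] and g' = ulin_grading'[OF G]
 obtain k \<alpha> \<beta> where *: "ulin (k * n0) (kron (I k) r0) n r \<alpha>" "ulin n r (k * n0) (kron (I k) r0) \<beta>"
  "\<beta> * \<alpha> = I (k * n0)" "e = \<alpha> * \<beta>" using e by (rule isoprojE)
 note [simp] = ulinD(1,2)[OF *(1)] ulinD(1,2)[OF *(2)] umodD(1,2)[OF M] gmodD(2,3,6,7)[OF G]
 have [simp]: "nr e = n" "nc e = n" by (simp_all add: *(4))
 have a: "ulin (k * n0) (kron (I k) (tw n0 r0)) n (tw n r) \<alpha>"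
  using ulin_tw[OF umod_free[OF U] M *(1)] by (simp add: tw_free[OF U])
 have b: "ulin n (tw n r) (k * n0) (kron (I k) (tw n0 r0)) \<beta>"
  using ulin_tw[OF M umod_free[OF U] *(2)] by (simp add: tw_free[OF U])
 have 1: "ulin (k * n0) (kron (I k) r0) n (tw n r) (\<alpha> * kron (I k) G)"
  by (rule ulin_compI[OF umod_free[OF U] umod_free[OF Ug] Mg a ulin_kron[OF U Ug g]])
 have 2: "ulin n (tw n r) (k * n0) (kron (I k) r0) (kron (I k) G * \<beta>)"
  by (rule ulin_compI[OF Mg umod_free[OF Ug] umod_free[OF U] ulin_kron[OF Ug U g'] b])
 have GG: "kron (I k) G * kron (I k) G = I (k * n0)" by (simp add: kron_mult gmodD(4)[OF G] kron_one mat_ring)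
 have 3: "(kron (I k) G * \<beta>) * (\<alpha> * kron (I k) G) = I (k * n0)"
  by (simp add: mat_ring mult_eq_assoc[OF *(3)] GG)
 have 4: "e = (\<alpha> * kron (I k) G) * (kron (I k) G * \<beta>)" by (simp add: mat_ring mult_eq_assoc[OF GG] *(4))
 have 5: "e * \<gamma> = \<gamma>" if \<gamma>: "ulin n0 r0 n (tw n r) \<gamma>" for \<gamma>
 proof -
  note [simp] = ulinD(1,2)[OF \<gamma>]
  have \<gamma>': "ulin n0 (tw n0 r0) n r \<gamma>" using ulin_tw[OF U Mg \<gamma>] by (simp add: tw_tw[OF M])
  have "e * (\<gamma> * G) = \<gamma> * G" by (rule isoproj_fix(1)[OF e]) (rule ulin_compI[OF U Ug M \<gamma>' g])
  hence "(e * \<gamma>) * G = \<gamma> * G" by (simp add: mat_ring)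
  thus ?thesis by (rule right_cancel_mat[OF _ gmodD(4)[OF G]]) simp_all
 qed
 have 6: "\<delta> * e = \<delta>" if \<delta>: "ulin n (tw n r) n0 r0 \<delta>" for \<delta>
 proof -
  note [simp] = ulinD(1,2)[OF \<delta>]
  have \<delta>': "ulin n r n0 (tw n0 r0) \<delta>" using ulin_tw[OF Mg U \<delta>] by (simp add: tw_tw[OF M])
  have "(G * \<delta>) * e = G * \<delta>" by (rule isoproj_fix(2)[OF e]) (rule ulin_compI[OF M Ug U g' \<delta>'])
  hence "G * (\<delta> * e) = G * \<delta>" by (simp add: mat_ring)
  thus ?thesis by (rule left_cancel_mat[OF _ gmodD(4)[OF G]]) simp_all
 qed
 show ?thesis unfolding isoproj_def using 1 2 3 4 5 6 by blast
qed

lemma sproj_basic: assumes S: "usimple n0 r0" and M: "gmod n r G" and E: "sproj n0 r0 n r G E"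
 shows "ulin n r n r E" "E * E = E" "G * E = E * G"
proof -
 have U: "umod n0 r0" using S by (simp add: usimple_def)
 note um = gmodD(1)[OF M]
 note [simp] = gmodD(2,3,6,7)[OF M]
 have "ulin n r n r E \<and> E * E = E \<and> G * E = E * G"
 proof (cases "selfdual n0 r0")
  case True
  hence e: "isoproj n0 r0 n r E" using E by (simp add: sproj_def)
  \<comment> \<open>The grading is a module map to the twist, on which \<open>E\<close> is again the
    isotypic projection.\<close>
  from isoproj_natural[OF U um umod_tw[OF um] e isoproj_tw[OF S um e True] ulin_grading[OF M]]
  show ?thesis using isoproj_ulin[OF U um e] by simp
 next
  case False
  then obtain e where e: "isoproj n0 r0 n r e" and E: "E = e + G * e * G" using E by (auto simp: sproj_def)
  note el = isoproj_ulin[OF U um e]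
  note [simp] = ulinD(1,2)[OF el(1)]
  note z = isoproj_twisted_zero[OF S M e False]
  have "ulin n r n r (G * e * G)"
   by (rule ulin_compI[OF um umod_tw[OF um] um ulin_compI[OF umod_tw[OF um] umod_tw[OF um] um ulin_grading'[OF M]
       ulin_tw[OF um um el(1)]] ulin_grading[OF M]])
  hence 1: "ulin n r n r E" unfolding E by (intro ulin_add el(1)) simp_all
  have zX: "e * (G * (e * X)) = 0\<^sub>m n (nc X)" if "nr X = n" for X
   using mult_eq_assoc[OF z, of X] that by (simp add: mat_ring)
  have 2: "E * E = E" by (simp add: E mat_ring z zX el(2) mult_eq_assoc[OF el(2)] mult_eq_assoc[OF gmodD(4)[OF M]])
  have 3: "G * E = E * G"
   by (simp add: E mat_ring mult_eq_assoc[OF gmodD(4)[OF M]] gmodD(4)[OF M] add_commute_mat_dim)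
  show ?thesis using 1 2 3 by simp
 qed
 thus "ulin n r n r E" "E * E = E" "G * E = E * G" by auto
qed

lemma sproj_natural: assumes S: "usimple n0 r0" and M: "gmod n r G" and N: "gmod n' r' G'"
  and E: "sproj n0 r0 n r G E" and E': "sproj n0 r0 n' r' G' E'" and f: "ulin n r n' r' f" shows "f * E = E' * f"
proof -
 have U: "umod n0 r0" using S by (simp add: usimple_def)
 note um = gmodD(1)[OF M] and un = gmodD(1)[OF N]
 note [simp] = gmodD(2,3,6,7)[OF M] gmodD(2,3,6,7)[OF N] ulinD(1,2)[OF f]
 show ?thesis
 proof (cases "selfdual n0 r0")
  case True
  thus ?thesis using E E' isoproj_natural[OF U um un _ _ f] by (simp add: sproj_def)
 next
  case False
  obtain e where e: "isoproj n0 r0 n r e" and E: "E = e + G * e * G" using E False by (auto simp: sproj_def)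
  obtain e' where e': "isoproj n0 r0 n' r' e'" and E': "E' = e' + G' * e' * G'" using E' False by (auto simp: sproj_def)
  note [simp] = ulinD(1,2)[OF isoproj_ulin(1)[OF U um e]] ulinD(1,2)[OF isoproj_ulin(1)[OF U un e']]
  have 1: "f * e = e' * f" by (rule isoproj_natural[OF U um un e e' f])
  \<comment> \<open>Naturality of the isotypic projection, applied to the conjugate of f by the
    gradings, settles the summand G e G.\<close>
  have "ulin n r n' r' (G' * (f * G))" by (rule ulin_compI[OF um umod_tw[OF un] un ulin_grading'[OF N]
      ulin_compI[OF um umod_tw[OF um] umod_tw[OF un] ulin_tw[OF um un f] ulin_grading[OF M]]])
  from isoproj_natural[OF U um un e e' this]
  have 2: "G' * (f * (G * e)) = e' * (G' * (f * G))" by (simp add: mat_ring)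
  have "f * (G * (e * G)) = G' * (G' * (f * (G * e))) * G" by (simp add: mat_ring mult_eq_assoc[OF gmodD(4)[OF N]])
  also have "... = G' * (e' * (G' * f))" by (simp add: 2 mat_ring gmodD(4)[OF M])
  finally show ?thesis by (simp add: E E' mat_ring 1)
 qed
qed

text \<open>As a right module, V \<otimes> M is \<open>d\<close> copies of M, and naturality along
  the column inclusions determines the projection. This is its compatibility with the action of the
  category.\<close>

lemma sproj_tensor: assumes S: "usimple n0 r0" and M: "gmod n r G" and E: "sproj n0 r0 n r G E"
  and H: "nr H = d" "nc H = d" "H * H = I d" and E': "sproj n0 r0 (d * n) (kron (I d) r) (kron H G) E'"
 shows "E' = kron (I d) E"
proof (rule eq_mat_by_blocks_col[of _ _ d n])
 note um = gmodD(1)[OF M] and DM = gmod_tensor[OF M H]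
 note [simp] = ulinD(1,2)[OF sproj_basic(1)[OF S M E]] ulinD(1,2)[OF sproj_basic(1)[OF S DM E']]
 show "nr E' = nr (kron (I d) E)" "nc E' = d * n" "nc (kron (I d) E) = d * n" by simp_all
 fix i
 show "E' * kron (ecol d i) (I n) = kron (I d) E * kron (ecol d i) (I n)"
  using sproj_natural[OF S M DM E E' ulin_block_col[OF um]]
  using kron_mult[of "ecol d i" "I (Suc 0)" "I n" E] by (simp add: kron_ring kron_one_left)
qed

lemma sproj_differential: assumes S: "usimple n0 r0" and M: "dgmod n r X G" and E: "sproj n0 r0 n r G E"
 shows "X * E = E * X"
proof -
 have g: "gmod n r G" and [simp]: "nr X = n" "nc X = n" and Xr: "X * r = r * (kron X (I a) + kron G XA)"
  using M by (simp_all add: dgmod_def)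
 note um = gmodD(1)[OF g]
 note E1 = sproj_basic[OF S g E]
 note [simp] = gmodD(2,3,6,7)[OF g] ulinD(1,2)[OF E1(1)]
 define F where "F = I n + (- 1) *s E"
 have F [simp]: "nr F = n" "nc F = n" by (simp_all add: F_def)
 have Flin: "ulin n r n r F" unfolding F_def by (intro ulin_add ulin_smult ulin_id um E1(1)) simp_all
 have EF: "E * F = 0\<^sub>m n n" "F * E = 0\<^sub>m n n" by (simp_all add: F_def mat_ring E1(2) add_self_smult zero_smult_mat)
 have GF: "G * F = F * G" by (simp add: F_def mat_ring E1(3))
 \<comment> \<open>The term with \<open>XA\<close> in the Leibniz rule carries the factor P Q, so
   \<open>P * (X * Q)\<close> is linear over the algebra although \<open>X\<close> is not.\<close>
 have key: "ulin n r n r (P * (X * Q))" if P: "ulin n r n r P" and Q: "ulin n r n r Q" and PQ: "P * Q = 0\<^sub>m n n" "G * Q = Q * G" for P Q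
 proof -
  note [simp] = ulinD(1,2)[OF P] ulinD(1,2)[OF Q]
  have "P * (X * Q) * r = P * ((X * r) * kron Q (I a))" by (simp add: mat_ring ulinD(3)[OF Q])
  also have "... = (P * r) * (kron (X * Q) (I a) + kron (Q * G) XA)" by (simp add: Xr kron_ring PQ(2))
  also have "... = r * (kron (P * (X * Q)) (I a) + kron ((P * Q) * G) XA)"
   by (simp add: ulinD(3)[OF P] kron_ring)
  also have "... = r * kron (P * (X * Q)) (I a)" unfolding PQ by (simp add: mat_ring kron_zero_left)
  finally show ?thesis by (simp add: ulin_def)
 qed
 \<comment> \<open>A module map commutes with E, but this one starts in the range of E and ends in
   that of the complement F; so it vanishes.\<close>
 have "F * (X * E) * E = E * (F * (X * E))" by (rule sproj_natural[OF S g g E E key[OF Flin E1(1) EF(2) E1(3)]])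
 hence 1: "F * (X * E) = 0\<^sub>m n n" by (simp add: mat_ring E1(2) mult_eq_assoc[OF EF(1)])
 have "E * (X * F) * E = E * (E * (X * F))" by (rule sproj_natural[OF S g g E E key[OF E1(1) Flin EF(1) GF]])
 hence 2: "E * (X * F) = 0\<^sub>m n n" by (simp add: mat_ring EF mult_eq_assoc[OF E1(2)])
 have "X * E = F * (X * E) + E * (X * E)" by (simp add: F_def mat_ring) (intro eq_matI; simp del: index_mult_mat(1))
 also have "... = E * (X * E) + E * (X * F)" by (simp add: 1 2 mat_ring)
 also have "... = E * X" by (simp add: F_def mat_ring) (intro eq_matI; simp del: index_mult_mat(1))
 finally show ?thesis .
qed

text \<open>A basis vector v0 of U yields the module map b \<mapsto> v0 b from the algebra to U. The
  isotypic projection fixes it, and its value v0 at 1 is nonzero.\<close>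

lemma sproj_regular_nonzero: assumes S: "usimple n0 r0" and E: "sproj n0 r0 a m GA E" shows "E \<noteq> 0\<^sub>m a a"
proof
 assume E0: "E = 0\<^sub>m a a"
 have U: "umod n0 r0" and n0: "0 < n0" using S by (simp_all add: usimple_def)
 note [simp] = umodD(1,2)[OF U]
 obtain e where e: "isoproj n0 r0 a m e" and ez: "e = 0\<^sub>m a a"
 proof (cases "selfdual n0 r0")
  case True
  thus thesis using E E0 that by (simp add: sproj_def)
 next
  case False
  then obtain e where e: "isoproj n0 r0 a m e" "E = e + GA * e * GA" using E by (auto simp: sproj_def)
  note el = isoproj_ulin[OF U umod_regular e(1)]
  note [simp] = ulinD(1,2)[OF el(1)]
  have "e * (GA * (e * GA)) = 0\<^sub>m a a"
   using mult_eq_assoc[OF isoproj_twisted_zero[OF S gmod_regular e(1) False], of GA] by (simp add: mat_ring)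
  \<comment> \<open>The two summands of E are orthogonal, so \<open>e\<close> vanishes together with
    E.\<close>
  hence "e * E = e" by (simp add: e(2) mat_ring el(2))
  thus thesis using E0 that[OF e(1)] by (simp add: mat_ring)
 qed
 define \<delta> where "\<delta> = r0 * kron (ecol n0 0) (I a)"
 have [simp]: "nr \<delta> = n0" "nc \<delta> = a" by (simp_all add: \<delta>_def)
 have "\<delta> * m = r0 * (kron (ecol n0 0) (I a) * kron (I 1) m)" by (simp add: \<delta>_def mat_ring kron_one_left)
 also have "kron (ecol n0 0) (I a) * kron (I 1) m = kron (I n0) m * kron (ecol n0 0) (I (a * a))"
  by (simp add: kron_ring)
 also have "r0 * ... = (r0 * kron r0 (I a)) * kron (ecol n0 0) (I (a * a))" by (simp add: umodD(3)[OF U] mat_ring)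
 also have "... = r0 * kron \<delta> (I a)" by (simp add: \<delta>_def kron_comp_left mat_ring kron_assoc kron_one)
 finally have "ulin a m n0 r0 \<delta>" by (simp add: ulin_def)
 from isoproj_fix(2)[OF e this] have "\<delta> = 0\<^sub>m n0 a" by (simp add: ez mat_ring)
 hence z: "\<delta> * u = 0\<^sub>m n0 1" by (simp add: mat_ring)
 have "\<delta> * u = r0 * (kron (I n0) u * ecol n0 0)"
  using kron_mult[of "ecol n0 0" "I (Suc 0)" "I a" u] by (simp add: \<delta>_def mat_ring kron_col_slide kron_one_left)
 also have "... = ecol n0 0" by (simp add: mult_eq_assoc[OF umodD(4)[OF U]] mat_ring)
 finally have "ecol n0 0 $$ (0, 0) = (0\<^sub>m n0 1 :: complex mat) $$ (0, 0)" using z by simp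
 thus False using n0 by (simp add: ecol_def)
qed

end

lemma add_left_cancel_mat: "A + B = A + C ==> nr A = nr B ==> nc A = nc B ==>
  nr A = nr C ==> nc A = nc C ==> B = (C :: complex mat)"
proof (rule eq_matI, goal_cases)
 case (1 i j)
 have "(A + B) $$ (i, j) = (A + C) $$ (i, j)" using 1(1) by simp
 thus ?case using 1(2-) by simp
qed auto

context mat_algebra
begin

definition sum_act :: "nat => complex mat => nat => complex mat => complex mat" where
 "sum_act n r n' r' = inl_mat n n' * r * kron (prl_mat n n') (I a) + inr_mat n n' * r' * kron (prr_mat n n') (I a)"

lemma sum_act: assumes "umod n r" "umod n' r'" shows "umod (n + n') (sum_act n r n' r')"
  "ulin n r (n + n') (sum_act n r n' r') (inl_mat n n')" "ulin n' r' (n + n') (sum_act n r n' r') (inr_mat n n')"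
  "ulin (n + n') (sum_act n r n' r') n r (prl_mat n n')" "ulin (n + n') (sum_act n r n' r') n' r' (prr_mat n n')"
proof -
 note [simp] = umodD(1,2)[OF assms(1)] umodD(1,2)[OF assms(2)]
 define s where "s = sum_act n r n' r'"
 have [simp]: "nr s = n + n'" "nc s = (n + n') * a" by (simp_all add: s_def sum_act_def)
 have s: "s = inl_mat n n' * (r * kron (prl_mat n n') (I a)) + inr_mat n n' * (r' * kron (prr_mat n n') (I a))"
  by (simp add: s_def sum_act_def mat_ring)
 have pl: "prl_mat n n' * s = r * kron (prl_mat n n') (I a)" and pr: "prr_mat n n' * s = r' * kron (prr_mat n n') (I a)"
  by (simp_all add: s mat_ring)
 have "s * kron s (I a) = inl_mat n n' * (r * kron (prl_mat n n' * s) (I a)) + inr_mat n n' * (r' * kron (prr_mat n n' * s) (I a))"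
  by (subst s) (simp add: kron_ring)
 also have "... = inl_mat n n' * ((r * kron r (I a)) * kron (prl_mat n n') (I (a * a))) +
   inr_mat n n' * ((r' * kron r' (I a)) * kron (prr_mat n n') (I (a * a)))"
  by (simp add: pl pr kron_comp_left kron_assoc kron_one mat_ring)
 also have "... = inl_mat n n' * (r * kron (prl_mat n n') m) + inr_mat n n' * (r' * kron (prr_mat n n') m)"
  by (simp add: umodD(3)[OF assms(1)] umodD(3)[OF assms(2)] kron_ring)
 also have "... = s * kron (I (n + n')) m" by (simp add: s kron_ring)
 finally have 1: "s * kron s (I a) = s * kron (I (n + n')) m" .
 have "s * kron (I (n + n')) u = inl_mat n n' * (r * (kron (I n) u * prl_mat n n')) + inr_mat n n' * (r' * (kron (I n') u * prr_mat n n'))"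
  by (simp add: s kron_ring kron_col_slide)
 also have "... = I (n + n')"
  by (simp add: mult_eq_assoc[OF umodD(4)[OF assms(1)]] mult_eq_assoc[OF umodD(4)[OF assms(2)]] mat_ring)
 finally show "umod (n + n') (sum_act n r n' r')" using 1 by (simp add: umod_def flip: s_def)
 show "ulin n r (n + n') (sum_act n r n' r') (inl_mat n n')" "ulin n' r' (n + n') (sum_act n r n' r') (inr_mat n n')"
  by (simp_all add: ulin_def sum_act_def kron_ring kron_one kron_zero_left)
 show "ulin (n + n') (sum_act n r n' r') n r (prl_mat n n')" "ulin (n + n') (sum_act n r n' r') n' r' (prr_mat n n')"
  using pl pr by (simp_all add: ulin_def s_def)
qed

end

section \<open>Derivations of graded modules, and the objects of even and odd type\<close>

context sweedler_algebra
begin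

text \<open>All that an action of x has to satisfy, except for D^2 = 0.\<close>

definition derivation :: "nat => complex mat => complex mat => complex mat => bool" where
 "derivation n r G D \<longleftrightarrow> nr D = n \<and> nc D = n \<and> D * r = r * (kron D (I a) + kron G XA) \<and>
  G * D = (- 1) *s (D * G)"

lemma XA_cas': "kron XA (I a) * c = (- 1) *s (kron GA XA * c)"
proof (rule eq_matI)
 fix i j assume "i < nr ((- 1) *s (kron GA XA * c))" "j < nc ((- 1) *s (kron GA XA * c))"
 hence ij: "i < a * a" "j < 1" by auto
 have "(kron XA (I a) * c + kron GA XA * c) $$ (i, j) = 0"
  using XA_cas ij by (simp add: mat_ring del: index_mult_mat(1) index_add_mat(1))
 thus "(kron XA (I a) * c) $$ (i, j) = ((- 1) *s (kron GA XA * c)) $$ (i, j)"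
  using ij by (simp add: eq_neg_iff_add_eq_0 del: index_mult_mat(1))
qed auto

text \<open>D(v) = G(v c1) x(c2). Centrality of \<open>c\<close> and the Leibniz rule of
  \<open>XA\<close> give D(v b) = D(v) b + G(v c1) g(c2) x(b), and G(v c1) g(c2) = G(v c1 c2) =
  G(v).\<close>

lemma derivation_exists: assumes "gmod n r G" obtains D where "derivation n r G D"
proof -
 note g = gmodD[OF assms]
 note um = umodD(3,4)[OF g(1)]
 note [simp] = g(2,3,6,7)
 define D where "D = r * kron (G * r) XA * kron (I n) c"
 have [simp]: "nr D = n" "nc D = n" by (simp_all add: D_def)
 have "D * r = r * kron (G * r) XA * (kron (I n) c * r)" by (simp add: D_def mat_ring)
 also have "kron (I n) c * r = kron (kron r (I a)) (I a) * kron (I (n * a)) c"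
  by (simp add: kron_col_slide mat_ring mat_kron)
 also have "r * kron (G * r) XA * ... = r * (kron (G * (r * kron r (I a))) XA * kron (I (n * a)) c)"
  by (simp add: kron_ring kron_mult_assoc)
 also have "kron (G * (r * kron r (I a))) XA = kron (G * r) XA * kron (I n) (kron m (I a))"
  using kron_mult[of "G * r" "kron (I n) m" XA "I a"] by (simp add: um(1) mat_ring kron_assoc)
 also have "r * (kron (G * r) XA * kron (I n) (kron m (I a)) * kron (I (n * a)) c) =
   r * (kron (G * r) XA * kron (I n) (kron m (I a) * kron (I a) c))"
  by (simp add: kron_comp_right kron_one_prod mat_ring)
 also have "... = r * (kron (G * r) XA * kron (I (n * a)) m * kron (I n) (kron c (I a)))"
  by (simp add: cas_central kron_comp_right kron_one_prod mat_ring)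
 also have "kron (G * r) XA * kron (I (n * a)) m = kron (G * r) (XA * m)" by (simp add: kron_ring)
 also have "kron (G * r) (XA * m) = kron (I n) m * (kron (kron (G * r) XA) (I a) + kron (kron (G * r) GA) XA)"
  by (simp add: XA_mult kron_mult kron_assoc mat_ring kron_add_right[symmetric])
 also have "r * (... * kron (I n) (kron c (I a))) =
   (r * kron (I n) m) * (kron (kron (G * r) XA) (I a) + kron (kron (G * r) GA) XA) * kron (kron (I n) c) (I a)"
  by (simp add: mat_ring kron_assoc)
 also have "... = r * (kron r (I a) * kron (kron (G * r) XA) (I a) * kron (kron (I n) c) (I a)) +
   r * (kron r (I a) * kron (kron (G * r) GA) XA * kron (kron (I n) c) (I a))"
  by (simp add: um(1)[symmetric] mat_ring)
 also have "kron r (I a) * kron (kron (G * r) XA) (I a) * kron (kron (I n) c) (I a) = kron D (I a)"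
  by (simp add: D_def kron_ring)
 also have "kron r (I a) * kron (kron (G * r) GA) XA * kron (kron (I n) c) (I a)
   = kron ((r * kron G GA) * kron r (I a) * kron (I n) c) XA" by (simp add: kron_ring)
 also have "(r * kron G GA) * kron r (I a) * kron (I n) c = G * (r * kron r (I a)) * kron (I n) c"
  by (simp add: mat_ring flip: g(5))
 also have "... = G" by (simp add: um kron_ring mult_cas)
 finally have 1: "D * r = r * (kron D (I a) + kron G XA)" by (simp add: mat_ring)
 have rG: "r * kron (I n) GA = G * (r * kron G (I a))"
  using mult_eq_assoc[OF g(5), of "kron G (I a)"] by (simp add: kron_ring g(4))
 have "G * D = (r * kron G GA) * (kron (G * r) XA * kron (I n) c)" by (simp add: D_def mat_ring flip: g(5))
 also have "... = r * (kron (G * (G * r)) (GA * XA) * kron (I n) c)" by (simp add: kron_ring kron_mult_assoc)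
 finally have GD: "G * D = (- 1) *s (r * (kron r (XA * GA) * kron (I n) c))"
  by (simp add: mat_ring GA_XA kron_smult_right mult_eq_assoc[OF g(4)])
 have "D * G = r * (kron (G * r) XA * (kron (I n) (kron GA GA * c) * G))" by (simp add: D_def mat_ring GA_cas)
 also have "kron (I n) (kron GA GA * c) * G = kron (I n) (kron GA GA) * (kron G (I (a * a)) * kron (I n) c)"
  by (simp add: kron_col_slide kron_ring)
 also have "kron (G * r) XA * ... = kron (G * r * kron (I n) GA * kron G (I a)) (XA * GA) * kron (I n) c"
  by (simp add: kron_one[symmetric] kron_assoc[symmetric] kron_mult kron_mult_assoc mat_ring)
 also have "G * r * kron (I n) GA * kron G (I a) = r"
  by (simp add: mat_ring rG mult_eq_assoc[OF rG] mult_eq_assoc[OF g(4)] kron_mult g(4) kron_one)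
 finally have "G * D = (- 1) *s (D * G)" using GD by simp
 hence "derivation n r G D" using 1 by (simp add: derivation_def)
 thus thesis by (rule that)
qed

text \<open>In D(D(v b)) the mixed terms (D G + G D)(v) x(b) cancel, and x^2 = 0 on the
  algebra.\<close>

lemma derivation_square:
 assumes "gmod n r G" "derivation n r G D" shows "ulin n r n r (D * D)" "G * (D * D) = (D * D) * G"
proof -
 note g = gmodD[OF assms(1)]
 note [simp] = g(2,3,6,7)
 have [simp]: "nr D = n" "nc D = n" and Dr: "D * r = r * (kron D (I a) + kron G XA)"
  and GD: "G * D = (- 1) *s (D * G)" using assms(2) by (simp_all add: derivation_def)
 have "D * D * r = r * kron (D * D) (I a)"
  by (simp add: Dr mult_eq_assoc[OF Dr] kron_ring XA_XA kron_zero_right GD kron_smult_left)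
   (intro eq_matI; simp del: index_mult_mat(1))
 thus "ulin n r n r (D * D)" by (simp add: ulin_def)
 show "G * (D * D) = (D * D) * G" by (simp add: mult_eq_assoc[OF GD] mat_ring GD)
qed

text \<open>For z(v) = D(v c1) c2 and q(v) = G(D(v c1)) x(c2), the Leibniz rule gives D z = D^2 + q.
  In z D = D^2 - q the other sign results from x c = 0, read as x(c1) \<otimes> c2 = - g(c1)
  \<otimes> x(c2), and from G D = - D G.\<close>

lemma avg_derivation: assumes "gmod n r G" "derivation n r G D"
 shows "ulin n r n r (avg r r D)" "G * avg r r D = (- 1) *s (avg r r D * G)"
  "D * avg r r D + avg r r D * D = 2 *s (D * D)"
proof -
 note g = gmodD[OF assms(1)]
 note [simp] = g(2,3,6,7)
 have [simp]: "nr D = n" "nc D = n" and Dr: "D * r = r * (kron D (I a) + kron G XA)"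
  and GD: "G * D = (- 1) *s (D * G)" using assms(2) by (simp_all add: derivation_def)
 define z where "z = avg r r D"
 have [simp]: "nr z = n" "nc z = n" by (simp_all add: z_def)
 have z: "z = r * (kron (D * r) (I a) * kron (I n) c)" by (simp add: z_def avg_def mat_ring)
 show "ulin n r n r (avg r r D)" by (rule avg_lin[OF g(1) g(1)]) simp_all
 have "G * z = (r * kron G GA) * (kron (D * r) (I a) * kron (I n) c)" unfolding z by (simp add: mat_ring flip: g(5))
 also have "... = r * (kron (G * (D * r)) GA * kron (I n) c)" by (simp add: kron_ring kron_mult_assoc)
 also have "... = (- 1) *s (r * (kron (D * (G * r)) GA * kron (I n) c))"
  by (simp add: mult_eq_assoc[OF GD] mat_ring kron_smult_left)
 finally have Gz: "G * z = (- 1) *s (r * (kron (D * (G * r)) GA * kron (I n) c))" .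
 have cG: "kron (I n) c * Y = kron Y (I (a * a)) * kron (I n) c" if "nr Y = n" "nc Y = n" for Y
  using that by (simp add: kron_col_slide kron_slide)
 have "z * G = r * (kron (D * r) (I a) * (kron (I n) (kron GA GA * c) * G))"
  unfolding z by (simp add: mat_ring GA_cas)
 also have "kron (I n) (kron GA GA * c) * G = kron (I n) (kron GA GA) * (kron G (I (a * a)) * kron (I n) c)"
  by (simp add: kron_comp_right mat_ring cG)
 also have "kron (D * r) (I a) * ... = kron (D * (r * kron G GA)) GA * kron (I n) c"
  by (simp add: kron_one[symmetric] kron_assoc[symmetric] kron_mult kron_mult_assoc mat_ring)
 finally have "z * G = r * (kron (D * (G * r)) GA * kron (I n) c)" by (simp add: g(5))
 thus "G * avg r r D = (- 1) *s (avg r r D * G)" using Gz by (simp add: z_def)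
 define q where "q = r * (kron (G * (D * r)) XA * kron (I n) c)"
 have [simp]: "nr q = n" "nc q = n" by (simp_all add: q_def)
 have DD: "avg r r (D * D) = D * D"
  using avg_comp_left[OF g(1) g(1) g(1) _ _ derivation_square(1)[OF assms], of "I n"] avg_one[OF g(1)]
  by (simp add: mat_ring)
 have "D * z = (D * r) * (kron (D * r) (I a) * kron (I n) c)" unfolding z by (simp add: mat_ring)
 also have "... = r * (kron D (I a) + kron G XA) * (kron (D * r) (I a) * kron (I n) c)" by (subst Dr) (rule refl)
 also have "... = r * (kron (D * (D * r)) (I a) * kron (I n) c) + q"
  unfolding q_def by (simp add: kron_ring kron_mult_assoc)
 also have "r * (kron (D * (D * r)) (I a) * kron (I n) c) = D * D" using DD by (simp add: avg_def mat_ring)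
 finally have Dz: "D * z = D * D + q" .
 have rD: "r * kron D (I a) = D * r + (- 1) *s (r * kron G XA)"
  by (simp add: Dr mat_ring) (intro eq_matI; simp del: index_mult_mat(1))
 have "z * D = r * (kron (D * r) (I a) * (kron D (I (a * a)) * kron (I n) c))" unfolding z by (simp add: mat_ring cG)
 also have "... = r * (kron (D * (r * kron D (I a))) (I a) * kron (I n) c)"
  by (simp add: kron_one[symmetric] kron_assoc[symmetric] kron_mult kron_mult_assoc mat_ring)
 also have "... = r * (kron (D * (D * r)) (I a) * kron (I n) c) +
   (- 1) *s (r * (kron (D * r) (I a) * (kron (kron G XA) (I a) * kron (I n) c)))"
  by (simp add: rD mat_ring kron_add_left kron_smult_left kron_mult_assoc kron_mult)
 also have "r * (kron (D * (D * r)) (I a) * kron (I n) c) = D * D" using DD by (simp add: avg_def mat_ring)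
 also have "kron (kron G XA) (I a) * kron (I n) c = kron G (kron XA (I a) * c)"
  by (simp add: kron_assoc kron_ring)
 also have "... = (- 1) *s (kron (kron G GA) XA * kron (I n) c)"
  by (simp add: XA_cas' kron_smult_right kron_assoc kron_ring)
 also have "(- 1) *s (r * (kron (D * r) (I a) * ((- 1) *s (kron (kron G GA) XA * kron (I n) c)))) =
   r * (kron (D * (r * kron G GA)) XA * kron (I n) c)" by (simp add: mat_ring kron_mult_assoc kron_mult)
 also have "D * (r * kron G GA) = (- 1) *s (G * (D * r))" by (simp add: mult_eq_assoc[OF GD] mat_ring flip: g(5))
 also have "r * (kron ... XA * kron (I n) c) = (- 1) *s q" by (simp add: q_def mat_ring kron_smult_left)
 finally have "z * D = D * D + (- 1) *s q" .
 thus "D * avg r r D + avg r r D * D = 2 *s (D * D)"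
  using Dz by (simp add: z_def[symmetric]) (intro eq_matI; simp del: index_mult_mat(1))
qed

text \<open>Tensoring with such an object will be an equivalence from \<open>V0\<close>.\<close>

definition even_type :: "nat => complex mat => complex mat => complex mat => bool" where
 "even_type n r X G \<longleftrightarrow> dgmod n r X G \<and> 0 < n \<and> (\<forall>f. ulin n r n r f \<longrightarrow> (\<exists>x. f = x *s I n))"

text \<open>The endomorphisms form a Clifford algebra with odd generator \<open>H\<close>. Tensoring
  with such an object will be an equivalence from \<open>S0\<close>, the differential of a D-module
  entering as the coefficient of \<open>H\<close>.\<close>

definition odd_type :: "nat => complex mat => complex mat => complex mat => complex mat => bool" where
 "odd_type n r X G H \<longleftrightarrow> dgmod n r X G \<and> 0 < n \<and> ulin n r n r H \<and> H * H = I n \<and>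
  G * H = (- 1) *s (H * G) \<and> X * H = (- 1) *s (H * X) \<and>
  (\<forall>f. ulin n r n r f \<longrightarrow> (\<exists>x y. f = x *s I n + y *s H))"

lemma derivation_square_zero: assumes g: "gmod n r G" and D: "derivation n r G D" and n: "0 < n"
  and sq: "D * D = l *s I n" and z: "D * avg r r D + avg r r D * D = 0\<^sub>m n n" shows "D * D = 0\<^sub>m n n"
proof -
 have "2 *s (D * D) = 0\<^sub>m n n" using avg_derivation(3)[OF g D] z by simp
 hence "(2 *s (l *s I n)) $$ (0, 0) = (0\<^sub>m n n :: complex mat) $$ (0, 0)" using sq by simp
 hence "l = 0" using n by simp
 thus ?thesis using sq by (simp add: zero_smult_mat)
qed

lemma even_type_exists: assumes S: "usimple n0 r0" and "selfdual n0 r0"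
 obtains X G where "even_type n0 r0 X G"
proof -
 have n0: "0 < n0" using S by (simp add: usimple_def)
 obtain G where G: "gmod n0 r0 G" using selfdualE[OF S assms(2)] .
 obtain D where D: "derivation n0 r0 G D" using derivation_exists[OF G] .
 note [simp] = gmodD(2,3,6,7)[OF G]
 have [simp]: "nr D = n0" "nc D = n0" and GD: "G * D = (- 1) *s (D * G)"
  and Dr: "D * r0 = r0 * (kron D (I a) + kron G XA)" using D by (simp_all add: derivation_def)
 obtain l where l: "D * D = l *s I n0" using schur_scalar[OF S derivation_square(1)[OF G D]] .
 obtain y where y: "avg r0 r0 D = y *s I n0" using schur_scalar[OF S avg_derivation(1)[OF G D]] .
 \<comment> \<open>The average is even as a scalar and odd as the average of an odd D, so it is
   zero.\<close>
 have "y *s G = (- 1) *s (y *s G)" using avg_derivation(2)[OF G D] by (simp add: y mat_ring)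
 hence "G * (y *s G) = G * ((- 1) *s (y *s G))" by simp
 hence "y *s I n0 = (- y) *s (I n0)" by (simp add: mat_ring gmodD(4)[OF G])
 hence "(y *s I n0) $$ (0, 0) = ((- y) *s (I n0)) $$ (0, 0)" by simp
 hence "y = 0" using n0 by simp
 hence "D * avg r0 r0 D + avg r0 r0 D * D = 0\<^sub>m n0 n0" by (simp add: y zero_smult_mat mat_ring)
 hence "D * D = 0\<^sub>m n0 n0" by (rule derivation_square_zero[OF G D n0 l])
 hence "even_type n0 r0 D G"
  using G n0 GD Dr schur_scalar[OF S] unfolding even_type_def dgmod_def by (metis \<open>nr D = n0\<close> \<open>nc D = n0\<close>)
 thus thesis by (rule that)
qed

lemma even_type_cover:
 assumes S: "usimple n0 r0" and sd: "selfdual n0 r0" and M: "gmod n r G" and E: "sproj n0 r0 n r G (I n)"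
 obtains k \<alpha> \<beta> where "ulin (k * n0) (kron (I k) r0) n r \<alpha>" "nr \<beta> = k * n0" "nc \<beta> = n"
  "\<alpha> * \<beta> = I n" "\<beta> * \<alpha> = I (k * n0)"
proof -
 have "isoproj n0 r0 n r (I n)" using E sd by (simp add: sproj_def)
 thus thesis by (rule isoprojE) (rule that, auto simp: ulin_def)
qed

text \<open>W is the sum of U and its twist; the grading \<open>GW\<close> exchanges the summands,
  and \<open>H\<close> is 1 on the first and -1 on the second. The second conclusion writes every
  graded module with trivial complement to the isotypic part as a multiple of W, compatibly with the
  gradings.\<close>

lemma odd_type_exists: assumes S: "usimple n0 r0" and nsd: "\<not> selfdual n0 r0"
 obtains nW rW XW GW H where "odd_type nW rW XW GW H"
  "\<And>n r G. gmod n r G ==> sproj n0 r0 n r G (I n) ==>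
   \<exists>k \<alpha> \<beta>. ulin (k * nW) (kron (I k) rW) n r \<alpha> \<and> nr \<beta> = k * nW \<and> nc \<beta> = n \<and>
    \<alpha> * \<beta> = I n \<and> \<beta> * \<alpha> = I (k * nW) \<and> \<alpha> * kron (I k) GW = G * \<alpha>"
proof -
 have U: "umod n0 r0" and n0: "0 < n0" using S by (simp_all add: usimple_def)
 define r1 where "r1 = tw n0 r0"
 have U1: "umod n0 r1" using umod_tw[OF U] by (simp add: r1_def)
 note [simp] = umodD(1,2)[OF U] umodD(1,2)[OF U1]
 let ?i = "inl_mat n0 n0" and ?j = "inr_mat n0 n0" and ?p = "prl_mat n0 n0" and ?q = "prr_mat n0 n0"
 define W where "W = n0 + n0"
 define rW where "rW = sum_act n0 r0 n0 r1"
 define GW where "GW = ?i * ?q + ?j * ?p"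
 define H where "H = ?i * ?p + (- 1) *s (?j * ?q)"
 note sa = sum_act[OF U U1, folded W_def rW_def]
 note uW = sa(1)
 note [simp] = umodD(1,2)[OF uW]
 have W0: "0 < W" using n0 by (simp add: W_def)
 have WW [simp]: "n0 + n0 = W" by (simp add: W_def)
 have dW [simp]: "nr GW = W" "nc GW = W" "nr H = W" "nc H = W" by (simp_all add: GW_def H_def)
 have one: "I W = ?i * ?p + ?j * ?q" by simp
 have r01: "r0 * kron (I n0) GA = r1" "r1 * kron (I n0) GA = r0" using tw_tw[OF U] by (simp_all add: r1_def tw_def)
 have r01': "r0 * kron Y GA = r1 * kron Y (I a)" "r1 * kron Y GA = r0 * kron Y (I a)" if "nr Y = n0" for Y
  using mult_eq_assoc[OF r01(1), of "kron Y (I a)"] mult_eq_assoc[OF r01(2), of "kron Y (I a)"] that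
  by (simp_all add: kron_ring)
 have pG: "?p * GW = ?q" "?q * GW = ?p" "GW * ?i = ?j" "GW * ?j = ?i" by (simp_all add: GW_def mat_ring)
 have GG: "GW * GW = I W" by (subst GW_def, subst one) (simp add: mat_ring pG del: biproduct_mat(5))
 have rW: "rW = ?i * (r0 * kron ?p (I a)) + ?j * (r1 * kron ?q (I a))" by (simp add: rW_def sum_act_def mat_ring)
 have "GW * rW = ?j * (r0 * kron ?p (I a)) + ?i * (r1 * kron ?q (I a))"
  by (simp add: rW mat_ring mult_eq_assoc[OF pG(3)] mult_eq_assoc[OF pG(4)])
 moreover have "rW * kron GW GA = ?i * (r0 * kron ?q GA) + ?j * (r1 * kron ?p GA)"
  by (simp add: rW kron_ring pG)
 ultimately have "GW * rW = rW * kron GW GA" by (simp add: r01' add_commute_mat_dim)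
 hence gW: "gmod W rW GW" using uW GG by (simp add: gmod_def)
 have Hlin: "ulin W rW W rW H"
  unfolding H_def by (intro ulin_add ulin_smult ulin_compI[OF uW U uW sa(2,4)] ulin_compI[OF uW U1 uW sa(3,5)]) simp_all
 have HH: "H * H = I W" by (subst one) (simp add: H_def mat_ring del: biproduct_mat(5))
 have GH: "GW * H = (- 1) *s (H * GW)" by (simp add: GW_def H_def mat_ring add_commute_mat_dim)
 have endo: "\<exists>x y. f = x *s I W + y *s H" if f: "ulin W rW W rW f" for f
 proof -
  note [simp] = ulinD(1,2)[OF f]
  \<comment> \<open>There are no nonzero maps between U and its twist, so an endomorphism of W is
    diagonal with scalar entries, hence a combination of 1 and \<open>H\<close>.\<close>
  have nz: "g = 0\<^sub>m n0 n0" if "ulin n0 r0 n0 r1 g" for g using nsd that by (auto simp: selfdual_def r1_def)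
  have "ulin n0 r0 n0 r0 (?p * (f * ?i))" by (rule ulin_compI[OF U uW U sa(4) ulin_compI[OF U uW uW f sa(2)]])
  then obtain x where x: "?p * (f * ?i) = x *s I n0" using schur_scalar[OF S] by blast
  have "ulin n0 r1 n0 r1 (?q * (f * ?j))" by (rule ulin_compI[OF U1 uW U1 sa(5) ulin_compI[OF U1 uW uW f sa(3)]])
  from ulin_tw[OF U1 U1 this] have "ulin n0 r0 n0 r0 (?q * (f * ?j))" by (simp add: r1_def tw_tw[OF U])
  then obtain y where y: "?q * (f * ?j) = y *s I n0" using schur_scalar[OF S] by blast
  have z1: "?q * (f * ?i) = 0\<^sub>m n0 n0"
   by (rule nz, rule ulin_compI[OF U uW U1 sa(5) ulin_compI[OF U uW uW f sa(2)]])
  have "ulin n0 r1 n0 r0 (?p * (f * ?j))" by (rule ulin_compI[OF U1 uW U sa(4) ulin_compI[OF U1 uW uW f sa(3)]])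
  from ulin_tw[OF U1 U this] have "ulin n0 r0 n0 r1 (?p * (f * ?j))" by (simp add: r1_def tw_tw[OF U])
  hence z2: "?p * (f * ?j) = 0\<^sub>m n0 n0" by (rule nz)
  have fi: "f * ?i = x *s ?i" using biproduct_sum_assoc[of "f * ?i" n0 n0] x z1 by (simp add: mat_ring)
  have fj: "f * ?j = y *s ?j" using biproduct_sum_assoc[of "f * ?j" n0 n0] y z2 by (simp add: mat_ring)
  have "f = f * (?i * ?p + ?j * ?q)" by (simp add: mat_ring)
  also have "... = x *s (?i * ?p) + y *s (?j * ?q)"
   by (simp add: mat_ring mult_eq_assoc[OF fi] mult_eq_assoc[OF fj] del: biproduct_mat(5))
  also have "... = ((x + y) / 2) *s (?i * ?p + ?j * ?q) + ((x - y) / 2) *s H"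
   unfolding H_def by (intro eq_matI) (auto simp: field_simps simp del: index_mult_mat(1) biproduct_mat(5))
  finally show ?thesis unfolding one[symmetric] by blast
 qed
 have HGHG: "(H * GW) * (H * GW) = (- 1) *s I W"
  by (simp add: mat_ring mult_eq_assoc[OF GH] mult_eq_assoc[OF HH] HH GG)
 have cmp': "P = 0" if "P *s (H * GW) = (- P) *s (H * GW)" for P
 proof -
  have "P *s (H * GW) * (H * GW) = (- P) *s (H * GW) * (H * GW)" using that by simp
  hence "(P *s I W) $$ (0,0) = ((- P) *s I W) $$ (0,0)" using HGHG by (simp add: smult_mult_mat_dim smult_smult_mat)
  thus "P = 0" using W0 by simp
 qed
 \<comment> \<open>The grading separates the two basis endomorphisms: 1 commutes and
   \<open>H\<close> anticommutes with \<open>GW\<close>.\<close>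
 have even: "\<exists>x. f = x *s I W" if f: "ulin W rW W rW f" and "GW * f = f * GW" for f
 proof -
  obtain x y where xy: "f = x *s I W + y *s H" using endo[OF f] by blast
  have "x *s GW + y *s (H * GW) = x *s GW + (- y) *s (H * GW)" using that(2) by (simp add: xy mat_ring GH)
  hence "y *s (H * GW) = (- y) *s (H * GW)" by (rule add_left_cancel_mat) simp_all
  hence "y = 0" by (rule cmp')
  thus ?thesis using xy by (auto simp: zero_smult_mat mat_ring)
 qed
 have odd: "\<exists>y. f = y *s H" if f: "ulin W rW W rW f" and "GW * f = (- 1) *s (f * GW)" for f
 proof -
  obtain x y where xy: "f = x *s I W + y *s H" using endo[OF f] by blast
  have "(- y) *s (H * GW) + x *s GW = (- y) *s (H * GW) + (- x) *s GW"
   using that(2) by (simp add: xy mat_ring GH add_commute_mat_dim)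
  hence "x *s GW = (- x) *s GW" by (rule add_left_cancel_mat) simp_all
  hence "x *s GW * GW = (- x) *s GW * GW" by simp
  hence "(x *s I W) $$ (0,0) = ((- x) *s I W) $$ (0,0)" using GG by (simp add: smult_mult_mat_dim)
  hence "x = 0" using W0 by simp
  thus ?thesis using xy by (auto simp: zero_smult_mat mat_ring)
 qed
 obtain D where D: "derivation W rW GW D" using derivation_exists[OF gW] .
 have [simp]: "nr D = W" "nc D = W" and GD: "GW * D = (- 1) *s (D * GW)"
  and Dr: "D * rW = rW * (kron D (I a) + kron GW XA)" using D by (simp_all add: derivation_def)
 have "H * D * rW = H * (rW * (kron D (I a) + kron GW XA))" by (simp add: mat_ring Dr)
 also have "... = rW * (kron (H * D) (I a) + kron (H * GW) XA)"
  by (simp add: mult_eq_assoc[OF ulinD(3)[OF Hlin]] kron_ring)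
 finally have hd: "H * D * rW = rW * (kron (H * D) (I a) + kron (H * GW) XA)" .
 have "D * H * rW = (D * rW) * kron H (I a)" by (simp add: mat_ring ulinD(3)[OF Hlin])
 also have "... = rW * (kron (D * H) (I a) + (- 1) *s kron (H * GW) XA)"
  by (simp add: Dr kron_ring GH kron_smult_left)
 finally have dh: "D * H * rW = rW * (kron (D * H) (I a) + (- 1) *s kron (H * GW) XA)" .
 have "(H * D + D * H) * rW = H * D * rW + D * H * rW" by (rule add_mult_mat_dim) simp_all
 also have "... = rW * kron (H * D + D * H) (I a)"
  unfolding hd dh by (simp add: mat_ring kron_add_left) (intro eq_matI; simp del: index_mult_mat(1))
 finally have "ulin W rW W rW (H * D + D * H)" by (simp add: ulin_def)
 moreover have "GW * (H * D + D * H) = (H * D + D * H) * GW"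
  by (simp add: mat_ring mult_eq_assoc[OF GH] mult_eq_assoc[OF GD] GH GD)
 ultimately obtain \<mu> where \<mu>: "H * D + D * H = \<mu> *s I W" using even by blast
 \<comment> \<open>H D + D H is an even endomorphism, hence a scalar \<mu>. Since H^2 = 1,
   subtracting (\<mu> / 2) H from D makes it anticommute with \<open>H\<close> and changes neither
   oddness nor the Leibniz rule.\<close>
 define X where "X = D + (- \<mu> / 2) *s H"
 have [simp]: "nr X = W" "nc X = W" by (simp_all add: X_def)
 have GX: "GW * X = (- 1) *s (X * GW)" by (simp add: X_def mat_ring GD GH)
 have "X * rW = rW * (kron X (I a) + kron GW XA)"
  by (simp add: X_def mat_ring Dr ulinD(3)[OF Hlin] kron_add_left kron_smult_left)
   (intro eq_matI; simp del: index_mult_mat(1))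
 hence dX: "derivation W rW GW X" using GX by (simp add: derivation_def)
 have "H * X + X * H = (H * D + D * H) + (- \<mu>) *s I W"
  by (simp add: X_def mat_ring HH) (intro eq_matI; simp del: index_mult_mat(1))
 hence HX: "H * X + X * H = 0\<^sub>m W W" by (simp add: \<mu> add_smult_self zero_smult_mat)
 have XH: "X * H = (- 1) *s (H * X)"
 proof (rule eq_matI)
  fix i j assume ij: "i < nr ((- 1) *s (H * X))" "j < nc ((- 1) *s (H * X))"
  have "(H * X + X * H) $$ (i, j) = 0" using HX ij by (simp del: index_mult_mat(1) index_add_mat(1))
  thus "(X * H) $$ (i, j) = ((- 1) *s (H * X)) $$ (i, j)" using ij by (simp add: add_eq_0_iff del: index_mult_mat(1))
 qed simp_all
 obtain l where l: "X * X = l *s I W" using even[OF derivation_square[OF gW dX]] by blast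
 \<comment> \<open>The average of the odd X is an odd endomorphism, so a multiple of
   \<open>H\<close>, which anticommutes with X.\<close>
 obtain y where y: "avg rW rW X = y *s H" using odd[OF avg_derivation(1,2)[OF gW dX]] by blast
 have "X * avg rW rW X + avg rW rW X * X = 0\<^sub>m W W" by (simp add: y mat_ring XH add_smult_self zero_smult_mat)
 hence "X * X = 0\<^sub>m W W" by (rule derivation_square_zero[OF gW dX W0 l])
 hence "dgmod W rW X GW" using dX gW by (simp add: dgmod_def derivation_def)
 hence ot: "odd_type W rW X GW H" using W0 Hlin HH GH XH endo by (simp add: odd_type_def)
 show thesis
 proof (rule that[OF ot])
  fix n r G assume M: "gmod n r G" and E: "sproj n0 r0 n r G (I n)"
  note um = gmodD(1)[OF M]
  note [simp] = gmodD(2,3,6,7)[OF M]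
  obtain e where e: "isoproj n0 r0 n r e" and e1: "I n = e + G * e * G" using E nsd by (auto simp: sproj_def)
  obtain k \<alpha> \<beta> where *: "ulin (k * n0) (kron (I k) r0) n r \<alpha>" "ulin n r (k * n0) (kron (I k) r0) \<beta>"
   "\<beta> * \<alpha> = I (k * n0)" "e = \<alpha> * \<beta>" using e by (rule isoprojE)
  note [simp] = ulinD(1,2)[OF *(1)] ulinD(1,2)[OF *(2)]
  have "\<beta> * (e * (G * e)) * \<alpha> = 0\<^sub>m (k * n0) (k * n0)"
   using isoproj_twisted_zero[OF S M e nsd] by (simp add: mat_ring)
  hence bGa: "\<beta> * (G * \<alpha>) = 0\<^sub>m (k * n0) (k * n0)"
   by (simp add: *(4) mat_ring *(3) mult_eq_assoc[OF *(3)])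
  have bGaX: "\<beta> * (G * (\<alpha> * Y)) = 0\<^sub>m (k * n0) (nc Y)" if "nr Y = k * n0" for Y
   using mult_eq_assoc[OF bGa, of Y] that by (simp add: mat_ring)
  have a1: "ulin (k * n0) (kron (I k) r1) n r (G * \<alpha>)" using ulin_tw[OF umod_free[OF U] um *(1)]
   by (intro ulin_compI[OF umod_free[OF U1] umod_tw[OF um] um ulin_grading'[OF M]]) (simp add: tw_free[OF U] r1_def)
  let ?p' = "kron (I k) ?p" and ?q' = "kron (I k) ?q" and ?i' = "kron (I k) ?i" and ?j' = "kron (I k) ?j"
  \<comment> \<open>The k copies of U in M and their images under G, which are copies of the twist,
    together fill M because 1 = e + G e G.\<close>
  define \<alpha>' where "\<alpha>' = \<alpha> * ?p' + G * \<alpha> * ?q'"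
  define \<beta>' where "\<beta>' = ?i' * \<beta> + ?j' * (\<beta> * G)"
  have [simp]: "nr \<alpha>' = n" "nc \<alpha>' = k * W" "nr \<beta>' = k * W" "nc \<beta>' = n"
   by (simp_all add: \<alpha>'_def \<beta>'_def)
  have 1: "ulin (k * W) (kron (I k) rW) n r \<alpha>'" unfolding \<alpha>'_def
   by (intro ulin_add ulin_compI[OF umod_free[OF uW] umod_free[OF U] um *(1)] ulin_compI[OF umod_free[OF uW] umod_free[OF U1] um a1]
     ulin_kron[OF uW U sa(4)] ulin_kron[OF uW U1 sa(5)]) simp_all
  have 2: "\<alpha>' * \<beta>' = I n"
   by (simp add: e1 \<alpha>'_def \<beta>'_def mat_ring kron_mult_assoc kron_mult kron_one kron_zero_right *(4))
  have "\<beta>' * \<alpha>' = kron (I k) (?i * ?p + ?j * ?q)"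
   by (simp add: \<alpha>'_def \<beta>'_def kron_ring mult_eq_assoc[OF *(3)] bGaX mult_eq_assoc[OF gmodD(4)[OF M]]
     kron_add_right del: biproduct_mat(5))
  hence 3: "\<beta>' * \<alpha>' = I (k * W)" by (simp add: kron_one)
  have 4: "\<alpha>' * kron (I k) GW = G * \<alpha>'"
   by (simp add: \<alpha>'_def kron_ring pG mult_eq_assoc[OF gmodD(4)[OF M]] add_commute_mat_dim)
  show "\<exists>k \<alpha> \<beta>. ulin (k * W) (kron (I k) rW) n r \<alpha> \<and> nr \<beta> = k * W \<and> nc \<beta> = n \<and>
    \<alpha> * \<beta> = I n \<and> \<beta> * \<alpha> = I (k * W) \<and> \<alpha> * kron (I k) GW = G * \<alpha>"
   using 1 2 3 4 by (intro exI[of _ k] exI[of _ \<alpha>'] exI[of _ \<beta>']) simp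
 qed
qed

end

section \<open>Linear categories and equivalences\<close>

lemma Hom_iff: "f : Hom C X Y \<longleftrightarrow> f : Arr C \<and> Dom C f = X \<and> Cod C f = Y"
 by (auto simp: Hom_def)

context category
begin

lemma arr_objs [simp]: "f : Arr C ==> Dom C f : Obj C" "f : Arr C ==> Cod C f : Obj C"
 by (simp_all add: Dom_Obj Cod_Obj)

lemma id_arr [simp]: "X : Obj C ==> Id C X : Arr C" "X : Obj C ==> Dom C (Id C X) = X" "X : Obj C ==> Cod C (Id C X) = X"
 using Id_Hom by (auto simp: Hom_iff)

lemma comp_arr [simp]: assumes "f : Arr C" "g : Arr C" "Cod C f = Dom C g"
 shows "Comp C g f : Arr C" "Dom C (Comp C g f) = Dom C f" "Cod C (Comp C g f) = Cod C g"
 using Comp_Hom[of f "Dom C f" "Cod C f" g "Cod C g"] assms by (auto simp: Hom_iff)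

lemma comp_id [simp]: "f : Arr C ==> Y = Cod C f ==> Comp C (Id C Y) f = f" "f : Arr C ==> X = Dom C f ==> Comp C f (Id C X) = f"
 using Id_left[of f "Dom C f" "Cod C f"] Id_right[of f "Dom C f" "Cod C f"] by (auto simp: Hom_iff)

lemma comp_assoc:
 "f : Arr C ==> g : Arr C ==> h : Arr C ==> Cod C f = Dom C g ==> Cod C g = Dom C h ==>
  Comp C (Comp C h g) f = Comp C h (Comp C g f)"
 using Comp_assoc[of f "Dom C f" "Cod C f" g "Cod C g" h "Cod C h"] by (auto simp: Hom_iff)

lemma comp_eq_assoc:
 "Comp C g f = k ==> f : Arr C ==> g : Arr C ==> Cod C f = Dom C g ==> x : Arr C ==> Cod C x = Dom C f ==>
  Comp C g (Comp C f x) = Comp C k x" by (simp add: comp_assoc[symmetric])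

lemma iso_arrE: assumes "iso_arr C X Y f"
 obtains g where "f : Arr C" "Dom C f = X" "Cod C f = Y" "g : Arr C" "Dom C g = Y" "Cod C g = X"
  "Comp C g f = Id C X" "Comp C f g = Id C Y" using assms by (auto simp: iso_arr_def Hom_iff)

lemma iso_arrD: "iso_arr C X Y f ==> f : Arr C" "iso_arr C X Y f ==> Dom C f = X" "iso_arr C X Y f ==> Cod C f = Y"
 by (auto simp: iso_arr_def Hom_iff)

lemma iso_arr_objs: "iso_arr C X Y f ==> X : Obj C" "iso_arr C X Y f ==> Y : Obj C"
 using iso_arrD[of X Y f] by auto

lemma iso_arrI:
 "f : Arr C ==> g : Arr C ==> Dom C f = X ==> Cod C f = Y ==> Dom C g = Y ==> Cod C g = X ==>
  Comp C g f = Id C X ==> Comp C f g = Id C Y ==> iso_arr C X Y f" by (auto simp: iso_arr_def Hom_iff)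

lemma iso_arr_id: "X : Obj C ==> iso_arr C X X (Id C X)" by (rule iso_arrI[of _ "Id C X"]) simp_all

lemma iso_arr_comp: assumes "iso_arr C X Y f" "iso_arr C Y Z g" shows "iso_arr C X Z (Comp C g f)"
proof -
 obtain f' where f [simp]: "f : Arr C" "Dom C f = X" "Cod C f = Y" "f' : Arr C" "Dom C f' = Y" "Cod C f' = X"
  and ff: "Comp C f' f = Id C X" "Comp C f f' = Id C Y" using assms(1) by (rule iso_arrE)
 obtain g' where g [simp]: "g : Arr C" "Dom C g = Y" "Cod C g = Z" "g' : Arr C" "Dom C g' = Z" "Cod C g' = Y"
  and gg: "Comp C g' g = Id C Y" "Comp C g g' = Id C Z" using assms(2) by (rule iso_arrE)
 show ?thesis by (rule iso_arrI[of _ "Comp C f' g'"])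
   (simp_all add: comp_assoc comp_eq_assoc[OF ff(2)] comp_eq_assoc[OF gg(1)] ff gg)
qed

definition inv_arr where
 "inv_arr f = (SOME g. g : Arr C \<and> Dom C g = Cod C f \<and> Cod C g = Dom C f \<and>
   Comp C g f = Id C (Dom C f) \<and> Comp C f g = Id C (Cod C f))"

lemma inv_arr: assumes "iso_arr C X Y f" shows "inv_arr f : Arr C" "Dom C (inv_arr f) = Y" "Cod C (inv_arr f) = X"
  "Comp C (inv_arr f) f = Id C X" "Comp C f (inv_arr f) = Id C Y" "iso_arr C Y X (inv_arr f)"
proof -
 obtain g where g: "f : Arr C" "Dom C f = X" "Cod C f = Y" "g : Arr C" "Dom C g = Y" "Cod C g = X"
  "Comp C g f = Id C X" "Comp C f g = Id C Y" using assms by (rule iso_arrE)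
 hence "\<exists>g. g : Arr C \<and> Dom C g = Cod C f \<and> Cod C g = Dom C f \<and>
   Comp C g f = Id C (Dom C f) \<and> Comp C f g = Id C (Cod C f)" by auto
 from someI_ex[OF this] show *: "inv_arr f : Arr C" "Dom C (inv_arr f) = Y" "Cod C (inv_arr f) = X"
  "Comp C (inv_arr f) f = Id C X" "Comp C f (inv_arr f) = Id C Y" using g by (simp_all add: inv_arr_def)
 show "iso_arr C Y X (inv_arr f)" by (rule iso_arrI[of _ f]) (use * g in simp_all)
qed

lemma iso_cancel_left:
 assumes "iso_arr C X Y e" "Comp C e f = Comp C e g" "f : Arr C" "g : Arr C" "Cod C f = X" "Cod C g = X"
 shows "f = g"
proof -
 note [simp] = iso_arrD[OF assms(1)] inv_arr(1,2,3)[OF assms(1)] assms(3-6)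
 have "Comp C (inv_arr e) (Comp C e f) = Comp C (inv_arr e) (Comp C e g)" using assms(2) by simp
 thus ?thesis by (simp add: comp_eq_assoc[OF inv_arr(4)[OF assms(1)]])
qed

lemma iso_cancel_right:
 assumes "iso_arr C X Y e" "Comp C f e = Comp C g e" "f : Arr C" "g : Arr C" "Dom C f = Y" "Dom C g = Y"
 shows "f = g"
proof -
 note [simp] = iso_arrD[OF assms(1)] inv_arr(1,2,3)[OF assms(1)] assms(3-6)
 have "Comp C (Comp C f e) (inv_arr e) = Comp C (Comp C g e) (inv_arr e)" using assms(2) by simp
 thus ?thesis by (simp add: comp_assoc inv_arr(5)[OF assms(1)])
qed

end

context linear_category
begin

lemma zero_arr [simp]: "X : Obj C ==> Y : Obj C ==> Zero C X Y : Arr C"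
 "X : Obj C ==> Y : Obj C ==> Dom C (Zero C X Y) = X" "X : Obj C ==> Y : Obj C ==> Cod C (Zero C X Y) = Y"
 using Zero_Hom by (auto simp: Hom_iff)

lemma add_arr [simp]: assumes "f : Arr C" "g : Arr C" "Dom C f = Dom C g" "Cod C f = Cod C g"
 shows "Add C f g : Arr C" "Dom C (Add C f g) = Dom C g" "Cod C (Add C f g) = Cod C g"
 using Add_Hom[of f "Dom C g" "Cod C g" g] assms by (auto simp: Hom_iff)

lemma smult_arr [simp]: assumes "f : Arr C"
 shows "Smult C c f : Arr C" "Dom C (Smult C c f) = Dom C f" "Cod C (Smult C c f) = Cod C f"
 using Smult_Hom[of f "Dom C f" "Cod C f" c] assms by (auto simp: Hom_iff)

lemma comp_add_left: "f : Arr C ==> g : Arr C ==> h : Arr C ==> Dom C g = Dom C h ==> Cod C g = Cod C h ==>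
  Cod C f = Dom C h ==> Comp C (Add C g h) f = Add C (Comp C g f) (Comp C h f)"
 using Comp_Add_left[of f "Dom C f" "Cod C f" g "Cod C h" h] by (auto simp: Hom_iff)

lemma comp_add_right: "f : Arr C ==> g : Arr C ==> h : Arr C ==> Dom C f = Dom C g ==> Cod C f = Cod C g ==>
  Cod C g = Dom C h ==> Comp C h (Add C f g) = Add C (Comp C h f) (Comp C h g)"
 using Comp_Add_right[of f "Dom C f" "Cod C f" g h "Cod C h"] by (auto simp: Hom_iff)

lemma comp_smult_left: "f : Arr C ==> g : Arr C ==> Cod C f = Dom C g ==> Comp C (Smult C c g) f = Smult C c (Comp C g f)"
 using Comp_Smult_left[of f "Dom C f" "Cod C f" g "Cod C g"] by (auto simp: Hom_iff)

lemma comp_smult_right: "f : Arr C ==> g : Arr C ==> Cod C f = Dom C g ==> Comp C g (Smult C c f) = Smult C c (Comp C g f)"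
 using Comp_Smult_right[of f "Dom C f" "Cod C f" g "Cod C g"] by (auto simp: Hom_iff)

lemma add_zero: "f : Arr C ==> X = Dom C f ==> Y = Cod C f ==> Add C f (Zero C X Y) = f"
 using Add_Zero[of f "Dom C f" "Cod C f"] by (auto simp: Hom_iff)

lemma add_commute: "f : Arr C ==> g : Arr C ==> Dom C f = Dom C g ==> Cod C f = Cod C g ==> Add C f g = Add C g f"
 using Add_commute[of f "Dom C f" "Cod C f" g] by (auto simp: Hom_iff)

lemma zero_add: "f : Arr C ==> X = Dom C f ==> Y = Cod C f ==> Add C (Zero C X Y) f = f"
 by (simp add: add_commute[of "Zero C (Dom C f) (Cod C f)" f] add_zero)

lemma add_inverse: "f : Arr C ==> Add C f (Smult C (- 1) f) = Zero C (Dom C f) (Cod C f)"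
 using Add_inverse[of f "Dom C f" "Cod C f"] by (auto simp: Hom_iff)

lemma add_assoc: "f : Arr C ==> g : Arr C ==> h : Arr C ==> Dom C f = Dom C g ==> Cod C f = Cod C g ==>
  Dom C g = Dom C h ==> Cod C g = Cod C h ==> Add C (Add C f g) h = Add C f (Add C g h)"
 using Add_assoc[of f "Dom C f" "Cod C f" g h] by (auto simp: Hom_iff)

lemma zero_smult: assumes "f : Arr C" shows "Smult C 0 f = Zero C (Dom C f) (Cod C f)"
proof -
 have f: "f : Hom C (Dom C f) (Cod C f)" using assms by (simp add: Hom_iff)
 have "Smult C (1 + - 1) f = Add C (Smult C 1 f) (Smult C (- 1) f)" using Smult_Add_left[OF f] .
 thus ?thesis using Smult_one[OF f] add_inverse[OF assms] by simp
qed

lemma comp_zero_right: assumes [simp]: "g : Arr C" "X : Obj C" and Y: "Y = Dom C g"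
 shows "Comp C g (Zero C X Y) = Zero C X (Cod C g)"
proof -
 have "Comp C g (Smult C 0 (Zero C X (Dom C g))) = Smult C 0 (Comp C g (Zero C X (Dom C g)))"
  by (rule comp_smult_right) simp_all
 thus ?thesis unfolding Y by (simp add: zero_smult)
qed

lemma comp_zero_left: assumes [simp]: "g : Arr C" "Z : Obj C" and Y: "Y = Cod C g"
 shows "Comp C (Zero C Y Z) g = Zero C (Dom C g) Z"
proof -
 have "Comp C (Smult C 0 (Zero C (Cod C g) Z)) g = Smult C 0 (Comp C (Zero C (Cod C g) Z) g)"
  by (rule comp_smult_left) simp_all
 thus ?thesis unfolding Y by (simp add: zero_smult)
qed

end

text \<open>Fully faithful and essentially surjective functors carry all later arguments;
  \<open>ffes_imp_equivalence\<close> and \<open>equivalence_imp_ffes\<close> exchange them with the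
  quasi-inverses of \<open>is_equivalence\<close>.\<close>

definition ffes :: "('o, 'a, 'z) lincat_scheme => ('p, 'b, 'y) lincat_scheme => ('o => 'p) => ('a => 'b) => bool" where
 "ffes C D Fo Fa \<longleftrightarrow> linear_functor C D Fo Fa \<and>
  (\<forall>X \<in> Obj C. \<forall>Y \<in> Obj C. bij_betw Fa (Hom C X Y) (Hom D (Fo X) (Fo Y))) \<and>
  (\<forall>N \<in> Obj D. \<exists>X \<in> Obj C. \<exists>f. iso_arr D (Fo X) N f)"

locale lin_functor = C: linear_category C + D: linear_category D
 for C :: "('o, 'a, 'z) lincat_scheme" and D :: "('p, 'b, 'y) lincat_scheme" +
 fixes Fo :: "'o => 'p" and Fa :: "'a => 'b" assumes lin_fun: "linear_functor C D Fo Fa"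
begin

lemma F_obj [simp]: "X : Obj C ==> Fo X : Obj D" and F_id [simp]: "X : Obj C ==> Fa (Id C X) = Id D (Fo X)"
 using lin_fun unfolding linear_functor_def by blast+

lemma F_arr [simp]: assumes "f : Arr C"
 shows "Fa f : Arr D" "Dom D (Fa f) = Fo (Dom C f)" "Cod D (Fa f) = Fo (Cod C f)"
proof -
 have "Fa f : Hom D (Fo (Dom C f)) (Fo (Cod C f))"
  using lin_fun assms C.arr_objs[OF assms] unfolding linear_functor_def Hom_def by blast
 thus "Fa f : Arr D" "Dom D (Fa f) = Fo (Dom C f)" "Cod D (Fa f) = Fo (Cod C f)" by (auto simp: Hom_iff)
qed

lemma F_comp [simp]: assumes "f : Arr C" "g : Arr C" "Cod C f = Dom C g"
 shows "Fa (Comp C g f) = Comp D (Fa g) (Fa f)"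
proof -
 have "f : Hom C (Dom C f) (Dom C g)" "g : Hom C (Dom C g) (Cod C g)" using assms by (auto simp: Hom_iff)
 thus ?thesis using lin_fun C.arr_objs[OF assms(1)] C.arr_objs[OF assms(2)] unfolding linear_functor_def by blast
qed

lemma F_add: assumes "f : Arr C" "g : Arr C" "Dom C f = Dom C g" "Cod C f = Cod C g"
 shows "Fa (Add C f g) = Add D (Fa f) (Fa g)"
proof -
 have "f : Hom C (Dom C f) (Cod C f)" "g : Hom C (Dom C f) (Cod C f)" using assms by (auto simp: Hom_iff)
 thus ?thesis using lin_fun C.arr_objs[OF assms(1)] unfolding linear_functor_def by blast
qed

lemma F_smult: assumes "f : Arr C" shows "Fa (Smult C c f) = Smult D c (Fa f)"
proof -
 have "f : Hom C (Dom C f) (Cod C f)" using assms by (auto simp: Hom_iff)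
 thus ?thesis using lin_fun C.arr_objs[OF assms(1)] unfolding linear_functor_def by blast
qed

lemma F_zero: assumes "X : Obj C" "Y : Obj C" shows "Fa (Zero C X Y) = Zero D (Fo X) (Fo Y)"
 using F_smult[of "Zero C X Y" 0] C.zero_smult[of "Zero C X Y"] D.zero_smult[of "Fa (Zero C X Y)"] assms by simp

lemma F_iso: assumes "iso_arr C X Y f" shows "iso_arr D (Fo X) (Fo Y) (Fa f)"
proof -
 obtain g where g [simp]: "f : Arr C" "Dom C f = X" "Cod C f = Y" "g : Arr C" "Dom C g = Y" "Cod C g = X"
  and gf: "Comp C g f = Id C X" "Comp C f g = Id C Y" using assms by (rule C.iso_arrE)
 show ?thesis
  by (rule D.iso_arrI[of _ "Fa g"]) (use C.iso_arr_objs[OF assms] in \<open>simp_all add: gf flip: F_comp\<close>)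
qed

end

lemma lin_functorI: "linear_category C ==> linear_category D ==> linear_functor C D Fo Fa ==> lin_functor C D Fo Fa"
 by (simp add: lin_functor_def lin_functor_axioms_def)

lemma linear_functorI: assumes "linear_category C" "linear_category D"
  and "\<And>X. X : Obj C ==> Fo X : Obj D" "\<And>X. X : Obj C ==> Fa (Id C X) = Id D (Fo X)"
  and "\<And>f. f : Arr C ==> Fa f : Arr D" "\<And>f. f : Arr C ==> Dom D (Fa f) = Fo (Dom C f)"
   "\<And>f. f : Arr C ==> Cod D (Fa f) = Fo (Cod C f)"
  and "\<And>f g. f : Arr C ==> g : Arr C ==> Cod C f = Dom C g ==> Fa (Comp C g f) = Comp D (Fa g) (Fa f)"
  and "\<And>f g. f : Arr C ==> g : Arr C ==> Dom C f = Dom C g ==> Cod C f = Cod C g ==> Fa (Add C f g) = Add D (Fa f) (Fa g)"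
  and "\<And>f c. f : Arr C ==> Fa (Smult C c f) = Smult D c (Fa f)" shows "linear_functor C D Fo Fa"
 using assms(3-) unfolding linear_functor_def Hom_def by auto

locale ff_functor = lin_functor + assumes ffes: "ffes C D Fo Fa"
begin

lemma full: assumes "h : Arr D" "Dom D h = Fo X" "Cod D h = Fo Y" "X : Obj C" "Y : Obj C"
 obtains f where "f : Arr C" "Dom C f = X" "Cod C f = Y" "Fa f = h"
proof -
 have "bij_betw Fa (Hom C X Y) (Hom D (Fo X) (Fo Y))" using ffes assms(4,5) by (simp add: ffes_def)
 moreover have "h : Hom D (Fo X) (Fo Y)" using assms by (simp add: Hom_iff)
 ultimately obtain f where "f : Hom C X Y" "Fa f = h" by (metis bij_betw_def imageE)
 thus thesis using that by (auto simp: Hom_iff)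
qed

lemma faithful: assumes "Fa f = Fa g" "f : Arr C" "g : Arr C" "Dom C f = Dom C g" "Cod C f = Cod C g"
 shows "f = g"
proof -
 have "inj_on Fa (Hom C (Dom C f) (Cod C f))" using ffes assms(2) by (simp add: ffes_def bij_betw_def)
 thus ?thesis using assms by (auto simp: Hom_iff inj_on_def)
qed

lemma reflect_iso: assumes "iso_arr D (Fo X) (Fo Y) (Fa f)" "f : Arr C" "Dom C f = X" "Cod C f = Y"
 shows "iso_arr C X Y f"
proof -
 obtain h where h: "h : Arr D" "Dom D h = Fo Y" "Cod D h = Fo X" "Comp D h (Fa f) = Id D (Fo X)" "Comp D (Fa f) h = Id D (Fo Y)"
  using assms(1) by (rule D.iso_arrE)
 have XY: "X : Obj C" "Y : Obj C" using assms(2-4) by auto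
 obtain g where g: "g : Arr C" "Dom C g = Y" "Cod C g = X" "Fa g = h" using full[OF h(1-3) XY(2,1)] .
 show ?thesis by (rule C.iso_arrI[OF assms(2) g(1)]; (rule faithful)?) (use assms(2-4) g h XY in simp_all)
qed

text \<open>A quasi-inverse by choice: \<open>Ga h\<close> is the arrow that F sends to h conjugated
  with the chosen isomorphisms \<open>eps\<close>.\<close>

definition Go where "Go N = (SOME X. X : Obj C \<and> (\<exists>f. iso_arr D (Fo X) N f))"
definition eps where "eps N = (SOME f. iso_arr D (Fo (Go N)) N f)"
definition Ga where
 "Ga h = (SOME f. f : Arr C \<and> Dom C f = Go (Dom D h) \<and> Cod C f = Go (Cod D h) \<and>
   Comp D (eps (Cod D h)) (Fa f) = Comp D h (eps (Dom D h)))"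

lemma Go: assumes "N : Obj D" shows "Go N : Obj C" "iso_arr D (Fo (Go N)) N (eps N)"
proof -
 have "\<exists>X. X : Obj C \<and> (\<exists>f. iso_arr D (Fo X) N f)" using ffes assms unfolding ffes_def by blast
 from someI_ex[OF this] show "Go N : Obj C" and "iso_arr D (Fo (Go N)) N (eps N)"
  by (auto simp: Go_def eps_def intro: someI_ex)
qed

lemma eps_arr [simp]: assumes "N : Obj D" shows "Go N : Obj C" "eps N : Arr D" "Dom D (eps N) = Fo (Go N)" "Cod D (eps N) = N"
 using Go[OF assms] D.iso_arrD[OF Go(2)[OF assms]] by auto

lemma Ga: assumes "h : Arr D" shows "Ga h : Arr C" "Dom C (Ga h) = Go (Dom D h)" "Cod C (Ga h) = Go (Cod D h)"
  "Comp D (eps (Cod D h)) (Fa (Ga h)) = Comp D h (eps (Dom D h))"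
proof -
 have o: "Dom D h : Obj D" "Cod D h : Obj D" using assms by simp_all
 note i = D.inv_arr[OF Go(2)[OF o(2)]]
 let ?k = "Comp D (D.inv_arr (eps (Cod D h))) (Comp D h (eps (Dom D h)))"
 have k: "?k : Arr D" "Dom D ?k = Fo (Go (Dom D h))" "Cod D ?k = Fo (Go (Cod D h))"
  using i(1-3) o assms by simp_all
 obtain f where f: "f : Arr C" "Dom C f = Go (Dom D h)" "Cod C f = Go (Cod D h)" "Fa f = ?k"
  using full[OF k] o by auto
 have "Comp D (eps (Cod D h)) ?k = Comp D h (eps (Dom D h))"
  using i(1-3) o assms by (simp add: D.comp_eq_assoc[OF i(5)])
 with f have "\<exists>f. f : Arr C \<and> Dom C f = Go (Dom D h) \<and> Cod C f = Go (Cod D h) \<and>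
   Comp D (eps (Cod D h)) (Fa f) = Comp D h (eps (Dom D h))" by metis
 from someI_ex[OF this] show "Ga h : Arr C" "Dom C (Ga h) = Go (Dom D h)" "Cod C (Ga h) = Go (Cod D h)"
  "Comp D (eps (Cod D h)) (Fa (Ga h)) = Comp D h (eps (Dom D h))" by (simp_all add: Ga_def)
qed

lemmas Ga_arr [simp] = Ga(1-3)

text \<open>Equations between arrows into \<open>Go N\<close> are tested after applying F and
  composing with \<open>eps N\<close>.\<close>

lemma eps_cancel:
 assumes "Comp D (eps N) (Fa f) = Comp D (eps N) (Fa g)" "N : Obj D" "f : Arr C" "g : Arr C" "Dom C f = Dom C g" "Cod C f = Go N" "Cod C g = Go N"
 shows "f = g"
proof (rule faithful)
 show "Fa f = Fa g" by (rule D.iso_cancel_left[OF Go(2)[OF assms(2)] assms(1)]) (use assms in simp_all)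
qed (use assms in simp_all)

lemma G_functor: "linear_functor D C Go Ga"
proof (rule linear_functorI[OF D.linear_category_axioms C.linear_category_axioms])
 fix X assume "X : Obj D"
 thus "Ga (Id D X) = Id C (Go X)" using Ga(4)[of "Id D X"] by (intro eps_cancel[of X]) simp_all
next
 fix f g assume "f : Arr D" "g : Arr D" "Cod D f = Dom D g"
 thus "Ga (Comp D g f) = Comp C (Ga g) (Ga f)"
  using Ga(4)[of "Comp D g f"] Ga(4)[of f] Ga(4)[of g] by (intro eps_cancel[of "Cod D g"])
   (simp_all add: D.comp_assoc D.comp_eq_assoc[where k = "Comp D g (eps (Dom D g))"])
next
 fix f g assume "f : Arr D" "g : Arr D" "Dom D f = Dom D g" "Cod D f = Cod D g"
 thus "Ga (Add D f g) = Add C (Ga f) (Ga g)" using Ga(4)[of "Add D f g"] Ga(4)[of f] Ga(4)[of g]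
  by (intro eps_cancel[of "Cod D g"]) (simp_all add: F_add D.comp_add_right D.comp_add_left)
next
 fix f c assume "f : Arr D"
 thus "Ga (Smult D c f) = Smult C c (Ga f)" using Ga(4)[of "Smult D c f"] Ga(4)[of f]
  by (intro eps_cancel[of "Cod D f"]) (simp_all add: F_smult D.comp_smult_right D.comp_smult_left)
qed simp_all

lemma equivalence: "is_equivalence C D Fo Fa"
proof -
 define \<eta> where "\<eta> X = (SOME f. f : Arr C \<and> Dom C f = X \<and> Cod C f = Go (Fo X) \<and> Comp D (eps (Fo X)) (Fa f) = Id D (Fo X))" for X
 have \<eta>: "\<eta> X : Arr C" "Dom C (\<eta> X) = X" "Cod C (\<eta> X) = Go (Fo X)" "Comp D (eps (Fo X)) (Fa (\<eta> X)) = Id D (Fo X)"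
  "iso_arr C X (Go (Fo X)) (\<eta> X)" if X: "X : Obj C" for X
 proof -
  have o: "Fo X : Obj D" using X by simp
  note i = D.inv_arr[OF Go(2)[OF o]]
  obtain f where f: "f : Arr C" "Dom C f = X" "Cod C f = Go (Fo X)" "Fa f = D.inv_arr (eps (Fo X))"
   by (rule full[OF i(1-3)]) (use X in simp_all)
  hence "\<exists>f. f : Arr C \<and> Dom C f = X \<and> Cod C f = Go (Fo X) \<and> Comp D (eps (Fo X)) (Fa f) = Id D (Fo X)" using i(5) by metis
  from someI_ex[OF this] show *: "\<eta> X : Arr C" "Dom C (\<eta> X) = X" "Cod C (\<eta> X) = Go (Fo X)" "Comp D (eps (Fo X)) (Fa (\<eta> X)) = Id D (Fo X)"
   by (simp_all add: \<eta>_def)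
  have "Fa (\<eta> X) = D.inv_arr (eps (Fo X))" by (rule D.iso_cancel_left[OF Go(2)[OF o]]) (use * i X in simp_all)
  thus "iso_arr C X (Go (Fo X)) (\<eta> X)" using i(6) * by (intro reflect_iso) simp_all
 qed
 have "natural_iso C C id id (Go \<circ> Fo) (Ga \<circ> Fa) \<eta>" unfolding natural_iso_def
 proof (intro conjI ballI)
  fix X Y f assume "X : Obj C" "Y : Obj C" "f : Hom C X Y"
  hence [simp]: "X : Obj C" "Y : Obj C" "f : Arr C" "Dom C f = X" "Cod C f = Y" by (auto simp: Hom_iff)
  note [simp] = \<eta>(1-3)
  have "Comp D (eps (Fo Y)) (Fa (Comp C (\<eta> Y) f)) = Fa f" by (simp add: D.comp_eq_assoc[OF \<eta>(4)])
  moreover have "Comp D (eps (Fo Y)) (Fa (Comp C (Ga (Fa f)) (\<eta> X))) = Fa f"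
   using Ga(4)[of "Fa f"] by (simp add: D.comp_eq_assoc[where k = "Comp D (Fa f) (eps (Fo X))"] D.comp_assoc \<eta>(4))
  ultimately have "Comp C (\<eta> Y) f = Comp C (Ga (Fa f)) (\<eta> X)" by (intro eps_cancel[of "Fo Y"]) simp_all
  thus "Comp C (\<eta> Y) (id f) = Comp C ((Ga \<circ> Fa) f) (\<eta> X)" by simp
 qed (simp add: \<eta>(5))
 moreover have "natural_iso D D (Fo \<circ> Go) (Fa \<circ> Ga) id id eps"
  unfolding natural_iso_def using Go(2) Ga(4) by (auto simp: Hom_iff)
 ultimately show ?thesis unfolding is_equivalence_def using lin_fun G_functor by blast
qed

end

lemma ffes_imp_equivalence:
 assumes "linear_category C" "linear_category D" "ffes C D Fo Fa" shows "is_equivalence C D Fo Fa"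
proof -
 have "linear_functor C D Fo Fa" using assms(3) by (simp add: ffes_def)
 then interpret ff_functor C D Fo Fa using assms by (simp add: ff_functor_def ff_functor_axioms_def lin_functorI)
 show ?thesis by (rule equivalence)
qed

lemma equivalence_imp_ffes:
 assumes C: "linear_category C" and D: "linear_category D" and E: "is_equivalence C D Fo Fa" shows "ffes C D Fo Fa"
proof -
 obtain Go Ga \<eta> \<epsilon> where F: "linear_functor C D Fo Fa" and G: "linear_functor D C Go Ga"
  and n: "natural_iso C C id id (Go \<circ> Fo) (Ga \<circ> Fa) \<eta>" and e: "natural_iso D D (Fo \<circ> Go) (Fa \<circ> Ga) id id \<epsilon>"
  using E unfolding is_equivalence_def by blast
 interpret C: linear_category C by fact
 interpret D: linear_category D by fact
 interpret F: lin_functor C D Fo Fa by (rule lin_functorI[OF C D F])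
 interpret G: lin_functor D C Go Ga by (rule lin_functorI[OF D C G])
 have \<eta>: "iso_arr C X (Go (Fo X)) (\<eta> X)" if "X : Obj C" for X using n that by (simp add: natural_iso_def)
 have \<eta>n: "Comp C (\<eta> (Cod C f)) f = Comp C (Ga (Fa f)) (\<eta> (Dom C f))" if "f : Arr C" for f
  using n that C.arr_objs[OF that] by (auto simp: natural_iso_def Hom_iff)
 have \<epsilon>: "iso_arr D (Fo (Go X)) X (\<epsilon> X)" if "X : Obj D" for X using e that by (simp add: natural_iso_def)
 have \<epsilon>n: "Comp D (\<epsilon> (Cod D f)) (Fa (Ga f)) = Comp D f (\<epsilon> (Dom D f))" if "f : Arr D" for f
  using e that D.arr_objs[OF that] by (auto simp: natural_iso_def Hom_iff)
 note \<eta>a = C.iso_arrD[OF \<eta>] and \<epsilon>a = D.iso_arrD[OF \<epsilon>]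
 have Ff: "f = g" if "Fa f = Fa g" "f : Arr C" "g : Arr C" "Dom C f = Dom C g" "Cod C f = Cod C g" for f g
 proof -
  have eq: "Comp C (\<eta> (Cod C f)) f = Comp C (\<eta> (Cod C f)) g"
   using \<eta>n[OF that(2)] \<eta>n[OF that(3)] that by simp
  show ?thesis by (rule C.iso_cancel_left[OF \<eta> eq]) (use that in simp_all)
 qed
 have Gf: "f = g" if "Ga f = Ga g" "f : Arr D" "g : Arr D" "Dom D f = Dom D g" "Cod D f = Cod D g" for f g
 proof -
  have eq: "Comp D f (\<epsilon> (Dom D f)) = Comp D g (\<epsilon> (Dom D f))"
   using \<epsilon>n[OF that(2)] \<epsilon>n[OF that(3)] that by simp
  show ?thesis by (rule D.iso_cancel_right[OF \<epsilon> eq]) (use that in simp_all)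
 qed
 show ?thesis unfolding ffes_def
 proof (intro conjI ballI F)
  fix X Y assume XY [simp]: "X : Obj C" "Y : Obj C"
  note [simp] = \<eta>a[OF XY(1)] \<eta>a[OF XY(2)]
  note iy = C.inv_arr[OF \<eta>[OF XY(2)]]
  note [simp] = iy(1-3)
  show "bij_betw Fa (Hom C X Y) (Hom D (Fo X) (Fo Y))" unfolding bij_betw_def
  proof (intro conjI)
   show "inj_on Fa (Hom C X Y)" using Ff by (auto simp: inj_on_def Hom_iff)
   have "h : Fa ` Hom C X Y" if "h : Hom D (Fo X) (Fo Y)" for h
   proof -
    have [simp]: "h : Arr D" "Dom D h = Fo X" "Cod D h = Fo Y" using that by (auto simp: Hom_iff)
    \<comment> \<open>The preimage of h is G h conjugated with the unit \<eta>. Then F f and h have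
      the same image under G, which is faithful.\<close>
    define f where "f = Comp C (C.inv_arr (\<eta> Y)) (Comp C (Ga h) (\<eta> X))"
    have [simp]: "f : Arr C" "Dom C f = X" "Cod C f = Y" by (simp_all add: f_def)
    have "Comp C (\<eta> Y) f = Comp C (Ga h) (\<eta> X)" by (simp add: f_def C.comp_eq_assoc[OF iy(5)])
    hence "Comp C (Ga (Fa f)) (\<eta> X) = Comp C (Ga h) (\<eta> X)" using \<eta>n[of f] by simp
    hence "Ga (Fa f) = Ga h" by (rule C.iso_cancel_right[OF \<eta>[OF XY(1)]]) simp_all
    hence "Fa f = h" by (rule Gf) simp_all
    thus ?thesis by (intro image_eqI[of _ _ f]) (simp_all add: Hom_iff)
   qed
   thus "Fa ` Hom C X Y = Hom D (Fo X) (Fo Y)" by (auto simp: Hom_iff)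
  qed
 next
  fix N assume "N : Obj D"
  thus "\<exists>X\<in>Obj C. \<exists>f. iso_arr D (Fo X) N f" using \<epsilon> by (intro bexI[of _ "Go N"]) auto
 qed
qed

lemma ffes_comp: assumes C: "linear_category C" and D: "linear_category D" and E: "linear_category E"
  and F: "ffes C D Fo Fa" and G: "ffes D E Go Ga" shows "ffes C E (Go \<circ> Fo) (Ga \<circ> Fa)"
proof -
 interpret E: linear_category E by fact
 interpret F: lin_functor C D Fo Fa using F by (intro lin_functorI[OF C D]) (simp add: ffes_def)
 interpret G: lin_functor D E Go Ga using G by (intro lin_functorI[OF D E]) (simp add: ffes_def)
 have "linear_functor C E (Go \<circ> Fo) (Ga \<circ> Fa)"
  by (rule linear_functorI[OF C E]) (simp_all add: F.F_add G.F_add F.F_smult G.F_smult)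
 moreover have "bij_betw (Ga \<circ> Fa) (Hom C X Y) (Hom E ((Go \<circ> Fo) X) ((Go \<circ> Fo) Y))" if "X : Obj C" "Y : Obj C" for X Y
 proof -
  have "bij_betw Fa (Hom C X Y) (Hom D (Fo X) (Fo Y))" using F that by (simp add: ffes_def)
  moreover have "bij_betw Ga (Hom D (Fo X) (Fo Y)) (Hom E (Go (Fo X)) (Go (Fo Y)))" using G that by (simp add: ffes_def)
  ultimately have "bij_betw (Ga \<circ> Fa) (Hom C X Y) (Hom E (Go (Fo X)) (Go (Fo Y)))" by (rule bij_betw_trans)
  thus ?thesis by simp
 qed
 moreover have "\<exists>X\<in>Obj C. \<exists>f. iso_arr E ((Go \<circ> Fo) X) N f" if N: "N : Obj E" for N
 proof -
  obtain Y f where Y: "Y : Obj D" "iso_arr E (Go Y) N f" using G N by (auto simp: ffes_def)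
  obtain X g where X: "X : Obj C" "iso_arr D (Fo X) Y g" using F Y by (auto simp: ffes_def)
  show ?thesis using E.iso_arr_comp[OF G.F_iso[OF X(2)] Y(2)] X(1) by auto
 qed
 ultimately show ?thesis by (simp add: ffes_def)
qed

text \<open>The structure on which module functors, their composition and their inversion rest.
  \<open>left_imp_module_category\<close> and \<open>left_module_categoryI\<close> connect it with
  \<open>left_module_category\<close>.\<close>

locale module_category = C: strict_monoidal_category C + M: linear_category M
 for C :: "('x, 'f) moncat" and M :: "('x, 'f, 'o, 'a) modcat" +
 assumes act_obj [simp]: "X : Obj C ==> p : Obj M ==> ActO M X p : Obj M"
  and act_arr [simp]: "f : Arr C ==> h : Arr M ==> ActA M f h : Arr M"
   "f : Arr C ==> h : Arr M ==> Dom M (ActA M f h) = ActO M (Dom C f) (Dom M h)"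
   "f : Arr C ==> h : Arr M ==> Cod M (ActA M f h) = ActO M (Cod C f) (Cod M h)"
  and act_id [simp]: "X : Obj C ==> p : Obj M ==> ActA M (Id C X) (Id M p) = Id M (ActO M X p)"
  and act_comp: "f : Arr C ==> g : Arr C ==> Cod C f = Dom C g ==> h : Arr M ==> k : Arr M ==>
   Cod M h = Dom M k ==> ActA M (Comp C g f) (Comp M k h) = Comp M (ActA M g k) (ActA M f h)"
  and assoc_iso: "X : Obj C ==> Y : Obj C ==> p : Obj M ==>
   iso_arr M (ActO M (TensO C X Y) p) (ActO M X (ActO M Y p)) (Assoc M X Y p)"
  and assoc_natural: "f : Arr C ==> g : Arr C ==> h : Arr M ==>
   Comp M (Assoc M (Cod C f) (Cod C g) (Cod M h)) (ActA M (TensA C f g) h) =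
   Comp M (ActA M f (ActA M g h)) (Assoc M (Dom C f) (Dom C g) (Dom M h))"
  and lunit_iso: "p : Obj M ==> iso_arr M (ActO M (Unit C) p) p (Lunit M p)" and lunit_natural: "h : Arr M ==>
   Comp M (Lunit M (Cod M h)) (ActA M (Id C (Unit C)) h) = Comp M h (Lunit M (Dom M h))"
begin

lemma tens_obj [simp]: "X : Obj C ==> Y : Obj C ==> TensO C X Y : Obj C" "Unit C : Obj C"
 by (simp_all add: C.TensO_Obj C.Unit_Obj)

lemma assoc_arr [simp]: assumes "X : Obj C" "Y : Obj C" "k : Obj M"
 shows "Assoc M X Y k : Arr M" "Dom M (Assoc M X Y k) = ActO M (TensO C X Y) k"
  "Cod M (Assoc M X Y k) = ActO M X (ActO M Y k)" using M.iso_arrD[OF assoc_iso[OF assms]] by simp_all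

lemma lunit_arr [simp]: assumes "k : Obj M"
 shows "Lunit M k : Arr M" "Dom M (Lunit M k) = ActO M (Unit C) k" "Cod M (Lunit M k) = k"
 using M.iso_arrD[OF lunit_iso[OF assms]] by simp_all

lemma act_id_comp: assumes "X : Obj C" "h : Arr M" "k : Arr M" "Cod M h = Dom M k"
 shows "Comp M (ActA M (Id C X) k) (ActA M (Id C X) h) = ActA M (Id C X) (Comp M k h)"
 using act_comp[of "Id C X" "Id C X" h k] assms by simp

lemma act_split: assumes "f : Arr C" "h : Arr M" "k : Arr M" "Cod M h = Dom M k"
 shows "ActA M f (Comp M k h) = Comp M (ActA M (Id C (Cod C f)) k) (ActA M f h)"
  "ActA M f (Comp M k h) = Comp M (ActA M f k) (ActA M (Id C (Dom C f)) h)"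
 using act_comp[of f "Id C (Cod C f)" h k] act_comp[of "Id C (Dom C f)" f h k] assms by simp_all

lemma act_iso:
 assumes "X : Obj C" "iso_arr M p q e" shows "iso_arr M (ActO M X p) (ActO M X q) (ActA M (Id C X) e)"
proof -
 obtain g where g [simp]: "e : Arr M" "Dom M e = p" "Cod M e = q" "g : Arr M" "Dom M g = q" "Cod M g = p"
  and eq: "Comp M g e = Id M p" "Comp M e g = Id M q" using assms(2) by (rule M.iso_arrE)
 show ?thesis by (rule M.iso_arrI[of _ "ActA M (Id C X) g"])
   (use assms(1) M.iso_arr_objs[OF assms(2)] in \<open>simp_all add: act_id_comp eq\<close>)
qed

lemma assoc_natural_id: assumes "X : Obj C" "Y : Obj C" "h : Arr M"
 shows "Comp M (Assoc M X Y (Cod M h)) (ActA M (Id C (TensO C X Y)) h) =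
   Comp M (ActA M (Id C X) (ActA M (Id C Y) h)) (Assoc M X Y (Dom M h))"
 using assoc_natural[of "Id C X" "Id C Y" h] assms by (simp add: C.TensA_Id)

end

lemma module_functorI: assumes M: "module_category C M" and N: "module_category C N" and F: "linear_functor M N Fo Fa"
  and iso: "\<And>X k. X : Obj C ==> k : Obj M ==> iso_arr N (Fo (ActO M X k)) (ActO N X (Fo k)) (s X k)"
  and nat: "\<And>f h. f : Arr C ==> h : Arr M ==> Comp N (s (Cod C f) (Cod M h)) (Fa (ActA M f h)) =
    Comp N (ActA N f (Fa h)) (s (Dom C f) (Dom M h))"
  and ass: "\<And>X Y k. X : Obj C ==> Y : Obj C ==> k : Obj M ==>
   Comp N (Assoc N X Y (Fo k)) (s (TensO C X Y) k) =
   Comp N (Comp N (ActA N (Id C X) (s Y k)) (s X (ActO M Y k))) (Fa (Assoc M X Y k))"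
  and un: "\<And>k. k : Obj M ==> Comp N (Lunit N (Fo k)) (s (Unit C) k) = Fa (Lunit M k)"
 shows "module_functor C M N Fo Fa s" unfolding module_functor_def using F iso ass un
 by (intro conjI ballI) (use nat in \<open>auto simp: Hom_iff\<close>)

locale mod_functor = M: module_category C M + N: module_category C N + lin_functor M N Fo Fa
 for C :: "('x, 'f) moncat" and M :: "('x, 'f, 'o, 'a) modcat" and N :: "('x, 'f, 'p, 'b) modcat" and Fo Fa +
 fixes s assumes module_fun: "module_functor C M N Fo Fa s"
begin

lemma s_iso: "X : Obj C ==> k : Obj M ==> iso_arr N (Fo (ActO M X k)) (ActO N X (Fo k)) (s X k)"
 using module_fun by (simp add: module_functor_def)

lemma s_arr [simp]: assumes "X : Obj C" "k : Obj M"
 shows "s X k : Arr N" "Dom N (s X k) = Fo (ActO M X k)" "Cod N (s X k) = ActO N X (Fo k)"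
 using N.M.iso_arrD[OF s_iso[OF assms]] by simp_all

lemma s_nat: assumes "f : Arr C" "h : Arr M"
 shows "Comp N (s (Cod C f) (Cod M h)) (Fa (ActA M f h)) = Comp N (ActA N f (Fa h)) (s (Dom C f) (Dom M h))"
proof -
 have "f : Hom C (Dom C f) (Cod C f)" "h : Hom M (Dom M h) (Cod M h)" using assms by (auto simp: Hom_iff)
 thus ?thesis using module_fun M.C.arr_objs[OF assms(1)] M.M.arr_objs[OF assms(2)]
  unfolding module_functor_def by blast
qed

lemma s_nat_id: assumes "X : Obj C" "h : Arr M"
 shows "Comp N (s X (Cod M h)) (Fa (ActA M (Id C X) h)) = Comp N (ActA N (Id C X) (Fa h)) (s X (Dom M h))"
 using s_nat[of "Id C X" h] assms by simp

lemma s_assoc: "X : Obj C ==> Y : Obj C ==> k : Obj M ==>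
   Comp N (Assoc N X Y (Fo k)) (s (TensO C X Y) k) =
   Comp N (Comp N (ActA N (Id C X) (s Y k)) (s X (ActO M Y k))) (Fa (Assoc M X Y k))"
 using module_fun by (simp add: module_functor_def)

lemma s_unit: "k : Obj M ==> Comp N (Lunit N (Fo k)) (s (Unit C) k) = Fa (Lunit M k)"
 using module_fun by (simp add: module_functor_def)

end

lemma mod_functorI: "module_category C M ==> module_category C N ==> module_functor C M N Fo Fa s ==> mod_functor C M N Fo Fa s"
 unfolding mod_functor_def mod_functor_axioms_def lin_functor_def lin_functor_axioms_def module_category_def
 by (simp add: module_functor_def)

lemma module_category_linear: "module_category C M ==> linear_category M" by (simp add: module_category_def)

lemma module_equivalent_iff: assumes "module_category C M" "module_category C N"
 shows "module_equivalent C M N \<longleftrightarrow> (\<exists>Fo Fa s. mod_functor C M N Fo Fa s \<and> ffes M N Fo Fa)"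
proof -
 have "module_functor C M N Fo Fa s \<longleftrightarrow> mod_functor C M N Fo Fa s" for Fo Fa s
  using mod_functorI[OF assms] by (auto simp: mod_functor_def mod_functor_axioms_def)
 moreover have "is_equivalence M N Fo Fa \<longleftrightarrow> ffes M N Fo Fa" for Fo Fa
  using equivalence_imp_ffes ffes_imp_equivalence assms module_category_linear by metis
 ultimately show ?thesis by (simp add: module_equivalent_def)
qed

lemma module_equivalent_trans:
 assumes M: "module_category C M" and N: "module_category C N" and P: "module_category C P"
  and MN: "module_equivalent C M N" and NP: "module_equivalent C N P" shows "module_equivalent C M P"
proof -
 obtain Fo Fa s where F: "mod_functor C M N Fo Fa s" and Ff: "ffes M N Fo Fa"
  using MN module_equivalent_iff[OF M N] by blast
 obtain Go Ga t where G: "mod_functor C N P Go Ga t" and Gf: "ffes N P Go Ga"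
  using NP module_equivalent_iff[OF N P] by blast
 interpret M: module_category C M by fact
 interpret N: module_category C N by fact
 interpret P: module_category C P by fact
 interpret F: mod_functor C M N Fo Fa s by fact
 interpret G: mod_functor C N P Go Ga t by fact
 define st where "st X k = Comp P (t X (Fo k)) (Ga (s X k))" for X k
 have fe: "ffes M P (Go \<circ> Fo) (Ga \<circ> Fa)"
  by (rule ffes_comp[OF M.M.linear_category_axioms N.M.linear_category_axioms P.M.linear_category_axioms Ff Gf])
 have "module_functor C M P (Go \<circ> Fo) (Ga \<circ> Fa) st"
 proof (rule module_functorI[OF M P])
  show "linear_functor M P (Go \<circ> Fo) (Ga \<circ> Fa)" using fe by (simp add: ffes_def)
  show "iso_arr P ((Go \<circ> Fo) (ActO M X k)) (ActO P X ((Go \<circ> Fo) k)) (st X k)" if "X : Obj C" "k : Obj M" for X k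
   unfolding st_def using P.M.iso_arr_comp[OF G.F_iso[OF F.s_iso[OF that]] G.s_iso[of X "Fo k"]] that by simp
 next
  fix f h assume [simp]: "f : Arr C" "h : Arr M"
  have "Comp P (st (Cod C f) (Cod M h)) (Ga (Fa (ActA M f h))) =
    Comp P (t (Cod C f) (Fo (Cod M h))) (Ga (Comp N (s (Cod C f) (Cod M h)) (Fa (ActA M f h))))"
   by (simp add: st_def P.M.comp_assoc)
  also have "... = Comp P (Comp P (t (Cod C f) (Cod N (Fa h))) (Ga (ActA N f (Fa h)))) (Ga (s (Dom C f) (Dom M h)))"
   by (simp add: F.s_nat P.M.comp_assoc del: G.F_comp) (simp add: P.M.comp_assoc)
  also have "... = Comp P (ActA P f (Ga (Fa h))) (st (Dom C f) (Dom M h))"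
   using G.s_nat[of f "Fa h"] by (simp add: st_def P.M.comp_assoc)
  finally show "Comp P (st (Cod C f) (Cod M h)) ((Ga \<circ> Fa) (ActA M f h)) =
    Comp P (ActA P f ((Ga \<circ> Fa) h)) (st (Dom C f) (Dom M h))" by simp
 next
  fix X Y k assume [simp]: "X : Obj C" "Y : Obj C" "k : Obj M"
  have "Comp P (Assoc P X Y (Go (Fo k))) (st (TensO C X Y) k) =
    Comp P (Comp P (Assoc P X Y (Go (Fo k))) (t (TensO C X Y) (Fo k))) (Ga (s (TensO C X Y) k))"
   by (simp add: st_def P.M.comp_assoc)
  also have "... = Comp P (Comp P (ActA P (Id C X) (t Y (Fo k))) (t X (ActO N Y (Fo k))))
    (Ga (Comp N (Assoc N X Y (Fo k)) (s (TensO C X Y) k)))" by (simp add: G.s_assoc P.M.comp_assoc)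
  also have "... = Comp P (ActA P (Id C X) (t Y (Fo k))) (Comp P (Comp P (t X (Cod N (s Y k))) (Ga (ActA N (Id C X) (s Y k))))
    (Comp P (Ga (s X (ActO M Y k))) (Ga (Fa (Assoc M X Y k)))))"
   by (simp add: F.s_assoc P.M.comp_assoc del: G.F_comp) (simp add: P.M.comp_assoc N.M.comp_assoc)
  also have "Comp P (t X (Cod N (s Y k))) (Ga (ActA N (Id C X) (s Y k))) =
    Comp P (ActA P (Id C X) (Ga (s Y k))) (t X (Fo (ActO M Y k)))" using G.s_nat_id[of X "s Y k"] by simp
  also have "Comp P (ActA P (Id C X) (t Y (Fo k))) (Comp P ... (Comp P (Ga (s X (ActO M Y k))) (Ga (Fa (Assoc M X Y k))))) =
    Comp P (Comp P (ActA P (Id C X) (t Y (Fo k))) (ActA P (Id C X) (Ga (s Y k)))) (Comp P (st X (ActO M Y k)) (Ga (Fa (Assoc M X Y k))))"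
   by (simp add: st_def P.M.comp_assoc)
  also have "Comp P (ActA P (Id C X) (t Y (Fo k))) (ActA P (Id C X) (Ga (s Y k))) = ActA P (Id C X) (st Y k)"
   by (simp add: P.act_id_comp st_def)
  finally show "Comp P (Assoc P X Y ((Go \<circ> Fo) k)) (st (TensO C X Y) k) =
   Comp P (Comp P (ActA P (Id C X) (st Y k)) (st X (ActO M Y k))) ((Ga \<circ> Fa) (Assoc M X Y k))"
   by (simp add: P.M.comp_assoc st_def)
 next
  fix k assume [simp]: "k : Obj M"
  have "Comp P (Lunit P (Go (Fo k))) (st (Unit C) k) = Comp P (Comp P (Lunit P (Go (Fo k))) (t (Unit C) (Fo k))) (Ga (s (Unit C) k))"
   by (simp add: st_def P.M.comp_assoc)
  also have "... = Ga (Comp N (Lunit N (Fo k)) (s (Unit C) k))" by (simp add: G.s_unit)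
  finally show "Comp P (Lunit P ((Go \<circ> Fo) k)) (st (Unit C) k) = (Ga \<circ> Fa) (Lunit M k)" by (simp add: F.s_unit del: G.F_comp)
 qed
 thus ?thesis using mod_functorI[OF M P] fe module_equivalent_iff[OF M P] by blast
qed

text \<open>The constraint \<open>t\<close> of the quasi-inverse is the arrow whose image under F
  compares \<open>eps\<close> at X \<rhd> n with the isomorphism \<open>e X n\<close> from F (X
  \<rhd> G n) to X \<rhd> n. Its coherence laws are checked after applying F and cancelling
  isomorphisms of this kind.\<close>

lemma module_equivalent_sym:
 assumes M: "module_category C M" and N: "module_category C N" and MN: "module_equivalent C M N"
 shows "module_equivalent C N M"
proof -
 obtain Fo Fa s where F: "mod_functor C M N Fo Fa s" and Ff: "ffes M N Fo Fa"
  using MN module_equivalent_iff[OF M N] by blast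
 interpret M: module_category C M by fact
 interpret N: module_category C N by fact
 interpret F: mod_functor C M N Fo Fa s by fact
 interpret F: ff_functor M N Fo Fa by unfold_locales (rule Ff)
 define t where "t X n = (SOME f. f : Arr M \<and> Dom M f = F.Go (ActO N X n) \<and> Cod M f = ActO M X (F.Go n) \<and>
  Comp N (Comp N (ActA N (Id C X) (F.eps n)) (s X (F.Go n))) (Fa f) = F.eps (ActO N X n))" for X n
 define e where "e X n = Comp N (ActA N (Id C X) (F.eps n)) (s X (F.Go n))" for X n
 have e_iso: "iso_arr N (Fo (ActO M X (F.Go n))) (ActO N X n) (e X n)" if "X : Obj C" "n : Obj N" for X n
  unfolding e_def by (rule N.M.iso_arr_comp[OF F.s_iso N.act_iso[OF _ F.Go(2)]]) (use that in simp_all)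
 note [simp] = N.M.iso_arrD[OF e_iso]
 have t: "t X n : Arr M" "Dom M (t X n) = F.Go (ActO N X n)" "Cod M (t X n) = ActO M X (F.Go n)"
   "Comp N (e X n) (Fa (t X n)) = F.eps (ActO N X n)" "iso_arr M (F.Go (ActO N X n)) (ActO M X (F.Go n)) (t X n)"
  if [simp]: "X : Obj C" "n : Obj N" for X n
 proof -
  note i = N.M.inv_arr[OF e_iso[OF that]]
  let ?k = "Comp N (N.M.inv_arr (e X n)) (F.eps (ActO N X n))"
  have k: "?k : Arr N" "Dom N ?k = Fo (F.Go (ActO N X n))" "Cod N ?k = Fo (ActO M X (F.Go n))"
   by (simp_all add: i(1-3))
  obtain f where f: "f : Arr M" "Dom M f = F.Go (ActO N X n)" "Cod M f = ActO M X (F.Go n)" "Fa f = ?k"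
   by (rule F.full[OF k]) simp_all
  have "Comp N (e X n) (Fa f) = F.eps (ActO N X n)" unfolding f(4) by (simp add: i(1-3) N.M.comp_eq_assoc[OF i(5)])
  hence "\<exists>f. f : Arr M \<and> Dom M f = F.Go (ActO N X n) \<and> Cod M f = ActO M X (F.Go n) \<and>
   Comp N (Comp N (ActA N (Id C X) (F.eps n)) (s X (F.Go n))) (Fa f) = F.eps (ActO N X n)"
   using f(1-3) unfolding e_def by blast
  from someI_ex[OF this] show *: "t X n : Arr M" "Dom M (t X n) = F.Go (ActO N X n)" "Cod M (t X n) = ActO M X (F.Go n)"
   "Comp N (e X n) (Fa (t X n)) = F.eps (ActO N X n)" unfolding t_def e_def by blast+
  have "Fa (t X n) = ?k"
   by (rule N.M.iso_cancel_left[OF e_iso[OF that]]) (simp_all add: * i(1-3) N.M.comp_eq_assoc[OF i(5)])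
  hence "iso_arr N (Fo (F.Go (ActO N X n))) (Fo (ActO M X (F.Go n))) (Fa (t X n))"
   using N.M.iso_arr_comp[OF F.Go(2) i(6)] by simp
  thus "iso_arr M (F.Go (ActO N X n)) (ActO M X (F.Go n)) (t X n)" by (rule F.reflect_iso) (simp_all add: *)
 qed
 note [simp] = t(1-3)
 have cancel: "f = g" if "Comp N (e X n) (Fa f) = Comp N (e X n) (Fa g)" "X : Obj C" "n : Obj N" "f : Arr M" "g : Arr M"
  "Dom M f = Dom M g" "Cod M f = ActO M X (F.Go n)" "Cod M g = ActO M X (F.Go n)" for f g X n
  by (rule F.faithful, rule N.M.iso_cancel_left[OF e_iso[OF that(2,3)] that(1)]) (use that in simp_all)
 have e_nat: "Comp N (e (Cod C f) (Cod N h)) (Fa (ActA M f (F.Ga h))) = Comp N (ActA N f h) (e (Dom C f) (Dom N h))"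
  if [simp]: "f : Arr C" "h : Arr N" for f h
 proof -
  have "Comp N (e (Cod C f) (Cod N h)) (Fa (ActA M f (F.Ga h))) =
    Comp N (ActA N (Id C (Cod C f)) (F.eps (Cod N h))) (Comp N (ActA N f (Fa (F.Ga h))) (s (Dom C f) (F.Go (Dom N h))))"
   using F.s_nat[of f "F.Ga h"] by (simp add: e_def N.M.comp_assoc)
  also have "... = Comp N (ActA N f (Comp N (F.eps (Cod N h)) (Fa (F.Ga h)))) (s (Dom C f) (F.Go (Dom N h)))"
   by (subst N.act_split(1)) (simp_all add: N.M.comp_assoc)
  also have "... = Comp N (ActA N f (Comp N h (F.eps (Dom N h)))) (s (Dom C f) (F.Go (Dom N h)))"
   by (simp add: F.Ga(4))
  also have "... = Comp N (ActA N f h) (e (Dom C f) (Dom N h))"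
   by (subst N.act_split(2)) (simp_all add: N.M.comp_assoc e_def)
  finally show ?thesis .
 qed
 have Gfun: "linear_functor N M F.Go F.Ga" by (rule F.G_functor)
 interpret G: lin_functor N M F.Go F.Ga by unfold_locales (rule Gfun)
 have "module_functor C N M F.Go F.Ga t"
 proof (rule module_functorI[OF N M Gfun t(5)])
  fix f h assume [simp]: "f : Arr C" "h : Arr N"
  show "Comp M (t (Cod C f) (Cod N h)) (F.Ga (ActA N f h)) = Comp M (ActA M f (F.Ga h)) (t (Dom C f) (Dom N h))"
  proof (rule cancel[of "Cod C f" "Cod N h"])
   have "Comp N (e (Cod C f) (Cod N h)) (Fa (Comp M (t (Cod C f) (Cod N h)) (F.Ga (ActA N f h)))) =
     Comp N (Comp N (e (Cod C f) (Cod N h)) (Fa (t (Cod C f) (Cod N h)))) (Fa (F.Ga (ActA N f h)))"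
    by (simp add: N.M.comp_assoc)
   also have "... = Comp N (ActA N f h) (F.eps (ActO N (Dom C f) (Dom N h)))"
    using F.Ga(4)[of "ActA N f h"] by (simp add: t(4))
   also have "... = Comp N (Comp N (ActA N f h) (e (Dom C f) (Dom N h))) (Fa (t (Dom C f) (Dom N h)))"
    by (simp add: N.M.comp_assoc t(4))
   also have "... = Comp N (e (Cod C f) (Cod N h)) (Fa (Comp M (ActA M f (F.Ga h)) (t (Dom C f) (Dom N h))))"
    by (simp add: N.M.comp_assoc flip: e_nat)
   finally show "Comp N (e (Cod C f) (Cod N h)) (Fa (Comp M (t (Cod C f) (Cod N h)) (F.Ga (ActA N f h)))) =
    Comp N (e (Cod C f) (Cod N h)) (Fa (Comp M (ActA M f (F.Ga h)) (t (Dom C f) (Dom N h))))" .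
  qed simp_all
 next
  fix X Y n assume [simp]: "X : Obj C" "Y : Obj C" "n : Obj N"
  \<comment> \<open>The isomorphism to be cancelled in the associativity law: \<open>e\<close> for
    Y, acted on by X, after the constraint of F.\<close>
  define E where "E = Comp N (ActA N (Id C X) (e Y n)) (s X (ActO M Y (F.Go n)))"
  have E_iso: "iso_arr N (Fo (ActO M X (ActO M Y (F.Go n)))) (ActO N X (ActO N Y n)) E"
   unfolding E_def by (rule N.M.iso_arr_comp[OF F.s_iso N.act_iso[OF _ e_iso]]) simp_all
  note [simp] = N.M.iso_arrD[OF E_iso]
  have "Comp N E (Fa (Comp M (Assoc M X Y (F.Go n)) (t (TensO C X Y) n))) =
   Comp N (ActA N (Id C X) (ActA N (Id C Y) (F.eps n))) (Comp N (Comp N (Comp N (ActA N (Id C X) (s Y (F.Go n))) (s X (ActO M Y (F.Go n))))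
    (Fa (Assoc M X Y (F.Go n)))) (Fa (t (TensO C X Y) n)))"
   unfolding E_def e_def by (subst N.act_split(1)) (simp_all add: N.M.comp_assoc)
  also have "... = Comp N (Comp N (ActA N (Id C X) (ActA N (Id C Y) (F.eps n))) (Assoc N X Y (Fo (F.Go n))))
    (Comp N (s (TensO C X Y) (F.Go n)) (Fa (t (TensO C X Y) n)))"
   by (subst F.s_assoc[symmetric]) (simp_all add: N.M.comp_assoc)
  also have "... = Comp N (Assoc N X Y n) (Comp N (e (TensO C X Y) n) (Fa (t (TensO C X Y) n)))"
   using N.assoc_natural_id[of X Y "F.eps n"] by (simp add: e_def N.M.comp_assoc[symmetric])
  also have "... = Comp N (Assoc N X Y n) (F.eps (ActO N (TensO C X Y) n))" by (simp add: t(4))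
  also have "... = Comp N (F.eps (ActO N X (ActO N Y n))) (Fa (F.Ga (Assoc N X Y n)))"
   using F.Ga(4)[of "Assoc N X Y n"] by simp
  also have "... = Comp N (Comp N (e X (ActO N Y n)) (Fa (t X (ActO N Y n)))) (Fa (F.Ga (Assoc N X Y n)))"
   by (simp add: t(4))
  also have "Comp N (e X (ActO N Y n)) (Fa (t X (ActO N Y n))) =
    Comp N (ActA N (Id C X) (Comp N (e Y n) (Fa (t Y n)))) (Comp N (s X (F.Go (ActO N Y n))) (Fa (t X (ActO N Y n))))"
   by (simp add: e_def[of X "ActO N Y n"] N.M.comp_assoc t(4))
  also have "... = Comp N (ActA N (Id C X) (e Y n)) (Comp N (Comp N (ActA N (Id C X) (Fa (t Y n))) (s X (Dom M (t Y n)))) (Fa (t X (ActO N Y n))))"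
   by (subst N.act_split(1)) (simp_all add: N.M.comp_assoc)
  also have "Comp N (ActA N (Id C X) (Fa (t Y n))) (s X (Dom M (t Y n))) = Comp N (s X (ActO M Y (F.Go n))) (Fa (ActA M (Id C X) (t Y n)))"
   using F.s_nat_id[of X "t Y n"] by simp
  also have "Comp N (Comp N (ActA N (Id C X) (e Y n)) (Comp N ... (Fa (t X (ActO N Y n))))) (Fa (F.Ga (Assoc N X Y n))) =
    Comp N E (Fa (Comp M (Comp M (ActA M (Id C X) (t Y n)) (t X (ActO N Y n))) (F.Ga (Assoc N X Y n))))"
   by (simp add: E_def N.M.comp_assoc)
  finally have "Fa (Comp M (Assoc M X Y (F.Go n)) (t (TensO C X Y) n)) =
    Fa (Comp M (Comp M (ActA M (Id C X) (t Y n)) (t X (ActO N Y n))) (F.Ga (Assoc N X Y n)))"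
   by (rule N.M.iso_cancel_left[OF E_iso]) simp_all
  thus "Comp M (Assoc M X Y (F.Go n)) (t (TensO C X Y) n) =
    Comp M (Comp M (ActA M (Id C X) (t Y n)) (t X (ActO N Y n))) (F.Ga (Assoc N X Y n))" by (rule F.faithful) simp_all
 next
  fix n assume [simp]: "n : Obj N"
  show "Comp M (Lunit M (F.Go n)) (t (Unit C) n) = F.Ga (Lunit N n)"
  proof (rule F.eps_cancel[of n])
   have "Comp N (F.eps n) (Fa (Comp M (Lunit M (F.Go n)) (t (Unit C) n))) =
     Comp N (Comp N (F.eps n) (Lunit N (Fo (F.Go n)))) (Comp N (s (Unit C) (F.Go n)) (Fa (t (Unit C) n)))"
    by (simp add: N.M.comp_assoc flip: F.s_unit)
   also have "... = Comp N (Lunit N n) (Comp N (e (Unit C) n) (Fa (t (Unit C) n)))"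
    using N.lunit_natural[of "F.eps n"] by (simp add: e_def N.M.comp_assoc[symmetric])
   also have "... = Comp N (F.eps n) (Fa (F.Ga (Lunit N n)))" using F.Ga(4)[of "Lunit N n"] by (simp add: t(4))
   finally show "Comp N (F.eps n) (Fa (Comp M (Lunit M (F.Go n)) (t (Unit C) n))) = Comp N (F.eps n) (Fa (F.Ga (Lunit N n)))" .
  qed simp_all
 qed
 moreover have "ffes N M F.Go F.Ga"
 proof -
  have es: "\<exists>n\<in>Obj N. \<exists>f. iso_arr M (F.Go n) k f" if [simp]: "k : Obj M" for k
  proof -
   note e = F.Go(2)[of "Fo k", simplified]
   obtain f where f: "f : Arr M" "Dom M f = F.Go (Fo k)" "Cod M f = k" "Fa f = F.eps (Fo k)"
    by (rule F.full[of "F.eps (Fo k)" "F.Go (Fo k)" k]) simp_all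
   hence "iso_arr M (F.Go (Fo k)) k f" using e by (intro F.reflect_iso) simp_all
   thus ?thesis by (intro bexI[of _ "Fo k"]) auto
  qed
  have "bij_betw F.Ga (Hom N p q) (Hom M (F.Go p) (F.Go q))" if [simp]: "p : Obj N" "q : Obj N" for p q
   unfolding bij_betw_def
  proof (intro conjI)
   show "inj_on F.Ga (Hom N p q)"
   proof (rule inj_onI)
    fix f g assume "f : Hom N p q" "g : Hom N p q" and eq: "F.Ga f = F.Ga g"
    hence fg [simp]: "f : Arr N" "Dom N f = p" "Cod N f = q" "g : Arr N" "Dom N g = p" "Cod N g = q"
     by (auto simp: Hom_iff)
    have "Comp N f (F.eps p) = Comp N g (F.eps p)" using F.Ga(4)[of f] F.Ga(4)[of g] eq by simp
    thus "f = g" by (rule N.M.iso_cancel_right[OF F.Go(2)[OF that(1)]]) simp_all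
   qed
   have "f : F.Ga ` Hom N p q" if "f : Hom M (F.Go p) (F.Go q)" for f
   proof -
    have [simp]: "f : Arr M" "Dom M f = F.Go p" "Cod M f = F.Go q" using that by (auto simp: Hom_iff)
    note i = N.M.inv_arr[OF F.Go(2)[OF \<open>p : Obj N\<close>]]
    define h where "h = Comp N (F.eps q) (Comp N (Fa f) (N.M.inv_arr (F.eps p)))"
    have h [simp]: "h : Arr N" "Dom N h = p" "Cod N h = q" by (simp_all add: h_def i(1-3))
    have "Comp N h (F.eps p) = Comp N (F.eps q) (Fa f)" by (simp add: h_def i(1-4) N.M.comp_assoc)
    hence "F.Ga h = f" using F.Ga(4)[of h] by (intro F.eps_cancel[of q]) simp_all
    thus ?thesis by (intro image_eqI[of _ _ h]) (simp_all add: Hom_iff)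
   qed
   thus "F.Ga ` Hom N p q = Hom M (F.Go p) (F.Go q)" by (auto simp: Hom_iff)
  qed
  thus ?thesis using es Gfun by (simp add: ffes_def)
 qed
 ultimately show ?thesis using mod_functorI[OF N M] module_equivalent_iff[OF N M] by blast
qed

text \<open>Extending a category by a tensor product or an action changes its record type, so the
  two are compared field by field.\<close>

lemma linear_category_cong: assumes "Obj D = Obj C" "Arr D = Arr C" "Dom D = Dom C" "Cod D = Cod C" "Id D = Id C"
  "Comp D = Comp C" "Zero D = Zero C" "Add D = Add C" "Smult D = Smult C" "linear_category C"
 shows "linear_category D"
 using assms(10) unfolding linear_category_def category_def linear_category_axioms_def Hom_def assms(1-9) .

lemma mat_lincat_simps [simp]:
 "Obj (mat_lincat Ob d P) = Ob"
 "(X, Y, f) : Arr (mat_lincat Ob d P) \<longleftrightarrow> X : Ob \<and> Y : Ob \<and> f : carrier_mat (d Y) (d X) \<and> P X Y f"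
 "Dom (mat_lincat Ob d P) (X, Y, f) = X" "Cod (mat_lincat Ob d P) (X, Y, f) = Y"
 "Id (mat_lincat Ob d P) X = (X, X, I (d X))"
 "Comp (mat_lincat Ob d P) (Y', Z, g) (X, Y, f) = (X, Z, g * f)"
 "Zero (mat_lincat Ob d P) X Y = (X, Y, 0\<^sub>m (d Y) (d X))"
 "Add (mat_lincat Ob d P) (X, Y, f) (X', Y', f') = (X, Y, f + f')"
 "Smult (mat_lincat Ob d P) c (X, Y, f) = (X, Y, c *s f)" by (simp_all add: mat_lincat_def)

lemma Hom_mat_lincat: "h : Hom (mat_lincat Ob d P) X Y \<longleftrightarrow>
  (\<exists>f. h = (X, Y, f) \<and> X : Ob \<and> Y : Ob \<and> nr f = d Y \<and> nc f = d X \<and> P X Y f)"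
 by (cases h) (auto simp: Hom_iff)

lemma mat_lincat_linear: assumes "\<And>X. X : Ob ==> P X X (I (d X))"
  and "\<And>X Y Z f g. X : Ob ==> Y : Ob ==> Z : Ob ==> nr f = d Y ==> nc f = d X ==>
   nr g = d Z ==> nc g = d Y ==> P X Y f ==> P Y Z g ==> P X Z (g * f)"
  and "\<And>X Y. X : Ob ==> Y : Ob ==> P X Y (0\<^sub>m (d Y) (d X))"
  and "\<And>X Y f g. X : Ob ==> Y : Ob ==> nr f = d Y ==> nc f = d X ==>
   nr g = d Y ==> nc g = d X ==> P X Y f ==> P X Y g ==> P X Y (f + g)"
  and "\<And>X Y f c. X : Ob ==> Y : Ob ==> nr f = d Y ==> nc f = d X ==> P X Y f ==> P X Y (c *s f)"
 shows "linear_category (mat_lincat Ob d P)"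
proof (unfold_locales, goal_cases)
 case (1 f) thus ?case by (cases f) auto
next
 case (2 f) thus ?case by (cases f) auto
next
 case (3 X) thus ?case using assms(1) by (auto simp: Hom_mat_lincat)
next
 case (4 f X Y g Z) thus ?case using assms(2) by (auto simp: Hom_mat_lincat)
next
 case (5 f X Y) thus ?case by (auto simp: Hom_mat_lincat one_mult_mat_dim)
next
 case (6 f X Y) thus ?case by (auto simp: Hom_mat_lincat mult_one_mat_dim)
next
 case (7 f W X g Y h Z) thus ?case by (auto simp: Hom_mat_lincat assoc_mult_mat_dim)
next
 case (8 X Y) thus ?case using assms(3) by (auto simp: Hom_mat_lincat)
next
 case (9 f X Y g) thus ?case using assms(4) by (auto simp: Hom_mat_lincat)
next
 case (10 f X Y c) thus ?case using assms(5) by (auto simp: Hom_mat_lincat)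
next
 case (11 f X Y g h) thus ?case by (auto simp: Hom_mat_lincat add_assoc_mat_dim)
next
 case (12 f X Y g) thus ?case by (auto simp: Hom_mat_lincat) (rule add_commute_mat_dim; simp)
next
 case (13 f X Y) thus ?case by (auto simp: Hom_mat_lincat add_zero_mat_dim)
next
 case (14 f X Y) thus ?case by (auto simp: Hom_mat_lincat add_self_smult zero_smult_mat)
next
 case (15 f X Y) thus ?case by (auto simp: Hom_mat_lincat one_smult_mat)
next
 case (16 f X Y c d) thus ?case by (auto simp: Hom_mat_lincat smult_smult_mat)
next
 case (17 f X Y c d) thus ?case by (auto simp: Hom_mat_lincat add_smult_self)
next
 case (18 f X Y g c) thus ?case by (auto simp: Hom_mat_lincat smult_add_mat_dim)
next
 case (19 f X Y g Z h) thus ?case by (auto simp: Hom_mat_lincat add_mult_mat_dim)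
next
 case (20 f X Y g h Z) thus ?case by (auto simp: Hom_mat_lincat mult_add_mat_dim)
next
 case (21 f X Y g Z c) thus ?case by (auto simp: Hom_mat_lincat smult_mult_mat_dim)
next
 case (22 f X Y g Z c) thus ?case by (auto simp: Hom_mat_lincat mult_smult_mat_dim)
qed

section \<open>Categories of matrices\<close>

text \<open>Everything below about \<^const>\<open>vect_cat\<close> and \<^const>\<open>sweedler_cat\<close> only uses that they are
 categories of matrices whose tensor product of arrows is the Kronecker product.\<close>

locale kron_category =
 fixes Ob :: "'o set" and d P and T :: "'o => 'o => 'o" and J :: 'o and C :: "('o, 'o \<times> 'o \<times> complex mat) moncat"
 assumes C_def: "C = lincat.extend (mat_lincat Ob d P)
   (moncat.fields T (\<lambda>(V, W, f) (V', W', g). (T V V', T W W', kron f g)) J)"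
  and P_id: "\<And>X. X : Ob ==> P X X (I (d X))"
  and P_comp: "\<And>X Y Z f g. X : Ob ==> Y : Ob ==> Z : Ob ==> nr f = d Y ==> nc f = d X ==>
   nr g = d Z ==> nc g = d Y ==> P X Y f ==> P Y Z g ==> P X Z (g * f)"
  and P_zero: "\<And>X Y. X : Ob ==> Y : Ob ==> P X Y (0\<^sub>m (d Y) (d X))"
  and P_add: "\<And>X Y f g. X : Ob ==> Y : Ob ==> nr f = d Y ==> nc f = d X ==>
   nr g = d Y ==> nc g = d X ==> P X Y f ==> P X Y g ==> P X Y (f + g)"
  and P_smult: "\<And>X Y f c. X : Ob ==> Y : Ob ==> nr f = d Y ==> nc f = d X ==> P X Y f ==> P X Y (c *s f)"
  and P_kron: "\<And>X Y X' Y' f g. X : Ob ==> Y : Ob ==> X' : Ob ==> Y' : Ob ==>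
   nr f = d Y ==> nc f = d X ==> nr g = d Y' ==> nc g = d X' ==>
   P X Y f ==> P X' Y' g ==> P (T X X') (T Y Y') (kron f g)"
  and T_obj: "X : Ob ==> Y : Ob ==> T X Y : Ob" and T_dim: "X : Ob ==> Y : Ob ==> d (T X Y) = d X * d Y"
  and T_assoc: "X : Ob ==> Y : Ob ==> Z : Ob ==> T (T X Y) Z = T X (T Y Z)"
  and I_obj: "J : Ob" and I_dim: "d J = Suc 0" and I_left: "X : Ob ==> T J X = X" and I_right: "X : Ob ==> T X J = X"
begin

lemma C_simps [simp]:
 "Obj C = Ob"
 "(X, Y, f) : Arr C \<longleftrightarrow> X : Ob \<and> Y : Ob \<and> nr f = d Y \<and> nc f = d X \<and> P X Y f"
 "Dom C (X, Y, f) = X" "Cod C (X, Y, f) = Y"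
 "Id C X = (X, X, I (d X))"
 "Comp C (Y', Z, g) (X, Y, f) = (X, Z, g * f)"
 "Zero C X Y = (X, Y, 0\<^sub>m (d Y) (d X))"
 "Add C (X, Y, f) (X', Y', f') = (X, Y, f + f')"
 "Smult C c (X, Y, f) = (X, Y, c *s f)"
 "TensO C = T" "TensA C (X, Y, f) (X', Y', f') = (T X X', T Y Y', kron f f')" "Unit C = J"
 by (auto simp: C_def lincat.defs moncat.defs)

lemma Hom_C: "h : Hom C X Y \<longleftrightarrow> (\<exists>f. h = (X, Y, f) \<and> X : Ob \<and> Y : Ob \<and> nr f = d Y \<and> nc f = d X \<and> P X Y f)"
 by (cases h) (auto simp: Hom_iff)

lemma Arr_C: "h : Arr C \<longleftrightarrow> (\<exists>X Y f. h = (X, Y, f) \<and> X : Ob \<and> Y : Ob \<and> nr f = d Y \<and> nc f = d X \<and> P X Y f)"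
 by (cases h) auto

lemma linear: "linear_category C"
proof (rule linear_category_cong[OF _ _ _ _ _ _ _ _ _ mat_lincat_linear])
 show "Obj C = Obj (mat_lincat Ob d P)" "Arr C = Arr (mat_lincat Ob d P)" "Dom C = Dom (mat_lincat Ob d P)"
  "Cod C = Cod (mat_lincat Ob d P)" "Id C = Id (mat_lincat Ob d P)"
  "Comp C = Comp (mat_lincat Ob d P)" "Zero C = Zero (mat_lincat Ob d P)" "Add C = Add (mat_lincat Ob d P)"
  "Smult C = Smult (mat_lincat Ob d P)" by (simp_all only: C_def lincat.defs category.simps lincat.simps)
qed (rule P_id P_comp P_zero P_add P_smult; assumption)+

lemma monoidal: "strict_monoidal_category C"
proof -
 interpret linear_category C by (rule linear)
 show ?thesis
 proof (unfold_locales, goal_cases)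
  case 1 thus ?case by (simp add: I_obj)
 next
  case (2 X Y) thus ?case by (simp add: T_obj)
 next
  case (3 f X Y g X' Y') thus ?case by (auto simp: Hom_C T_obj T_dim P_kron)
 next
  case (4 X Y) thus ?case by (simp add: T_dim kron_one)
 next
  case (5 f X Y g Z f' X' Y' g' Z') thus ?case by (auto simp: Hom_C kron_mult)
 next
  case (6 f X Y g h X' Y') thus ?case by (auto simp: Hom_C kron_add_left)
 next
  case (7 f X' Y' g X Y h) thus ?case by (auto simp: Hom_C kron_add_right)
 next
  case (8 f X Y g X' Y' c) thus ?case by (auto simp: Hom_C kron_smult_left)
 next
  case (9 f X Y g X' Y' c) thus ?case by (auto simp: Hom_C kron_smult_right)
 next
  case (10 X Y Z) thus ?case by (simp add: T_assoc)
 next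
  case (11 f g h) thus ?case by (auto simp: Arr_C T_assoc kron_assoc)
 next
  case (12 X) thus ?case by (simp add: I_left)
 next
  case (13 X) thus ?case by (simp add: I_right)
 next
  case (14 f) thus ?case by (auto simp: Arr_C I_left I_dim kron_one_left)
 next
  case (15 f) thus ?case by (auto simp: Arr_C I_right I_dim kron_one_right)
 qed
qed

end

interpretation vect: kron_category UNIV id "\<lambda>_ _ _. True" "(*)" 1 vect_cat
 by unfold_locales (simp_all add: vect_cat_def)

lemma SM_D: assumes "(X, G) : SM" shows "nr G = nr X" "nc X = nr X" "nc G = nr X"
  "X * X = 0\<^sub>m (nr X) (nr X)" "G * G = I (nr X)" "G * X = (- 1) *s (X * G)"
proof -
 obtain n where n: "X : carrier_mat n n" "G : carrier_mat n n" "X * X = 0\<^sub>m n n" "G * G = I n" "G * X = - (X * G)"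
  using assms unfolding sweedler_modules_def by blast
 have d: "nr X = n" "nc X = n" "nr G = n" "nc G = n" using n(1,2) by simp_all
 show "nr G = nr X" "nc X = nr X" "nc G = nr X" by (simp_all only: d)
 show "X * X = 0\<^sub>m (nr X) (nr X)" "G * G = I (nr X)" by (simp_all only: d n(3,4))
 show "G * X = (- 1) *s (X * G)" unfolding n(5) by (rule uminus_eq_smult)
qed
lemma SM_I:
 "nr G = nr X ==> nc X = nr X ==> nc G = nr X ==>
  X * X = 0\<^sub>m (nr X) (nr X) ==> G * G = I (nr X) ==> G * X = (- 1) *s (X * G) ==> (X, G) : SM"
  unfolding sweedler_modules_def mem_Collect_eq case_prod_conv uminus_eq_smult
  by (intro exI[of _ "nr X"] conjI carrier_matI refl)

lemma sdim_pair [simp]: "sdim (X, G) = nr X" by (simp add: sdim_def)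

lemma sweedler_tensor_pair: "sweedler_tensor (X, G) (Y, H) = (kron X (I (nr Y)) + kron G Y, kron G H)"
 by (simp add: sweedler_tensor_def sdim_def)

lemma sweedler_tensor_closed: assumes "(X, G) : SM" "(Y, H) : SM"
 shows "sweedler_tensor (X, G) (Y, H) : SM"
proof -
 note V = SM_D[OF assms(1)] and W = SM_D[OF assms(2)]
 note [simp] = V(1-3) W(1-3)
 \<comment> \<open>The two summands x \<otimes> 1 and g \<otimes> x of the coproduct anticommute and
   square to zero.\<close>
 have 1: "kron X (I (nr Y)) * kron G Y = (- 1) *s (kron G Y * kron X (I (nr Y)))"
  by (simp add: kron_mult V(6) kron_smult_left mat_ring)
 show ?thesis unfolding sweedler_tensor_pair by (rule SM_I)
   (simp_all add: mat_ring 1 kron_mult V(4-6) W(4-6) kron_zero_left kron_zero_right kron_smult_left kron_smult_right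
    kron_one add_smult_self add_self_smult zero_smult_mat)
qed

interpretation sw: kron_category SM sdim "\<lambda>V W f. f * fst V = fst W * f \<and> f * snd V = snd W * f"
 sweedler_tensor "(0\<^sub>m 1 1, I 1)" SC
proof (unfold_locales, goal_cases)
 case 1 show ?case by (simp add: sweedler_cat_def)
next
 case (2 V)
 obtain X G where V: "V = (X, G)" by (cases V)
 note [simp] = SM_D(1-3)[OF 2[unfolded V]]
 show ?case by (simp add: V mat_ring)
next
 case (3 V W Z f g)
 obtain X G where V: "V = (X, G)" by (cases V)
 obtain Y H where W: "W = (Y, H)" by (cases W)
 obtain Z1 Z2 where Z: "Z = (Z1, Z2)" by (cases Z)
 note [simp] = SM_D(1-3)[OF 3(1)[unfolded V]] SM_D(1-3)[OF 3(2)[unfolded W]]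
  SM_D(1-3)[OF 3(3)[unfolded Z]] 3(4-7)[unfolded V W Z sdim_pair]
 have f: "f * X = Y * f" "f * G = H * f" and g: "g * Y = Z1 * g" "g * H = Z2 * g"
  using 3(8,9) by (simp_all add: V W Z)
 show ?case by (simp add: V W Z mat_ring f mult_eq_assoc[OF g(1)] mult_eq_assoc[OF g(2)])
next
 case (4 V W)
 obtain X G where V: "V = (X, G)" by (cases V)
 obtain Y H where W: "W = (Y, H)" by (cases W)
 note [simp] = SM_D(1-3)[OF 4(1)[unfolded V]] SM_D(1-3)[OF 4(2)[unfolded W]]
 show ?case by (simp add: V W mat_ring)
next
 case (5 V W f g)
 obtain X G where V: "V = (X, G)" by (cases V)
 obtain Y H where W: "W = (Y, H)" by (cases W)
 note [simp] = SM_D(1-3)[OF 5(1)[unfolded V]] SM_D(1-3)[OF 5(2)[unfolded W]] 5(3-6)[unfolded V W sdim_pair]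
 show ?case using 5(7,8) by (simp add: V W mat_ring)
next
 case (6 V W f c)
 obtain X G where V: "V = (X, G)" by (cases V)
 obtain Y H where W: "W = (Y, H)" by (cases W)
 note [simp] = SM_D(1-3)[OF 6(1)[unfolded V]] SM_D(1-3)[OF 6(2)[unfolded W]] 6(3-4)[unfolded V W sdim_pair]
 show ?case using 6(5) by (simp add: V W mat_ring)
next
 case (7 V W V' W' f g)
 obtain X G where V: "V = (X, G)" by (cases V)
 obtain Y H where W: "W = (Y, H)" by (cases W)
 obtain X' G' where V': "V' = (X', G')" by (cases V')
 obtain Y' H' where W': "W' = (Y', H')" by (cases W')
 note [simp] = SM_D(1-3)[OF 7(1)[unfolded V]] SM_D(1-3)[OF 7(2)[unfolded W]]
  SM_D(1-3)[OF 7(3)[unfolded V']] SM_D(1-3)[OF 7(4)[unfolded W']] 7(5-8)[unfolded V W V' W' sdim_pair]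
 have f: "f * X = Y * f" "f * G = H * f" and g: "g * X' = Y' * g" "g * G' = H' * g"
  using 7(9,10) by (simp_all add: V W V' W')
 show ?case by (simp add: V W V' W' sweedler_tensor_pair kron_ring f g)
next
 case (8 V W) thus ?case by (cases V; cases W) (simp add: sweedler_tensor_closed)
next
 case (9 V W)
 obtain X G where V: "V = (X, G)" by (cases V)
 obtain Y H where W: "W = (Y, H)" by (cases W)
 note [simp] = SM_D(1-3)[OF 9(1)[unfolded V]] SM_D(1-3)[OF 9(2)[unfolded W]]
 show ?case by (simp add: V W sweedler_tensor_pair)
next
 case (10 V W Z)
 obtain X G where V: "V = (X, G)" by (cases V)
 obtain Y H where W: "W = (Y, H)" by (cases W)
 obtain Z1 Z2 where Z: "Z = (Z1, Z2)" by (cases Z)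
 note [simp] = SM_D(1-3)[OF 10(1)[unfolded V]] SM_D(1-3)[OF 10(2)[unfolded W]]
  SM_D(1-3)[OF 10(3)[unfolded Z]]
 show ?case
  by (simp add: V W Z sweedler_tensor_pair kron_assoc kron_add_left kron_add_right kron_one add_assoc_mat_dim)
next
 case 11 show ?case by (rule SM_I) (simp_all add: mat_ring)
next
 case 12 show ?case by simp
next
 case (13 V)
 obtain X G where V: "V = (X, G)" by (cases V)
 note [simp] = SM_D(1-3)[OF 13[unfolded V]]
 show ?case by (simp add: V sweedler_tensor_pair kron_zero_left kron_one_left mat_ring)
next
 case (14 V)
 obtain X G where V: "V = (X, G)" by (cases V)
 note [simp] = SM_D(1-3)[OF 14[unfolded V]]
 show ?case by (simp add: V sweedler_tensor_pair kron_zero_right kron_one_right mat_ring)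
qed

context strict_monoidal_category
begin

lemma tens_obj [simp]: "X : Obj C ==> Y : Obj C ==> TensO C X Y : Obj C" "Unit C : Obj C"
 by (simp_all add: TensO_Obj Unit_Obj)

lemma tens_arr [simp]: assumes "f : Arr C" "g : Arr C"
 shows "TensA C f g : Arr C" "Dom C (TensA C f g) = TensO C (Dom C f) (Dom C g)" "Cod C (TensA C f g) = TensO C (Cod C f) (Cod C g)"
 using TensA_Hom[of f "Dom C f" "Cod C f" g "Dom C g" "Cod C g"] assms by (auto simp: Hom_iff)

lemma tens_comp:
 "f : Arr C ==> g : Arr C ==> Cod C f = Dom C g ==> f' : Arr C ==> g' : Arr C ==> Cod C f' = Dom C g' ==>
  TensA C (Comp C g f) (Comp C g' f') = Comp C (TensA C g g') (TensA C f f')"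
 using TensA_Comp[of f "Dom C f" "Cod C f" g "Cod C g" f' "Dom C f'" "Cod C f'" g' "Cod C g'"] by (auto simp: Hom_iff)

lemma tens_id [simp]: "X : Obj C ==> Y : Obj C ==> TensA C (Id C X) (Id C Y) = Id C (TensO C X Y)"
 by (rule TensA_Id)

end

lemma regular_module_category:
 fixes C :: "('x, 'f) moncat" assumes "strict_monoidal_category C" shows "module_category C (regular_modcat C)"
proof -
 interpret strict_monoidal_category C by fact
 have [simp]: "Obj (regular_modcat C) = Obj C" "Arr (regular_modcat C) = Arr C" "Dom (regular_modcat C) = Dom C"
  "Cod (regular_modcat C) = Cod C" "Id (regular_modcat C) = Id C"
  "Comp (regular_modcat C) = Comp C" "ActO (regular_modcat C) = TensO C" "ActA (regular_modcat C) = TensA C"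
  "Assoc (regular_modcat C) = (\<lambda>X Y Z. Id C (TensO C X (TensO C Y Z)))" "Lunit (regular_modcat C) = Id C"
  by (simp_all add: regular_modcat_def lincat.defs modcat.defs)
 have lin: "linear_category (regular_modcat C)"
  by (rule linear_category_cong[OF _ _ _ _ _ _ _ _ _ linear_category_axioms])
   (simp_all add: regular_modcat_def lincat.defs modcat.defs)
 then interpret R: linear_category "regular_modcat C" .
 show ?thesis
  by unfold_locales (simp_all add: tens_comp TensO_assoc TensA_assoc Unit_TensO TensO_Unit Unit_TensA TensA_Unit
    R.iso_arr_id[simplified])
qed

context linear_category
begin

lemma smult_one: "f : Arr C ==> Smult C 1 f = f" using Smult_one[of f "Dom C f" "Cod C f"] by (simp add: Hom_iff)

lemma smult_smult: "f : Arr C ==> Smult C c (Smult C d f) = Smult C (c * d) f"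
 using Smult_Smult[of f "Dom C f" "Cod C f"] by (simp add: Hom_iff)

lemma smult_add_left: "f : Arr C ==> Smult C (c + d) f = Add C (Smult C c f) (Smult C d f)"
 using Smult_Add_left[of f "Dom C f" "Cod C f"] by (simp add: Hom_iff)

lemma smult_add_right: "f : Arr C ==> g : Arr C ==> Dom C f = Dom C g ==> Cod C f = Cod C g ==>
  Smult C c (Add C f g) = Add C (Smult C c f) (Smult C c g)"
 using Smult_Add_right[of f "Dom C f" "Cod C f" g] by (simp add: Hom_iff)

end

lemma left_imp_module_category: assumes C: "strict_monoidal_category C" and M: "left_module_category C M"
 shows "module_category C M"
proof -
 interpret C: strict_monoidal_category C by fact
 interpret left_module_category C M by fact
 show ?thesis
 proof (unfold_locales, goal_cases)
  case (1 X p) thus ?case by (rule ActO_Obj)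
 next
  case (2 f h) thus ?case using ActA_Hom[of f "Dom C f" "Cod C f" h "Dom M h" "Cod M h"] by (simp add: Hom_iff)
 next
  case (3 f h) thus ?case using ActA_Hom[of f "Dom C f" "Cod C f" h "Dom M h" "Cod M h"] by (simp add: Hom_iff)
 next
  case (4 f h) thus ?case using ActA_Hom[of f "Dom C f" "Cod C f" h "Dom M h" "Cod M h"] by (simp add: Hom_iff)
 next
  case (5 X p) thus ?case by (rule ActA_Id)
 next
  case (6 f g h k) thus ?case
   using ActA_Comp[of f "Dom C f" "Cod C f" g "Cod C g" h "Dom M h" "Cod M h" k "Cod M k"] by (simp add: Hom_iff)
 next
  case (7 X Y p) thus ?case by (rule Assoc_iso)
 next
  case (8 f g h) thus ?case
   using Assoc_natural[of f "Dom C f" "Cod C f" g "Dom C g" "Cod C g" h "Dom M h" "Cod M h"] by (simp add: Hom_iff)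
 next
  case (9 p) thus ?case by (rule Lunit_iso)
 next
  case (10 h) thus ?case using Lunit_natural[of h "Dom M h" "Cod M h"] by (simp add: Hom_iff)
 qed
qed

lemma left_module_categoryI: assumes "module_category C M" "finite_linear_category M"
  and "\<And>f g h. f : Arr C ==> g : Arr C ==> Dom C f = Dom C g ==> Cod C f = Cod C g ==> h : Arr M ==>
   ActA M (Add C f g) h = Add M (ActA M f h) (ActA M g h)"
  and "\<And>f h k. f : Arr C ==> h : Arr M ==> k : Arr M ==> Dom M h = Dom M k ==> Cod M h = Cod M k ==>
   ActA M f (Add M h k) = Add M (ActA M f h) (ActA M f k)"
  and "\<And>f h c. f : Arr C ==> h : Arr M ==> ActA M (Smult C c f) h = Smult M c (ActA M f h)"
  and "\<And>f h c. f : Arr C ==> h : Arr M ==> ActA M f (Smult M c h) = Smult M c (ActA M f h)"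
  and "\<And>X Y Z p. X : Obj C ==> Y : Obj C ==> Z : Obj C ==> p : Obj M ==>
   Comp M (Assoc M X Y (ActO M Z p)) (Assoc M (TensO C X Y) Z p) =
     Comp M (ActA M (Id C X) (Assoc M Y Z p)) (Assoc M X (TensO C Y Z) p)"
  and "\<And>X p. X : Obj C ==> p : Obj M ==>
   Comp M (ActA M (Id C X) (Lunit M p)) (Assoc M X (Unit C) p) = Id M (ActO M X p)" shows "left_module_category C M"
proof -
 interpret module_category C M by fact
 show ?thesis
 proof (unfold_locales, goal_cases)
  case 1 show ?case by fact
 next
  case (2 X p) thus ?case by simp
 next
  case (3 f X Y h p q) thus ?case by (auto simp: Hom_iff)
 next
  case (4 X p) thus ?case by simp
 next
  case (5 f X Y g Z h p q k r) thus ?case by (auto simp: Hom_iff act_comp)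
 next
  case (6 f X Y g h p q) thus ?case by (auto simp: Hom_iff assms(3))
 next
  case (7 f X Y h p q k) thus ?case by (auto simp: Hom_iff assms(4))
 next
  case (8 f X Y h p q c) thus ?case by (auto simp: Hom_iff assms(5))
 next
  case (9 f X Y h p q c) thus ?case by (auto simp: Hom_iff assms(6))
 next
  case (10 X Y p) thus ?case by (rule assoc_iso)
 next
  case (11 f X X' g Y Y' h p p') thus ?case using assoc_natural[of f g h] by (auto simp: Hom_iff)
 next
  case (12 p) thus ?case by (rule lunit_iso)
 next
  case (13 h p q) thus ?case using lunit_natural[of h] by (auto simp: Hom_iff)
 next
  case (14 X Y Z p) thus ?case by (rule assms(7))
 next
  case (15 X p) thus ?case by (rule assms(8))
 qed
qed

section \<open>Right modules over an algebra object as a module category\<close>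

locale algebra_object = strict_monoidal_category C for C :: "('x, 'f) moncat" +
 fixes A :: "('x, 'f) alg" assumes alg: "algebra_in C A"
begin

abbreviation "AA \<equiv> AObj A"

lemma AA_obj [simp]: "AA : Obj C" and mult_arr [simp]: "AMult A : Arr C" "Dom C (AMult A) = TensO C AA AA" "Cod C (AMult A) = AA"
 and unit_arr [simp]: "AUnit A : Arr C" "Dom C (AUnit A) = Unit C" "Cod C (AUnit A) = AA"
 using alg by (simp_all add: algebra_in_def Let_def Hom_iff)

lemma right_module_iff: "right_module C A V r \<longleftrightarrow> V : Obj C \<and> r : Arr C \<and> Dom C r = TensO C V AA \<and> Cod C r = V \<and>
  Comp C r (TensA C r (Id C AA)) = Comp C r (TensA C (Id C V) (AMult A)) \<and> Comp C r (TensA C (Id C V) (AUnit A)) = Id C V"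
 by (auto simp: right_module_def Hom_iff)

lemma mod_simps [simp]:
 "(V, r) : Obj (mod_lincat C A) \<longleftrightarrow> right_module C A V r"
 "((V, r), (W, s), f) : Arr (mod_lincat C A) \<longleftrightarrow> right_module C A V r \<and> right_module C A W s \<and> f : Arr C \<and>
  Dom C f = V \<and> Cod C f = W \<and> Comp C f r = Comp C s (TensA C f (Id C AA))"
 "Dom (mod_lincat C A) (p, q, f) = p" "Cod (mod_lincat C A) (p, q, f) = q"
 "Id (mod_lincat C A) p = (p, p, Id C (fst p))"
 "Comp (mod_lincat C A) (q', t, g) (p, q, f) = (p, t, Comp C g f)"
 "Zero (mod_lincat C A) p q = (p, q, Zero C (fst p) (fst q))"
 "Add (mod_lincat C A) (p, q, f) (p', q', g) = (p, q, Add C f g)"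
 "Smult (mod_lincat C A) c (p, q, f) = (p, q, Smult C c f)" by (auto simp: mod_lincat_def Hom_iff)

lemma Hom_mod: "h : Hom (mod_lincat C A) p q \<longleftrightarrow> (\<exists>V r W s f. h = (p, q, f) \<and> p = (V, r) \<and> q = (W, s) \<and>
  right_module C A V r \<and> right_module C A W s \<and> f : Arr C \<and> Dom C f = V \<and> Cod C f = W \<and> Comp C f r = Comp C s (TensA C f (Id C AA)))"
 by (cases h; cases p; cases q) (auto simp: Hom_iff)

lemma tens_right_comp: "f : Arr C ==> g : Arr C ==> Cod C f = Dom C g ==>
  TensA C (Comp C g f) (Id C AA) = Comp C (TensA C g (Id C AA)) (TensA C f (Id C AA))"
 using tens_comp[of f g "Id C AA" "Id C AA"] by simp

lemma linear_mod: "linear_category (mod_lincat C A)"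
proof (unfold_locales, goal_cases)
 case (1 f) thus ?case by (cases f) auto
next
 case (2 f) thus ?case by (cases f) auto
next
 case (3 X) thus ?case by (cases X) (auto simp: Hom_mod right_module_iff)
next
 case (4 f X Y g Z)
 then obtain f0 g0 V r W s U t where [simp]: "f = (X, Y, f0)" "g = (Y, Z, g0)" "X = (V, r)" "Y = (W, s)" "Z = (U, t)"
  and m: "right_module C A V r" "right_module C A W s" "right_module C A U t"
  and [simp]: "f0 : Arr C" "Dom C f0 = V" "Cod C f0 = W" "g0 : Arr C" "Dom C g0 = W" "Cod C g0 = U"
  and e: "Comp C f0 r = Comp C s (TensA C f0 (Id C AA))" "Comp C g0 s = Comp C t (TensA C g0 (Id C AA))"
  by (auto simp: Hom_mod)
 have [simp]: "r : Arr C" "Dom C r = TensO C V AA" "Cod C r = V" "s : Arr C" "Dom C s = TensO C W AA" "Cod C s = W"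
  "t : Arr C" "Dom C t = TensO C U AA" "Cod C t = U" using m by (auto simp: right_module_iff)
 show ?case using m by (simp add: Hom_mod comp_assoc tens_right_comp e(1) comp_eq_assoc[OF e(2)])
next
 case (5 f X Y) thus ?case by (auto simp: Hom_mod)
next
 case (6 f X Y) thus ?case by (auto simp: Hom_mod)
next
 case (7 f W X g Y h Z) thus ?case by (auto simp: Hom_mod comp_assoc)
next
 case (8 X Y)
 obtain V r W s where [simp]: "X = (V, r)" "Y = (W, s)" by (cases X; cases Y)
 \<comment> \<open>Preservation of zero arrows follows from linearity, as a zero arrow is 0 times
   itself.\<close>
 have "TensA C (Zero C V W) (Id C AA) = TensA C (Smult C 0 (Zero C V W)) (Id C AA)" if "V : Obj C" "W : Obj C"
  using that zero_smult[of "Zero C V W"] by simp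
 moreover have "TensA C (Smult C 0 (Zero C V W)) (Id C AA) = Zero C (TensO C V AA) (TensO C W AA)" if "V : Obj C" "W : Obj C"
  using that TensA_Smult_left[of "Zero C V W" V W "Id C AA" AA AA 0] by (simp add: Hom_iff zero_smult)
 ultimately show ?case using 8 by (auto simp: Hom_mod right_module_iff comp_zero_left comp_zero_right)
next
 case (9 f X Y g)
 then obtain f0 g0 V r W s where [simp]: "f = (X, Y, f0)" "g = (X, Y, g0)" "X = (V, r)" "Y = (W, s)"
  and m: "right_module C A V r" "right_module C A W s"
  and [simp]: "f0 : Arr C" "Dom C f0 = V" "Cod C f0 = W" "g0 : Arr C" "Dom C g0 = V" "Cod C g0 = W"
  and e: "Comp C f0 r = Comp C s (TensA C f0 (Id C AA))" "Comp C g0 r = Comp C s (TensA C g0 (Id C AA))"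
  by (auto simp: Hom_mod)
 have [simp]: "r : Arr C" "Dom C r = TensO C V AA" "Cod C r = V" "s : Arr C" "Dom C s = TensO C W AA" "Cod C s = W"
  using m by (auto simp: right_module_iff)
 have "TensA C (Add C f0 g0) (Id C AA) = Add C (TensA C f0 (Id C AA)) (TensA C g0 (Id C AA))"
  by (rule TensA_Add_left[of _ V W _ _ AA AA]) (simp_all add: Hom_iff)
 thus ?case using m by (simp add: Hom_mod comp_add_left comp_add_right e)
next
 case (10 f X Y c)
 then obtain f0 V r W s where [simp]: "f = (X, Y, f0)" "X = (V, r)" "Y = (W, s)"
  and m: "right_module C A V r" "right_module C A W s" and [simp]: "f0 : Arr C" "Dom C f0 = V" "Cod C f0 = W"
  and e: "Comp C f0 r = Comp C s (TensA C f0 (Id C AA))" by (auto simp: Hom_mod)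
 have [simp]: "r : Arr C" "Dom C r = TensO C V AA" "Cod C r = V" "s : Arr C" "Dom C s = TensO C W AA" "Cod C s = W"
  using m by (auto simp: right_module_iff)
 have "TensA C (Smult C c f0) (Id C AA) = Smult C c (TensA C f0 (Id C AA))"
  by (rule TensA_Smult_left[of _ V W _ AA AA]) (simp_all add: Hom_iff)
 thus ?case using m by (simp add: Hom_mod comp_smult_left comp_smult_right e)
next
 case (11 f X Y g h) thus ?case by (auto simp: Hom_mod add_assoc)
next
 case (12 f X Y g) thus ?case by (auto simp: Hom_mod intro: add_commute)
next
 case (13 f X Y) thus ?case by (auto simp: Hom_mod add_zero)
next
 case (14 f X Y) thus ?case by (auto simp: Hom_mod add_inverse)
next
 case (15 f X Y) thus ?case by (auto simp: Hom_mod smult_one)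
next
 case (16 f X Y c d) thus ?case by (auto simp: Hom_mod smult_smult)
next
 case (17 f X Y c d) thus ?case by (auto simp: Hom_mod smult_add_left)
next
 case (18 f X Y g c) thus ?case by (auto simp: Hom_mod smult_add_right)
next
 case (19 f X Y g Z h) thus ?case by (auto simp: Hom_mod comp_add_left)
next
 case (20 f X Y g h Z) thus ?case by (auto simp: Hom_mod comp_add_right)
next
 case (21 f X Y g Z c) thus ?case by (auto simp: Hom_mod comp_smult_left)
next
 case (22 f X Y g Z c) thus ?case by (auto simp: Hom_mod comp_smult_right)
qed

lemma mod_cat_simps [simp]:
 "Obj (mod_cat C A) = Obj (mod_lincat C A)" "Arr (mod_cat C A) = Arr (mod_lincat C A)"
 "Dom (mod_cat C A) = Dom (mod_lincat C A)" "Cod (mod_cat C A) = Cod (mod_lincat C A)"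
 "Id (mod_cat C A) = Id (mod_lincat C A)" "Comp (mod_cat C A) = Comp (mod_lincat C A)"
 "Zero (mod_cat C A) = Zero (mod_lincat C A)" "Add (mod_cat C A) = Add (mod_lincat C A)"
 "Smult (mod_cat C A) = Smult (mod_lincat C A)"
 "ActO (mod_cat C A) X (V, r) = (TensO C X V, TensA C (Id C X) r)"
 "ActA (mod_cat C A) f ((V, r), (W, s), h) =
    ((TensO C (Dom C f) V, TensA C (Id C (Dom C f)) r),
     (TensO C (Cod C f) W, TensA C (Id C (Cod C f)) s), TensA C f h)"
 "Assoc (mod_cat C A) X Y (V, r) = ((TensO C X (TensO C Y V), TensA C (Id C (TensO C X Y)) r),
   (TensO C X (TensO C Y V), TensA C (Id C (TensO C X Y)) r), Id C (TensO C X (TensO C Y V)))"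
 "Lunit (mod_cat C A) p = (p, p, Id C (fst p))" by (auto simp: mod_cat_def lincat.defs modcat.defs Let_def)

lemma linear_mod_cat: "linear_category (mod_cat C A)"
 by (rule linear_category_cong[OF _ _ _ _ _ _ _ _ _ linear_mod]) simp_all

lemma act_right_module:
 assumes "right_module C A V r" "X : Obj C" shows "right_module C A (TensO C X V) (TensA C (Id C X) r)"
proof -
 have [simp]: "V : Obj C" "r : Arr C" "Dom C r = TensO C V AA" "Cod C r = V" "X : Obj C"
  and e: "Comp C r (TensA C r (Id C AA)) = Comp C r (TensA C (Id C V) (AMult A))" "Comp C r (TensA C (Id C V) (AUnit A)) = Id C V"
  using assms by (auto simp: right_module_iff)
 have "Comp C (TensA C (Id C X) r) (TensA C (TensA C (Id C X) r) (Id C AA)) = TensA C (Id C X) (Comp C r (TensA C r (Id C AA)))"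
  using tens_comp[of "Id C X" "Id C X" "TensA C r (Id C AA)" r] by (simp add: TensA_assoc)
 also have "... = Comp C (TensA C (Id C X) r) (TensA C (Id C (TensO C X V)) (AMult A))"
  using tens_comp[of "Id C X" "Id C X" "TensA C (Id C V) (AMult A)" r] by (simp add: e TensA_assoc flip: tens_id)
 finally have 1: "Comp C (TensA C (Id C X) r) (TensA C (TensA C (Id C X) r) (Id C AA)) =
  Comp C (TensA C (Id C X) r) (TensA C (Id C (TensO C X V)) (AMult A))" .
 have "Comp C (TensA C (Id C X) r) (TensA C (Id C (TensO C X V)) (AUnit A)) = TensA C (Id C X) (Comp C r (TensA C (Id C V) (AUnit A)))"
  using tens_comp[of "Id C X" "Id C X" "TensA C (Id C V) (AUnit A)" r] by (simp add: TensA_assoc TensO_Unit flip: tens_id)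
 thus ?thesis using 1 by (simp add: right_module_iff TensO_assoc e)
qed

lemma act_hom: assumes "((V, r), (W, s), h) : Arr (mod_lincat C A)" "f : Arr C"
 shows "Comp C (TensA C f h) (TensA C (Id C (Dom C f)) r) =
  Comp C (TensA C (Id C (Cod C f)) s) (TensA C (TensA C f h) (Id C AA))"
proof -
 have [simp]: "V : Obj C" "r : Arr C" "Dom C r = TensO C V AA" "Cod C r = V"
  "W : Obj C" "s : Arr C" "Dom C s = TensO C W AA" "Cod C s = W" "h : Arr C" "Dom C h = V" "Cod C h = W" "f : Arr C"
  and e: "Comp C h r = Comp C s (TensA C h (Id C AA))" using assms by (auto simp: right_module_iff)
 have "Comp C (TensA C f h) (TensA C (Id C (Dom C f)) r) = TensA C f (Comp C h r)"
  using tens_comp[of "Id C (Dom C f)" f r h] by simp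
 also have "... = Comp C (TensA C (Id C (Cod C f)) s) (TensA C f (TensA C h (Id C AA)))"
  using tens_comp[of f "Id C (Cod C f)" "TensA C h (Id C AA)" s] by (simp add: e)
 finally show ?thesis by (simp add: TensA_assoc)
qed

lemma mod_cat_module_category: "module_category C (mod_cat C A)"
proof -
 interpret L: linear_category "mod_cat C A" by (rule linear_mod_cat)
 show ?thesis
 proof (unfold_locales, goal_cases)
  case (1 X p) thus ?case by (cases p) (simp add: act_right_module)
 next
  case (2 f h)
  obtain V r W s h0 where [simp]: "h = ((V, r), (W, s), h0)" by (cases h) auto
  have "right_module C A V r" "right_module C A W s" "h0 : Arr C" "Dom C h0 = V" "Cod C h0 = W" using 2(2) by simp_all
  thus ?case using 2 act_hom[of V r W s h0 f] by (simp add: act_right_module)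
 next
  case (3 f h) thus ?case by (cases h) (auto split: prod.splits)
 next
  case (4 f h) thus ?case by (cases h) (auto split: prod.splits)
 next
  case (5 X p) thus ?case by (cases p) (simp add: right_module_iff)
 next
  case (6 f g h k) thus ?case by (cases h; cases k) (auto simp: tens_comp)
 next
  case (7 X Y p)
  obtain V r where [simp]: "p = (V, r)" by (cases p)
  have m: "right_module C A V r" and [simp]: "X : Obj C" "Y : Obj C" using 7 by simp_all
  hence [simp]: "V : Obj C" "r : Arr C" by (auto simp: right_module_iff)
  have "TensA C (Id C X) (TensA C (Id C Y) r) = TensA C (Id C (TensO C X Y)) r" by (simp add: TensA_assoc flip: tens_id)
  thus ?case
   using L.iso_arr_id[of "(TensO C X (TensO C Y V), TensA C (Id C (TensO C X Y)) r)"] act_right_module[OF m, of "TensO C X Y"]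
   by (simp add: TensO_assoc)
 next
  case (8 f g h)
  obtain V r W s h0 where [simp]: "h = ((V, r), (W, s), h0)" by (cases h) auto
  have [simp]: "f : Arr C" "g : Arr C" "h0 : Arr C" "V : Obj C" "r : Arr C" "W : Obj C" "s : Arr C" "Dom C h0 = V" "Cod C h0 = W"
   using 8 by (auto simp: right_module_iff)
  have e: "TensA C (Id C X) (TensA C (Id C Y) t) = TensA C (Id C (TensO C X Y)) t"
   if "X : Obj C" "Y : Obj C" "t : Arr C" for X Y t using TensA_assoc[of "Id C X" "Id C Y" t] that by simp
  show ?case by (simp add: TensA_assoc[of f g h0] TensO_assoc e)
 next
  case (9 p)
  obtain V r where [simp]: "p = (V, r)" by (cases p)
  have m: "right_module C A V r" using 9 by simp
  hence [simp]: "V : Obj C" "r : Arr C" by (auto simp: right_module_iff)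
  show ?case using L.iso_arr_id[of "(V, r)"] m by (simp add: Unit_TensO Unit_TensA)
 next
  case (10 h)
  obtain V r W s h0 where [simp]: "h = ((V, r), (W, s), h0)" by (cases h) auto
  have [simp]: "h0 : Arr C" "V : Obj C" "r : Arr C" "W : Obj C" "s : Arr C" "Dom C h0 = V" "Cod C h0 = W"
   using 10 by (auto simp: right_module_iff)
  show ?case by (simp add: Unit_TensO Unit_TensA)
 qed
qed

end

section \<open>Full subcategories and natural idempotents\<close>

definition full_sub :: "('o, 'a, 'z) lincat_scheme => 'o set => ('o, 'a, 'z) lincat_scheme" where
 "full_sub C S = C\<lparr>Obj := S, Arr := {f : Arr C. Dom C f : S \<and> Cod C f : S}\<rparr>"

lemma full_sub_simps [simp]:
 "Obj (full_sub C S) = S" "f : Arr (full_sub C S) \<longleftrightarrow> f : Arr C \<and> Dom C f : S \<and> Cod C f : S"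
 "Dom (full_sub C S) = Dom C" "Cod (full_sub C S) = Cod C" "Id (full_sub C S) = Id C"
 "Comp (full_sub C S) = Comp C" "Zero (full_sub C S) = Zero C" "Add (full_sub C S) = Add C" "Smult (full_sub C S) = Smult C"
 by (auto simp: full_sub_def)

context linear_category
begin

lemma full_sub_linear: assumes "S \<subseteq> Obj C" shows "linear_category (full_sub C S)"
proof -
 note [simp] = subsetD[OF assms]
 show ?thesis
  by unfold_locales (auto simp: Hom_iff comp_assoc add_assoc add_zero add_inverse smult_one smult_smult smult_add_left
    smult_add_right comp_add_left comp_add_right comp_smult_left comp_smult_right intro: add_commute)
qed

lemma full_sub_iso: "S \<subseteq> Obj C ==> X : S ==> Y : S ==> iso_arr (full_sub C S) X Y f \<longleftrightarrow> iso_arr C X Y f"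
 by (auto simp: iso_arr_def Hom_iff)

text \<open>An idempotent natural endomorphism of the identity functor.\<close>

definition nat_idem where
 "nat_idem E \<longleftrightarrow> (\<forall>X \<in> Obj C. E X : Arr C \<and> Dom C (E X) = X \<and> Cod C (E X) = X \<and> Comp C (E X) (E X) = E X) \<and>
   (\<forall>f \<in> Arr C. Comp C f (E (Dom C f)) = Comp C (E (Cod C f)) f)"

lemma nat_idemD: assumes "nat_idem E"
 shows "X : Obj C ==> E X : Arr C" "X : Obj C ==> Dom C (E X) = X" "X : Obj C ==> Cod C (E X) = X"
  "X : Obj C ==> Comp C (E X) (E X) = E X" "f : Arr C ==> Comp C f (E (Dom C f)) = Comp C (E (Cod C f)) f"
 using assms by (simp_all add: nat_idem_def)

lemma nat_idem_iso: assumes "nat_idem E" "iso_arr C X Y f" shows "E X = Id C X \<longleftrightarrow> E Y = Id C Y"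
proof -
 have o [simp]: "X : Obj C" "Y : Obj C" using iso_arr_objs[OF assms(2)] .
 note [simp] = iso_arrD[OF assms(2)] nat_idemD(1-3)[OF assms(1)]
 have n: "Comp C f (E X) = Comp C (E Y) f" using nat_idemD(5)[OF assms(1), of f] by simp
 show ?thesis
 proof
  assume "E X = Id C X"
  hence "Comp C (E Y) f = Comp C (Id C Y) f" using n by simp
  thus "E Y = Id C Y" by (rule iso_cancel_right[OF assms(2)]) simp_all
 next
  assume "E Y = Id C Y"
  hence "Comp C f (E X) = Comp C f (Id C X)" using n by simp
  thus "E X = Id C X" by (rule iso_cancel_left[OF assms(2)]) simp_all
 qed
qed

definition compl where "compl E X = Add C (Id C X) (Smult C (- 1) (E X))"

lemma compl_arr: assumes "nat_idem E" "X : Obj C"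
 shows "compl E X : Arr C" "Dom C (compl E X) = X" "Cod C (compl E X) = X"
  "Comp C (compl E X) (E X) = Zero C X X" "Comp C (E X) (compl E X) = Zero C X X" "Comp C (compl E X) (compl E X) = compl E X"
  "Add C (E X) (compl E X) = Id C X"
proof -
 note [simp] = nat_idemD(1-4)[OF assms(1)] assms(2)
 show [simp]: "compl E X : Arr C" "Dom C (compl E X) = X" "Cod C (compl E X) = X" by (simp_all add: compl_def)
 show 1: "Comp C (compl E X) (E X) = Zero C X X" by (simp add: compl_def comp_add_left comp_smult_left add_inverse)
 show 2: "Comp C (E X) (compl E X) = Zero C X X" by (simp add: compl_def comp_add_right comp_smult_right add_inverse)
 have "Comp C (compl E X) (compl E X) = Add C (Comp C (Id C X) (compl E X)) (Smult C (- 1) (Comp C (E X) (compl E X)))"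
  by (subst (1) compl_def) (simp add: comp_add_left comp_smult_left)
 also have "... = compl E X" unfolding 2 using zero_smult[of "Zero C X X"] smult_smult[of "Zero C X X" "- 1" 0] by (simp add: add_zero)
 finally show "Comp C (compl E X) (compl E X) = compl E X" .
 have "Add C (E X) (compl E X) = Add C (compl E X) (E X)" by (rule add_commute) simp_all
 also have "... = Add C (Id C X) (Add C (Smult C (- 1) (E X)) (E X))" by (simp add: compl_def add_assoc)
 also have "Add C (Smult C (- 1) (E X)) (E X) = Add C (E X) (Smult C (- 1) (E X))" by (rule add_commute) simp_all
 finally show "Add C (E X) (compl E X) = Id C X" by (simp add: add_inverse add_zero)
qed

lemma nat_idem_compl: assumes "nat_idem E" shows "nat_idem (compl E)"
proof -
 note [simp] = nat_idemD(1-4)[OF assms(1)]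
 have "Comp C f (compl E (Dom C f)) = Comp C (compl E (Cod C f)) f" if [simp]: "f : Arr C" for f
  using nat_idemD(5)[OF assms, of f]
  by (simp add: compl_def comp_add_left comp_add_right comp_smult_left comp_smult_right)
 thus ?thesis unfolding nat_idem_def using compl_arr[OF assms] by simp
qed

end

context ff_functor
begin

text \<open>The idempotent at N is conjugated from an isomorphic object in the image of F.
  \<open>key\<close> compares it along arbitrary arrows from image objects, which gives naturality
  and independence of the choices.\<close>

lemma push_nat_idem:
 assumes "C.nat_idem E" obtains e where "D.nat_idem e" "\<And>X. X : Obj C ==> e (Fo X) = Fa (E X)"
proof -
 note [simp] = C.nat_idemD(1-4)[OF assms]
 define e where "e N = Comp D (eps N) (Comp D (Fa (E (Go N))) (D.inv_arr (eps N)))" for N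
 note i = D.inv_arr[OF Go(2)]
 note [simp] = i(1-3)
 have e [simp]: "e N : Arr D" "Dom D (e N) = N" "Cod D (e N) = N" if "N : Obj D" for N
  using that by (simp_all add: e_def)
 have key: "Comp D (e N) g = Comp D g (Fa (E X))" if [simp]: "N : Obj D" "X : Obj C" "g : Arr D" "Dom D g = Fo X" "Cod D g = N" for N X g
 proof -
  obtain f where f [simp]: "f : Arr C" "Dom C f = X" "Cod C f = Go N" and Ff: "Fa f = Comp D (D.inv_arr (eps N)) g"
   by (rule full[of "Comp D (D.inv_arr (eps N)) g" X "Go N"]) simp_all
  have g: "g = Comp D (eps N) (Fa f)" by (simp add: Ff D.comp_eq_assoc[OF i(5)])
  have "Comp D (e N) g = Comp D (eps N) (Comp D (Fa (E (Go N))) (Fa f))" by (simp add: e_def D.comp_assoc flip: Ff)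
  also have "... = Comp D (eps N) (Fa (Comp C (E (Go N)) f))" by simp
  also have "Comp C (E (Go N)) f = Comp C f (E X)" using C.nat_idemD(5)[OF assms, of f] by simp
  also have "Comp D (eps N) (Fa (Comp C f (E X))) = Comp D g (Fa (E X))" by (subst g) (simp add: D.comp_assoc)
  finally show ?thesis .
 qed
 have FE: "Comp D (Fa (E X)) (Fa (E X)) = Fa (E X)" if "X : Obj C" for X using that by (simp flip: F_comp)
 have Fe: "e (Fo X) = Fa (E X)" if [simp]: "X : Obj C" for X using key[of "Fo X" X "Id D (Fo X)"] by simp
 have ee: "Comp D (e N) (e N) = e N" if [simp]: "N : Obj D" for N
 proof -
  have "Comp D (e N) (Comp D (eps N) (Comp D (Fa (E (Go N))) (D.inv_arr (eps N)))) =
    Comp D (Comp D (e N) (eps N)) (Comp D (Fa (E (Go N))) (D.inv_arr (eps N)))" by (simp add: D.comp_assoc)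
  also have "... = Comp D (eps N) (Comp D (Fa (E (Go N))) (D.inv_arr (eps N)))"
   by (simp add: key[of N "Go N"] D.comp_assoc D.comp_eq_assoc[OF FE])
  finally show ?thesis by (simp add: e_def[symmetric])
 qed
 have "Comp D g (e (Dom D g)) = Comp D (e (Cod D g)) g" if [simp]: "g : Arr D" for g
 proof (rule D.iso_cancel_right[OF Go(2)[of "Dom D g"]])
  show "Comp D (Comp D g (e (Dom D g))) (eps (Dom D g)) = Comp D (Comp D (e (Cod D g)) g) (eps (Dom D g))"
   using key[of "Cod D g" "Go (Dom D g)" "Comp D g (eps (Dom D g))"] key[of "Dom D g" "Go (Dom D g)" "eps (Dom D g)"]
   by (simp add: D.comp_assoc)
 qed simp_all
 hence "D.nat_idem e" unfolding D.nat_idem_def using ee by simp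
 thus thesis using Fe by (rule that)
qed

lemma pull_nat_idem:
 assumes "D.nat_idem e" obtains E where "C.nat_idem E" "\<And>X. X : Obj C ==> Fa (E X) = e (Fo X)"
proof -
 note [simp] = D.nat_idemD(1-4)[OF assms]
 define E where "E X = (SOME f. f : Arr C \<and> Dom C f = X \<and> Cod C f = X \<and> Fa f = e (Fo X))" for X
 have E: "E X : Arr C" "Dom C (E X) = X" "Cod C (E X) = X" "Fa (E X) = e (Fo X)" if [simp]: "X : Obj C" for X
 proof -
  obtain f where "f : Arr C" "Dom C f = X" "Cod C f = X" "Fa f = e (Fo X)"
   by (rule full[of "e (Fo X)" X X]) simp_all
  hence "\<exists>f. f : Arr C \<and> Dom C f = X \<and> Cod C f = X \<and> Fa f = e (Fo X)" by blast
  from someI_ex[OF this] show "E X : Arr C" "Dom C (E X) = X" "Cod C (E X) = X" "Fa (E X) = e (Fo X)"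
   by (simp_all add: E_def)
 qed
 note [simp] = E
 have "Comp C (E X) (E X) = E X" if [simp]: "X : Obj C" for X by (rule faithful) simp_all
 moreover have "Comp C f (E (Dom C f)) = Comp C (E (Cod C f)) f" if [simp]: "f : Arr C" for f
  using D.nat_idemD(5)[OF assms, of "Fa f"] by (intro faithful) simp_all
 ultimately have "C.nat_idem E" unfolding C.nat_idem_def by simp
 thus thesis using E(4) by (rule that)
qed

lemma ffes_full_sub:
 assumes S: "S \<subseteq> Obj C" "S' \<subseteq> Obj D" and SS: "\<And>X. X : Obj C ==> X : S \<longleftrightarrow> Fo X : S'"
  and iso: "\<And>X N f. X : Obj C ==> N : S' ==> iso_arr D (Fo X) N f ==> Fo X : S'"
 shows "ffes (full_sub C S) (full_sub D S') Fo Fa"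
proof -
 interpret C': linear_category "full_sub C S" by (rule C.full_sub_linear[OF S(1)])
 interpret D': linear_category "full_sub D S'" by (rule D.full_sub_linear[OF S(2)])
 note [simp] = subsetD[OF S(1)] subsetD[OF S(2)]
 have "linear_functor (full_sub C S) (full_sub D S') Fo Fa"
  by (rule linear_functorI[OF C'.linear_category_axioms D'.linear_category_axioms])
   (auto simp: F_add F_smult simp flip: SS)
 moreover have "bij_betw Fa (Hom (full_sub C S) X Y) (Hom (full_sub D S') (Fo X) (Fo Y))" if "X : S" "Y : S" for X Y
 proof -
  have "Hom (full_sub C S) X Y = Hom C X Y" "Hom (full_sub D S') (Fo X) (Fo Y) = Hom D (Fo X) (Fo Y)"
   using that SS[of X] SS[of Y] by (auto simp: Hom_iff)
  thus ?thesis using ffes that by (simp add: ffes_def)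
 qed
 moreover have "\<exists>X\<in>S. \<exists>f. iso_arr (full_sub D S') (Fo X) N f" if N: "N : S'" for N
 proof -
  have o: "N : Obj D" using N by simp
  have "Fo (Go N) : S'" by (rule iso[OF _ N Go(2)[OF o]]) (simp add: o)
  thus ?thesis using Go(2)[OF o] N S SS[of "Go N"] o by (intro bexI[of _ "Go N"]) (auto simp: D.full_sub_iso)
 qed
 ultimately show ?thesis by (simp add: ffes_def)
qed

end

lemma ff_functorI: "linear_category C ==> linear_category D ==> ffes C D Fo Fa ==> ff_functor C D Fo Fa"
 by (simp add: ff_functor_def ff_functor_axioms_def lin_functorI ffes_def)

lemma linear_equivalent_iff:
 "linear_category C ==> linear_category D ==> linear_equivalent C D \<longleftrightarrow> (\<exists>Fo Fa. ffes C D Fo Fa)"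
 using ffes_imp_equivalence equivalence_imp_ffes unfolding linear_equivalent_def by metis

section \<open>Modules over a finite-dimensional algebra and its central idempotents\<close>

definition vect_alg :: "nat => complex mat => complex mat => (nat, nat \<times> nat \<times> complex mat) alg" where
 "vect_alg a m u = \<lparr>AObj = a, AMult = (a * a, a, m), AUnit = (1, a, u)\<rparr>"

lemma vect_alg_simps [simp]: "AObj (vect_alg a m u) = a" "AMult (vect_alg a m u) = (a * a, a, m)" "AUnit (vect_alg a m u) = (1, a, u)"
 by (simp_all add: vect_alg_def)

lemma algebra_in_vect: "mat_algebra a m u ==> algebra_in vect_cat (vect_alg a m u)"
 by (simp add: algebra_in_def Let_def vect_alg_def Hom_iff mat_algebra_def mat_algebra.intro)

lemma algebra_in_vectE: assumes "algebra_in vect_cat R" obtains a m u where "R = vect_alg a m u" "mat_algebra a m u"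
proof -
 obtain a m' u' where R: "R = \<lparr>AObj = a, AMult = m', AUnit = u'\<rparr>" by (cases R) auto
 obtain p q m where m: "m' = (p, q, m)" by (cases m')
 obtain p' q' u where u: "u' = (p', q', u)" by (cases u')
 have "R = vect_alg a m u" "mat_algebra a m u"
  using assms by (auto simp: R m u algebra_in_def Let_def Hom_iff vect_alg_def mat_algebra_def)
 thus thesis by (rule that)
qed

context mat_algebra
begin

lemma algebra_object_vect: "algebra_object vect_cat (vect_alg a m u)"
 by (simp add: algebra_object_def algebra_object_axioms_def vect.monoidal algebra_in_vect mat_algebra_axioms)

abbreviation "vmod n r \<equiv> (n, (n * a, n, r))"

lemma right_module_vect: "right_module vect_cat (vect_alg a m u) n rr \<longleftrightarrow> (\<exists>r. rr = (n * a, n, r) \<and> umod n r)"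
 by (cases rr) (auto simp: right_module_def vect_alg_def Hom_iff umod_def)

abbreviation "VM \<equiv> mod_lincat vect_cat (vect_alg a m u)"

lemma vect_mod_obj: "N : Obj VM \<longleftrightarrow> (\<exists>n r. N = vmod n r \<and> umod n r)"
 by (cases N) (auto simp: mod_lincat_def right_module_vect)

lemma vect_mod_arr: "h : Arr VM \<longleftrightarrow>
  (\<exists>n r n' r' f. h = (vmod n r, vmod n' r', (n, n', f)) \<and> umod n r \<and> umod n' r' \<and> ulin n r n' r' f)"
 by (cases h) (auto simp: mod_lincat_def right_module_vect Hom_iff ulin_def)

lemma vect_mod_simps:
 "Dom VM (p, q, h) = p" "Cod VM (p, q, h) = q"
 "Id VM (n, rr) = ((n, rr), (n, rr), (n, n, I n))"
 "Comp VM (q', t, (n', n'', g)) (p, q, (n, n3, f)) = (p, t, (n, n'', g * f))"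
 "Add VM (p, q, (n, n', f)) (p', q', (n3, n4, g)) = (p, q, (n, n', f + g))"
 "Smult VM c (p, q, (n, n', f)) = (p, q, (n, n', c *s f))" by (simp_all add: mod_lincat_def)

text \<open>A natural idempotent on modules is multiplication by a central idempotent, its value
  \<open>E\<close> on the regular module applied to 1: every vector v of a module gives a module map
  b \<mapsto> v b, along which naturality transports \<open>E\<close>.\<close>

lemma nat_idem_central: assumes "linear_category.nat_idem VM e"
 obtains E where "nr E = a" "nc E = a" "E * E = E" "E * m = m * kron E (I a)" "E * m = m * kron (I a) E"
  "\<And>n r. umod n r ==> e (vmod n r) = (vmod n r, vmod n r, (n, n, r * kron (I n) (E * u)))"
  "\<And>n r. umod n r ==> (r * kron (I n) (E * u)) * r = r * kron (I n) E"
proof -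
 interpret R: algebra_object vect_cat "vect_alg a m u" by (rule algebra_object_vect)
 interpret L: linear_category "VM" by (rule R.linear_mod)
 note [simp] = vect_mod_simps
 have ob: "vmod n r : Obj VM" if "umod n r" for n r using that vect_mod_obj by blast
 have "\<exists>f. e (vmod n r) = (vmod n r, vmod n r, (n, n, f)) \<and> ulin n r n r f \<and> f * f = f" if "umod n r" for n r
 proof -
  note * = L.nat_idemD(1-4)[OF assms ob[OF that]]
  obtain n1 r1 n2 r2 f where h: "e (vmod n r) = (vmod n1 r1, vmod n2 r2, (n1, n2, f))" "ulin n1 r1 n2 r2 f"
   using *(1) vect_mod_arr by blast
  hence "n1 = n" "r1 = r" "n2 = n" "r2 = r" using *(2,3) by simp_all
  thus ?thesis using h *(4) by simp
 qed
 then obtain em where em: "e (vmod n r) = (vmod n r, vmod n r, (n, n, em n r))" "ulin n r n r (em n r)"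
  "em n r * em n r = em n r" if "umod n r" for n r by metis
 have nat: "f * em n r = em n' r' * f" if "umod n r" "umod n' r'" "ulin n r n' r' f" for n r n' r' f
 proof -
  have "(vmod n r, vmod n' r', (n, n', f)) : Arr VM" using that vect_mod_arr by blast
  from L.nat_idemD(5)[OF assms this] show ?thesis using em(1)[OF that(1)] em(1)[OF that(2)] by simp
 qed
 define E where "E = em a m"
 have E: "ulin a m a m E" "E * E = E" using em(2,3)[OF umod_regular] by (simp_all add: E_def)
 note [simp] = ulinD(1,2)[OF E(1)]
 have key: "em n r * r = r * kron (I n) E" if r: "umod n r" for n r
 proof -
  note [simp] = umodD(1,2)[OF r] ulinD(1,2)[OF em(2)[OF r]]
  show ?thesis
  proof (rule eq_mat_by_blocks_col[of _ _ n a])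
   fix i assume "i < n"
   let ?k = "kron (ecol n i) (I a)"
   have "(r * ?k) * m = r * (kron (ecol n i) (I a) * kron (I 1) m)" by (simp add: mat_ring kron_one_left)
   also have "... = (r * kron (I n) m) * kron (ecol n i) (I (a * a))" by (simp add: kron_ring)
   also have "... = r * kron (r * ?k) (I a)"
    by (simp add: umodD(3)[OF r, symmetric] kron_comp_left mat_ring kron_assoc kron_one)
   finally have "ulin a m n r (r * ?k)" by (simp add: ulin_def)
   from nat[OF umod_regular r this] have "em n r * r * ?k = r * (?k * E)" by (simp add: E_def[symmetric] mat_ring)
   also have "?k * E = kron (I n) E * ?k"
    using kron_mult[of "ecol n i" "I (Suc 0)" "I a" E] by (simp add: kron_ring kron_one_left)
   finally show "em n r * r * ?k = r * kron (I n) E * ?k" by (simp add: mat_ring)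
  qed simp_all
 qed
 have val: "em n r = r * kron (I n) (E * u)" if r: "umod n r" for n r
 proof -
  note [simp] = umodD(1,2)[OF r] ulinD(1,2)[OF em(2)[OF r]]
  have "em n r = em n r * r * kron (I n) u" by (simp add: mat_ring umodD(4)[OF r])
  thus ?thesis by (simp add: key[OF r] kron_ring)
 qed
 show thesis
 proof (rule that[of E])
  show "E * m = m * kron E (I a)" by (rule ulinD(3)[OF E(1)])
  show "E * m = m * kron (I a) E" using key[OF umod_regular] by (simp add: E_def)
 qed (use E(2) em(1) val key in simp_all)
qed

text \<open>The objects on which a natural idempotent acts as the identity are the modules over a corner
 of the algebra; a rank factorization of the idempotent provides coordinates for the corner.\<close>

lemma full_sub_nat_idem: assumes e: "linear_category.nat_idem VM e"
 defines "S \<equiv> {N : Obj VM. e N = Id VM N}"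
 obtains R Fo Fa where "algebra_in vect_cat R" "ffes (full_sub VM S) (mod_lincat vect_cat R) Fo Fa"
proof -
 obtain E where dE [simp]: "nr E = a" "nc E = a" and EE: "E * E = E" and Em: "E * m = m * kron E (I a)"
  and mE: "E * m = m * kron (I a) E"
  and ev: "\<And>n r. umod n r ==> e (vmod n r) = (vmod n r, vmod n r, (n, n, r * kron (I n) (E * u)))"
  and ek: "\<And>n r. umod n r ==> (r * kron (I n) (E * u)) * r = r * kron (I n) E"
  using nat_idem_central[OF e] by metis
 obtain k J P where [simp]: "nr J = a" "nc J = k" "nr P = k" "nc P = a" and E: "E = J * P" and PJ: "P * J = I k"
  by (rule mat_split_idem[OF EE dE])
 have EJ: "E * J = J" "P * E = P" by (simp_all add: E mat_ring PJ mult_eq_assoc[OF PJ])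
 \<comment> \<open>The multiplication of the corner algebra E A, read in the coordinates
   \<open>J\<close> and \<open>P\<close>; \<open>EmJ\<close> will say that products of elements of
   the corner stay in it.\<close>
 define m1 where "m1 = P * (m * kron J J)"
 define u1 where "u1 = P * u"
 have d1 [simp]: "nr m1 = k" "nc m1 = k * k" "nr u1 = k" "nc u1 = Suc 0" by (simp_all add: m1_def u1_def)
 have EmJ: "E * (m * kron J J) = m * kron J J" by (simp add: mult_eq_assoc[OF Em] kron_ring EJ)
 have Jm1: "J * m1 = m * kron J J" using EmJ by (simp add: m1_def E mat_ring)
 have "m1 * kron m1 (I k) = P * (m * kron (J * m1) J)" by (simp add: m1_def kron_ring)
 also have "... = P * ((m * kron m (I a)) * kron (kron J J) J)" by (simp add: Jm1 kron_ring)
 also have "... = P * (m * kron J (J * m1))" by (simp add: alg_assoc Jm1 mat_ring kron_assoc kron_mult)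
 also have "... = m1 * kron (I k) m1" by (simp add: m1_def kron_ring)
 finally have assoc1: "m1 * kron m1 (I k) = m1 * kron (I k) m1" .
 \<comment> \<open>E applied to 1 is the unit of the corner.\<close>
 have Eu: "m * kron (E * u) J = J" "m * kron J (E * u) = J"
 proof -
  have "m * kron (E * u) J = (m * kron E (I a)) * kron u J" by (simp add: kron_ring)
  also have "... = E * ((m * kron u (I a)) * J)"
   using kron_mult[of u "I (Suc 0)" "I a" J] by (simp add: mat_ring kron_one_left flip: Em)
  finally show "m * kron (E * u) J = J" by (simp add: alg_unit_left mat_ring EJ)
  have "m * kron J (E * u) = (m * kron (I a) E) * kron J u" by (simp add: kron_ring)
  also have "... = E * ((m * kron (I a) u) * J)" by (simp add: mat_ring kron_col_slide flip: mE)
  finally show "m * kron J (E * u) = J" by (simp add: alg_unit_right mat_ring EJ)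
 qed
 have Ju: "J * u1 = E * u" by (simp add: u1_def E mat_ring)
 have B: "mat_algebra k m1 u1"
 proof
  show "m1 * kron u1 (I k) = I k" "m1 * kron (I k) u1 = I k" by (simp_all add: m1_def kron_ring Ju Eu PJ)
 qed (simp_all add: assoc1)
 interpret B: mat_algebra k m1 u1 by (rule B)
 interpret R: algebra_object vect_cat "vect_alg a m u" by (rule algebra_object_vect)
 interpret R1: algebra_object vect_cat "vect_alg k m1 u1" by (rule B.algebra_object_vect)
 interpret LM: linear_category "VM" by (rule R.linear_mod)
 interpret LN: linear_category B.VM by (rule R1.linear_mod)
 have Ssub: "S \<subseteq> Obj VM" by (auto simp: S_def)
 interpret LS: linear_category "full_sub VM S" by (rule LM.full_sub_linear[OF Ssub])
 have S1: "N : S \<longleftrightarrow> (\<exists>n r. N = vmod n r \<and> umod n r \<and> r * kron (I n) (E * u) = I n)" for N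
  unfolding S_def using ev by (auto simp: vect_mod_obj vect_mod_simps)
 have S2: "r * kron (I n) E = r" if "umod n r" "r * kron (I n) (E * u) = I n" for n r
  using ek[OF that(1)] umodD(1)[OF that(1)] by (simp add: that(2) mat_ring)
 \<comment> \<open>Restriction of the action to the corner. On the modules in \<open>S\<close> the
   action factors through E by \<open>S2\<close>, so the module maps remain the same.\<close>
 define Fo :: "nat \<times> nat \<times> nat \<times> complex mat => nat \<times> nat \<times> nat \<times> complex mat" where "Fo = (\<lambda>(n, p, q, r). (n, n * k, n, r * kron (I n) J))"
 define Fa where "Fa = (\<lambda>(p, q, f :: nat \<times> nat \<times> complex mat). (Fo p, Fo q, f))"
 have Fo [simp]: "Fo (vmod n r) = B.vmod n (r * kron (I n) J)" for n r by (simp add: Fo_def)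
 have Fa [simp]: "Fa (p, q, f) = (Fo p, Fo q, f)" for p q f by (simp add: Fa_def)
 have um: "B.umod n (r * kron (I n) J)" if r: "umod n r" "r * kron (I n) (E * u) = I n" for n r
 proof -
  note [simp] = umodD(1,2)[OF r(1)]
  have "(r * kron (I n) J) * kron (r * kron (I n) J) (I k) = r * kron r J * kron (kron (I n) J) (I k)"
   by (simp add: kron_ring)
  also have "... = (r * kron r (I a)) * kron (I n) (kron J J)" by (simp add: kron_ring kron_assoc[symmetric])
  also have "... = (r * kron (I n) J) * kron (I n) m1" by (simp add: umodD(3)[OF r(1)] kron_ring Jm1)
  finally show ?thesis using r(2) by (simp add: B.umod_def kron_ring Ju)
 qed
 have lin: "ulin n r n' r' f \<longleftrightarrow> B.ulin n (r * kron (I n) J) n' (r' * kron (I n') J) f"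
  if r: "umod n r" "r * kron (I n) (E * u) = I n" and r': "umod n' r'" "r' * kron (I n') (E * u) = I n'" for n r n' r' f
 proof
  note [simp] = umodD(1,2)[OF r(1)] umodD(1,2)[OF r'(1)]
  { assume f: "ulin n r n' r' f"
   note [simp] = ulinD(1,2)[OF f]
   have "f * (r * kron (I n) J) = (f * r) * kron (I n) J" by (simp add: mat_ring)
   thus "B.ulin n (r * kron (I n) J) n' (r' * kron (I n') J) f"
    by (simp add: B.ulin_def ulinD(3)[OF f] kron_ring) }
  { assume f: "B.ulin n (r * kron (I n) J) n' (r' * kron (I n') J) f"
   note [simp] = B.ulinD(1,2)[OF f]
   have "f * r = f * (r * kron (I n) J) * kron (I n) P" by (simp add: kron_ring S2[OF r] flip: E)
   also have "... = (r' * kron (I n') E) * kron f (I a)" by (simp add: B.ulinD(3)[OF f] kron_ring E)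
   finally show "ulin n r n' r' f" by (simp add: ulin_def S2[OF r']) }
 qed
 have Farr: "Fa h : Arr (B.VM) \<and> Dom (B.VM) (Fa h) = Fo (Dom VM h)
   \<and> Cod (B.VM) (Fa h) = Fo (Cod VM h)" if "h : Arr (full_sub VM S)" for h
  using that um lin by (auto simp: vect_mod_arr B.vect_mod_arr vect_mod_simps B.vect_mod_simps S1)
 have "linear_functor (full_sub VM S) (B.VM) Fo Fa"
 proof (rule linear_functorI[OF LS.linear_category_axioms LN.linear_category_axioms], goal_cases)
  case (1 X) thus ?case using um by (auto simp: S1 B.vect_mod_obj)
 next
  case (2 X) thus ?case by (auto simp: S1 vect_mod_simps B.vect_mod_simps)
 next
  case (3 f) thus ?case using Farr by blast
 next
  case (4 f) thus ?case using Farr[of f] by simp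
 next
  case (5 f) thus ?case using Farr[of f] by simp
 next
  case (6 f g) thus ?case by (auto simp: vect_mod_arr vect_mod_simps B.vect_mod_simps)
 next
  case (7 f g) thus ?case by (auto simp: vect_mod_arr vect_mod_simps B.vect_mod_simps)
 next
  case (8 f c) thus ?case by (auto simp: vect_mod_arr vect_mod_simps B.vect_mod_simps)
 qed
 moreover have "bij_betw Fa (Hom (full_sub VM S) X Y) (Hom (B.VM) (Fo X) (Fo Y))"
  if XY: "X : S" "Y : S" for X Y
 proof -
  obtain n r where [simp]: "X = vmod n r" and r: "umod n r" "r * kron (I n) (E * u) = I n"
   using XY(1)[unfolded S1] by blast
  obtain n' r' where [simp]: "Y = vmod n' r'" and r': "umod n' r'" "r' * kron (I n') (E * u) = I n'"
   using XY(2)[unfolded S1] by blast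
  have H1: "h : Hom (full_sub VM S) X Y \<longleftrightarrow> (\<exists>f. h = (X, Y, (n, n', f)) \<and> ulin n r n' r' f)" for h
   using XY r(1) r'(1) by (auto simp: Hom_iff vect_mod_arr vect_mod_simps)
  have H2: "h : Hom (B.VM) (Fo X) (Fo Y) \<longleftrightarrow>
    (\<exists>f. h = (Fo X, Fo Y, (n, n', f)) \<and> B.ulin n (r * kron (I n) J) n' (r' * kron (I n') J) f)" for h
   using um[OF r] um[OF r'] by (auto simp: Hom_iff B.vect_mod_arr B.vect_mod_simps)
  show ?thesis unfolding bij_betw_def
  proof (intro conjI)
   show "inj_on Fa (Hom (full_sub VM S) X Y)" unfolding inj_on_def using H1 by auto
   show "Fa ` Hom (full_sub VM S) X Y = Hom (B.VM) (Fo X) (Fo Y)"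
    unfolding set_eq_iff image_iff Bex_def H1 H2 using lin[OF r r'] by auto
  qed
 qed
 moreover have "\<exists>X\<in>S. \<exists>f. iso_arr (B.VM) (Fo X) N f"
  if N: "N : Obj (B.VM)" for N
 proof -
  obtain n s where Ns: "N = B.vmod n s" and s: "B.umod n s" using N B.vect_mod_obj by blast
  note [simp] = B.umodD(1,2)[OF s]
  \<comment> \<open>Conversely, a module over the corner becomes one over the whole algebra through
    the projection \<open>P\<close>.\<close>
  define r where "r = s * kron (I n) P"
  have [simp]: "nr r = n" "nc r = n * a" by (simp_all add: r_def)
  have PmEE: "P * (m * kron E E) = P * m"
  proof -
   have "P * (m * kron E E) = P * ((m * kron E (I a)) * kron (I a) E)" by (simp add: kron_ring)
   also have "... = (P * E) * (m * kron (I a) E)" by (simp add: mat_ring flip: Em)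
   also have "... = (P * E) * m" by (simp add: EJ(2), simp add: mult_eq_assoc[OF EJ(2)] flip: mE)
   finally show ?thesis by (simp add: EJ)
  qed
  have m1PP: "m1 * kron P P = P * m" using PmEE by (simp add: m1_def kron_ring E)
  have "r * kron r (I a) = s * (kron s P * kron (kron (I n) P) (I a))" by (simp add: r_def kron_ring)
  also have "... = (s * kron s (I k)) * kron (I n) (kron P P)" by (simp add: kron_ring kron_assoc[symmetric])
  also have "... = r * kron (I n) m" by (simp add: B.umodD(3)[OF s] r_def kron_ring m1PP)
  finally have "r * kron r (I a) = r * kron (I n) m" .
  moreover have "r * kron (I n) u = I n" using B.umodD(4)[OF s] by (simp add: r_def kron_ring u1_def)
  ultimately have r: "umod n r" by (simp add: umod_def)
  have "r * kron (I n) (E * u) = s * kron (I n) (P * E * u)" by (simp add: r_def kron_ring)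
  also have "... = I n" using B.umodD(4)[OF s] by (simp add: EJ u1_def)
  finally have rS: "vmod n r : S" using r S1 by blast
  have "Fo (vmod n r) = N" by (simp add: Ns r_def kron_ring PJ kron_one)
  thus ?thesis using LN.iso_arr_id[OF N] rS by metis
 qed
 ultimately have "ffes (full_sub VM S) (B.VM) Fo Fa" by (simp add: ffes_def)
 thus thesis by (rule that[OF algebra_in_vect[OF B]])
qed

lemma vect_split_idem: assumes "umod n r" "ulin n r n r e" "e * e = e"
 obtains k s i p where "umod k s" "ulin k s n r i" "ulin n r k s p" "p * i = I k" "i * p = e"
proof -
 obtain k s J P L Q where *: "umod k s" "ulin n r k s P" "ulin k s n r J" "e = J * P"
  "nr L = k" "nc L = n" "nr Q = n" "nc Q = k" "L * J = I k" "P * Q = I k" using ulin_image[OF assms(1,1,2)] .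
 note [simp] = *(5-8) ulinD(1,2)[OF *(2)] ulinD(1,2)[OF *(3)]
 have "P * J = I k" using idem_factors[OF assms(3)[unfolded *(4)] *(9,10)] by simp
 thus thesis using that *(1-4) by metis
qed

end

section \<open>Natural idempotents and direct sums\<close>

context linear_category
begin

definition splits where
 "splits X e Y i p \<longleftrightarrow> Y : Obj C \<and> i : Arr C \<and> Dom C i = Y \<and> Cod C i = X \<and> p : Arr C \<and> Dom C p = X \<and> Cod C p = Y \<and>
  Comp C p i = Id C Y \<and> Comp C i p = e"

text \<open>With \<open>biprods\<close>, the property of finite linear categories by which a natural
  idempotent decomposes them. Both hold for modules over an algebra and are reflected by
  equivalences.\<close>

definition split_idem where
 "split_idem \<longleftrightarrow> (\<forall>e \<in> Arr C. Dom C e = Cod C e \<and> Comp C e e = e \<longrightarrow> (\<exists>Y i p. splits (Dom C e) e Y i p))"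

definition biprod where
 "biprod X1 X2 Y i1 i2 p1 p2 \<longleftrightarrow> Y : Obj C \<and> i1 : Arr C \<and> Dom C i1 = X1 \<and> Cod C i1 = Y \<and> i2 : Arr C \<and> Dom C i2 = X2 \<and> Cod C i2 = Y \<and>
   p1 : Arr C \<and> Dom C p1 = Y \<and> Cod C p1 = X1 \<and> p2 : Arr C \<and> Dom C p2 = Y \<and> Cod C p2 = X2 \<and>
   Comp C p1 i1 = Id C X1 \<and> Comp C p2 i2 = Id C X2 \<and> Add C (Comp C i1 p1) (Comp C i2 p2) = Id C Y"

definition biprods where
 "biprods \<longleftrightarrow> (\<forall>X1 \<in> Obj C. \<forall>X2 \<in> Obj C. \<exists>Y i1 i2 p1 p2. biprod X1 X2 Y i1 i2 p1 p2)"

end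

context ff_functor
begin

lemma split_idem_reflect: assumes "D.split_idem" shows "C.split_idem" unfolding C.split_idem_def
proof (intro ballI impI)
 fix e assume "e : Arr C" "Dom C e = Cod C e \<and> Comp C e e = e"
 hence [simp]: "e : Arr C" "Cod C e = Dom C e" and ee: "Comp C e e = e" by auto
 have "Comp D (Fa e) (Fa e) = Fa e" using ee by (simp flip: F_comp)
 then obtain N i p where "D.splits (Fo (Dom C e)) (Fa e) N i p" using assms unfolding D.split_idem_def by force
 hence [simp]: "N : Obj D" "i : Arr D" "Dom D i = N" "Cod D i = Fo (Dom C e)" "p : Arr D" "Dom D p = Fo (Dom C e)" "Cod D p = N"
  and pi: "Comp D p i = Id D N" "Comp D i p = Fa e" by (auto simp: D.splits_def)
 note v = D.inv_arr[OF Go(2)[OF \<open>N : Obj D\<close>]]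
 note [simp] = v(1-3)
 obtain i' where [simp]: "i' : Arr C" "Dom C i' = Go N" "Cod C i' = Dom C e" and Fi: "Fa i' = Comp D i (eps N)"
  by (rule full[of "Comp D i (eps N)" "Go N" "Dom C e"]) simp_all
 obtain p' where [simp]: "p' : Arr C" "Dom C p' = Dom C e" "Cod C p' = Go N" and Fp: "Fa p' = Comp D (D.inv_arr (eps N)) p"
  by (rule full[of "Comp D (D.inv_arr (eps N)) p" "Dom C e" "Go N"]) simp_all
 have "Comp C p' i' = Id C (Go N)"
  by (rule faithful) (simp_all add: Fi Fp D.comp_assoc D.comp_eq_assoc[OF pi(1)] v(4))
 moreover have "Comp C i' p' = e" by (rule faithful) (simp_all add: Fi Fp D.comp_assoc D.comp_eq_assoc[OF v(5)] pi(2))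
 ultimately have "C.splits (Dom C e) e (Go N) i' p'" by (simp add: C.splits_def)
 thus "\<exists>Y i p. C.splits (Dom C e) e Y i p" by blast
qed

lemma biprods_reflect: assumes "D.biprods" shows "C.biprods" unfolding C.biprods_def
proof (intro ballI)
 fix X1 X2 assume [simp]: "X1 : Obj C" "X2 : Obj C"
 obtain N i1 i2 p1 p2 where "D.biprod (Fo X1) (Fo X2) N i1 i2 p1 p2"
  using assms unfolding D.biprods_def by (metis F_obj \<open>X1 : Obj C\<close> \<open>X2 : Obj C\<close>)
 hence [simp]: "N : Obj D" "i1 : Arr D" "Dom D i1 = Fo X1" "Cod D i1 = N" "i2 : Arr D" "Dom D i2 = Fo X2" "Cod D i2 = N"
   "p1 : Arr D" "Dom D p1 = N" "Cod D p1 = Fo X1" "p2 : Arr D" "Dom D p2 = N" "Cod D p2 = Fo X2"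
  and pi: "Comp D p1 i1 = Id D (Fo X1)" "Comp D p2 i2 = Id D (Fo X2)" "Add D (Comp D i1 p1) (Comp D i2 p2) = Id D N"
  by (auto simp: D.biprod_def)
 note v = D.inv_arr[OF Go(2)[OF \<open>N : Obj D\<close>]]
 define w where "w = D.inv_arr (eps N)"
 note [simp] = v(1-3)[folded w_def]
 obtain j1 where [simp]: "j1 : Arr C" "Dom C j1 = X1" "Cod C j1 = Go N" and J1: "Fa j1 = Comp D w i1"
  by (rule full[of "Comp D w i1" X1 "Go N"]) simp_all
 obtain j2 where [simp]: "j2 : Arr C" "Dom C j2 = X2" "Cod C j2 = Go N" and J2: "Fa j2 = Comp D w i2"
  by (rule full[of "Comp D w i2" X2 "Go N"]) simp_all
 obtain q1 where [simp]: "q1 : Arr C" "Dom C q1 = Go N" "Cod C q1 = X1" and Q1: "Fa q1 = Comp D p1 (eps N)"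
  by (rule full[of "Comp D p1 (eps N)" "Go N" X1]) simp_all
 obtain q2 where [simp]: "q2 : Arr C" "Dom C q2 = Go N" "Cod C q2 = X2" and Q2: "Fa q2 = Comp D p2 (eps N)"
  by (rule full[of "Comp D p2 (eps N)" "Go N" X2]) simp_all
 note ve = D.comp_eq_assoc[OF v(5)[folded w_def]]
 have "Comp C q1 j1 = Id C X1" by (rule faithful) (simp_all add: J1 Q1 D.comp_assoc ve pi)
 moreover have "Comp C q2 j2 = Id C X2" by (rule faithful) (simp_all add: J2 Q2 D.comp_assoc ve pi)
 moreover have "Add C (Comp C j1 q1) (Comp C j2 q2) = Id C (Go N)"
 proof (rule faithful)
  have "Fa (Add C (Comp C j1 q1) (Comp C j2 q2)) = Comp D w (Comp D (Add D (Comp D i1 p1) (Comp D i2 p2)) (eps N))"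
   by (simp add: F_add J1 J2 Q1 Q2 D.comp_assoc D.comp_add_left D.comp_add_right)
  thus "Fa (Add C (Comp C j1 q1) (Comp C j2 q2)) = Fa (Id C (Go N))" by (simp add: pi v(4)[folded w_def])
 qed simp_all
 ultimately have "C.biprod X1 X2 (Go N) j1 j2 q1 q2" by (simp add: C.biprod_def)
 thus "\<exists>Y i1 i2 p1 p2. C.biprod X1 X2 Y i1 i2 p1 p2" by blast
qed

end

lemma (in mat_algebra) vect_mod_props:
 "linear_category.split_idem VM"
 "linear_category.biprods VM"
proof -
 interpret R: algebra_object vect_cat "vect_alg a m u" by (rule algebra_object_vect)
 interpret L: linear_category "VM" by (rule R.linear_mod)
 note [simp] = vect_mod_simps
 have ob: "vmod n r : Obj VM" if "umod n r" for n r using that vect_mod_obj by blast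
 have ar: "(vmod n r, vmod n' r', (n, n', f)) : Arr VM"
  if "umod n r" "umod n' r'" "ulin n r n' r' f" for n r n' r' f using that vect_mod_arr by blast
 show "L.split_idem" unfolding L.split_idem_def
 proof (intro ballI impI)
  fix h assume h: "h : Arr VM"
   "Dom VM h = Cod VM h \<and>
    Comp VM h h = h"
  obtain n r n' r' f where he: "h = (vmod n r, vmod n' r', (n, n', f))" and um: "umod n r" "ulin n r n' r' f"
   using h(1) vect_mod_arr by blast
  have "n' = n" "r' = r" and ff: "f * f = f" using h(2) by (simp_all add: he)
  hence f: "ulin n r n r f" and he: "h = (vmod n r, vmod n r, (n, n, f))" using um he by simp_all
  obtain k s i p where *: "umod k s" "ulin k s n r i" "ulin n r k s p" "p * i = I k" "i * p = f"
   using vect_split_idem[OF um(1) f ff] .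
  have "L.splits (vmod n r) h (vmod k s) (vmod k s, vmod n r, (k, n, i)) (vmod n r, vmod k s, (n, k, p))"
   unfolding L.splits_def using ob[OF *(1)] ar[OF *(1) um(1) *(2)] ar[OF um(1) *(1) *(3)] *(4,5) by (simp add: he)
  moreover have "Dom VM h = vmod n r" by (simp add: he)
  ultimately show "\<exists>Y i p. L.splits (Dom VM h) h Y i p" by metis
 qed
 show "L.biprods" unfolding L.biprods_def
 proof (intro ballI)
  fix X1 X2 assume "X1 : Obj VM" "X2 : Obj VM"
  then obtain n r n' r' where X: "X1 = vmod n r" "X2 = vmod n' r'" and r: "umod n r" "umod n' r'"
   using vect_mod_obj by metis
  note sa = sum_act[OF r]
  define s where "s = sum_act n r n' r'"
  have "L.biprod X1 X2 (vmod (n + n') s) (vmod n r, vmod (n + n') s, (n, n + n', inl_mat n n'))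
   (vmod n' r', vmod (n + n') s, (n', n + n', inr_mat n n')) (vmod (n + n') s, vmod n r, (n + n', n, prl_mat n n'))
   (vmod (n + n') s, vmod n' r', (n + n', n', prr_mat n n'))" unfolding L.biprod_def X
   using ob[OF sa(1)] ar[OF r(1) sa(1,2)] ar[OF r(2) sa(1,3)] ar[OF sa(1) r(1) sa(4)] ar[OF sa(1) r(2) sa(5)]
   by (simp add: s_def)
  thus "\<exists>Y i1 i2 p1 p2. L.biprod X1 X2 Y i1 i2 p1 p2" by blast
 qed
qed

text \<open>Everything is transported from modules over an algebra. The last claim ensures that the
  summands cut out by an idempotent are finite, as \<open>left_module_category\<close> demands of
  them in \<open>indecomposable\<close>.\<close>

lemma finite_linear_category_props: assumes "finite_linear_category M"
 shows "linear_category M" "linear_category.split_idem M" "linear_category.biprods M"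
  "linear_category.nat_idem M E ==> finite_linear_category (full_sub M {X : Obj M. E X = Id M X})"
proof -
 obtain R where M: "linear_category M" and "algebra_in vect_cat R" and eq: "linear_equivalent M (mod_lincat vect_cat R)"
  using assms unfolding finite_linear_category_def by blast
 then obtain a m u where R: "R = vect_alg a m u" and A: "mat_algebra a m u" by (auto elim: algebra_in_vectE)
 interpret A: mat_algebra a m u by fact
 interpret R: algebra_object vect_cat "vect_alg a m u" by (rule A.algebra_object_vect)
 interpret M: linear_category M by fact
 have L: "linear_category A.VM" by (rule R.linear_mod)
 then interpret L: linear_category "A.VM" .
 obtain Fo Fa where F: "ffes M A.VM Fo Fa" using eq linear_equivalent_iff[OF M L] unfolding R by blast
 interpret F: ff_functor M "A.VM" Fo Fa by (rule ff_functorI[OF M L F])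
 show "linear_category M" by fact
 show "M.split_idem" by (rule F.split_idem_reflect[OF A.vect_mod_props(1)])
 show "M.biprods" by (rule F.biprods_reflect[OF A.vect_mod_props(2)])
 assume E: "M.nat_idem E"
 obtain e where e: "L.nat_idem e" and Fe: "\<And>X. X : Obj M ==> e (Fo X) = Fa (E X)" using F.push_nat_idem[OF E] by metis
 define S where "S = {X : Obj M. E X = Id M X}"
 define S' where "S' = {N : Obj A.VM. e N = Id A.VM N}"
 obtain R1 Go Ga where R1: "algebra_in vect_cat R1" and G: "ffes (full_sub A.VM S') (mod_lincat vect_cat R1) Go Ga"
  using A.full_sub_nat_idem[OF e] unfolding S'_def .
 have S: "S \<subseteq> Obj M" "S' \<subseteq> Obj A.VM" by (auto simp: S_def S'_def)
 note [simp] = M.nat_idemD(1-3)[OF E]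
 have SS: "X : S \<longleftrightarrow> Fo X : S'" if [simp]: "X : Obj M" for X
 proof -
  have "Fa (E X) = Fa (Id M X) \<longleftrightarrow> E X = Id M X" by (rule iffI, rule F.faithful) simp_all
  thus ?thesis by (simp add: S_def S'_def Fe)
 qed
 have F': "ffes (full_sub M S) (full_sub A.VM S') Fo Fa"
 proof (rule F.ffes_full_sub[OF S SS])
  fix X N f assume "X : Obj M" "N : S'" "iso_arr A.VM (Fo X) N f"
  thus "Fo X : S'" using L.nat_idem_iso[OF e] by (simp add: S'_def)
 qed
 have l1: "linear_category (full_sub M S)" by (rule M.full_sub_linear[OF S(1)])
 have l2: "linear_category (full_sub A.VM S')" by (rule L.full_sub_linear[OF S(2)])
 have l3: "linear_category (mod_lincat vect_cat R1)"
  by (rule algebra_object.linear_mod) (simp add: algebra_object_def algebra_object_axioms_def vect.monoidal R1)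
 have "linear_equivalent (full_sub M S) (mod_lincat vect_cat R1)"
  using ffes_comp[OF l1 l2 l3 F' G] linear_equivalent_iff[OF l1 l3] by blast
 thus "finite_linear_category (full_sub M {X : Obj M. E X = Id M X})"
  unfolding finite_linear_category_def using l1 R1 by (auto simp: S_def)
qed

lemma finite_linear_category_cong:
 assumes "finite_linear_category M" "linear_category M'" "ffes M' M Fo Fa" shows "finite_linear_category M'"
proof -
 obtain R where M: "linear_category M" and R: "algebra_in vect_cat R" and eq: "linear_equivalent M (mod_lincat vect_cat R)"
  using assms unfolding finite_linear_category_def by blast
 have l3: "linear_category (mod_lincat vect_cat R)"
  by (rule algebra_object.linear_mod) (simp add: algebra_object_def algebra_object_axioms_def vect.monoidal R)
 show ?thesis
  using ffes_comp[OF assms(2) M l3 assms(3)] eq linear_equivalent_iff[OF M l3] linear_equivalent_iff[OF assms(2) l3] assms(2) R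
  unfolding finite_linear_category_def by blast
qed

lemma full_sub_act [simp]:
 "ActO (full_sub M S) = ActO M" "ActA (full_sub M S) = ActA M" "Assoc (full_sub M S) = Assoc M" "Lunit (full_sub M S) = Lunit M"
 for M :: "('x, 'f, 'o, 'a) modcat" by (simp_all add: full_sub_def)

lemma full_sub_left_module_category:
 assumes M: "left_module_category C M" and S: "S \<subseteq> Obj M" and act: "\<And>X p. X : Obj C ==> p : S ==> ActO M X p : S"
  and C: "strict_monoidal_category C" and fin: "finite_linear_category (full_sub M S)"
 shows "left_module_category C (full_sub M S)"
proof -
 interpret C: strict_monoidal_category C by fact
 interpret M: left_module_category C M by fact
 interpret L: linear_category "full_sub M S" by (rule M.full_sub_linear[OF S])
 have H: "h : Hom (full_sub M S) p q \<longleftrightarrow> h : Hom M p q \<and> p : S \<and> q : S" for h p q by (auto simp: Hom_iff)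
 note o = subsetD[OF S]
 show ?thesis
 proof (unfold_locales, goal_cases)
  case 1 show ?case by (rule fin)
 next
  case (2 X m) thus ?case by (simp add: act)
 next
  case (3 f X Y h m n) thus ?case using M.ActA_Hom C.arr_objs by (auto simp: H Hom_iff act)
 next
  case (4 X m) thus ?case using M.ActA_Id o by simp
 next
  case (5 f X Y g Z h m n k p) thus ?case using M.ActA_Comp by (fastforce simp: H)
 next
  case (6 f X Y g h m n) thus ?case using M.ActA_Add_left by (fastforce simp: H)
 next
  case (7 f X Y h m n k) thus ?case using M.ActA_Add_right by (fastforce simp: H)
 next
  case (8 f X Y h m n c) thus ?case using M.ActA_Smult_left by (fastforce simp: H)
 next
  case (9 f X Y h m n c) thus ?case using M.ActA_Smult_right by (fastforce simp: H)
 next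
  case (10 X Y m) thus ?case using M.Assoc_iso o by (simp add: M.full_sub_iso[OF S] act C.TensO_Obj)
 next
  case (11 f X X' g Y Y' h m m') thus ?case using M.Assoc_natural by (fastforce simp: H)
 next
  case (12 m) thus ?case using M.Lunit_iso o by (simp add: M.full_sub_iso[OF S] act C.Unit_Obj)
 next
  case (13 h m m') thus ?case using M.Lunit_natural by (fastforce simp: H)
 next
  case (14 X Y Z m) thus ?case using M.pentagon o by simp
 next
  case (15 X m) thus ?case using M.triangle o by simp
 qed
qed

section \<open>Direct sum decompositions from idempotents compatible with the action\<close>

lemma direct_sum_simps [simp]:
 "Obj (Defs.direct_sum M N) = Obj M \<times> Obj N" "Arr (Defs.direct_sum M N) = Arr M \<times> Arr N"
 "Dom (Defs.direct_sum M N) (f, f') = (Dom M f, Dom N f')" "Cod (Defs.direct_sum M N) (f, f') = (Cod M f, Cod N f')"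
 "Id (Defs.direct_sum M N) (p, p') = (Id M p, Id N p')"
 "Comp (Defs.direct_sum M N) (g, g') (f, f') = (Comp M g f, Comp N g' f')"
 "Zero (Defs.direct_sum M N) (p, p') (q, q') = (Zero M p q, Zero N p' q')"
 "Add (Defs.direct_sum M N) (g, g') (f, f') = (Add M g f, Add N g' f')"
 "Smult (Defs.direct_sum M N) c (f, f') = (Smult M c f, Smult N c f')"
 "ActO (Defs.direct_sum M N) X (p, p') = (ActO M X p, ActO N X p')" "ActA (Defs.direct_sum M N) h (f, f') = (ActA M h f, ActA N h f')"
 "Assoc (Defs.direct_sum M N) X Y (p, p') = (Assoc M X Y p, Assoc N X Y p')" "Lunit (Defs.direct_sum M N) (p, p') = (Lunit M p, Lunit N p')"
 by (simp_all add: Defs.direct_sum_def)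

lemma iso_arr_direct_sum:
 "iso_arr (Defs.direct_sum M N) (p, p') (q, q') (f, f') \<longleftrightarrow> iso_arr M p q f \<and> iso_arr N p' q' f'"
 by (simp add: iso_arr_def Hom_iff Bex_def split_paired_Ex) blast

lemma direct_sum_module_category:
 assumes M: "module_category C M" and N: "module_category C N" shows "module_category C (Defs.direct_sum M N)"
proof -
 interpret M: module_category C M by fact
 interpret N: module_category C N by fact
 have L: "linear_category (Defs.direct_sum M N)"
  apply unfold_locales apply (auto simp: Hom_iff M.M.comp_assoc M.M.add_assoc M.M.add_zero M.M.add_inverse M.M.smult_one M.M.smult_smult
    M.M.smult_add_left M.M.smult_add_right M.M.comp_add_left M.M.comp_add_right M.M.comp_smult_left M.M.comp_smult_right
    N.M.comp_assoc N.M.add_assoc N.M.add_zero N.M.add_inverse N.M.smult_one N.M.smult_smult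
    N.M.smult_add_left N.M.smult_add_right N.M.comp_add_left N.M.comp_add_right N.M.comp_smult_left N.M.comp_smult_right
)
   apply (metis M.M.add_commute) apply (metis N.M.add_commute) done
 interpret L: linear_category "Defs.direct_sum M N" by (rule L)
 show ?thesis
  by unfold_locales (auto simp: M.act_comp N.act_comp iso_arr_direct_sum M.assoc_iso N.assoc_iso M.lunit_iso N.lunit_iso
    M.assoc_natural N.assoc_natural M.lunit_natural N.lunit_natural)
qed

lemma module_functor_pair:
 assumes M: "module_category C M" and N1: "module_category C N1" and N2: "module_category C N2"
  and F1: "module_functor C M N1 F1 a1 s1" and F2: "module_functor C M N2 F2 a2 s2"
 shows "module_functor C M (Defs.direct_sum N1 N2) (\<lambda>p. (F1 p, F2 p)) (\<lambda>f. (a1 f, a2 f)) (\<lambda>X p. (s1 X p, s2 X p))"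
proof -
 interpret F1: mod_functor C M N1 F1 a1 s1 by (rule mod_functorI[OF M N1 F1])
 interpret F2: mod_functor C M N2 F2 a2 s2 by (rule mod_functorI[OF M N2 F2])
 note D = direct_sum_module_category[OF N1 N2]
 have lf: "linear_functor M (Defs.direct_sum N1 N2) (\<lambda>p. (F1 p, F2 p)) (\<lambda>f. (a1 f, a2 f))"
  by (rule linear_functorI[OF module_category_linear[OF M] module_category_linear[OF D]])
   (simp_all add: F1.F_add F2.F_add F1.F_smult F2.F_smult)
 show ?thesis by (rule module_functorI[OF M D lf])
   (simp_all add: iso_arr_direct_sum F1.s_iso F2.s_iso F1.s_nat F2.s_nat F1.s_assoc F2.s_assoc F1.s_unit F2.s_unit)
qed

text \<open>When the idempotent commutes with the action, its fixed objects \<open>S\<close> form a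
  module subcategory, and chosen splittings of the idempotents give a module functor onto
  it.\<close>

locale act_idem = left_module_category C M for C :: "('x, 'f) moncat" and M :: "('x, 'f, 'o, 'a) modcat" +
 fixes E assumes mon: "strict_monoidal_category C" and nat: "nat_idem E"
  and act: "\<And>X p. X : Obj C ==> p : Obj M ==> E (ActO M X p) = ActA M (Id C X) (E p)"
begin

definition "S = {p : Obj M. E p = Id M p}"
definition sob where sob_eq: "sob p = (SOME q. \<exists>i r. splits p (E p) q i r)"
definition inc where inc_eq: "inc p = (SOME i. \<exists>r. splits p (E p) (sob p) i r)"
definition prj where prj_eq: "prj p = (SOME r. splits p (E p) (sob p) (inc p) r)"

sublocale MC: module_category C M by (rule left_imp_module_category[OF mon left_module_category_axioms])

lemmas Ed [simp] = nat_idemD(1-3)[OF nat]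

lemma splits: assumes "p : Obj M" shows "splits p (E p) (sob p) (inc p) (prj p)"
proof -
 have "\<exists>q i r. splits p (E p) q i r"
  using finite_linear_category_props(2)[OF finite_linear_category] nat_idemD(1-4)[OF nat] assms
  unfolding split_idem_def by metis
 from someI_ex[OF this] have "\<exists>i r. splits p (E p) (sob p) i r" unfolding sob_eq .
 from someI_ex[OF this] have "\<exists>r. splits p (E p) (sob p) (inc p) r" unfolding inc_eq .
 from someI_ex[OF this] show ?thesis unfolding prj_eq .
qed

lemma spl [simp]: assumes "p : Obj M"
 shows "sob p : Obj M" "inc p : Arr M" "Dom M (inc p) = sob p" "Cod M (inc p) = p"
  "prj p : Arr M" "Dom M (prj p) = p" "Cod M (prj p) = sob p" using splits[OF assms] by (simp_all add: splits_def)

lemma spl_eq: assumes "p : Obj M" shows "Comp M (prj p) (inc p) = Id M (sob p)" "Comp M (inc p) (prj p) = E p"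
 using splits[OF assms] by (simp_all add: splits_def)

lemma E_inj: assumes [simp]: "p : Obj M" shows "Comp M (E p) (inc p) = inc p" "Comp M (prj p) (E p) = prj p"
 by (simp_all add: spl_eq(2)[symmetric] comp_assoc spl_eq(1) comp_eq_assoc[OF spl_eq(1)])

lemma E_nat: "f : Arr M ==> Dom M f = p ==> Cod M f = q ==> Comp M f (E p) = Comp M (E q) f"
 using nat_idemD(5)[OF nat, of f] by simp

lemma sob_S [simp]: assumes [simp]: "p : Obj M" shows "sob p : S"
proof -
 have "E (sob p) = Comp M (Comp M (prj p) (inc p)) (E (sob p))" by (simp add: spl_eq(1))
 also have "... = Comp M (prj p) (Comp M (E p) (inc p))" using E_nat[of "inc p" "sob p" p] by (simp add: comp_assoc)
 also have "... = Id M (sob p)" by (simp add: E_inj spl_eq(1))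
 finally show ?thesis by (simp add: S_def)
qed

lemma S_sub: "S \<subseteq> Obj M" by (auto simp: S_def)
lemma S_obj [simp]: "p : S ==> p : Obj M" by (rule subsetD[OF S_sub])
lemma S_id: "p : S ==> E p = Id M p" unfolding S_def by blast

lemma act_S [simp]: assumes "X : Obj C" "p : S" shows "ActO M X p : S"
proof -
 have "E (ActO M X p) = ActA M (Id C X) (Id M p)"
  using act[OF assms(1) S_obj[OF assms(2)]] unfolding S_id[OF assms(2)] .
 also have "... = Id M (ActO M X p)" by (rule MC.act_id[OF assms(1) S_obj[OF assms(2)]])
 finally show ?thesis using MC.act_obj[OF assms(1) S_obj[OF assms(2)]] unfolding S_def by blast
qed

lemma sub_finite: "finite_linear_category (full_sub M S)"
 unfolding S_def by (rule finite_linear_category_props(4)[OF finite_linear_category nat])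

lemma sub_left: "left_module_category C (full_sub M S)"
 by (rule full_sub_left_module_category[OF left_module_category_axioms S_sub act_S mon sub_finite])

lemma sub_module_category: "module_category C (full_sub M S)" by (rule left_imp_module_category[OF mon sub_left])

text \<open>The effect on arrows of cutting objects down to the images of their idempotents;
  \<open>cut_act\<close> is the module constraint of this functor.\<close>

definition "crn f = Comp M (prj (Cod M f)) (Comp M f (inc (Dom M f)))"
definition "cut_act X p = Comp M (ActA M (Id C X) (prj p)) (inc (ActO M X p))"

lemma cut_arr [simp]: "f : Arr M ==> crn f : Arr M" "f : Arr M ==> Dom M (crn f) = sob (Dom M f)" "f : Arr M ==> Cod M (crn f) = sob (Cod M f)"
 by (simp_all add: crn_def)

lemma inj_cut: assumes [simp]: "f : Arr M" shows "Comp M (inc (Cod M f)) (crn f) = Comp M f (inc (Dom M f))"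
proof -
 have "Comp M (inc (Cod M f)) (crn f) = Comp M (Comp M (E (Cod M f)) f) (inc (Dom M f))"
  by (simp add: crn_def comp_eq_assoc[OF spl_eq(2)] comp_assoc)
 also have "... = Comp M f (inc (Dom M f))" by (simp add: E_nat[of f, symmetric] comp_assoc E_inj)
 finally show ?thesis .
qed

lemma cut_prj: assumes [simp]: "f : Arr M" shows "Comp M (crn f) (prj (Dom M f)) = Comp M (prj (Cod M f)) f"
proof -
 have "Comp M (crn f) (prj (Dom M f)) = Comp M (prj (Cod M f)) (Comp M f (E (Dom M f)))"
  by (simp add: crn_def spl_eq(2) comp_assoc)
 also have "... = Comp M (Comp M (prj (Cod M f)) (E (Cod M f))) f" by (simp add: E_nat[of f] comp_assoc)
 finally show ?thesis by (simp add: E_inj)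
qed

lemma cut_functor: "linear_functor M (full_sub M S) sob crn"
proof (rule linear_functorI[OF linear_category_axioms module_category_linear[OF sub_module_category]], goal_cases)
 case (2 X) thus ?case by (simp add: crn_def spl_eq(1))
next
 case (6 f g)
 hence "Comp M (crn g) (crn f) = Comp M (Comp M (crn g) (prj (Dom M g))) (Comp M f (inc (Dom M f)))"
  by (simp add: crn_def[of f] comp_assoc)
 thus ?case using 6 by (simp add: cut_prj) (simp add: crn_def comp_assoc)
next
 case (7 f g) thus ?case by (simp add: crn_def comp_add_left comp_add_right)
next
 case (8 f c) thus ?case by (simp add: crn_def comp_smult_left comp_smult_right)
qed simp_all

lemma cut_act_iso: assumes [simp]: "X : Obj C" "p : Obj M"
 shows "iso_arr M (sob (ActO M X p)) (ActO M X (sob p)) (cut_act X p)"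
proof -
 let ?g = "Comp M (prj (ActO M X p)) (ActA M (Id C X) (inc p))"
 let ?I = "ActA M (Id C X)"
 have "Comp M ?g (cut_act X p) = Comp M (prj (ActO M X p)) (Comp M (Comp M (?I (inc p)) (?I (prj p))) (inc (ActO M X p)))"
  by (simp add: cut_act_def comp_assoc)
 also have "Comp M (?I (inc p)) (?I (prj p)) = E (ActO M X p)" by (simp add: MC.act_id_comp spl_eq act)
 finally have 1: "Comp M ?g (cut_act X p) = Id M (sob (ActO M X p))" by (simp add: E_inj spl_eq)
 have "Comp M (cut_act X p) ?g = Comp M (?I (prj p)) (Comp M (E (ActO M X p)) (?I (inc p)))"
  by (simp add: cut_act_def comp_assoc comp_eq_assoc[OF spl_eq(2)])
 also have "... = Id M (ActO M X (sob p))" by (simp add: act MC.act_id_comp E_inj spl_eq)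
 finally show ?thesis using 1 by (intro iso_arrI[of _ ?g]) (simp_all add: cut_act_def)
qed

lemma cut_module_functor: "module_functor C M (full_sub M S) sob crn cut_act"
proof (rule module_functorI[OF MC.module_category_axioms sub_module_category cut_functor])
 fix X p assume "X : Obj C" "p : Obj M"
 thus "iso_arr (full_sub M S) (sob (ActO M X p)) (ActO (full_sub M S) X (sob p)) (cut_act X p)"
  using cut_act_iso by (simp add: full_sub_iso[OF S_sub])
next
 fix f h assume [simp]: "f : Arr C" "h : Arr M"
 have "Comp M (cut_act (Cod C f) (Cod M h)) (crn (ActA M f h)) =
   Comp M (ActA M (Id C (Cod C f)) (prj (Cod M h))) (Comp M (inc (Cod M (ActA M f h))) (crn (ActA M f h)))"
  by (simp add: cut_act_def comp_assoc)
 also have "... = Comp M (ActA M f (Comp M (prj (Cod M h)) h)) (inc (ActO M (Dom C f) (Dom M h)))"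
  by (subst inj_cut, simp, subst MC.act_split(1)) (simp_all add: comp_assoc)
 also have "Comp M (prj (Cod M h)) h = Comp M (crn h) (prj (Dom M h))" by (simp add: cut_prj)
 also have "Comp M (ActA M f ...) (inc (ActO M (Dom C f) (Dom M h))) = Comp M (ActA M f (crn h)) (cut_act (Dom C f) (Dom M h))"
  by (subst MC.act_split(2)) (simp_all add: cut_act_def comp_assoc)
 finally show "Comp (full_sub M S) (cut_act (Cod C f) (Cod M h)) (crn (ActA M f h)) =
    Comp (full_sub M S) (ActA (full_sub M S) f (crn h)) (cut_act (Dom C f) (Dom M h))" by simp
next
 fix X Y k assume [simp]: "X : Obj C" "Y : Obj C" "k : Obj M"
 let ?I = "\<lambda>X. ActA M (Id C X)"
 have "Comp M (Comp M (?I X (cut_act Y k)) (cut_act X (ActO M Y k))) (crn (Assoc M X Y k)) =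
   Comp M (?I X (cut_act Y k)) (Comp M (?I X (prj (ActO M Y k))) (Comp M (inc (Cod M (Assoc M X Y k))) (crn (Assoc M X Y k))))"
  by (simp add: cut_act_def comp_assoc)
 also have "... = Comp M (?I X (Comp M (cut_act Y k) (prj (ActO M Y k)))) (Comp M (Assoc M X Y k) (inc (ActO M (TensO C X Y) k)))"
  by (subst inj_cut, simp, subst MC.act_id_comp[symmetric]) (simp_all add: comp_assoc cut_act_iso[THEN iso_arrD(1)] cut_act_iso[THEN iso_arrD(2)])
 also have "Comp M (cut_act Y k) (prj (ActO M Y k)) = ?I Y (prj k)"
  by (simp add: cut_act_def comp_assoc spl_eq act MC.act_id_comp E_inj)
 also have "Comp M (?I X (?I Y (prj k))) (Comp M (Assoc M X Y k) (inc (ActO M (TensO C X Y) k))) =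
   Comp M (Assoc M X Y (sob k)) (cut_act (TensO C X Y) k)"
  using MC.assoc_natural_id[of X Y "prj k"] by (simp add: cut_act_def comp_assoc[symmetric])
 finally show "Comp (full_sub M S) (Assoc (full_sub M S) X Y (sob k)) (cut_act (TensO C X Y) k) =
   Comp (full_sub M S) (Comp (full_sub M S) (ActA (full_sub M S) (Id C X) (cut_act Y k)) (cut_act X (ActO M Y k))) (crn (Assoc M X Y k))"
  by simp
next
 fix k assume [simp]: "k : Obj M"
 have "Comp M (Lunit M (sob k)) (cut_act (Unit C) k) = Comp M (Comp M (prj k) (Lunit M k)) (inc (ActO M (Unit C) k))"
  using MC.lunit_natural[of "prj k"] by (simp add: cut_act_def comp_assoc[symmetric])
 thus "Comp (full_sub M S) (Lunit (full_sub M S) (sob k)) (cut_act (Unit C) k) = crn (Lunit M k)"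
  by (simp add: crn_def comp_assoc)
qed

lemma act_idem_compl: "act_idem C M (compl E)"
proof -
 have "compl E (ActO M X p) = ActA M (Id C X) (compl E p)" if [simp]: "X : Obj C" "p : Obj M" for X p
 proof -
  have "ActA M (Id C X) (compl E p) = Add M (ActA M (Id C X) (Id M p)) (ActA M (Id C X) (Smult M (- 1) (E p)))"
   unfolding compl_def by (rule ActA_Add_right[of _ X X _ p p]) (simp_all add: Hom_iff)
  also have "ActA M (Id C X) (Smult M (- 1) (E p)) = Smult M (- 1) (ActA M (Id C X) (E p))"
   by (rule ActA_Smult_right[of _ X X _ p p]) (simp_all add: Hom_iff)
  finally show ?thesis by (simp add: compl_def act)
 qed
 thus ?thesis by unfold_locales (simp_all add: mon nat_idem_compl[OF nat])
qed

end

text \<open>M is equivalent to the sum of the subcategories fixed by E and by 1 - E. The objects p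
  and q witness that neither of them is zero.\<close>

lemma act_idem_decomposes:
 fixes M :: "('x, 'f, 'o, 'a) modcat"
 assumes AI: "act_idem C M E" and p: "p : Obj M" "E p \<noteq> Zero M p p" and q: "q : Obj M" "E q \<noteq> Id M q"
 shows "\<not> indecomposable C M"
proof -
 interpret A: act_idem C M E by fact
 interpret B: act_idem C M "A.compl E" by (rule A.act_idem_compl)
 let ?M1 = "full_sub M A.S" and ?M2 = "full_sub M B.S"
 note D = direct_sum_module_category[OF A.sub_module_category B.sub_module_category]
 let ?Fo = "\<lambda>p. (A.sob p, B.sob p)" and ?Fa = "\<lambda>f. (A.crn f, B.crn f)"
 note cE = A.compl_arr[OF A.nat]
 have mf: "module_functor C M (Defs.direct_sum ?M1 ?M2) ?Fo ?Fa (\<lambda>X p. (A.cut_act X p, B.cut_act X p))"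
  by (rule module_functor_pair[OF A.MC.module_category_axioms A.sub_module_category B.sub_module_category A.cut_module_functor B.cut_module_functor])
 hence lf: "linear_functor M (Defs.direct_sum ?M1 ?M2) ?Fo ?Fa" by (simp add: module_functor_def)
 have AB: "Comp M (A.prj p) (B.inc p) = Zero M (B.sob p) (A.sob p)" "Comp M (B.prj p) (A.inc p) = Zero M (A.sob p) (B.sob p)"
  if [simp]: "p : Obj M" for p
 proof -
  have "Comp M (A.prj p) (B.inc p) = Comp M (Comp M (A.prj p) (E p)) (Comp M (A.compl E p) (B.inc p))"
   by (simp add: A.E_inj B.E_inj)
  also have "... = Comp M (A.prj p) (Comp M (Comp M (E p) (A.compl E p)) (B.inc p))" by (simp add: A.comp_assoc A.comp_eq_assoc[OF cE(5)] cE)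
  finally show "Comp M (A.prj p) (B.inc p) = Zero M (B.sob p) (A.sob p)"
   by (simp add: cE A.comp_zero_left A.comp_zero_right)
  have "Comp M (B.prj p) (A.inc p) = Comp M (Comp M (B.prj p) (A.compl E p)) (Comp M (E p) (A.inc p))"
   by (simp add: A.E_inj B.E_inj)
  also have "... = Comp M (B.prj p) (Comp M (Comp M (A.compl E p) (E p)) (A.inc p))" by (simp add: A.comp_assoc A.comp_eq_assoc[OF cE(4)] cE)
  finally show "Comp M (B.prj p) (A.inc p) = Zero M (A.sob p) (B.sob p)"
   by (simp add: cE A.comp_zero_left A.comp_zero_right)
 qed
 have one: "Add M (Comp M (A.inc p) (A.prj p)) (Comp M (B.inc p) (B.prj p)) = Id M p" if "p : Obj M" for p
  using cE(7)[OF that] by (simp add: A.spl_eq[OF that] B.spl_eq[OF that])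
 have bij: "bij_betw ?Fa (Hom M r s) (Hom (Defs.direct_sum ?M1 ?M2) (?Fo r) (?Fo s))" if [simp]: "r : Obj M" "s : Obj M" for r s
  unfolding bij_betw_def
 proof (intro conjI)
  show "inj_on ?Fa (Hom M r s)"
  proof (rule inj_onI)
   fix f g assume "f : Hom M r s" "g : Hom M r s" and eq: "?Fa f = ?Fa g"
   hence [simp]: "f : Arr M" "Dom M f = r" "Cod M f = s" "g : Arr M" "Dom M g = r" "Cod M g = s" by (auto simp: Hom_iff)
   have "Comp M f (A.inc r) = Comp M g (A.inc r)" using A.inj_cut[of f] A.inj_cut[of g] eq by simp
   moreover have "Comp M f (B.inc r) = Comp M g (B.inc r)" using B.inj_cut[of f] B.inj_cut[of g] eq by simp
   moreover have "h = Add M (Comp M (Comp M h (A.inc r)) (A.prj r)) (Comp M (Comp M h (B.inc r)) (B.prj r))"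
    if [simp]: "h : Arr M" "Dom M h = r" for h
   proof -
    have "h = Comp M h (Add M (Comp M (A.inc r) (A.prj r)) (Comp M (B.inc r) (B.prj r)))" by (simp add: one)
    thus ?thesis by (simp add: A.comp_add_right A.comp_assoc)
   qed
   ultimately show "f = g" by (metis \<open>f : Arr M\<close> \<open>Dom M f = r\<close> \<open>g : Arr M\<close> \<open>Dom M g = r\<close>)
  qed
  have "h : ?Fa ` Hom M r s" if "h : Hom (Defs.direct_sum ?M1 ?M2) (?Fo r) (?Fo s)" for h
  proof -
   obtain x y where h: "h = (x, y)" by (cases h)
   have [simp]: "x : Arr M" "Dom M x = A.sob r" "Cod M x = A.sob s" "y : Arr M" "Dom M y = B.sob r" "Cod M y = B.sob s"
    using that by (auto simp: h Hom_iff)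
   \<comment> \<open>The block diagonal arrow with corners x and y; the relations \<open>AB\<close>
     remove the mixed terms from its corners.\<close>
   define f where "f = Add M (Comp M (A.inc s) (Comp M x (A.prj r))) (Comp M (B.inc s) (Comp M y (B.prj r)))"
   have [simp]: "f : Arr M" "Dom M f = r" "Cod M f = s" by (simp_all add: f_def)
   have "A.crn f = x"
    by (simp add: A.crn_def, simp add: f_def A.comp_add_left A.comp_add_right A.comp_assoc A.spl_eq AB
      A.comp_eq_assoc[OF A.spl_eq(1)] A.comp_eq_assoc[OF AB(1)] A.comp_zero_left A.comp_zero_right A.add_zero)
   moreover have "B.crn f = y"
    by (simp add: B.crn_def, simp add: f_def A.comp_add_left A.comp_add_right A.comp_assoc B.spl_eq AB
      A.comp_eq_assoc[OF B.spl_eq(1)] A.comp_eq_assoc[OF AB(2)] A.comp_zero_left A.comp_zero_right A.zero_add)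
   ultimately show ?thesis by (intro image_eqI[of _ _ f]) (simp_all add: h Hom_iff)
  qed
  thus "?Fa ` Hom M r s = Hom (Defs.direct_sum ?M1 ?M2) (?Fo r) (?Fo s)" by (auto simp: Hom_iff)
 qed
 have es: "\<exists>r\<in>Obj M. \<exists>f. iso_arr (Defs.direct_sum ?M1 ?M2) (?Fo r) n f" if "n : Obj (Defs.direct_sum ?M1 ?M2)" for n
 proof -
  obtain n1 n2 where n: "n = (n1, n2)" by (cases n)
  have n1: "n1 : A.S" "n2 : B.S" using that by (simp_all add: n)
  hence [simp]: "n1 : Obj M" "n2 : Obj M" by simp_all
  \<comment> \<open>A pair is reached from the biproduct of its entries: E is 1 on \<open>n1\<close>
    and 0 on \<open>n2\<close>, so E and its complement cut the biproduct into \<open>n1\<close> and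
    \<open>n2\<close>.\<close>
  obtain r i1 i2 p1 p2 where "A.biprod n1 n2 r i1 i2 p1 p2"
   using finite_linear_category_props(3)[OF A.finite_linear_category] unfolding A.biprods_def by (metis \<open>n1 : Obj M\<close> \<open>n2 : Obj M\<close>)
  hence [simp]: "r : Obj M" "i1 : Arr M" "Dom M i1 = n1" "Cod M i1 = r" "i2 : Arr M" "Dom M i2 = n2" "Cod M i2 = r"
   "p1 : Arr M" "Dom M p1 = r" "Cod M p1 = n1" "p2 : Arr M" "Dom M p2 = r" "Cod M p2 = n2"
  and pi: "Comp M p1 i1 = Id M n1" "Comp M p2 i2 = Id M n2" "Add M (Comp M i1 p1) (Comp M i2 p2) = Id M r"
   by (auto simp: A.biprod_def)
  have z1: "A.compl E n1 = Zero M n1 n1" using A.S_id[OF n1(1)] A.add_inverse[of "Id M n1"] by (simp add: A.compl_def)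
  have z2: "E n2 = Zero M n2 n2" using B.S_id[OF n1(2)] cE(4)[of n2] by simp
  have ee: "Comp M (E r) i1 = i1" using A.E_nat[of i1 n1 r] A.S_id[OF n1(1)] by simp
  have ff: "Comp M (A.compl E r) i2 = i2" using B.E_nat[of i2 n2 r] B.S_id[OF n1(2)] by simp
  have p2A: "Comp M p2 (A.inc r) = Zero M (A.sob r) n2"
  proof -
   have "Comp M p2 (A.inc r) = Comp M (Comp M p2 (E r)) (A.inc r)" by (simp add: A.comp_assoc A.E_inj)
   also have "... = Zero M (A.sob r) n2" by (simp add: A.E_nat[of p2 r n2] z2 A.comp_zero_left)
   finally show ?thesis .
  qed
  have p1B: "Comp M p1 (B.inc r) = Zero M (B.sob r) n1"
  proof -
   have "Comp M p1 (B.inc r) = Comp M (Comp M p1 (A.compl E r)) (B.inc r)" by (simp add: A.comp_assoc B.E_inj cE)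
   also have "... = Zero M (B.sob r) n1" by (simp add: B.E_nat[of p1 r n1] z1 A.comp_zero_left)
   finally show ?thesis .
  qed
  have i1: "iso_arr M (A.sob r) n1 (Comp M p1 (A.inc r))"
  proof (rule A.iso_arrI[of _ "Comp M (A.prj r) i1"])
   have "Comp M (Comp M (A.prj r) i1) (Comp M p1 (A.inc r)) = Comp M (A.prj r) (Comp M (Add M (Comp M i1 p1) (Comp M i2 p2)) (A.inc r))"
    by (simp add: A.comp_assoc A.comp_add_left p2A A.comp_zero_right A.add_zero)
   thus "Comp M (Comp M (A.prj r) i1) (Comp M p1 (A.inc r)) = Id M (A.sob r)" by (simp add: pi A.spl_eq)
   show "Comp M (Comp M p1 (A.inc r)) (Comp M (A.prj r) i1) = Id M n1"
    by (simp add: A.comp_assoc A.comp_eq_assoc[OF A.spl_eq(2)] ee pi)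
  qed simp_all
  have i2: "iso_arr M (B.sob r) n2 (Comp M p2 (B.inc r))"
  proof (rule A.iso_arrI[of _ "Comp M (B.prj r) i2"])
   have "Comp M (Comp M (B.prj r) i2) (Comp M p2 (B.inc r)) = Comp M (B.prj r) (Comp M (Add M (Comp M i1 p1) (Comp M i2 p2)) (B.inc r))"
    by (simp add: A.comp_assoc A.comp_add_left p1B A.comp_zero_right A.zero_add)
   thus "Comp M (Comp M (B.prj r) i2) (Comp M p2 (B.inc r)) = Id M (B.sob r)" by (simp add: pi B.spl_eq)
   show "Comp M (Comp M p2 (B.inc r)) (Comp M (B.prj r) i2) = Id M n2"
    by (simp add: A.comp_assoc A.comp_eq_assoc[OF B.spl_eq(2)] ff pi)
  qed simp_all
  show ?thesis by (rule bexI[of _ r], rule exI[of _ "(Comp M p1 (A.inc r), Comp M p2 (B.inc r))"])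
    (simp_all add: n iso_arr_direct_sum A.full_sub_iso[OF A.S_sub] A.full_sub_iso[OF B.S_sub] i1 i2 n1)
 qed
 have "ffes M (Defs.direct_sum ?M1 ?M2) ?Fo ?Fa" using lf bij es by (simp add: ffes_def)
 hence eq: "module_equivalent C M (Defs.direct_sum ?M1 ?M2)"
  using mod_functorI[OF A.MC.module_category_axioms D mf] module_equivalent_iff[OF A.MC.module_category_axioms D] by blast
 have n1: "nonzero_category ?M1"
 proof -
  have "Id M (A.sob p) \<noteq> Zero M (A.sob p) (A.sob p)"
  proof
   assume "Id M (A.sob p) = Zero M (A.sob p) (A.sob p)"
   hence "Comp M (A.inc p) (Comp M (Id M (A.sob p)) (A.prj p)) = Comp M (A.inc p) (Comp M (Zero M (A.sob p) (A.sob p)) (A.prj p))" by simp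
   thus False using p by (simp add: A.spl_eq A.comp_zero_left A.comp_zero_right)
  qed
  thus ?thesis using p(1) unfolding nonzero_category_def by (intro bexI[of _ "A.sob p"]) simp_all
 qed
 have n2: "nonzero_category ?M2"
 proof -
  have "Id M (B.sob q) \<noteq> Zero M (B.sob q) (B.sob q)"
  proof
   assume "Id M (B.sob q) = Zero M (B.sob q) (B.sob q)"
   hence "Comp M (B.inc q) (Comp M (Id M (B.sob q)) (B.prj q)) = Comp M (B.inc q) (Comp M (Zero M (B.sob q) (B.sob q)) (B.prj q))" by simp
   hence "A.compl E q = Zero M q q" using q by (simp add: B.spl_eq A.comp_zero_left A.comp_zero_right)
   thus False using cE(7)[OF q(1)] q by (simp add: A.add_zero)
  qed
  thus ?thesis using q(1) unfolding nonzero_category_def by (intro bexI[of _ "B.sob q"]) simp_all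
 qed
 show ?thesis unfolding indecomposable_def using A.sub_left B.sub_left n1 n2 eq by blast
qed

text \<open>The counterpart of \<open>eq_mat_by_blocks_col\<close> for the fast index: columns with
  equal remainder modulo k are compared.\<close>

lemma eq_mat_by_inner_col: assumes "nr A = nr B" "nc A = n * k" "nc B = n * k"
  and "\<And>i. i < k ==> A * kron (I n) (ecol k i) = B * kron (I n) (ecol k i)" shows "A = B"
proof -
 have idx: "(A * kron (I n) (ecol k i)) $$ (r, s) = A $$ (r, s * k + i)"
  if "i < k" "nc A = n * k" "r < nr A" "s < n" for A :: "complex mat" and i r s
 proof -
  have l: "s * k + i < n * k" using that by (intro mult_add_less)
  have "(A * kron (I n) (ecol k i)) $$ (r, s) = (\<Sum>p<n * k. A $$ (r, p) * kron (I n) (ecol k i) $$ (p, s))"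
   using that by (subst index_mult_mat_sum) auto
  also have "... = (\<Sum>p<n * k. if p = s * k + i then A $$ (r, p) else 0)"
  proof (rule sum.cong)
   fix p assume p: "p : {..<n * k}"
   have "p = s * k + i \<longleftrightarrow> p div k = s \<and> p mod k = i" using that(1) by (rule eq_mult_add_iff)
   thus "A $$ (r, p) * kron (I n) (ecol k i) $$ (p, s) = (if p = s * k + i then A $$ (r, p) else 0)"
    using p that div_mod_less[of p n k] by (auto simp: ecol_def)
  qed simp
  also have "... = A $$ (r, s * k + i)" using l by simp
  finally show ?thesis .
 qed
 show ?thesis
 proof (rule eq_matI)
  fix r j assume r: "r < nr B" and "j < nc B"
  hence j: "j div k < n" "j mod k < k" using assms(3) div_mod_less[of j n k] by auto
  have "A $$ (r, j div k * k + j mod k) = B $$ (r, j div k * k + j mod k)"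
   using idx[OF j(2) assms(2) _ j(1)] idx[OF j(2) assms(3) _ j(1)] r assms(1) assms(4)[OF j(2)] by metis
  thus "A $$ (r, j) = B $$ (r, j)" by simp
 qed (use assms(1-3) in auto)
qed

lemma kron_ecol: assumes "p < a" "q < b" shows "kron (ecol a p) (ecol b q) = ecol (a * b) (p * b + q)"
proof (rule eq_matI)
 fix i j assume "i < nr (ecol (a * b) (p * b + q))" "j < nc (ecol (a * b) (p * b + q))"
 hence ij: "i < a * b" "j = 0" by auto
 have "i = p * b + q \<longleftrightarrow> i div b = p \<and> i mod b = q" using assms(2) by (rule eq_mult_add_iff)
 thus "kron (ecol a p) (ecol b q) $$ (i, j) = ecol (a * b) (p * b + q) $$ (i, j)"
  using ij div_mod_less[of i a b] by (auto simp: ecol_def)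
qed auto

lemma eq_mat_by_inner_col2: assumes "nr A = nr B" "nc A = n * (a * b)" "nc B = n * (a * b)"
  and "\<And>p q. p < a ==> q < b ==> A * kron (I n) (kron (ecol a p) (ecol b q)) = B * kron (I n) (kron (ecol a p) (ecol b q))"
 shows "A = B"
proof (rule eq_mat_by_inner_col[OF assms(1-3)])
 fix i assume "i < a * b"
 hence "i div b < a" "i mod b < b" by (auto simp: div_mod_less)
 thus "A * kron (I n) (ecol (a * b) i) = B * kron (I n) (ecol (a * b) i)"
  using assms(4)[of "i div b" "i mod b"] by (simp add: kron_ecol)
qed

section \<open>Algebras with a monomial basis\<close>

text \<open>Algebras with basis vectors e_0, ..., e_(a-1), unit e_0 and products e_p e_q = w(p, q)
  e_s for s = t(p, q). The dual numbers, Sweedler's algebra and the Clifford algebra have this form,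
  and their laws become finite checks of indices.\<close>

locale monomial_algebra =
 fixes a :: nat and t :: "nat => nat => nat" and w :: "nat => nat => complex"
 assumes a_pos: "0 < a" and t_less: "p < a ==> q < a ==> t p q < a"
  and t_unit: "q < a ==> t 0 q = q \<and> t q 0 = q \<and> w 0 q = 1 \<and> w q 0 = 1"
  and t_assoc: "p < a ==> q < a ==> s < a ==> w p q * w (t p q) s = w q s * w p (t q s) \<and> t (t p q) s = t p (t q s)"
begin

definition mm :: "complex mat" where
 "mm = mat a (a * a) (\<lambda>(l, k). if l = t (k div a) (k mod a) then w (k div a) (k mod a) else 0)"

lemma dim_mm [simp]: "nr mm = a" "nc mm = a * a" by (simp_all add: mm_def)

lemma mm_ecol: assumes "p < a" "q < a" shows "mm * kron (ecol a p) (ecol a q) = w p q *s ecol a (t p q)"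
proof (rule eq_matI)
 fix i j assume "i < nr (w p q *s ecol a (t p q))" "j < nc (w p q *s ecol a (t p q))"
 hence ij: "i < a" "j = 0" by auto
 have "p * a + q < a * a" using assms by (intro mult_add_less)
 thus "(mm * kron (ecol a p) (ecol a q)) $$ (i, j) = (w p q *s ecol a (t p q)) $$ (i, j)"
  using ij assms by (simp add: kron_ecol del: index_mult_mat(1)) (simp add: mm_def ecol_def)
qed auto

sublocale mat_algebra a mm "ecol a 0"
proof
 show "mm * kron mm (I a) = mm * kron (I a) mm"
 proof (rule eq_mat_by_inner_col2[of _ _ a a a])
  show "nc (mm * kron mm (I a)) = a * (a * a)" by simp
  fix q s assume q: "q < a" "s < a"
  show "mm * kron mm (I a) * kron (I a) (kron (ecol a q) (ecol a s)) =
   mm * kron (I a) mm * kron (I a) (kron (ecol a q) (ecol a s))"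
  proof (rule eq_mat_by_inner_col[of _ _ 1 a])
   fix p assume p: "p < a"
   have "mm * kron mm (I a) * kron (I a) (kron (ecol a q) (ecol a s)) * ecol a p =
     mm * (kron mm (I a) * kron (kron (ecol a p) (ecol a q)) (ecol a s))"
    using kron_col_slide[of "kron (ecol a q) (ecol a s)" "ecol a p" a] by (simp add: mat_ring kron_assoc)
   also have "... = mm * kron (mm * kron (ecol a p) (ecol a q)) (ecol a s)" by (simp add: kron_ring)
   also have "... = (w p q * w (t p q) s) *s ecol a (t (t p q) s)"
    using p q t_less by (simp add: mm_ecol kron_smult_left mat_ring mult.commute)
   also have "... = mm * kron (ecol a p) (mm * kron (ecol a q) (ecol a s))"
    using p q t_less[of q s] t_assoc[of p q s] by (simp add: mm_ecol kron_smult_right mat_ring mult.commute)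
   also have "... = mm * (kron (I a) mm * kron (ecol a p) (kron (ecol a q) (ecol a s)))"
    by (simp add: kron_ring)
   also have "... = mm * kron (I a) mm * kron (I a) (kron (ecol a q) (ecol a s)) * ecol a p"
    using kron_col_slide[of "kron (ecol a q) (ecol a s)" "ecol a p" a] by (simp add: mat_ring)
   finally show "mm * kron mm (I a) * kron (I a) (kron (ecol a q) (ecol a s)) * kron (I 1) (ecol a p) =
    mm * kron (I a) mm * kron (I a) (kron (ecol a q) (ecol a s)) * kron (I 1) (ecol a p)" by (simp add: kron_one_left)
  qed (simp_all add: kron_one_left)
 qed simp_all
 show "mm * kron (ecol a 0) (I a) = I a"
 proof (rule eq_mat_by_inner_col[of _ _ 1 a])
  fix p assume p: "p < a"
  have "kron (ecol a 0) (I a) * ecol a p = kron (ecol a 0) (ecol a p)"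
   using kron_mult[of "ecol a 0" "I (Suc 0)" "I a" "ecol a p"] by (simp add: mat_ring kron_one_left)
  thus "mm * kron (ecol a 0) (I a) * kron (I 1) (ecol a p) = I a * kron (I 1) (ecol a p)"
   using mm_ecol[OF a_pos p] t_unit[OF p] by (simp add: mat_ring kron_one_left)
 qed simp_all
 show "mm * kron (I a) (ecol a 0) = I a"
 proof (rule eq_mat_by_inner_col[of _ _ 1 a])
  fix p assume p: "p < a"
  show "mm * kron (I a) (ecol a 0) * kron (I 1) (ecol a p) = I a * kron (I 1) (ecol a p)"
   using mm_ecol[OF p a_pos] t_unit[OF p] by (simp add: mat_ring kron_one_left kron_col_slide)
 qed simp_all
qed simp_all

text \<open>The right action in which e_p acts by \<open>\<rho> p\<close>; the fast column index
  belongs to the algebra.\<close>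

definition act_of :: "nat => (nat => complex mat) => complex mat" where
 "act_of n \<rho> = mat n (n * a) (\<lambda>(i, k). \<rho> (k mod a) $$ (i, k div a))"

lemma act_of [simp]: "nr (act_of n \<rho>) = n" "nc (act_of n \<rho>) = n * a" by (simp_all add: act_of_def)

lemma act_of_ecol: assumes "p < a" "nr (\<rho> p) = n" "nc (\<rho> p) = n"
 shows "act_of n \<rho> * kron (I n) (ecol a p) = \<rho> p"
proof (rule eq_mat_by_inner_col[of _ _ 1 n])
 fix s assume s: "s < n"
 have "kron (I n) (ecol a p) * ecol n s = ecol (n * a) (s * a + p)"
  using kron_ecol[OF s assms(1)] by (simp add: kron_col_slide)
 hence e: "act_of n \<rho> * kron (I n) (ecol a p) * ecol n s = act_of n \<rho> * ecol (n * a) (s * a + p)"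
  by (simp add: mat_ring)
 have l: "s * a + p < n * a" using s assms by (intro mult_add_less)
 have d: "(s * a + p) div a = s" "(s * a + p) mod a = p" using assms(1) by simp_all
 have "act_of n \<rho> * ecol (n * a) (s * a + p) = \<rho> p * ecol n s"
  using assms s l d by (intro eq_matI) (auto simp del: index_mult_mat(1), simp add: act_of_def)
 thus "act_of n \<rho> * kron (I n) (ecol a p) * kron (I 1) (ecol n s) = \<rho> p * kron (I 1) (ecol n s)"
  using e by (simp add: kron_one_left)
qed (use assms in simp_all)

lemma umod_comp: assumes "nr r = n" "nc r = n * a" "p < a" "q < a"
 shows "r * kron r (I a) * kron (I n) (kron (ecol a p) (ecol a q)) = (r * kron (I n) (ecol a q)) * (r * kron (I n) (ecol a p))"
  "r * kron (I n) mm * kron (I n) (kron (ecol a p) (ecol a q)) = w p q *s (r * kron (I n) (ecol a (t p q)))"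
proof -
 have "r * kron r (I a) * kron (I n) (kron (ecol a p) (ecol a q)) = r * kron (r * kron (I n) (ecol a p)) (ecol a q)"
  using assms by (simp add: kron_ring kron_assoc[symmetric])
 also have "... = r * (kron (I n) (ecol a q) * (r * kron (I n) (ecol a p)))"
  using assms by (subst kron_col_slide) simp_all
 finally show "r * kron r (I a) * kron (I n) (kron (ecol a p) (ecol a q)) = (r * kron (I n) (ecol a q)) * (r * kron (I n) (ecol a p))"
  using assms by (simp add: mat_ring)
 show "r * kron (I n) mm * kron (I n) (kron (ecol a p) (ecol a q)) = w p q *s (r * kron (I n) (ecol a (t p q)))"
  using assms by (simp add: kron_ring mm_ecol kron_smult_right)
qed

text \<open>Right modules reverse the order: acting by e_p and then by e_q is the matrix product
  with the operator of e_q on the left.\<close>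

lemma umod_iff: assumes "nr r = n" "nc r = n * a"
 shows "umod n r \<longleftrightarrow> r * kron (I n) (ecol a 0) = I n \<and> (\<forall>p<a. \<forall>q<a.
  (r * kron (I n) (ecol a q)) * (r * kron (I n) (ecol a p)) = w p q *s (r * kron (I n) (ecol a (t p q))))"
proof -
 have "r * kron r (I a) = r * kron (I n) mm \<longleftrightarrow> (\<forall>p<a. \<forall>q<a.
  (r * kron (I n) (ecol a q)) * (r * kron (I n) (ecol a p)) = w p q *s (r * kron (I n) (ecol a (t p q))))"
 proof
  assume "r * kron r (I a) = r * kron (I n) mm"
  thus "\<forall>p<a. \<forall>q<a. (r * kron (I n) (ecol a q)) * (r * kron (I n) (ecol a p)) = w p q *s (r * kron (I n) (ecol a (t p q)))"
   using umod_comp[OF assms] by metis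
 next
  assume *: "\<forall>p<a. \<forall>q<a. (r * kron (I n) (ecol a q)) * (r * kron (I n) (ecol a p)) = w p q *s (r * kron (I n) (ecol a (t p q)))"
  show "r * kron r (I a) = r * kron (I n) mm"
  proof (rule eq_mat_by_inner_col2[of _ _ n a a])
   fix p q assume "p < a" "q < a"
   thus "r * kron r (I a) * kron (I n) (kron (ecol a p) (ecol a q)) = r * kron (I n) mm * kron (I n) (kron (ecol a p) (ecol a q))"
    using umod_comp[OF assms] * by metis
  qed (simp_all add: assms)
 qed
 thus ?thesis using assms by (auto simp: umod_def)
qed

lemma ulin_iff: assumes "nr r = n" "nc r = n * a" "nr r' = n'" "nc r' = n' * a" "nr f = n'" "nc f = n"
 shows "ulin n r n' r' f \<longleftrightarrow> (\<forall>p<a. f * (r * kron (I n) (ecol a p)) = (r' * kron (I n') (ecol a p)) * f)"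
proof -
 have e: "r' * kron f (I a) * kron (I n) (ecol a p) = (r' * kron (I n') (ecol a p)) * f" for p
  using assms by (simp add: kron_ring kron_col_slide)
 have e': "f * r * kron (I n) (ecol a p) = f * (r * kron (I n) (ecol a p))" for p using assms by (simp add: mat_ring)
 show ?thesis
 proof
  assume "ulin n r n' r' f"
  hence "f * r = r' * kron f (I a)" by (rule ulinD(3))
  thus "\<forall>p<a. f * (r * kron (I n) (ecol a p)) = (r' * kron (I n') (ecol a p)) * f" using e e' by metis
 next
  assume *: "\<forall>p<a. f * (r * kron (I n) (ecol a p)) = (r' * kron (I n') (ecol a p)) * f"
  have "f * r = r' * kron f (I a)" by (rule eq_mat_by_inner_col[of _ _ n a]) (use assms * e e' in auto)
  thus "ulin n r n' r' f" using assms by (simp add: ulin_def)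
 qed
qed

text \<open>Objects are given by operators obeying the relations of the algebra, and
  \<open>act_of\<close> assembles them into modules; so the category is equivalent to a module
  category and hence finite.\<close>

lemma finite_rep_category:
 fixes rep :: "'o => nat => complex mat" assumes lin: "linear_category (mat_lincat Ob d P)"
  and dims: "\<And>X p. X : Ob ==> p < a ==> nr (rep X p) = d X \<and> nc (rep X p) = d X"
  and rep: "\<And>X. X : Ob ==> rep X 0 = I (d X)"
   "\<And>X p q. X : Ob ==> p < a ==> q < a ==> rep X q * rep X p = w p q *s rep X (t p q)"
  and hom: "\<And>X Y f. X : Ob ==> Y : Ob ==> nr f = d Y ==> nc f = d X ==>
   P X Y f \<longleftrightarrow> (\<forall>p<a. f * rep X p = rep Y p * f)"
  and surj: "\<And>n \<rho>. (\<And>p. p < a ==> nr (\<rho> p) = n \<and> nc (\<rho> p) = n) ==> \<rho> 0 = I n ==>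
   (\<And>p q. p < a ==> q < a ==> \<rho> q * \<rho> p = w p q *s \<rho> (t p q)) ==> \<exists>X\<in>Ob. d X = n \<and> (\<forall>p<a. rep X p = \<rho> p)"
 shows "finite_linear_category (mat_lincat Ob d P)"
proof -
 let ?R = "vect_alg a mm (ecol a 0)"
 interpret R: algebra_object vect_cat ?R by (rule algebra_object_vect)
 interpret L: linear_category "mod_lincat vect_cat ?R" by (rule R.linear_mod)
 interpret K: linear_category "mat_lincat Ob d P" by (rule lin)
 define r where "r X = act_of (d X) (rep X)" for X
 have rd [simp]: "nr (r X) = d X" "nc (r X) = d X * a" for X by (simp_all add: r_def)
 have re: "r X * kron (I (d X)) (ecol a p) = rep X p" if "X : Ob" "p < a" for X p
  unfolding r_def by (rule act_of_ecol) (use that dims in auto)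
 have um: "umod (d X) (r X)" if X: "X : Ob" for X
  unfolding umod_iff[OF rd] using re[OF X] rep(1)[OF X] rep(2)[OF X] t_less a_pos by simp
 have ul: "ulin (d X) (r X) (d Y) (r Y) f \<longleftrightarrow> P X Y f" if "X : Ob" "Y : Ob" "nr f = d Y" "nc f = d X" for X Y f
  unfolding ulin_iff[OF rd rd that(3,4)] hom[OF that] using re that by simp
 define Fo where "Fo X = vmod (d X) (r X)" for X
 define Fa where "Fa = (\<lambda>(X, Y, f :: complex mat). (Fo X, Fo Y, (d X, d Y, f)))"
 have Fa [simp]: "Fa (X, Y, f) = (Fo X, Fo Y, (d X, d Y, f))" for X Y f by (simp add: Fa_def)
 have ob: "Fo X : Obj (mod_lincat vect_cat ?R)" if "X : Ob" for X using um[OF that] vect_mod_obj by (auto simp: Fo_def)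
 have ar: "(Fo X, Fo Y, (d X, d Y, f)) : Arr (mod_lincat vect_cat ?R) \<longleftrightarrow> nr f = d Y \<and> nc f = d X \<and> P X Y f"
  if "X : Ob" "Y : Ob" for X Y f
  using um[OF that(1)] um[OF that(2)] ul[OF that, of f] ulinD[of "d X" "r X" "d Y" "r Y" f]
  by (auto simp: vect_mod_arr Fo_def)
 have "linear_functor (mat_lincat Ob d P) (mod_lincat vect_cat ?R) Fo Fa"
 proof (rule linear_functorI[OF lin L.linear_category_axioms], goal_cases)
  case (1 X) thus ?case by (simp add: ob)
 next
  case (2 X) thus ?case by (simp add: Fo_def vect_mod_simps)
 next
  case (3 f) thus ?case by (cases f) (auto simp: ar)
 next
  case (4 f) thus ?case by (cases f) (simp add: vect_mod_simps)
 next
  case (5 f) thus ?case by (cases f) (simp add: vect_mod_simps)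
 next
  case (6 f g) thus ?case by (cases f; cases g) (simp add: vect_mod_simps)
 next
  case (7 f g) thus ?case by (cases f; cases g) (simp add: vect_mod_simps)
 next
  case (8 f c) thus ?case by (cases f) (simp add: vect_mod_simps)
 qed
 moreover have "bij_betw Fa (Hom (mat_lincat Ob d P) X Y) (Hom (mod_lincat vect_cat ?R) (Fo X) (Fo Y))"
  if XY: "X : Obj (mat_lincat Ob d P)" "Y : Obj (mat_lincat Ob d P)" for X Y
 proof -
  have XY: "X : Ob" "Y : Ob" using XY by simp_all
  have H: "h : Hom (mod_lincat vect_cat ?R) (Fo X) (Fo Y) \<longleftrightarrow> (\<exists>f. h = (Fo X, Fo Y, (d X, d Y, f)) \<and> nr f = d Y \<and> nc f = d X \<and> P X Y f)" for h
  proof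
   assume h: "h : Hom (mod_lincat vect_cat ?R) (Fo X) (Fo Y)"
   then obtain n s n' s' f where hh: "h = (vmod n s, vmod n' s', (n, n', f))" unfolding Hom_iff using vect_mod_arr by blast
   hence "h = (Fo X, Fo Y, (d X, d Y, f))" using h by (simp add: Hom_iff vect_mod_simps Fo_def)
   thus "\<exists>f. h = (Fo X, Fo Y, (d X, d Y, f)) \<and> nr f = d Y \<and> nc f = d X \<and> P X Y f"
    using h ar[OF XY, of f] by (auto simp: Hom_iff)
  next
   assume "\<exists>f. h = (Fo X, Fo Y, (d X, d Y, f)) \<and> nr f = d Y \<and> nc f = d X \<and> P X Y f"
   thus "h : Hom (mod_lincat vect_cat ?R) (Fo X) (Fo Y)" using ar[OF XY] by (auto simp: Hom_iff vect_mod_simps)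
  qed
  show ?thesis unfolding bij_betw_def
  proof (intro conjI)
   show "inj_on Fa (Hom (mat_lincat Ob d P) X Y)" unfolding inj_on_def by (auto simp: Hom_iff)
   show "Fa ` Hom (mat_lincat Ob d P) X Y = Hom (mod_lincat vect_cat ?R) (Fo X) (Fo Y)"
    unfolding set_eq_iff image_iff Bex_def H using XY by (auto simp: Hom_iff)
  qed
 qed
 moreover have "\<exists>X\<in>Obj (mat_lincat Ob d P). \<exists>f. iso_arr (mod_lincat vect_cat ?R) (Fo X) N f"
  if N: "N : Obj (mod_lincat vect_cat ?R)" for N
 proof -
  obtain n s where Ns: "N = vmod n s" and s: "umod n s" using N vect_mod_obj by blast
  note sd = umodD(1,2)[OF s]
  note si = umod_iff[OF sd, THEN iffD1, OF s]
  have "\<exists>X\<in>Ob. d X = n \<and> (\<forall>p<a. rep X p = s * kron (I n) (ecol a p))"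
   by (rule surj) (use si sd in simp_all)
  then obtain X where X: "X : Ob" "d X = n" "\<And>p. p < a ==> rep X p = s * kron (I n) (ecol a p)" by blast
  have "r X = s"
  proof (rule eq_mat_by_inner_col[of _ _ n a])
   fix p assume "p < a"
   thus "r X * kron (I n) (ecol a p) = s * kron (I n) (ecol a p)" using re[OF X(1), of p] X(2) X(3)[of p] by simp
  qed (use X sd in simp_all)
  hence "Fo X = N" by (simp add: Fo_def Ns X)
  hence "\<exists>f. iso_arr (mod_lincat vect_cat ?R) (Fo X) N f" using L.iso_arr_id[OF N] by metis
  thus ?thesis using X(1) by (metis mat_lincat_simps(1))
 qed
 ultimately have "ffes (mat_lincat Ob d P) (mod_lincat vect_cat ?R) Fo Fa" by (simp add: ffes_def)
 hence "linear_equivalent (mat_lincat Ob d P) (mod_lincat vect_cat ?R)"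
  using linear_equivalent_iff[OF lin L.linear_category_axioms] by blast
 thus ?thesis unfolding finite_linear_category_def using lin algebra_in_vect[OF mat_algebra_axioms] by blast
qed

end

section \<open>The two concrete module categories and their finiteness\<close>

lemma less2_cases: "(p::nat) < 2 ==> p = 0 \<or> p = 1" by auto

lemma less4_cases: "(p::nat) < 4 ==> p = 0 \<or> p = 1 \<or> p = 2 \<or> p = 3" by auto

lemma all_less2: "(\<forall>p<2. Q p) \<longleftrightarrow> Q 0 \<and> Q (1::nat)" using less2_cases by auto

lemma all_less4: "(\<forall>p<4. Q p) \<longleftrightarrow> Q 0 \<and> Q 1 \<and> Q 2 \<and> Q (3::nat)"
 using less4_cases by auto

interpretation dual_numbers: monomial_algebra 2 "\<lambda>p q. (p + q) mod 2" "\<lambda>p q. if p = 1 \<and> q = 1 then 0 else 1"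
proof (standard, goal_cases)
 case (4 p q s)
 show ?case using less2_cases[OF 4(1)] less2_cases[OF 4(2)] less2_cases[OF 4(3)] by (elim disjE; hypsubst; simp)
next
 case (3 q)
 show ?case using less2_cases[OF 3] by (elim disjE; hypsubst; simp)
qed simp_all

text \<open>Index i + 2 j stands for g^i x^j. The weight is 0 when x^2 occurs and otherwise the sign
  of moving x past g, with products taken in the order that right modules require.\<close>

interpretation sweedler_basis: monomial_algebra 4 "\<lambda>p q. (p + q) mod 2 + 2 * ((p div 2 + q div 2) mod 2)"
  "\<lambda>p q. if 2 \<le> p \<and> 2 \<le> q then 0 else if odd p \<and> 2 \<le> q then - 1 else 1"
proof (standard, goal_cases)
 case (4 p q s)
 show ?case using less4_cases[OF 4(1)] less4_cases[OF 4(2)] less4_cases[OF 4(3)] by (elim disjE; hypsubst; simp)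
next
 case (2 p q)
 show ?case using less4_cases[OF 2(1)] less4_cases[OF 2(2)] by (elim disjE; hypsubst; simp)
next
 case (3 q)
 show ?case using less4_cases[OF 3] by (elim disjE; hypsubst; simp)
qed simp_all

lemma CM_D: assumes "X : CM" shows "nc X = nr X" "X * X = 0\<^sub>m (nr X) (nr X)"
 using assms by (auto simp: coideal_modules_def)

lemma CM_I: assumes "nr X = n" "nc X = n" "X * X = 0\<^sub>m n n" shows "X : CM"
 using assms by (auto simp: coideal_modules_def)

lemma coideal_linear: "linear_category (mat_lincat CM nr (\<lambda>X Y f. f * X = Y * f))"
proof (rule mat_lincat_linear, goal_cases)
 case (1 X)
 note [simp] = CM_D(1)[OF 1]
 show ?case by (simp add: mat_ring)
next
 case (2 X Y Z f g)
 note [simp] = CM_D(1)[OF 2(1)] CM_D(1)[OF 2(2)] CM_D(1)[OF 2(3)] 2(4-7)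
 show ?case by (simp add: mat_ring 2(8) mult_eq_assoc[OF 2(9)])
next
 case (3 X Y)
 note [simp] = CM_D(1)[OF 3(1)] CM_D(1)[OF 3(2)]
 show ?case by (simp add: mat_ring)
next
 case (4 X Y f g)
 note [simp] = CM_D(1)[OF 4(1)] CM_D(1)[OF 4(2)] 4(3-6)
 show ?case by (simp add: mat_ring 4(7,8))
next
 case (5 X Y f c)
 note [simp] = CM_D(1)[OF 5(1)] CM_D(1)[OF 5(2)] 5(3-4)
 show ?case by (simp add: mat_ring 5(5))
qed

lemma coideal_finite: "finite_linear_category (mat_lincat CM nr (\<lambda>X Y f. f * X = Y * f))"
proof (rule dual_numbers.finite_rep_category[where rep = "\<lambda>X p. if p = 0 then I (nr X) else X", OF coideal_linear], goal_cases)
 case (3 X p q) thus ?case using CM_D[OF 3(1)] less2_cases[OF 3(2)] less2_cases[OF 3(3)]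
  by (elim disjE; simp add: mat_ring zero_smult_mat)
next
 case (4 X Y f) thus ?case using CM_D[of X] CM_D[of Y] by (simp add: all_less2)
next
 case (5 n \<rho>)
 have d: "nr (\<rho> 1) = n" "nc (\<rho> 1) = n" using 5(1)[of 1] by simp_all
 have "\<rho> 1 * \<rho> 1 = 0\<^sub>m n n" using 5(3)[of 1 1] 5(2) by (simp add: zero_smult_mat)
 hence "\<rho> 1 : CM" using d by (intro CM_I)
 thus ?case using 5(2) d by (intro bexI[of _ "\<rho> 1"]) (simp_all add: all_less2)
qed (auto simp: CM_D)

lemma (in kron_category) mat_linear: "linear_category (mat_lincat Ob d P)"
 by (rule mat_lincat_linear) (rule P_id P_comp P_zero P_add P_smult; assumption)+

lemma sweedler_cat_finite: "finite_linear_category (mat_lincat SM sdim (\<lambda>V W f. f * fst V = fst W * f \<and> f * snd V = snd W * f))"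
proof (rule sweedler_basis.finite_rep_category[where rep = "\<lambda>(X, G) p. if p = 0 then I (nr X) else if p = 1 then G else if p = 2 then X else G * X", OF sw.mat_linear], goal_cases)
 case (1 V p) thus ?case by (cases V) (auto dest: SM_D)
next
 case (2 V) thus ?case by (cases V) auto
next
 case (3 V p q)
 obtain X G where V: "V = (X, G)" by (cases V)
 note VD = SM_D[OF 3(1)[unfolded V]]
 note [simp] = VD(1-3)
 have e: "X * G = (- 1) *s (G * X)" unfolding VD(6) by (simp add: mat_ring smult_smult_mat)
 show ?case using less4_cases[OF 3(2)] less4_cases[OF 3(3)] VD(4,5) by (elim disjE; simp add: V)
   (simp_all add: mat_ring e mult_eq_assoc[OF VD(5)] mult_eq_assoc[OF VD(4)] mult_eq_assoc[OF e] zero_smult_mat)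
next
 case (4 V W f)
 obtain X G where V: "V = (X, G)" by (cases V)
 obtain Y H where W: "W = (Y, H)" by (cases W)
 note [simp] = SM_D(1-3)[OF 4(1)[unfolded V]] SM_D(1-3)[OF 4(2)[unfolded W]] 4(3,4)[unfolded V W sdim_pair]
 have "f * (G * X) = H * Y * f" if "f * X = Y * f" "f * G = H * f"
  using that by (simp add: mat_ring mult_eq_assoc[OF that(2)])
 thus ?case by (auto simp add: all_less4 V W mat_ring)
next
 case (5 n \<rho>)
 let ?X = "\<rho> 2" and ?G = "\<rho> 1"
 have d: "nr ?X = n" "nc ?X = n" "nr ?G = n" "nc ?G = n" "nr (\<rho> 3) = n" "nc (\<rho> 3) = n" using 5(1) by simp_all
 have x: "?X * ?X = 0\<^sub>m n n" using 5(3)[of 2 2] 5(2) d by (simp add: zero_smult_mat)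
 have g: "?G * ?G = I n" using 5(3)[of 1 1] 5(2) d by (simp add: one_smult_mat)
 have 1: "?G * ?X = \<rho> 3" using 5(3)[of 2 1] d by (simp add: one_smult_mat numeral_3_eq_3)
 have 2: "?X * ?G = (- 1) *s \<rho> 3" using 5(3)[of 1 2] d by (simp add: numeral_3_eq_3)
 have "(?X, ?G) : SM"
  by (rule SM_I) (simp_all del: One_nat_def add: d x g 1 2 mat_ring smult_smult_mat)
 thus ?case using 5(2) d 1 by (intro bexI[of _ "(?X, ?G)"]) (simp_all del: One_nat_def add: all_less4)
qed

lemma finite_linear_category_eq: assumes "finite_linear_category C"
  and "Obj D = Obj C" "Arr D = Arr C" "Dom D = Dom C" "Cod D = Cod C" "Id D = Id C"
  "Comp D = Comp C" "Zero D = Zero C" "Add D = Add C" "Smult D = Smult C" shows "finite_linear_category D"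
proof -
 have C: "linear_category C" using assms(1) by (simp add: finite_linear_category_def)
 have D: "linear_category D" by (rule linear_category_cong[OF assms(2-) C])
 interpret linear_category C by (rule C)
 have "linear_functor D C id id" by (rule linear_functorI[OF D C]) (simp_all add: assms(2-))
 moreover have "Hom D = Hom C" by (intro ext) (simp add: Hom_def assms(2-))
 ultimately have "ffes D C id id" using iso_arr_id by (fastforce simp: ffes_def assms(2) bij_betw_def)
 thus ?thesis by (rule finite_linear_category_cong[OF assms(1) D])
qed

lemma V0_simps [simp]:
 "Obj V0 = Obj SC" "Arr V0 = Arr SC" "Dom V0 = Dom SC"
 "Cod V0 = Cod SC" "Id V0 = Id SC"
 "Comp V0 = Comp SC" "Zero V0 = Zero SC" "Add V0 = Add SC" "Smult V0 = Smult SC"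
 "ActO V0 = TensO SC" "ActA V0 = TensA SC"
 "Assoc V0 = (\<lambda>X Y Z. Id SC (TensO SC X (TensO SC Y Z)))" "Lunit V0 = Id SC"
 by (simp_all add: V0_def regular_modcat_def lincat.defs modcat.defs)

interpretation sw: strict_monoidal_category SC by (rule sw.monoidal)

lemma V0_left_module_category: "left_module_category SC V0"
proof (rule left_module_categoryI)
 show "module_category SC V0" unfolding V0_def by (rule regular_module_category[OF sw.monoidal])
 show "finite_linear_category V0" by (rule finite_linear_category_eq[OF sweedler_cat_finite])
   (simp_all only: V0_simps sw.C_def lincat.defs category.simps lincat.simps)
next
 fix X p assume Xp: "X : Obj SC" "p : Obj V0"
 hence "p : SM" by simp
 note e = sw.I_left[OF this, simplified]
 show "Comp V0 (ActA V0 (Id SC X) (Lunit V0 p)) (Assoc V0 X (Unit SC) p) = Id V0 (ActO V0 X p)"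
  using Xp by (simp add: e mat_ring kron_one sw.T_dim)
qed (auto simp: sw.Arr_C kron_add_left kron_add_right kron_smult_left kron_smult_right sw.T_assoc sw.T_obj mat_ring kron_one sw.T_dim sw.I_obj sw.I_left sw.I_right)

lemma S0_simps [simp]:
 "Obj S0 = CM"
 "(X, Y, f) : Arr S0 \<longleftrightarrow> X : CM \<and> Y : CM \<and> nr f = nr Y \<and> nc f = nr X \<and> f * X = Y * f"
 "Dom S0 (X, Y, f) = X" "Cod S0 (X, Y, f) = Y"
 "Id S0 X = (X, X, I (nr X))"
 "Comp S0 (Y', Z, g) (X, Y, f) = (X, Z, g * f)"
 "Zero S0 X Y = (X, Y, 0\<^sub>m (nr Y) (nr X))"
 "Add S0 (X, Y, f) (X', Y', f') = (X, Y, f + f')"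
 "Smult S0 c (X, Y, f) = (X, Y, c *s f)"
 "ActO S0 = coideal_act"
 "ActA S0 (V, W, f) (X, Y, h) = (coideal_act V X, coideal_act W Y, kron f h)"
 "Assoc S0 V W X = (coideal_act V (coideal_act W X), coideal_act V (coideal_act W X), I (nr (coideal_act V (coideal_act W X))))"
 "Lunit S0 X = (X, X, I (nr X))" by (auto simp: S0_def lincat.defs modcat.defs Let_def)

lemma S0_linear: "linear_category S0" by (rule linear_category_cong[OF _ _ _ _ _ _ _ _ _ coideal_linear])
  (simp_all only: S0_def lincat.defs category.simps lincat.simps)

lemma coideal_act_dim: "(X, G) : SM ==> nr (coideal_act (X, G) Y) = nr X * nr Y"
 by (simp add: coideal_act_def SM_D)

lemma coideal_act_obj: assumes "(X, G) : SM" "Y : CM" shows "coideal_act (X, G) Y : CM"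
proof -
 note VD = SM_D[OF assms(1)] and YD = CM_D[OF assms(2)]
 note [simp] = VD(1-3) YD(1)
 have 1: "kron X (I (nr Y)) * kron G Y = (- 1) *s (kron G Y * kron X (I (nr Y)))"
  by (simp add: kron_mult VD(6) kron_smult_left mat_ring)
 show ?thesis unfolding coideal_act_def by (rule CM_I[of _ "nr X * nr Y"])
   (simp_all add: mat_ring 1 kron_mult VD(4-6) YD(2) kron_zero_left kron_zero_right kron_smult_left kron_smult_right
    kron_one add_smult_self add_self_smult zero_smult_mat)
qed

lemma coideal_act_tensor: assumes "(X, G) : SM" "(Y, H) : SM" "Z : CM"
 shows "coideal_act (sweedler_tensor (X, G) (Y, H)) Z = coideal_act (X, G) (coideal_act (Y, H) Z)"
proof -
 note [simp] = SM_D(1-3)[OF assms(1)] SM_D(1-3)[OF assms(2)] CM_D(1)[OF assms(3)]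
 show ?thesis by (simp add: coideal_act_def sweedler_tensor_pair mat_ring kron_add_left kron_add_right kron_assoc kron_one[symmetric] add_assoc_mat_dim)
qed

lemma coideal_act_unit: "Z : CM ==> coideal_act (0\<^sub>m (Suc 0) (Suc 0), I (Suc 0)) Z = Z"
 using CM_D(1)[of Z] by (simp add: coideal_act_def kron_one_left kron_zero_left mat_ring)

lemma S0_module_category: "module_category SC S0"
proof -
 interpret S0: linear_category S0 by (rule S0_linear)
 have obj: "coideal_act V X : CM" if "V : SM" "X : CM" for V X
  using that coideal_act_obj by (cases V) blast
 have dim: "nr (coideal_act V X) = sdim V * nr X" if "V : SM" for V X using that coideal_act_dim by (cases V) simp
 have tens: "coideal_act (sweedler_tensor V W) X = coideal_act V (coideal_act W X)"
  if "V : SM" "W : SM" "X : CM" for V W X using that coideal_act_tensor by (cases V; cases W) simp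
 have arr: "ActA S0 f h : Arr S0" if f: "f : Arr SC" and h: "h : Arr S0" for f h
 proof -
  obtain X G X' G' ff where F: "f = ((X, G), (X', G'), ff)" "(X, G) : SM" "(X', G') : SM"
   and fd [simp]: "nr ff = nr X'" "nc ff = nr X" and fe: "ff * X = X' * ff" "ff * G = G' * ff"
   using f by (cases f) auto
  obtain Y Y' hh where H: "h = (Y, Y', hh)" "Y : CM" "Y' : CM"
   and hd [simp]: "nr hh = nr Y'" "nc hh = nr Y" and he: "hh * Y = Y' * hh" using h by (cases h) auto
  note [simp] = SM_D(1-3)[OF F(2)] SM_D(1-3)[OF F(3)] CM_D(1)[OF H(2)] CM_D(1)[OF H(3)]
  have "kron ff hh * coideal_act (X, G) Y = coideal_act (X', G') Y' * kron ff hh"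
   by (simp add: coideal_act_def kron_ring fe he)
  thus ?thesis using F(2,3) H(2,3) by (simp add: F(1) H(1) obj dim)
 qed
 show ?thesis
 proof (unfold_locales, goal_cases)
  case (1 X p) thus ?case by (simp add: obj)
 next
  case (2 f h) thus ?case by (rule arr)
 next
  case (3 f h) thus ?case by (cases f; cases h) simp
 next
  case (4 f h) thus ?case by (cases f; cases h) simp
 next
  case (5 X p) thus ?case by (simp add: dim kron_one)
 next
  case (6 f g h k) thus ?case by (cases f; cases h; cases g; cases k) (simp add: kron_mult)
 next
  case (7 X Y p)
  hence "coideal_act X (coideal_act Y p) : Obj S0" by (simp add: obj)
  from S0.iso_arr_id[OF this] 7 show ?case by (simp add: tens)
 next
  case (8 f g h)
  thus ?case by (cases f; cases h; cases g) (simp add: kron_assoc tens obj dim mat_ring)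
 next
  case (9 p)
  hence "p : Obj S0" by simp
  from S0.iso_arr_id[OF this] 9 show ?case by (simp add: coideal_act_unit)
 next
  case (10 h) thus ?case by (cases h) (simp add: coideal_act_unit kron_one_left mat_ring)
 qed
qed

lemma S0_left_module_category: "left_module_category SC S0"
proof (rule left_module_categoryI)
 show "module_category SC S0" by (rule S0_module_category)
 then interpret S0: module_category SC S0 .
 show "finite_linear_category S0"
  by (rule finite_linear_category_eq[OF coideal_finite]) (simp_all only: S0_def lincat.defs category.simps lincat.simps)
 have dim: "nr (coideal_act V X) = sdim V * nr X" if "V : SM" for V X using that coideal_act_dim by (cases V) simp
 have tens: "coideal_act (sweedler_tensor V W) X = coideal_act V (coideal_act W X)"
  if "V : SM" "W : SM" "X : CM" for V W X using that coideal_act_tensor by (cases V; cases W) simp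
 have obj: "coideal_act V X : CM" if "V : SM" "X : CM" for V X
  using that coideal_act_obj by (cases V) blast
 fix f g h k c
 { assume "f : Arr SC" "g : Arr SC" "Dom SC f = Dom SC g" "Cod SC f = Cod SC g" "h : Arr S0"
  thus "ActA S0 (Add SC f g) h = Add S0 (ActA S0 f h) (ActA S0 g h)"
   by (cases f; cases h; cases g) (simp add: kron_add_left) }
 { assume "f : Arr SC" "h : Arr S0" "k : Arr S0" "Dom S0 h = Dom S0 k" "Cod S0 h = Cod S0 k"
  thus "ActA S0 f (Add S0 h k) = Add S0 (ActA S0 f h) (ActA S0 f k)"
   by (cases f; cases h; cases k) (simp add: kron_add_right) }
 { assume "f : Arr SC" "h : Arr S0"
  thus "ActA S0 (Smult SC c f) h = Smult S0 c (ActA S0 f h)" "ActA S0 f (Smult S0 c h) = Smult S0 c (ActA S0 f h)"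
   by (cases f; cases h; simp add: kron_smult_left kron_smult_right)+ }
 fix X Y Z p
 { assume "X : Obj SC" "Y : Obj SC" "Z : Obj SC" "p : Obj S0"
  thus "Comp S0 (Assoc S0 X Y (ActO S0 Z p)) (Assoc S0 (TensO SC X Y) Z p) =
     Comp S0 (ActA S0 (Id SC X) (Assoc S0 Y Z p)) (Assoc S0 X (TensO SC Y Z) p)"
   by (simp add: tens sw.T_obj obj dim kron_one mat_ring) }
 { assume "X : Obj SC" "p : Obj S0"
  thus "Comp S0 (ActA S0 (Id SC X) (Lunit S0 p)) (Assoc S0 X (Unit SC) p) = Id S0 (ActO S0 X p)"
   by (simp add: coideal_act_unit dim kron_one mat_ring) }
qed

section \<open>Relative projectivity and separability\<close>

context strict_monoidal_category
begin

lemma tens_comp_id: "f : Arr C ==> g : Arr C ==> Cod C f = Dom C g ==> X : Obj C ==>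
  TensA C (Comp C g f) (Id C X) = Comp C (TensA C g (Id C X)) (TensA C f (Id C X))"
 using tens_comp[of f g "Id C X" "Id C X"] by simp

lemma id_tens_comp: "f : Arr C ==> g : Arr C ==> Cod C f = Dom C g ==> X : Obj C ==>
  TensA C (Id C X) (Comp C g f) = Comp C (TensA C (Id C X) g) (TensA C (Id C X) f)"
 using tens_comp[of "Id C X" "Id C X" f g] by simp

lemma tens_slide: "f : Arr C ==> g : Arr C ==>
  Comp C (TensA C f (Id C (Cod C g))) (TensA C (Id C (Dom C f)) g) = Comp C (TensA C (Id C (Cod C f)) g) (TensA C f (Id C (Dom C g)))"
 using tens_comp[of "Id C (Dom C f)" f g "Id C (Cod C g)"] tens_comp[of f "Id C (Cod C f)" "Id C (Dom C g)" g] by simp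

end

context algebra_object
begin

lemma alg_eqs:
 "Comp C (AMult A) (TensA C (AMult A) (Id C AA)) = Comp C (AMult A) (TensA C (Id C AA) (AMult A))"
 "Comp C (AMult A) (TensA C (AUnit A) (Id C AA)) = Id C AA" "Comp C (AMult A) (TensA C (Id C AA) (AUnit A)) = Id C AA"
 using alg by (simp_all add: algebra_in_def Let_def)

text \<open>A bimodule map \<open>p\<close> from \<open>A \<otimes> X \<otimes> A\<close> to \<open>A\<close> is determined by its restriction \<open>\<phi>\<close> to \<open>X\<close>, hence
 factors through the multiplication \<open>A \<otimes> A \<rightarrow> A\<close>; a section of \<open>p\<close> then yields one of the multiplication.\<close>

lemma relatively_projective_imp_separable: assumes "relatively_projective_algebra C A" shows "separable_algebra C A"
proof -
 let ?m = "AMult A" and ?u = "AUnit A" and ?v = "Id C AA"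
 obtain X R i p j q where [simp]: "X : Obj C" and ip:
  "i : bimodule_hom C A (regular_bimodule A) (free_bimodule C A X)"
  "p : bimodule_hom C A (free_bimodule C A X) (regular_bimodule A)" "Comp C p i = Id C (BObj (regular_bimodule A))"
  using assms unfolding relatively_projective_algebra_def bimodule_summand_def by blast
 let ?x = "Id C X" and ?xa = "Id C (TensO C X AA)"
 have [simp]: "i : Arr C" "Dom C i = AA" "Cod C i = TensO C AA (TensO C X AA)"
  "p : Arr C" "Cod C p = AA" "Dom C p = TensO C AA (TensO C X AA)"
  and il: "Comp C i ?m = Comp C (TensA C ?m ?xa) (TensA C ?v i)"
  and ir: "Comp C i ?m = Comp C (TensA C (Id C (TensO C AA X)) ?m) (TensA C i ?v)"
  and pl: "Comp C p (TensA C ?m ?xa) = Comp C ?m (TensA C ?v p)"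
  and pr: "Comp C p (TensA C (Id C (TensO C AA X)) ?m) = Comp C ?m (TensA C p ?v)" and pi: "Comp C p i = ?v"
  using ip[unfolded bimodule_hom_def regular_bimodule_def free_bimodule_def Hom_iff mem_Collect_eq bimod.simps] by blast+
 \<comment> \<open>\<phi>(x) = p(1, x, 1) and \<psi>(a, x) = a \<phi>(x); left and right linearity
   give p(a, x, b) = \<psi>(a, x) b.\<close>
 define \<phi> where "\<phi> = Comp C p (TensA C ?u (TensA C ?x ?u))"
 define \<psi> where "\<psi> = Comp C ?m (TensA C ?v \<phi>)"
 have [simp]: "\<phi> : Arr C" "Dom C \<phi> = X" "Cod C \<phi> = AA" by (simp_all add: \<phi>_def TensO_Unit Unit_TensO)
 have [simp]: "\<psi> : Arr C" "Dom C \<psi> = TensO C AA X" "Cod C \<psi> = AA" by (simp_all add: \<psi>_def)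
 have 1: "Comp C p (TensA C ?u ?xa) = Comp C ?m (TensA C \<phi> ?v)"
 proof -
  have "TensA C \<phi> ?v = Comp C (TensA C p ?v) (TensA C ?u (TensA C ?x (TensA C ?u ?v)))"
   by (simp add: \<phi>_def tens_comp_id TensO_Unit Unit_TensO TensA_assoc)
  hence "Comp C ?m (TensA C \<phi> ?v) = Comp C (Comp C ?m (TensA C p ?v)) (TensA C ?u (TensA C ?x (TensA C ?u ?v)))"
   by (simp add: comp_assoc TensO_assoc Unit_TensO)
  also have "... = Comp C p (Comp C (TensA C ?v (TensA C ?x ?m)) (TensA C ?u (TensA C ?x (TensA C ?u ?v))))"
   by (simp add: pr[symmetric] comp_assoc TensO_assoc Unit_TensO TensA_assoc flip: tens_id)
  also have "Comp C (TensA C ?v (TensA C ?x ?m)) (TensA C ?u (TensA C ?x (TensA C ?u ?v))) = TensA C ?u ?xa"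
   by (simp add: tens_comp[symmetric] Unit_TensO alg_eqs)
  finally show ?thesis by simp
 qed
 have 2: "p = Comp C ?m (TensA C \<psi> ?v)"
 proof -
  have "p = Comp C p (TensA C (Comp C ?m (TensA C ?v ?u)) ?xa)" by (simp add: alg_eqs)
  also have "... = Comp C (Comp C p (TensA C ?m ?xa)) (TensA C ?v (TensA C ?u ?xa))"
   by (subst tens_comp_id) (simp_all add: comp_assoc TensA_assoc TensO_assoc TensO_Unit Unit_TensO)
  also have "... = Comp C ?m (TensA C ?v (Comp C p (TensA C ?u ?xa)))"
   by (simp add: pl comp_assoc id_tens_comp TensO_assoc Unit_TensO)
  also have "... = Comp C (Comp C ?m (TensA C ?m ?v)) (TensA C ?v (TensA C \<phi> ?v))"
   by (simp add: 1 alg_eqs comp_assoc id_tens_comp TensO_assoc)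
  also have "... = Comp C ?m (TensA C \<psi> ?v)"
   by (simp add: \<psi>_def tens_comp_id comp_assoc TensA_assoc TensO_assoc)
  finally show ?thesis .
 qed
 \<comment> \<open>Since p is the multiplication after \<psi> on the first two factors, this part of
   p composed with the section \<open>i\<close> is a section of the multiplication.\<close>
 define s where "s = Comp C (TensA C \<psi> ?v) i"
 have [simp]: "s : Arr C" "Dom C s = AA" "Cod C s = TensO C AA AA" by (simp_all add: s_def TensO_assoc)
 have "Comp C ?m s = ?v" using pi by (simp add: s_def 2 comp_assoc TensO_assoc)
 moreover have "Comp C s ?m = Comp C (TensA C ?m ?v) (TensA C ?v s)"
 proof -
  have "Comp C \<psi> (TensA C ?m ?x) = Comp C ?m (Comp C (TensA C ?v \<phi>) (TensA C ?m ?x))" by (simp add: \<psi>_def comp_assoc)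
  also have "Comp C (TensA C ?v \<phi>) (TensA C ?m ?x) = Comp C (TensA C ?m ?v) (TensA C ?v (TensA C ?v \<phi>))"
   using tens_slide[of ?m \<phi>] by (simp add: TensA_assoc flip: tens_id)
  also have "Comp C ?m ... = Comp C ?m (TensA C ?v \<psi>)"
   by (simp add: \<psi>_def comp_eq_assoc[OF alg_eqs(1)] comp_assoc id_tens_comp TensO_assoc)
  finally have e: "Comp C \<psi> (TensA C ?m ?x) = Comp C ?m (TensA C ?v \<psi>)" .
  have "Comp C s ?m = Comp C (Comp C (TensA C \<psi> ?v) (TensA C (TensA C ?m ?x) ?v)) (TensA C ?v i)"
   by (simp add: s_def comp_assoc il TensO_assoc TensA_assoc)
  also have "... = Comp C (TensA C (Comp C \<psi> (TensA C ?m ?x)) ?v) (TensA C ?v i)"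
   by (simp add: tens_comp_id TensO_assoc)
  also have "... = Comp C (TensA C ?m ?v) (TensA C ?v s)"
   by (simp add: e s_def tens_comp_id id_tens_comp comp_assoc TensO_assoc TensA_assoc)
  finally show ?thesis .
 qed
 moreover have "Comp C s ?m = Comp C (TensA C ?v ?m) (TensA C s ?v)"
 proof -
  have "Comp C s ?m = Comp C (Comp C (TensA C \<psi> ?v) (TensA C (Id C (TensO C AA X)) ?m)) (TensA C i ?v)"
   by (simp add: s_def comp_assoc ir TensO_assoc)
  also have "Comp C (TensA C \<psi> ?v) (TensA C (Id C (TensO C AA X)) ?m) = Comp C (TensA C ?v ?m) (TensA C \<psi> (Id C (TensO C AA AA)))"
   using tens_slide[of \<psi> ?m] by simp
  also have "Comp C ... (TensA C i ?v) = Comp C (TensA C ?v ?m) (TensA C s ?v)"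
   by (simp add: s_def tens_comp_id comp_assoc TensO_assoc TensA_assoc)
  finally show ?thesis .
 qed
 ultimately show ?thesis
  unfolding separable_algebra_def by (intro bexI[of _ s]) (simp_all add: bimodule_hom_def regular_bimodule_def Hom_iff)
qed

text \<open>The image of an idempotent bimodule endomorphism is a bimodule. It supplies the
  complementary summand that \<open>bimodule_summand\<close> asks for.\<close>

lemma bimodule_split:
 assumes Q: "bimodule C A Q" and e: "e : bimodule_hom C A Q Q" and sp: "splits (BObj Q) e Y j q"
 defines "R \<equiv> \<lparr>BObj = Y, BLeft = Comp C q (Comp C (BLeft Q) (TensA C (Id C AA) j)),
  BRight = Comp C q (Comp C (BRight Q) (TensA C j (Id C AA)))\<rparr>"
 shows "bimodule C A R" "j : bimodule_hom C A R Q" "q : bimodule_hom C A Q R"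
proof -
 let ?m = "AMult A" and ?u = "AUnit A" and ?v = "Id C AA"
 define V L T where "V = BObj Q" and "L = BLeft Q" and "T = BRight Q"
 have [simp]: "V : Obj C" "L : Arr C" "Dom C L = TensO C AA V" "Cod C L = V" "T : Arr C" "Dom C T = TensO C V AA" "Cod C T = V"
  and LL: "Comp C L (TensA C ?v L) = Comp C L (TensA C ?m (Id C V))" and Lu: "Comp C L (TensA C ?u (Id C V)) = Id C V"
  and TT: "Comp C T (TensA C T ?v) = Comp C T (TensA C (Id C V) ?m)" and Tu: "Comp C T (TensA C (Id C V) ?u) = Id C V"
  and LT: "Comp C T (TensA C L ?v) = Comp C L (TensA C ?v T)"
  using Q[unfolded bimodule_def left_module_def right_module_def Hom_iff] unfolding V_def L_def T_def by blast+
 have [simp]: "e : Arr C" "Dom C e = V" "Cod C e = V" and eL: "Comp C e L = Comp C L (TensA C ?v e)" and eT: "Comp C e T = Comp C T (TensA C e ?v)"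
  using e[unfolded bimodule_hom_def Hom_iff mem_Collect_eq] unfolding V_def L_def T_def by blast+
 have [simp]: "Y : Obj C" "j : Arr C" "Dom C j = Y" "Cod C j = V" "q : Arr C" "Dom C q = V" "Cod C q = Y"
  and qj: "Comp C q j = Id C Y" and jq: "Comp C j q = e" using sp[unfolded splits_def] unfolding V_def by blast+
 have qe: "Comp C q e = q" using comp_eq_assoc[OF qj, of q] by (simp add: jq)
 have ej: "Comp C e j = j" using qj by (simp add: jq[symmetric] comp_assoc)
 define L' T' where "L' = Comp C q (Comp C L (TensA C ?v j))" and "T' = Comp C q (Comp C T (TensA C j ?v))"
 have [simp]: "L' : Arr C" "Dom C L' = TensO C AA Y" "Cod C L' = Y" "T' : Arr C" "Dom C T' = TensO C Y AA" "Cod C T' = Y"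
  by (simp_all add: L'_def T'_def)
 have R: "R = \<lparr>BObj = Y, BLeft = L', BRight = T'\<rparr>" by (simp add: R_def L'_def T'_def L_def T_def)
 have jL: "Comp C j L' = Comp C L (TensA C ?v j)"
 proof -
  have "Comp C j L' = Comp C (Comp C e L) (TensA C ?v j)" by (simp add: L'_def comp_assoc comp_eq_assoc[OF jq])
  also have "... = Comp C L (TensA C ?v (Comp C e j))" by (simp add: eL comp_assoc id_tens_comp)
  finally show ?thesis by (simp add: ej)
 qed
 have jT: "Comp C j T' = Comp C T (TensA C j ?v)"
 proof -
  have "Comp C j T' = Comp C (Comp C e T) (TensA C j ?v)" by (simp add: T'_def comp_assoc comp_eq_assoc[OF jq])
  also have "... = Comp C T (TensA C (Comp C e j) ?v)" by (simp add: eT comp_assoc tens_comp_id)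
  finally show ?thesis by (simp add: ej)
 qed
 have qL: "Comp C q L = Comp C L' (TensA C ?v q)"
 proof -
  have "Comp C L' (TensA C ?v q) = Comp C q (Comp C L (TensA C ?v e))" by (simp add: L'_def comp_assoc id_tens_comp[symmetric] jq)
  also have "... = Comp C q L" by (simp add: eL[symmetric] comp_eq_assoc[OF qe])
  finally show ?thesis by simp
 qed
 have qT: "Comp C q T = Comp C T' (TensA C q ?v)"
 proof -
  have "Comp C T' (TensA C q ?v) = Comp C q (Comp C T (TensA C e ?v))" by (simp add: T'_def comp_assoc tens_comp_id[symmetric] jq)
  also have "... = Comp C q T" by (simp add: eT[symmetric] comp_eq_assoc[OF qe])
  finally show ?thesis by simp
 qed
 have cancel: "f = g" if "Comp C j f = Comp C j g" "f : Arr C" "g : Arr C" "Cod C f = Y" "Cod C g = Y" for f g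
  using arg_cong[OF that(1), of "Comp C q"] that(2-) by (simp add: comp_eq_assoc[OF qj])
 have "Comp C L' (TensA C ?v L') = Comp C L' (TensA C ?m (Id C Y))"
 proof (rule cancel)
  have "Comp C j (Comp C L' (TensA C ?v L')) = Comp C L (TensA C ?v (Comp C j L'))"
   by (simp add: comp_eq_assoc[OF jL] comp_assoc id_tens_comp)
  also have "... = Comp C (Comp C L (TensA C ?v L)) (TensA C ?v (TensA C ?v j))"
   by (simp add: jL comp_assoc id_tens_comp)
  also have "... = Comp C L (Comp C (TensA C ?m (Id C V)) (TensA C (Id C (TensO C AA AA)) j))"
   by (simp add: LL comp_assoc TensO_assoc TensA_assoc flip: tens_id)
  also have "Comp C (TensA C ?m (Id C V)) (TensA C (Id C (TensO C AA AA)) j) = Comp C (TensA C ?v j) (TensA C ?m (Id C Y))"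
   using tens_slide[of ?m j] by simp
  finally show "Comp C j (Comp C L' (TensA C ?v L')) = Comp C j (Comp C L' (TensA C ?m (Id C Y)))"
   by (simp add: comp_eq_assoc[OF jL] comp_assoc)
 qed (simp_all add: TensO_assoc)
 moreover have "Comp C L' (TensA C ?u (Id C Y)) = Id C Y"
 proof (rule cancel)
  have "Comp C (TensA C ?v j) (TensA C ?u (Id C Y)) = Comp C (TensA C ?u (Id C V)) j"
   using tens_slide[of ?u j] by (simp add: Unit_TensA)
  thus "Comp C j (Comp C L' (TensA C ?u (Id C Y))) = Comp C j (Id C Y)"
   by (simp add: comp_eq_assoc[OF jL] comp_assoc comp_eq_assoc[OF Lu] Unit_TensO)
 qed (simp_all add: Unit_TensO)
 moreover have "Comp C T' (TensA C T' ?v) = Comp C T' (TensA C (Id C Y) ?m)"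
 proof (rule cancel)
  have "Comp C j (Comp C T' (TensA C T' ?v)) = Comp C T (TensA C (Comp C j T') ?v)"
   by (simp add: comp_eq_assoc[OF jT] comp_assoc tens_comp_id)
  also have "... = Comp C (Comp C T (TensA C T ?v)) (TensA C (TensA C j ?v) ?v)"
   by (simp add: jT comp_assoc tens_comp_id)
  also have "... = Comp C T (Comp C (TensA C (Id C V) ?m) (TensA C j (Id C (TensO C AA AA))))"
   by (simp add: TT comp_assoc TensO_assoc TensA_assoc)
  also have "Comp C (TensA C (Id C V) ?m) (TensA C j (Id C (TensO C AA AA))) = Comp C (TensA C j ?v) (TensA C (Id C Y) ?m)"
   using tens_slide[of j ?m] by simp
  finally show "Comp C j (Comp C T' (TensA C T' ?v)) = Comp C j (Comp C T' (TensA C (Id C Y) ?m))"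
   by (simp add: comp_eq_assoc[OF jT] comp_assoc)
 qed (simp_all add: TensO_assoc)
 moreover have "Comp C T' (TensA C (Id C Y) ?u) = Id C Y"
 proof (rule cancel)
  have "Comp C (TensA C j ?v) (TensA C (Id C Y) ?u) = Comp C (TensA C (Id C V) ?u) j"
   using tens_slide[of j ?u] by (simp add: TensA_Unit)
  thus "Comp C j (Comp C T' (TensA C (Id C Y) ?u)) = Comp C j (Id C Y)"
   by (simp add: comp_eq_assoc[OF jT] comp_assoc comp_eq_assoc[OF Tu] TensO_Unit)
 qed (simp_all add: TensO_Unit)
 moreover have "Comp C T' (TensA C L' ?v) = Comp C L' (TensA C ?v T')"
 proof (rule cancel)
  have "Comp C j (Comp C T' (TensA C L' ?v)) = Comp C T (TensA C (Comp C j L') ?v)"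
   by (simp add: comp_eq_assoc[OF jT] comp_assoc tens_comp_id)
  also have "... = Comp C (Comp C T (TensA C L ?v)) (TensA C (TensA C ?v j) ?v)"
   by (simp add: jL comp_assoc tens_comp_id)
  also have "... = Comp C L (Comp C (TensA C ?v T) (TensA C ?v (TensA C j ?v)))"
   by (simp add: LT comp_assoc TensO_assoc TensA_assoc)
  also have "... = Comp C L (TensA C ?v (Comp C j T'))" by (simp add: jT id_tens_comp)
  finally show "Comp C j (Comp C T' (TensA C L' ?v)) = Comp C j (Comp C L' (TensA C ?v T'))"
   by (simp add: comp_eq_assoc[OF jL] comp_assoc id_tens_comp)
 qed (simp_all add: TensO_assoc)
 ultimately show "bimodule C A R" unfolding R bimodule_def left_module_def right_module_def by (simp add: Hom_iff)
 show "j : bimodule_hom C A R Q" using jL jT unfolding R bimodule_hom_def L_def T_def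
  by (simp add: Hom_iff V_def[symmetric])
 show "q : bimodule_hom C A Q R" using qL qT unfolding R bimodule_hom_def L_def T_def
  by (simp add: Hom_iff V_def[symmetric])
qed

text \<open>With the unit object for X the free bimodule is A \<otimes> A. The idempotent s m has
  image A, and splitting its complement gives the other summand.\<close>

lemma separable_imp_relatively_projective:
 assumes sep: "separable_algebra C A" and sp: "split_idem" shows "relatively_projective_algebra C A"
proof -
 let ?m = "AMult A" and ?v = "Id C AA" and ?Q = "free_bimodule C A (Unit C)" and ?P = "regular_bimodule A"
 define V where "V = TensO C AA AA"
 obtain s where [simp]: "s : Arr C" "Dom C s = AA" "Cod C s = V"
  and sl: "Comp C s ?m = Comp C (TensA C ?m ?v) (TensA C ?v s)"
  and sr: "Comp C s ?m = Comp C (TensA C ?v ?m) (TensA C s ?v)" and ms: "Comp C ?m s = ?v"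
  using sep[unfolded separable_algebra_def bimodule_hom_def regular_bimodule_def Hom_iff Bex_def mem_Collect_eq bimod.simps]
  unfolding V_def by blast
 have Q: "?Q = \<lparr>BObj = V, BLeft = TensA C ?m ?v, BRight = TensA C ?v ?m\<rparr>"
  by (simp add: free_bimodule_def V_def Unit_TensO TensO_Unit)
 have VO: "V : Obj C" "TensO C AA AA = V" "TensO C AA V = TensO C V AA" by (simp_all add: V_def TensO_assoc)
 note [simp] = VO(1,2)
 have idV: "Id C V = TensA C ?v ?v" by simp
 have bQ: "bimodule C A ?Q" unfolding Q bimodule_def left_module_def right_module_def bimod.simps
 proof (intro conjI)
  show "Comp C (TensA C ?m ?v) (TensA C ?v (TensA C ?m ?v)) = Comp C (TensA C ?m ?v) (TensA C ?m (Id C V))"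
   using arg_cong[OF alg_eqs(1), of "\<lambda>f. TensA C f ?v"] by (simp add: tens_comp_id TensA_assoc idV del: tens_id)
  show "Comp C (TensA C ?m ?v) (TensA C (AUnit A) (Id C V)) = Id C V"
   using arg_cong[OF alg_eqs(2), of "\<lambda>f. TensA C f ?v"]
   by (simp add: tens_comp_id TensA_assoc idV TensO_assoc Unit_TensO del: tens_id)
  show "Comp C (TensA C ?v ?m) (TensA C (TensA C ?v ?m) ?v) = Comp C (TensA C ?v ?m) (TensA C (Id C V) ?m)"
   using arg_cong[OF alg_eqs(1), of "TensA C ?v"] by (simp add: id_tens_comp TensA_assoc idV del: tens_id)
  show "Comp C (TensA C ?v ?m) (TensA C (Id C V) (AUnit A)) = Id C V"
   using arg_cong[OF alg_eqs(3), of "TensA C ?v"] by (simp add: id_tens_comp TensA_assoc idV TensO_assoc TensO_Unit del: tens_id)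
  show "Comp C (TensA C ?v ?m) (TensA C (TensA C ?m ?v) ?v) = Comp C (TensA C ?m ?v) (TensA C ?v (TensA C ?v ?m))"
   using tens_slide[of ?m ?m] by (simp add: TensA_assoc idV del: tens_id)
 qed (simp_all add: Hom_iff VO(3))
 have assoc': "Comp C ?m (TensA C ?m ?v) = Comp C ?m (TensA C ?v ?m)" by (rule alg_eqs(1))
 have mQ: "?m : bimodule_hom C A ?Q ?P" and sQ: "s : bimodule_hom C A ?P ?Q"
  unfolding bimodule_hom_def Q regular_bimodule_def using sl sr by (simp_all add: Hom_iff assoc')
 define i where "i = Comp C s ?m"
 have [simp]: "i : Arr C" "Dom C i = V" "Cod C i = V" by (simp_all add: i_def)
 have ii: "Comp C i i = i" by (simp add: i_def comp_assoc comp_eq_assoc[OF ms])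
 have iL: "Comp C i (TensA C ?m ?v) = Comp C (TensA C ?m ?v) (TensA C ?v i)"
  by (simp add: i_def comp_assoc alg_eqs(1) id_tens_comp VO(3)) (simp add: comp_eq_assoc[OF sl] comp_assoc VO(3))
 have iR: "Comp C i (TensA C ?v ?m) = Comp C (TensA C ?v ?m) (TensA C i ?v)"
  by (simp add: i_def comp_assoc alg_eqs(1)[symmetric] tens_comp_id VO(3)) (simp add: comp_eq_assoc[OF sr] comp_assoc VO(3))
 define e where "e = Add C (Id C V) (Smult C (- 1) i)"
 have [simp]: "e : Arr C" "Dom C e = V" "Cod C e = V" by (simp_all add: e_def)
 have i0: "Add C i (Smult C (- 1) i) = Zero C V V" using Add_inverse[of i V V] by (simp add: Hom_iff)
 have "Comp C i e = Zero C V V" by (simp add: e_def comp_add_right comp_smult_right ii i0)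
 moreover have "Comp C (Add C (Id C V) (Smult C (- 1) i)) e = Add C e (Smult C (- 1) (Comp C i e))"
  by (simp add: comp_add_left comp_smult_left)
 ultimately have "Comp C e e = Add C e (Smult C (- 1) (Zero C V V))" by (simp add: e_def[symmetric])
 moreover have "Smult C (- 1) (Zero C V V) = Zero C V V"
  using Smult_Smult[of "Zero C V V" V V "- 1" 0] zero_smult[of "Zero C V V"] by (simp add: Hom_iff)
 ultimately have "Comp C e e = e" by (simp add: add_zero)
 then obtain Y j q where sp: "splits V e Y j q" using sp unfolding split_idem_def by force
 have eQ: "e : bimodule_hom C A ?Q ?Q"
 proof -
  have 1: "TensA C ?v e = Add C (Id C (TensO C V AA)) (Smult C (- 1) (TensA C ?v i))"
   using TensA_Add_right[of ?v AA AA "Id C V" V V "Smult C (- 1) i"] TensA_Smult_right[of ?v AA AA i V V "- 1"]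
   by (simp add: Hom_iff e_def VO(3))
  have 2: "TensA C e ?v = Add C (Id C (TensO C V AA)) (Smult C (- 1) (TensA C i ?v))"
   using TensA_Add_left[of "Id C V" V V "Smult C (- 1) i" ?v AA AA] TensA_Smult_left[of i V V ?v AA AA "- 1"]
   by (simp add: Hom_iff e_def)
  show ?thesis unfolding bimodule_hom_def Q by (simp add: Hom_iff VO(3) 1 2)
    (simp add: e_def comp_add_left comp_add_right comp_smult_left comp_smult_right VO(3) iL iR)
 qed
 have BV: "BObj ?Q = V" by (simp add: Q)
 note R = bimodule_split[OF bQ eQ sp[folded BV]]
 have [simp]: "Y : Obj C" "j : Arr C" "Dom C j = Y" "Cod C j = V" "q : Arr C" "Dom C q = V" "Cod C q = Y"
  and qj: "Comp C q j = Id C Y" and jq: "Comp C j q = e" using sp[unfolded splits_def] by blast+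
 have "Add C i e = Id C V"
  using Add_assoc[of i V V "Smult C (- 1) i" "Id C V"] add_commute[of "Id C V" "Smult C (- 1) i"]
   add_commute[of "Zero C V V" "Id C V"] by (simp add: e_def Hom_iff i0 add_zero)
 hence "bimodule_summand C A ?P ?Q" unfolding bimodule_summand_def using R mQ sQ ms qj jq
  by (intro exI[of _ "\<lparr>BObj = Y, BLeft = Comp C q (Comp C (BLeft ?Q) (TensA C (Id C AA) j)),
   BRight = Comp C q (Comp C (BRight ?Q) (TensA C j (Id C AA)))\<rparr>"] exI[of _ s] exI[of _ ?m] exI[of _ j] exI[of _ q])
   (simp add: regular_bimodule_def BV i_def)
 thus ?thesis unfolding relatively_projective_algebra_def by (intro bexI[of _ "Unit C"]) simp_all
qed

end

text \<open>It suffices to split the underlying matrix: an idempotent commuting with x and g lets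
  both act on its image.\<close>

lemma sweedler_cat_split_idem: "sw.split_idem" unfolding sw.split_idem_def
proof (intro ballI impI)
 fix h assume h: "h : Arr SC" "Dom SC h = Cod SC h \<and> Comp SC h h = h"
 obtain X G e where he: "h = ((X, G), (X, G), e)" using h by (cases h) auto
 have V: "(X, G) : SM" and [simp]: "nr e = nr X" "nc e = nr X"
  and eX: "e * X = X * e" and eG: "e * G = G * e" and ee: "e * e = e" using h by (simp_all add: he)
 note VD = SM_D[OF V]
 note [simp] = VD(1-3)
 obtain k J P where *: "nr J = nr X" "nc J = k" "nr P = k" "nc P = nr X" "e = J * P" "P * J = I k"
  using \<open>nr e = nr X\<close> \<open>nc e = nr X\<close> by (rule mat_split_idem[OF ee, of "nr X"])
 note [simp] = *(1-4)
 have eJ: "e * J = J" by (simp add: *(5) mat_ring *(6))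
 have Pe: "P * e = P" by (simp add: *(5) mult_eq_assoc[OF *(6)] mat_ring)
 have JP: "J * (P * M) = e * M" if "nr M = nr X" for M using that by (simp add: *(5) mat_ring)
 have XJ: "e * (X * J) = X * J" using mult_eq_assoc[OF eX, of J] by (simp add: mat_ring eJ)
 have GJ: "e * (G * J) = G * J" using mult_eq_assoc[OF eG, of J] by (simp add: mat_ring eJ)
 define X' where "X' = P * X * J" define G' where "G' = P * G * J"
 have W: "(X', G') : SM"
 proof (rule SM_I)
  show "X' * X' = 0\<^sub>m (nr X') (nr X')" by (simp add: X'_def mat_ring JP XJ mult_eq_assoc[OF VD(4)])
  show "G' * G' = I (nr X')" by (simp add: X'_def G'_def mat_ring JP GJ mult_eq_assoc[OF VD(5)] *(6))
  show "G' * X' = (- 1) *s (X' * G')" by (simp add: X'_def G'_def mat_ring JP GJ XJ mult_eq_assoc[OF VD(6)])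
 qed (simp_all add: X'_def G'_def)
 have XP: "P * (X * e) = P * X" using mult_eq_assoc[OF Pe, of X] by (simp add: mat_ring eX)
 have GP: "P * (G * e) = P * G" using mult_eq_assoc[OF Pe, of G] by (simp add: mat_ring eG)
 have "sw.splits (X, G) h (X', G') ((X', G'), (X, G), J) ((X, G), (X', G'), P)" unfolding sw.splits_def using V W
  by (simp add: he *(5,6)) (simp add: X'_def G'_def mat_ring JP XJ GJ XP GP *(5)[symmetric])
 moreover have "Dom SC h = (X, G)" by (simp add: he)
 ultimately show "\<exists>Y i p. sw.splits (Dom SC h) h Y i p" by metis
qed

section \<open>Separable algebras in the Sweedler category and their modules as matrix data\<close>

definition swalg :: "complex mat => complex mat => complex mat => complex mat => (smod, sarr) alg" where
 "swalg m u X G = \<lparr>AObj = (X, G), AMult = (sweedler_tensor (X, G) (X, G), (X, G), m), AUnit = ((0\<^sub>m 1 1, I 1), (X, G), u)\<rparr>"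

lemma swalg_simps [simp]:
 "AObj (swalg m u X G) = (X, G)" "AMult (swalg m u X G) = (sweedler_tensor (X, G) (X, G), (X, G), m)"
 "AUnit (swalg m u X G) = ((0\<^sub>m 1 1, I 1), (X, G), u)" by (simp_all add: swalg_def)

lemma sweedler_tensor_unit [simp]: assumes "V : SM"
 shows "sweedler_tensor V (0\<^sub>m (Suc 0) (Suc 0), I (Suc 0)) = V" "sweedler_tensor (0\<^sub>m (Suc 0) (Suc 0), I (Suc 0)) V = V"
 using sw.I_left[OF assms] sw.I_right[OF assms] by simp_all

lemma sweedler_unit_modules [simp]: "(0\<^sub>m (Suc 0) (Suc 0), I (Suc 0)) : SM" using sw.I_obj by simp

lemma snd_sweedler_tensor [simp]: "snd (sweedler_tensor (X, G) (Y, H)) = kron G H" by (simp add: sweedler_tensor_pair)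

lemma fst_sweedler_tensor [simp]: "fst (sweedler_tensor (X, G) (Y, H)) = kron X (I (nr Y)) + kron G Y"
 by (simp add: sweedler_tensor_pair)

context sweedler_algebra
begin

lemma sweedler_obj [simp]: "(XA, GA) : SM" by (rule SM_I) (simp_all add: XA_XA GA_GA GA_XA)

text \<open>Applied to 1 b = b, the Leibniz rule gives x(1) b + x(b) = x(b), so x(1) b = 0; then
  take b = 1.\<close>

lemma XA_unit: "XA * u = 0\<^sub>m a 1"
proof -
 have "XA + 0\<^sub>m a a = XA * (m * kron u (I a))" by (simp add: alg_unit_left mat_ring)
 also have "... = m * (kron (XA * u) (I a)) + m * (kron u XA)"
  by (simp add: mult_eq_assoc[OF XA_mult] kron_ring GA_unit)
 also have "m * kron u XA = m * kron u (I a) * XA"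
  using kron_mult[of u "I (Suc 0)" "I a" XA] by (simp add: mat_ring kron_one_left)
 also have "... = XA" by (simp add: alg_unit_left mat_ring)
 finally have "XA + 0\<^sub>m a a = XA + m * (kron (XA * u) (I a))"
  by (simp add: add_commute_mat_dim[of "m * kron (XA * u) (I a)"])
 hence z: "m * kron (XA * u) (I a) = 0\<^sub>m a a"
  using add_left_cancel_mat[of XA "0\<^sub>m a a" "m * kron (XA * u) (I a)"] by simp
 have "m * kron (XA * u) (I a) * u = m * kron (I a) u * (XA * u)"
  using kron_mult[of "XA * u" "I (Suc 0)" "I a" u] by (simp add: mat_ring kron_one_left kron_one_right kron_mult kron_col_slide)
 hence "m * kron (XA * u) (I a) * u = XA * u" by (simp add: alg_unit_right mat_ring)
 thus ?thesis by (simp add: z mat_ring)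
qed

lemma sweedler_alg: "algebra_in SC (swalg m u XA GA)"
 by (simp add: algebra_in_def Let_def Hom_iff sw.T_obj sw.T_dim mat_ring GA_mult GA_unit XA_mult XA_unit sw.T_assoc alg_assoc alg_unit_left alg_unit_right)

text \<open>The section is b \<mapsto> b c1 \<otimes> c2 = c1 \<otimes> c2 b. The two forms give
  linearity on both sides, and the invariance of \<open>c\<close> makes it a morphism of the
  category.\<close>

lemma separable: "separable_algebra SC (swalg m u XA GA)"
proof -
 define s where "s = kron m (I a) * kron (I a) c"
 have [simp]: "nr s = a * a" "nc s = a" by (simp_all add: s_def)
 have s': "s = kron (I a) m * kron c (I a)" by (simp add: s_def cas_central)
 have ms: "m * s = I a"
 proof -
  have "m * s = m * kron m (I a) * kron (I a) c" by (simp add: s_def mat_ring)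
  also have "... = m * kron (I a) (m * c)" by (simp add: alg_assoc kron_ring)
  finally show ?thesis by (simp add: mult_cas alg_unit_right)
 qed
 have sl: "s * m = kron m (I a) * kron (I a) s"
 proof -
  have "s * m = kron m (I a) * kron m c"
   using kron_col_slide[of c m a] by (simp add: s_def kron_ring kron_comp_left)
  also have "kron m c = kron (kron m (I a)) (I a) * kron (I (a * a)) c"
   using kron_slide(1)[of m "a * a" c "a * a"] by (simp add: kron_assoc kron_one)
  also have "kron m (I a) * ... = kron (m * kron m (I a)) (I a) * kron (I (a * a)) c"
   by (simp add: kron_ring kron_mult_assoc)
  also have "... = kron m (I a) * (kron (I a) (kron m (I a)) * kron (I a) (kron (I a) c))"
   by (simp add: alg_assoc kron_comp_left kron_assoc kron_one_prod mat_ring)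
  also have "... = kron m (I a) * kron (I a) s" by (simp add: s_def kron_ring)
  finally show ?thesis .
 qed
 have sr: "s * m = kron (I a) m * kron s (I a)"
 proof -
  have "s * m = kron (I a) m * kron c m"
   using kron_mult[of c "I (Suc 0)" "I a" m] by (simp add: s' mat_ring kron_one_left)
  also have "kron c m = kron (I a) (kron (I a) m) * kron c (I (a * a))"
   using kron_slide(2)[of c "a * a" m "a * a"] by (simp add: kron_one_prod)
  also have "kron (I a) m * ... = kron (I a) (m * kron (I a) m) * kron c (I (a * a))"
   by (simp add: kron_ring kron_mult_assoc)
  also have "... = kron (I a) m * (kron (kron (I a) m) (I a) * kron (kron c (I a)) (I a))"
   by (simp add: alg_assoc[symmetric] kron_comp_right kron_assoc kron_one mat_ring)
  also have "... = kron (I a) m * kron s (I a)" by (simp add: s' kron_ring)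
  finally show ?thesis .
 qed
 have sGX: "s * f = kron m (I a) * kron f c" if [simp]: "nr f = a" "nc f = a" for f
  using kron_col_slide[of c f a] by (simp add: s_def kron_ring)
 have sG: "s * GA = kron GA GA * s"
 proof -
  have "s * GA = kron m (I a) * (kron GA (kron GA GA) * kron (I a) c)" by (simp add: sGX kron_ring GA_cas)
  also have "... = kron (GA * m) GA * kron (I a) c" by (simp add: GA_mult kron_ring kron_assoc[symmetric] kron_mult_assoc)
  finally show ?thesis by (simp add: s_def kron_ring kron_mult_assoc)
 qed
 have sX: "s * XA = (kron XA (I a) + kron GA XA) * s"
 proof -
  have "s * XA = kron m (I a) * (kron XA c + kron GA ((kron XA (I a) + kron GA XA) * c))"
   by (simp add: sGX XA_cas kron_zero_right mat_ring)
  also have "... = kron m (I a) * ((kron (kron XA (I a)) (I a) + kron (kron GA XA) (I a) + kron (kron GA GA) XA) * kron (I a) c)"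
   by (simp add: kron_ring kron_assoc kron_add_right kron_one add_assoc_mat_dim)
  also have "... = (kron (XA * m) (I a) + kron (GA * m) XA) * kron (I a) c"
   by (simp add: XA_mult GA_mult kron_ring kron_mult_assoc kron_add_left)
  finally show ?thesis by (simp add: s_def kron_ring kron_mult_assoc)
 qed
 show ?thesis unfolding separable_algebra_def by (rule bexI[of _ "((XA, GA), sweedler_tensor (XA, GA) (XA, GA), s)"])
   (simp_all add: bimodule_hom_def regular_bimodule_def Hom_iff sw.T_obj sw.T_dim sG sX ms sl[symmetric] sr[symmetric] sw.T_assoc)
qed

text \<open>That the action is a morphism of \<open>sweedler_cat\<close> amounts to the clauses of
  \<open>gmod\<close> and \<open>dgmod\<close> on its compatibility with g and x.\<close>

lemma sweedler_right_module:
 "right_module SC (swalg m u XA GA) V rr \<longleftrightarrow>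
  (\<exists>r. rr = (sweedler_tensor V (XA, GA), V, r) \<and> dgmod (nr (fst V)) r (fst V) (snd V))"
proof -
 obtain X G where V: "V = (X, G)" by (cases V)
 show ?thesis
 proof
  assume R: "right_module SC (swalg m u XA GA) V rr"
  then obtain r where rr: "rr = (sweedler_tensor V (XA, GA), V, r)" and VO: "(X, G) : SM"
   by (cases rr) (auto simp: right_module_def Hom_iff V)
  note VD = SM_D[OF VO]
  note [simp] = VD(1-3)
  have "dgmod (nr X) r X G" using R VD(4-6) unfolding rr V
   by (simp add: right_module_def Hom_iff dgmod_def gmod_def umod_def sw.T_obj sw.T_dim sw.T_assoc)
  thus "\<exists>r. rr = (sweedler_tensor V (XA, GA), V, r) \<and> dgmod (nr (fst V)) r (fst V) (snd V)"
   using rr V by auto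
 next
  assume "\<exists>r. rr = (sweedler_tensor V (XA, GA), V, r) \<and> dgmod (nr (fst V)) r (fst V) (snd V)"
  then obtain r where rr: "rr = (sweedler_tensor V (XA, GA), V, r)" and d: "dgmod (nr X) r X G" using V by auto
  have VO: "(X, G) : SM" using d by (intro SM_I) (auto simp: dgmod_def gmod_def)
  note [simp] = SM_D(1-3)[OF VO]
  show "right_module SC (swalg m u XA GA) V rr" using VO d unfolding rr V
   by (simp add: right_module_def Hom_iff dgmod_def gmod_def umod_def sw.T_obj sw.T_dim sw.T_assoc)
 qed
qed

definition smod :: "complex mat => complex mat => complex mat => smod \<times> sarr" where
 "smod r X G = ((X, G), (sweedler_tensor (X, G) (XA, GA), (X, G), r))"

lemma smod_inj [simp]: "smod r X G = smod r' X' G' \<longleftrightarrow> r = r' \<and> X = X' \<and> G = G'"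
 by (auto simp: smod_def)

sublocale S: algebra_object SC "swalg m u XA GA"
 by (simp add: algebra_object_def algebra_object_axioms_def sw.monoidal sweedler_alg)

abbreviation "MM \<equiv> mod_cat SC (swalg m u XA GA)"

lemma smod_obj: "N : Obj MM \<longleftrightarrow> (\<exists>n r X G. N = smod r X G \<and> dgmod n r X G)"
proof -
 obtain X G rr where N: "N = ((X, G), rr)" by (cases N) auto
 have n: "n = nr X" if "dgmod n r X G" for n r using that by (simp add: dgmod_def)
 show ?thesis unfolding N by (auto simp: sweedler_right_module smod_def dest: n)
qed

lemma smod_in [simp]: "smod r X G : Obj MM \<longleftrightarrow> dgmod (nr X) r X G"
 by (simp add: smod_def sweedler_right_module)

lemma dgmod_sweedler: "dgmod n r X G ==> (X, G) : SM" by (intro SM_I) (auto simp: dgmod_def gmod_def)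

lemma smod_arr: "h : Arr MM \<longleftrightarrow> (\<exists>n r X G n' r' X' G' f. h = (smod r X G, smod r' X' G', ((X, G), (X', G'), f)) \<and>
  dgmod n r X G \<and> dgmod n' r' X' G' \<and> ulin n r n' r' f \<and> f * X = X' * f \<and> f * G = G' * f)" (is "_ \<longleftrightarrow> ?R")
proof
 assume h: "h : Arr MM"
 obtain N N' f where hh: "h = (N, N', f)" by (cases h)
 have "N : Obj MM" "N' : Obj MM" using h unfolding hh by (cases N; cases N'; simp)+
 then obtain n r X G n' r' X' G' where N: "N = smod r X G" "N' = smod r' X' G'" and d: "dgmod n r X G" "dgmod n' r' X' G'"
  unfolding smod_obj by blast
 have dX: "nr X = n" "nr X' = n'" using d by (simp_all add: dgmod_def)
 obtain f' where f: "f = ((X, G), (X', G'), f')" using h unfolding hh N smod_def by (cases f) auto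
 have "ulin n r n' r' f' \<and> f' * X = X' * f' \<and> f' * G = G' * f'"
  using h unfolding hh N f by (simp add: smod_def ulin_def dX)
 thus ?R using d unfolding hh N f by blast
next
 assume ?R
 then obtain n r X G n' r' X' G' f where h: "h = (smod r X G, smod r' X' G', ((X, G), (X', G'), f))"
  and d: "dgmod n r X G" "dgmod n' r' X' G'" and f: "ulin n r n' r' f" "f * X = X' * f" "f * G = G' * f" by blast
 have dX: "nr X = n" "nr X' = n'" using d by (simp_all add: dgmod_def)
 show "h : Arr MM" unfolding h using d f dgmod_sweedler[OF d(1)] dgmod_sweedler[OF d(2)]
  by (simp add: smod_def ulin_def dX sweedler_right_module)
qed

end

text \<open>The separability element is c = s(1): bimodule linearity gives b c = s(b) = c b, and c
  inherits the invariance of 1.\<close>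

lemma sweedler_algebraE: assumes "algebra_in SC A" "separable_algebra SC A"
 obtains a m u c X G where "sweedler_algebra a m u c X G" "A = swalg m u X G"
proof -
 obtain X G where AO: "AObj A = (X, G)" by (cases "AObj A")
 have A: "(X, G) : SM" "AMult A : Hom SC (sweedler_tensor (X, G) (X, G)) (X, G)"
  "AUnit A : Hom SC (Unit SC) (X, G)" using assms(1) by (simp_all add: algebra_in_def Let_def AO)
 obtain m where m: "AMult A = (sweedler_tensor (X, G) (X, G), (X, G), m)" using A(2) by (cases "AMult A") (auto simp: Hom_iff)
 obtain u where u: "AUnit A = ((0\<^sub>m 1 1, I 1), (X, G), u)" using A(3) by (cases "AUnit A") (auto simp: Hom_iff)
 obtain s0 where s0: "s0 : bimodule_hom SC A (regular_bimodule A)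
    \<lparr>BObj = AObj A \<otimes>\<^bsub>SC\<^esub> AObj A,
     BLeft = AMult A \<boxtimes>\<^bsub>SC\<^esub> Id SC (AObj A),
     BRight = Id SC (AObj A) \<boxtimes>\<^bsub>SC\<^esub> AMult A\<rparr>"
  "AMult A \<cdot>\<^bsub>SC\<^esub> s0 = Id SC (AObj A)" using assms(2) unfolding separable_algebra_def by blast
 obtain s where s: "s0 = ((X, G), sweedler_tensor (X, G) (X, G), s)"
  using s0(1) by (cases s0) (auto simp: bimodule_hom_def regular_bimodule_def Hom_iff AO)
 have AA: "A = swalg m u X G" using AO m u by (cases A) (simp add: swalg_def)
 note VD = SM_D[OF A(1)]
 note [simp] = VD(1-3)
 define a where "a = nr X"
 have ad: "nr X = a" by (simp add: a_def)
 have m': "nr m = a" "nc m = a * a" "G * m = m * kron G G" "X * m = m * (kron X (I a) + kron G X)"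
  using A(2) unfolding m by (simp_all add: Hom_iff ad sw.T_dim)
 have u': "nr u = a" "nc u = Suc 0" "G * u = u" "X * u = 0\<^sub>m a 1"
 proof -
  have ud: "nr u = a" "nc u = Suc 0" and 1: "u * 0\<^sub>m 1 1 = X * u" and 2: "u * I 1 = G * u"
   using A(3) unfolding u by (simp_all add: Hom_iff ad)
  show "nr u = a" "nc u = Suc 0" by (rule ud)+
  show "G * u = u" "X * u = 0\<^sub>m a 1" unfolding 1[symmetric] 2[symmetric] by (simp_all add: ud mat_ring)
 qed
 have e: "m * kron m (I a) = m * kron (I a) m" "m * kron u (I a) = I a" "m * kron (I a) u = I a"
  using assms(1) unfolding AA by (simp_all add: algebra_in_def Let_def ad)
 have s': "nr s = a * a" "nc s = a" "s * X = (kron X (I a) + kron G X) * s" "s * G = kron G G * s"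
  "s * m = kron m (I a) * kron (I a) s" "s * m = kron (I a) m * kron s (I a)" "m * s = I a"
 proof -
  let ?s = "((X, G), sweedler_tensor (X, G) (X, G), s)" and ?m = "(sweedler_tensor (X, G) (X, G), (X, G), m)"
  have "?s : Arr SC" and 1: "Comp SC ?s ?m = Comp SC (TensA SC ?m (Id SC (X, G))) (TensA SC (Id SC (X, G)) ?s)"
   and 2: "Comp SC ?s ?m = Comp SC (TensA SC (Id SC (X, G)) ?m) (TensA SC ?s (Id SC (X, G)))"
   using s0(1)[unfolded AA s bimodule_hom_def regular_bimodule_def Hom_iff mem_Collect_eq bimod.simps swalg_simps] by blast+
  thus "nr s = a * a" "nc s = a" "s * X = (kron X (I a) + kron G X) * s" "s * G = kron G G * s"
   by (simp_all add: ad sw.T_dim)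
  show "s * m = kron m (I a) * kron (I a) s" using 1 by (simp add: ad)
  show "s * m = kron (I a) m * kron s (I a)" using 2 by (simp add: ad)
  show "m * s = I a" using s0(2) unfolding AA s by (simp add: ad)
 qed
 note [simp] = m'(1,2) u'(1,2) s'(1,2) ad
 define c where "c = s * u"
 have [simp]: "nr c = a * a" "nc c = Suc 0" by (simp_all add: c_def)
 have "kron m (I a) * kron (I a) c = s * m * kron (I a) u" unfolding s'(5) by (simp add: c_def kron_ring)
 moreover have "kron (I a) m * kron c (I a) = s * m * kron u (I a)"
  unfolding s'(6) by (simp add: c_def kron_ring)
 ultimately have cc: "kron m (I a) * kron (I a) c = kron (I a) m * kron c (I a)" by (simp add: mat_ring e(2,3))
 have "sweedler_algebra a m u c X G"
 proof (unfold_locales, goal_cases)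
  case 10 show ?case using mult_eq_assoc[OF s'(7), of u] by (simp add: c_def mat_ring)
 next
  case 22 show ?case using arg_cong[OF s'(4), of "\<lambda>f. f * u"] by (simp add: c_def mat_ring u')
 next
  case 23 show ?case using arg_cong[OF s'(3), of "\<lambda>f. f * u"] by (simp add: c_def mat_ring u')
 qed (simp_all add: e cc VD(4-6) m' u')
 thus thesis using AA by (rule that)
qed

text \<open>Acting on a fixed object w; strictness makes all constraints identities.\<close>

lemma (in algebra_object) act_functor: assumes w: "w : Obj (mod_cat C A)"
 shows "module_functor C (regular_modcat C) (mod_cat C A) (\<lambda>X. ActO (mod_cat C A) X w)
  (\<lambda>f. ActA (mod_cat C A) f (Id (mod_cat C A) w))
  (\<lambda>X Y. Id (mod_cat C A) (ActO (mod_cat C A) (TensO C X Y) w))"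
proof -
 interpret M: module_category C "mod_cat C A" by (rule mod_cat_module_category)
 interpret R: module_category C "regular_modcat C" by (rule regular_module_category) (rule strict_monoidal_category_axioms)
 have rs [simp]: "Obj (regular_modcat C) = Obj C" "Arr (regular_modcat C) = Arr C" "Dom (regular_modcat C) = Dom C"
  "Cod (regular_modcat C) = Cod C" "Id (regular_modcat C) = Id C" "Comp (regular_modcat C) = Comp C"
  "Add (regular_modcat C) = Add C" "Smult (regular_modcat C) = Smult C"
  "ActO (regular_modcat C) = TensO C" "ActA (regular_modcat C) = TensA C"
  "Assoc (regular_modcat C) = (\<lambda>X Y Z. Id C (TensO C X (TensO C Y Z)))" "Lunit (regular_modcat C) = Id C"
  by (simp_all add: regular_modcat_def lincat.defs modcat.defs)
 obtain V r where ww: "w = (V, r)" by (cases w)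
 have m: "right_module C A V r" using w by (simp add: ww)
 hence [simp]: "V : Obj C" "r : Arr C" by (auto simp: right_module_iff)
 have idt: "TensA C (Id C X) (TensA C (Id C Y) t) = TensA C (Id C (TensO C X Y)) t"
  if "X : Obj C" "Y : Obj C" "t : Arr C" for X Y t using TensA_assoc[of "Id C X" "Id C Y" t] that by simp
 have ao [simp]: "ActO (mod_cat C A) X w : Obj (mod_lincat C A)" if "X : Obj C" for X
  using M.act_obj[OF that w] by simp
 have iw: "(w, w, Id C (fst w)) : Arr (mod_lincat C A)" using M.M.id_arr(1)[OF w] by simp
 show ?thesis
 proof (rule module_functorI[OF R.module_category_axioms M.module_category_axioms])
  show "linear_functor (regular_modcat C) (mod_cat C A) (\<lambda>X. ActO (mod_cat C A) X w)
   (\<lambda>f. ActA (mod_cat C A) f (Id (mod_cat C A) w))"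
  proof (rule linear_functorI[OF R.M.linear_category_axioms M.M.linear_category_axioms], goal_cases)
   case (1 X) thus ?case using w by simp
  next
   case (2 X) thus ?case using w M.act_id[of X w] by simp
  next
   case (3 f) thus ?case using w iw M.act_arr(1)[of f "Id (mod_cat C A) w"] by simp
  next
   case (4 f) thus ?case using w iw M.act_arr(2)[of f "Id (mod_cat C A) w"] by simp
  next
   case (5 f) thus ?case using w iw M.act_arr(3)[of f "Id (mod_cat C A) w"] by simp
  next
   case (6 f g) thus ?case by (simp add: ww tens_comp_id)
  next
   case (7 f g)
   thus ?case using TensA_Add_left[of f "Dom C f" "Cod C f" g "Id C V" V V] by (simp add: ww Hom_iff)
  next
   case (8 f c)
   thus ?case using TensA_Smult_left[of f "Dom C f" "Cod C f" "Id C V" V V] by (simp add: ww Hom_iff)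
  qed
 next
  fix X Y assume XY: "X : Obj C" "Y : Obj (regular_modcat C)"
  hence "ActO (mod_cat C A) (TensO C X Y) w : Obj (mod_cat C A)" by simp
  from M.M.iso_arr_id[OF this] XY
  show "iso_arr (mod_cat C A) (ActO (mod_cat C A) (ActO (regular_modcat C) X Y) w) (ActO (mod_cat C A) X (ActO (mod_cat C A) Y w))
    (Id (mod_cat C A) (ActO (mod_cat C A) (TensO C X Y) w))" by (simp add: ww TensO_assoc idt)
 next
  fix f h assume "f : Arr C" "h : Arr (regular_modcat C)"
  thus "Comp (mod_cat C A) (Id (mod_cat C A) (ActO (mod_cat C A) (TensO C (Cod C f) (Cod (regular_modcat C) h)) w))
    (ActA (mod_cat C A) (ActA (regular_modcat C) f h) (Id (mod_cat C A) w)) =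
   Comp (mod_cat C A) (ActA (mod_cat C A) f (ActA (mod_cat C A) h (Id (mod_cat C A) w)))
    (Id (mod_cat C A) (ActO (mod_cat C A) (TensO C (Dom C f) (Dom (regular_modcat C) h)) w))"
   by (simp add: ww TensO_assoc TensA_assoc idt)
 next
  fix X Y Z assume "X : Obj C" "Y : Obj C" "Z : Obj (regular_modcat C)"
  thus "Comp (mod_cat C A) (Assoc (mod_cat C A) X Y (ActO (mod_cat C A) Z w))
    (Id (mod_cat C A) (ActO (mod_cat C A) (TensO C (TensO C X Y) Z) w)) =
   Comp (mod_cat C A) (Comp (mod_cat C A) (ActA (mod_cat C A) (Id C X) (Id (mod_cat C A) (ActO (mod_cat C A) (TensO C Y Z) w)))
    (Id (mod_cat C A) (ActO (mod_cat C A) (TensO C X (ActO (regular_modcat C) Y Z)) w)))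
    (ActA (mod_cat C A) (Assoc (regular_modcat C) X Y Z) (Id (mod_cat C A) w))" by (simp add: ww TensO_assoc idt)
 next
  fix Z assume "Z : Obj (regular_modcat C)"
  thus "Comp (mod_cat C A) (Lunit (mod_cat C A) (ActO (mod_cat C A) Z w)) (Id (mod_cat C A) (ActO (mod_cat C A) (TensO C (Unit C) Z) w)) =
   ActA (mod_cat C A) (Lunit (regular_modcat C) Z) (Id (mod_cat C A) w)" by (simp add: ww Unit_TensO)
 qed
qed

section \<open>Transport of structure, arrows in coordinates, and the even case\<close>

context sweedler_algebra
begin

lemma ulin_inverse:
 assumes "umod n r" "umod n' r'" "ulin n r n' r' \<alpha>" "nr \<beta> = n" "nc \<beta> = n'" "\<alpha> * \<beta> = I n'" "\<beta> * \<alpha> = I n"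
 shows "ulin n' r' n r \<beta>"
proof -
 note [simp] = umodD(1,2)[OF assms(1)] umodD(1,2)[OF assms(2)] ulinD(1,2)[OF assms(3)] assms(4,5)
 have "\<beta> * r' = \<beta> * (r' * kron (\<alpha> * \<beta>) (I a))" by (simp add: assms(6) kron_one mat_ring)
 also have "... = \<beta> * (r' * kron \<alpha> (I a)) * kron \<beta> (I a)" by (simp add: kron_comp_left mat_ring)
 also have "... = r * kron \<beta> (I a)"
  unfolding ulinD(3)[OF assms(3), symmetric] by (simp add: mult_eq_assoc[OF assms(7)] mat_ring)
 finally show ?thesis by (simp add: ulin_def)
qed

lemma dgmodD: assumes "dgmod n r X G"
 shows "umod n r" "gmod n r G" "nr X = n" "nc X = n" "X * X = 0\<^sub>m n n" "G * X = (- 1) *s (X * G)"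
  "X * r = r * (kron X (I a) + kron G XA)" "nr G = n" "nc G = n" "G * G = I n" "G * r = r * kron G GA"
  "nr r = n" "nc r = n * a" using assms by (auto simp: dgmod_def gmod_def umod_def)

text \<open>Moves x and g along an isomorphism of underlying modules. Every object thus acquires the
  standard coordinates \<open>kron (I k) r\<close> of a multiple.\<close>

lemma dgmod_transport:
 assumes M: "dgmod n r X G" and s: "umod k s" and \<alpha>: "ulin k s n r \<alpha>" "nr \<beta> = k" "nc \<beta> = n" "\<alpha> * \<beta> = I n" "\<beta> * \<alpha> = I k"
 shows "dgmod k s (\<beta> * X * \<alpha>) (\<beta> * G * \<alpha>)"
proof -
 note d = dgmodD[OF M]
 note \<beta> = ulin_inverse[OF s d(1) \<alpha>]
 note [simp] = d(3,4,8,9,12,13) ulinD(1,2)[OF \<alpha>(1)] ulinD(1,2)[OF \<beta>] umodD(1,2)[OF s]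
 note ab = mult_eq_assoc[OF \<alpha>(4)]
 have \<alpha>s: "\<alpha> * s = r * kron \<alpha> (I a)" and \<beta>r: "\<beta> * r = s * kron \<beta> (I a)" using \<alpha>(1) \<beta> by (simp_all add: ulin_def)
 have GX: "G * (X * \<alpha>) = (- 1) *s (X * (G * \<alpha>))" using mult_eq_assoc[OF d(6), of \<alpha>] by (simp add: mat_ring)
 have "\<beta> * (G * (\<alpha> * s)) = \<beta> * (G * r) * kron \<alpha> (I a)" by (simp add: \<alpha>s mat_ring)
 also have "... = s * (kron \<beta> (I a) * (kron G GA * kron \<alpha> (I a)))"
  by (simp add: d(11) mat_ring mult_eq_assoc[OF \<beta>r])
 finally have 1: "\<beta> * (G * (\<alpha> * s)) = s * kron (\<beta> * (G * \<alpha>)) GA" by (simp add: kron_ring)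
 have "\<beta> * (X * (\<alpha> * s)) = \<beta> * (X * r) * kron \<alpha> (I a)" by (simp add: \<alpha>s mat_ring)
 also have "... = s * (kron \<beta> (I a) * ((kron X (I a) + kron G XA) * kron \<alpha> (I a)))"
  by (simp add: d(7) mat_ring mult_eq_assoc[OF \<beta>r])
 finally have 2: "\<beta> * (X * (\<alpha> * s)) = s * (kron (\<beta> * (X * \<alpha>)) (I a) + kron (\<beta> * (G * \<alpha>)) XA)" by (simp add: kron_ring)
 show ?thesis using s unfolding dgmod_def gmod_def
  by (simp add: mat_ring ab mult_eq_assoc[OF d(10)] mult_eq_assoc[OF d(5)] GX \<alpha>(5)) (simp add: 1 2 mat_ring)
qed

end

lemma (in algebra_object) act_tensor: assumes "p : Obj (mod_cat C A)" "X : Obj C" "Y : Obj C"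
 shows "ActO (mod_cat C A) (TensO C X Y) p = ActO (mod_cat C A) X (ActO (mod_cat C A) Y p)"
  "ActO (mod_cat C A) (Unit C) p = p"
proof -
 obtain V r where p: "p = (V, r)" by (cases p)
 have [simp]: "V : Obj C" "r : Arr C" using assms(1) by (auto simp: p right_module_iff)
 show "ActO (mod_cat C A) (TensO C X Y) p = ActO (mod_cat C A) X (ActO (mod_cat C A) Y p)"
  using TensA_assoc[of "Id C X" "Id C Y" r] assms(2,3) by (simp add: p TensO_assoc)
 show "ActO (mod_cat C A) (Unit C) p = p" by (simp add: p Unit_TensO Unit_TensA)
qed

context sweedler_algebra
begin

definition smarr :: "smod \<times> sarr => smod \<times> sarr => complex mat => (smod \<times> sarr) \<times> (smod \<times> sarr) \<times> sarr" where
 "smarr N N' f = (N, N', (fst N, fst N', f))"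

lemma smarr_inj [simp]: "smarr N N' f = smarr P P' g \<longleftrightarrow> N = P \<and> N' = P' \<and> f = g"
 by (auto simp: smarr_def)

lemma fst_smod [simp]: "fst (smod r X G) = (X, G)" by (simp add: smod_def)

lemma smarr_simps:
 "Dom MM (smarr N N' f) = N" "Cod MM (smarr N N' f) = N'"
 "Comp MM (smarr N' N'' g) (smarr N N' f) = smarr N N'' (g * f)"
 "Id MM (smod r X G) = smarr (smod r X G) (smod r X G) (I (nr X))"
 "Add MM (smarr N N' f) (smarr N N' g) = smarr N N' (f + g)"
 "Smult MM z (smarr N N' f) = smarr N N' (z *s f)"
 "Lunit MM (smod r X G) = smarr (smod r X G) (smod r X G) (I (nr X))" by (simp_all add: smarr_def)

lemma smarr_in: "dgmod n r X G ==> dgmod n' r' X' G' ==>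
  smarr (smod r X G) (smod r' X' G') f : Arr MM \<longleftrightarrow> ulin n r n' r' f \<and> f * X = X' * f \<and> f * G = G' * f"
proof -
 assume d: "dgmod n r X G" "dgmod n' r' X' G'"
 have n: "k = n" if "dgmod k r X G" for k using that d(1) by (simp add: dgmod_def)
 have n': "k = n'" if "dgmod k r' X' G'" for k using that d(2) by (simp add: dgmod_def)
 show ?thesis
 proof
  assume "smarr (smod r X G) (smod r' X' G') f : Arr MM"
  then obtain k k' where "dgmod k r X G" "dgmod k' r' X' G'" "ulin k r k' r' f" "f * X = X' * f" "f * G = G' * f"
   unfolding smod_arr smarr_def by auto
  thus "ulin n r n' r' f \<and> f * X = X' * f \<and> f * G = G' * f" using n n' by metis
 next
  assume "ulin n r n' r' f \<and> f * X = X' * f \<and> f * G = G' * f"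
  thus "smarr (smod r X G) (smod r' X' G') f : Arr MM" unfolding smod_arr smarr_def fst_smod using d by blast
 qed
qed

lemma smod_hom: assumes "dgmod n r X G" "dgmod n' r' X' G'"
 shows "h : Hom MM (smod r X G) (smod r' X' G') \<longleftrightarrow> (\<exists>f. h = smarr (smod r X G) (smod r' X' G') f \<and> ulin n r n' r' f \<and> f * X = X' * f \<and> f * G = G' * f)"
proof
 assume h: "h : Hom MM (smod r X G) (smod r' X' G')"
 hence "h : Arr MM" "Dom MM h = smod r X G" "Cod MM h = smod r' X' G'" by (simp_all add: Hom_iff)
 then obtain f where "h = smarr (smod r X G) (smod r' X' G') f" unfolding smod_arr smarr_def by auto
 thus "\<exists>f. h = smarr (smod r X G) (smod r' X' G') f \<and> ulin n r n' r' f \<and> f * X = X' * f \<and> f * G = G' * f"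
  using h smarr_in[OF assms] by (auto simp: Hom_iff simp del: S.mod_cat_simps)
next
 assume "\<exists>f. h = smarr (smod r X G) (smod r' X' G') f \<and> ulin n r n' r' f \<and> f * X = X' * f \<and> f * G = G' * f"
 thus "h : Hom MM (smod r X G) (smod r' X' G')"
  using smarr_in[OF assms] by (auto simp: Hom_iff smarr_simps simp del: S.mod_cat_simps)
qed

lemma act_smod: assumes V: "(X, G) : SM" and N: "dgmod n r Y K"
 shows "ActO MM (X, G) (smod r Y K) = smod (kron (I (nr X)) r) (kron X (I n) + kron G Y) (kron G K)"
  "dgmod (nr X * n) (kron (I (nr X)) r) (kron X (I n) + kron G Y) (kron G K)"
proof -
 have n: "nr Y = n" using N by (simp add: dgmod_def)
 have tw: "sweedler_tensor (X, G) (Y, K) = (kron X (I n) + kron G Y, kron G K)" by (simp add: sweedler_tensor_pair n)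
 have "sweedler_tensor (X, G) (sweedler_tensor (Y, K) (XA, GA)) = sweedler_tensor (kron X (I n) + kron G Y, kron G K) (XA, GA)"
  unfolding tw[symmetric] using sw.T_assoc[OF V dgmod_sweedler[OF N] sweedler_obj] by simp
 thus e: "ActO MM (X, G) (smod r Y K) = smod (kron (I (nr X)) r) (kron X (I n) + kron G Y) (kron G K)"
  by (simp add: smod_def tw)
 interpret M: module_category SC MM by (rule S.mod_cat_module_category)
 have "smod r Y K : Obj MM" unfolding smod_obj using N by blast
 hence "ActO MM (X, G) (smod r Y K) : Obj MM" using M.act_obj[of "(X, G)"] V by simp
 then obtain k where k: "dgmod k (kron (I (nr X)) r) (kron X (I n) + kron G Y) (kron G K)"
  unfolding e smod_obj by auto
 hence "k = nr X * n" using SM_D(1)[OF V] by (simp add: dgmod_def n)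
 thus "dgmod (nr X * n) (kron (I (nr X)) r) (kron X (I n) + kron G Y) (kron G K)" using k by simp
qed

lemma smarr_iso:
 assumes M: "dgmod n r X G" and N: "dgmod n' r' X' G'" and \<alpha>: "ulin n r n' r' \<alpha>" "\<alpha> * X = X' * \<alpha>" "\<alpha> * G = G' * \<alpha>"
  and \<beta>: "nr \<beta> = n" "nc \<beta> = n'" "\<alpha> * \<beta> = I n'" "\<beta> * \<alpha> = I n"
 shows "iso_arr MM (smod r X G) (smod r' X' G') (smarr (smod r X G) (smod r' X' G') \<alpha>)"
proof -
 interpret L: linear_category MM by (rule S.linear_mod_cat)
 note d = dgmodD[OF M] and d' = dgmodD[OF N]
 note \<beta>l = ulin_inverse[OF d(1) d'(1) \<alpha>(1) \<beta>]
 note [simp] = d(3,4,8,9) d'(3,4,8,9) ulinD(1,2)[OF \<alpha>(1)] \<beta>(1,2)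
 have c: "\<beta> * f' = f * \<beta>" if "\<alpha> * f = f' * \<alpha>" "nr f = n" "nc f = n" "nr f' = n'" "nc f' = n'" for f f'
 proof -
  have "\<beta> * f' = \<beta> * ((f' * \<alpha>) * \<beta>)" using that by (simp add: mat_ring \<beta>(3))
  also have "... = f * \<beta>" using that(2-) by (simp add: that(1)[symmetric] mat_ring mult_eq_assoc[OF \<beta>(4)])
  finally show ?thesis .
 qed
 have "smarr (smod r X G) (smod r' X' G') \<alpha> : Arr MM" "smarr (smod r' X' G') (smod r X G) \<beta> : Arr MM"
  unfolding smarr_in[OF M N] smarr_in[OF N M] using \<alpha> \<beta>l c[OF \<alpha>(2)] c[OF \<alpha>(3)] by simp_all
 thus ?thesis by (rule L.iso_arrI) (simp_all add: smarr_simps \<beta>(3,4) del: S.mod_cat_simps)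
qed

lemma act_smarr: "ActA MM (V, V', f) (smarr N N' h) = smarr (ActO MM V N) (ActO MM V' N') (kron f h)"
 by (cases N; cases N') (simp add: smarr_def)

lemma assoc_smod: assumes "V : SM" "V' : SM" "dgmod n r X G"
 shows "Assoc MM V V' (smod r X G) = smarr (ActO MM (sweedler_tensor V V') (smod r X G)) (ActO MM (sweedler_tensor V V') (smod r X G)) (I (sdim V * (sdim V' * n)))"
proof -
 have "nr X = n" using assms(3) by (simp add: dgmod_def)
 thus ?thesis using sw.T_assoc[OF assms(1,2) dgmod_sweedler[OF assms(3)]] assms dgmod_sweedler[OF assms(3)]
  by (simp add: smarr_def smod_def sw.T_dim sw.T_obj)
qed

text \<open>Blockwise as in \<open>ulin_free_scalar\<close>, now with two coefficients per
  block.\<close>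

lemma ulin_free_odd:
 assumes "umod n r" "\<And>f. ulin n r n r f ==> \<exists>x y. f = x *s I n + y *s H" "nr H = n" "nc H = n"
  "ulin (k * n) (kron (I k) r) (l * n) (kron (I l) r) f"
 obtains F F' where "nr F = l" "nc F = k" "nr F' = l" "nc F' = k" "f = kron F (I n) + kron F' H"
proof -
 note [simp] = umodD(1,2)[OF assms(1)] ulinD(1,2)[OF assms(5)] assms(3,4)
 have "\<exists>x y. kron (erow l j) (I n) * (f * kron (ecol k i) (I n)) = x *s I n + y *s H" for i j
  by (intro assms(2) ulin_compI[OF _ _ _ ulin_block_row ulin_compI[OF _ _ _ assms(5) ulin_block_col]]
    umod_free assms(1))
 then obtain x y where x: "kron (erow l j) (I n) * (f * kron (ecol k i) (I n)) = x j i *s I n + y j i *s H" for i j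
  by metis
 define F where "F z = mat l k (\<lambda>(j, i). z j i :: complex)" for z
 have [simp]: "nr (F z) = l" "nc (F z) = k" for z by (simp_all add: F_def)
 have F: "erow l j * (F z * ecol k i) = z j i *s I (Suc 0)" if "j < l" "i < k" for i j z
  using erow_mult_ecol[of j "F z" i] that by (simp add: F_def assoc_mult_mat_dim)
 have "f = kron (F x) (I n) + kron (F y) H"
  by (rule eq_mat_by_blocks_col[of _ _ k n]; (rule eq_mat_by_blocks_row[of _ _ l n])?)
   (simp_all add: x kron_ring F kron_smult_left kron_one kron_one_left)
 thus thesis by (intro that[of "F x" "F y"]) simp_all
qed

text \<open>W has only scalar endomorphisms, so maps and structures on multiples of W come from the
  first tensor factor: V \<mapsto> V \<otimes> W is fully faithful, and the actions of g and x on a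
  multiple of W determine a module V.\<close>

lemma even_equivalent: assumes E: "even_type n0 r0 D G0"
  and cover: "\<And>n r X G. dgmod n r X G ==> \<exists>k \<alpha> \<beta>. ulin (k * n0) (kron (I k) r0) n r \<alpha> \<and>
   nr \<beta> = k * n0 \<and> nc \<beta> = n \<and> \<alpha> * \<beta> = I n \<and> \<beta> * \<alpha> = I (k * n0)"
 shows "module_equivalent SC V0 MM"
proof -
 have W: "dgmod n0 r0 D G0" and n0: "0 < n0" and sc: "\<And>f. ulin n0 r0 n0 r0 f ==> \<exists>x. f = x *s I n0"
  using E by (auto simp: even_type_def)
 note d = dgmodD[OF W]
 note [simp] = d(3,4,8,9,12,13)
 have nz: "(I n0 :: complex mat) \<noteq> 0\<^sub>m (nr (I n0 :: complex mat)) (nc (I n0 :: complex mat))"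
  using one_mat_neq_zero[OF n0] by simp
 have GG0: "G0 \<noteq> 0\<^sub>m (nr G0) (nc G0)"
  using d(10) one_mat_neq_zero[OF n0] by (metis d(8,9) left_mult_zero_mat carrier_matI)
 have V0m: "module_category SC V0" unfolding V0_def by (rule regular_module_category[OF sw.monoidal])
 note MMm = S.mod_cat_module_category
 define w where "w = smod r0 D G0"
 have "w : Obj MM" unfolding smod_obj w_def using W by blast
 hence F: "module_functor SC V0 MM (\<lambda>X. ActO MM X w) (\<lambda>f. ActA MM f (Id MM w))
   (\<lambda>X Y. Id MM (ActO MM (TensO SC X Y) w))" unfolding V0_def by (rule S.act_functor)
 hence lin: "linear_functor V0 MM (\<lambda>X. ActO MM X w) (\<lambda>f. ActA MM f (Id MM w))"
  by (simp add: module_functor_def)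
 note Fo = act_smod[OF _ W, folded w_def]
 have Fa: "ActA MM (V, V', f) (Id MM w) = smarr (ActO MM V w) (ActO MM V' w) (kron f (I n0))" for V V' f
  unfolding w_def smarr_simps act_smarr by simp
 have "bij_betw (\<lambda>f. ActA MM f (Id MM w)) (Hom V0 V V') (Hom MM (ActO MM V w) (ActO MM V' w))"
  if VV: "V : Obj V0" "V' : Obj V0" for V V'
 proof -
  obtain X G X' G' where V: "V = (X, G)" "V' = (X', G')" by (cases V; cases V')
  have VO: "(X, G) : SM" "(X', G') : SM" using VV by (simp_all add: V)
  note [simp] = SM_D(1-3)[OF VO(1)] SM_D(1-3)[OF VO(2)]
  have H0: "h : Hom V0 V V' \<longleftrightarrow> (\<exists>f. h = (V, V', f) \<and> nr f = nr X' \<and> nc f = nr X \<and> f * X = X' * f \<and> f * G = G' * f)" for h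
   using VO by (cases h) (auto simp: V Hom_iff)
  have "h : (\<lambda>f. ActA MM f (Id MM w)) ` Hom V0 V V'" if h: "h : Hom MM (ActO MM V w) (ActO MM V' w)" for h
  proof -
   obtain f where hf: "h = smarr (ActO MM V w) (ActO MM V' w) f"
    and f: "ulin (nr X * n0) (kron (I (nr X)) r0) (nr X' * n0) (kron (I (nr X')) r0) f"
    "f * (kron X (I n0) + kron G D) = (kron X' (I n0) + kron G' D) * f" "f * kron G G0 = kron G' G0 * f"
    using h unfolding V Fo(1)[OF VO(1)] Fo(1)[OF VO(2)] smod_hom[OF Fo(2)[OF VO(1)] Fo(2)[OF VO(2)]] by blast
   obtain \<phi> where \<phi>: "nr \<phi> = nr X'" "nc \<phi> = nr X" "f = kron \<phi> (I n0)"
    using ulin_free_scalar[OF d(1) sc f(1)] by blast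
   note [simp] = \<phi>(1,2)
   \<comment> \<open>Compatibility of \<phi> with g comes first: in the condition for x the terms
     with \<open>D\<close> cancel only after it is known.\<close>
   have "kron (\<phi> * G) G0 = kron (G' * \<phi>) G0" using f(3) unfolding \<phi>(3) by (simp add: kron_ring)
   hence g: "\<phi> * G = G' * \<phi>" by (rule kron_cancel_right[OF _ _ _ GG0]) simp_all
   have "kron (\<phi> * G) D + kron (\<phi> * X) (I n0) = kron (\<phi> * G) D + kron (X' * \<phi>) (I n0)"
    using f(2) unfolding \<phi>(3) by (simp add: kron_ring g add_commute_mat_dim[of "kron (G' * \<phi>) D"])
   hence "kron (\<phi> * X) (I n0) = kron (X' * \<phi>) (I n0)" by (rule add_left_cancel_mat) simp_all
   hence "\<phi> * X = X' * \<phi>" by (rule kron_cancel_right[OF _ _ _ nz]) simp_all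
   thus ?thesis using g by (intro image_eqI[of _ _ "(V, V', \<phi>)"]) (simp_all only: H0 Fa hf \<phi>(3), auto)
  qed
  moreover have "inj_on (\<lambda>f. ActA MM f (Id MM w)) (Hom V0 V V')"
  proof (rule inj_onI)
   fix h h' assume hh: "h : Hom V0 V V'" "h' : Hom V0 V V'" "ActA MM h (Id MM w) = ActA MM h' (Id MM w)"
   then obtain f f' where f: "h = (V, V', f)" "h' = (V, V', f')" and [simp]: "nr f = nr X'" "nc f = nr X"
    "nr f' = nr X'" "nc f' = nr X" by (auto simp: H0)
   have "kron f (I n0) = kron f' (I n0)" using hh(3) unfolding f Fa smarr_inj by blast
   hence "f = f'" by (rule kron_cancel_right[OF _ _ _ nz]) simp_all
   thus "h = h'" by (simp add: f)
  qed
  ultimately show ?thesis using lin VV unfolding bij_betw_def linear_functor_def by blast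
 qed
 moreover have "\<exists>V\<in>Obj V0. \<exists>f. iso_arr MM (ActO MM V w) N f" if N: "N : Obj MM" for N
 proof -
  obtain n r X G where NN: "N = smod r X G" and M: "dgmod n r X G" using N smod_obj by blast
  note dM = dgmodD[OF M]
  obtain k \<alpha> \<beta> where \<alpha>: "ulin (k * n0) (kron (I k) r0) n r \<alpha>" and \<beta>: "nr \<beta> = k * n0" "nc \<beta> = n"
   "\<alpha> * \<beta> = I n" "\<beta> * \<alpha> = I (k * n0)" using cover[OF M] by blast
  define X' where "X' = \<beta> * X * \<alpha>"
  define G' where "G' = \<beta> * G * \<alpha>"
  have T: "dgmod (k * n0) (kron (I k) r0) X' G'" unfolding X'_def G'_def by (rule dgmod_transport[OF M umod_free[OF d(1)] \<alpha> \<beta>])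
  note dT = dgmodD[OF T]
  note [simp] = dM(3,4,8,9,12,13) dT(3,4,8,9) ulinD(1,2)[OF \<alpha>] \<beta>(1,2)
  \<comment> \<open>G' and 1 \<otimes> G0 are both semilinear for the automorphism
    \<open>GA\<close>, which is an involution, so their product is linear.\<close>
  have "G' * kron (I k) G0 * kron (I k) r0 = (G' * kron (I k) r0) * kron (kron (I k) G0) GA"
   by (simp add: kron_ring d(11) kron_assoc)
  hence "ulin (k * n0) (kron (I k) r0) (k * n0) (kron (I k) r0) (G' * kron (I k) G0)"
   by (simp add: ulin_def dT(11) kron_ring GA_GA)
  then obtain g where g: "nr g = k" "nc g = k" "G' * kron (I k) G0 = kron g (I n0)"
   using ulin_free_scalar[OF d(1) sc] by metis
  note [simp] = g(1,2)
  have "G' = G' * (kron (I k) G0 * kron (I k) G0)" by (simp add: kron_mult d(10) mat_ring kron_one)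
  also have "... = kron g G0" unfolding assoc_mult_mat_dim[symmetric]
   by (subst assoc_mult_mat_dim[symmetric]) (simp_all add: g(3) kron_ring del: assoc_mult_mat_dim)
  finally have Gg: "G' = kron g G0" .
  have 1: "X' * kron (I k) r0 = kron (I k) r0 * kron X' (I a) + kron (I k) r0 * kron (kron g G0) XA"
   using dT(7) unfolding Gg by (simp add: mat_ring)
  have 2: "kron g D * kron (I k) r0 = kron (I k) r0 * kron (kron g D) (I a) + kron (I k) r0 * kron (kron g G0) XA"
   by (simp add: kron_mult d(7) mat_ring kron_assoc kron_add_right)
  \<comment> \<open>X' and g \<otimes> D obey the same Leibniz rule, with respect to the grading G'
    = g \<otimes> G0, so their difference is linear.\<close>
  have "(X' + (- 1) *s kron g D) * kron (I k) r0 = kron (I k) r0 * kron X' (I a) + (- 1) *s (kron (I k) r0 * kron (kron g D) (I a))"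
   unfolding mat_ring by (simp add: mat_ring 1 2) (intro eq_matI; simp del: index_mult_mat(1))
  hence "ulin (k * n0) (kron (I k) r0) (k * n0) (kron (I k) r0) (X' + (- 1) *s kron g D)"
   by (simp add: ulin_def mat_ring kron_add_left kron_smult_left)
  then obtain x where x: "nr x = k" "nc x = k" "X' + (- 1) *s kron g D = kron x (I n0)"
   using ulin_free_scalar[OF d(1) sc] by metis
  note [simp] = x(1,2)
  have Xx: "X' = kron x (I n0) + kron g D" unfolding x(3)[symmetric] by (intro eq_matI; simp del: index_mult_mat(1))
  \<comment> \<open>Comparing coefficients in the relations between G' and X' shows that x and g
    satisfy those of Sweedler's algebra.\<close>
  have "kron (g * g) (I n0) = kron (I k) (I n0)" using dT(10) by (simp add: Gg kron_mult d(10) kron_one)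
  hence gg: "g * g = I k" by (rule kron_cancel_right[OF _ _ _ nz]) simp_all
  have "kron (I k) (G0 * D) + kron (g * x) G0 = kron (I k) (G0 * D) + kron ((- 1) *s (x * g)) G0"
   using dT(6)[unfolded Gg Xx]
   by (simp add: kron_ring gg d(6) kron_smult_right kron_smult_left add_commute_mat_dim[of "kron (g * x) G0"] add_commute_mat_dim[of "(- 1) *s kron (x * g) G0"])
  hence "kron (g * x) G0 = kron ((- 1) *s (x * g)) G0" by (rule add_left_cancel_mat) simp_all
  hence gx: "g * x = (- 1) *s (x * g)" by (rule kron_cancel_right[OF _ _ _ GG0]) simp_all
  have "kron (x * x) (I n0) = kron (0\<^sub>m k k) (I n0)"
   using dT(5)[unfolded Xx] by (simp add: kron_ring gg d(5) gx kron_smult_left kron_zero_right kron_zero_left add_assoc_mat_dim add_smult_self add_self_smult zero_smult_mat)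
  hence xx: "x * x = 0\<^sub>m k k" by (rule kron_cancel_right[OF _ _ _ nz]) simp_all
  have VO: "(x, g) : SM" by (rule SM_I) (simp_all add: xx gg gx)
  have "\<alpha> * X' = X * \<alpha>" "\<alpha> * G' = G * \<alpha>" by (simp_all add: X'_def G'_def mat_ring mult_eq_assoc[OF \<beta>(3)])
  from smarr_iso[OF T M \<alpha> this \<beta>] have "iso_arr MM (ActO MM (x, g) w) N (smarr (ActO MM (x, g) w) N \<alpha>)"
   unfolding Fo(1)[OF VO] x(1) NN Xx Gg .
  thus ?thesis using VO by (intro bexI[of _ "(x, g)"]) (blast, simp)
 qed
 ultimately have "ffes V0 MM (\<lambda>X. ActO MM X w) (\<lambda>f. ActA MM f (Id MM w))"
  using lin unfolding ffes_def by blast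
 thus ?thesis using module_equivalent_iff[OF V0m MMm] mod_functorI[OF V0m MMm F] by blast
qed

end

section \<open>Odd type\<close>

locale odd_object = sweedler_algebra +
 fixes nW :: nat and rW XW GW H :: "complex mat" assumes odd: "odd_type nW rW XW GW H"
begin

lemma W: "dgmod nW rW XW GW" and nW: "0 < nW" and H: "ulin nW rW nW rW H" "H * H = I nW"
  "GW * H = (- 1) *s (H * GW)" "XW * H = (- 1) *s (H * XW)"
 and W_endo: "ulin nW rW nW rW f ==> \<exists>x y. f = x *s I nW + y *s H" using odd unfolding odd_type_def by blast+

lemmas W_dims [simp] = dgmodD(3,4,8,9,12,13)[OF W] ulinD(1,2)[OF H(1)]

text \<open>\<open>ep\<close> and \<open>em\<close> are the projections to the eigenspaces of
  \<open>H\<close> for 1 and -1. By \<open>anti_e\<close>, operators that anticommute with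
  \<open>H\<close> exchange them.\<close>

definition "ep = (1/2) *s (I nW + H)"
definition "em = (1/2) *s (I nW + (- 1) *s H)"

lemma e_dims [simp]: "nr ep = nW" "nc ep = nW" "nr em = nW" "nc em = nW" by (simp_all add: ep_def em_def)

lemma e_sum: "ep + em = I nW" unfolding ep_def em_def by (intro eq_matI; simp add: field_simps del: index_mult_mat(1))

lemma H_e: "H * ep = ep" "ep * H = ep" "H * em = (- 1) *s em" "em * H = (- 1) *s em"
 by (simp_all add: ep_def em_def mat_ring H(2) smult_smult_mat; intro eq_matI; simp del: index_mult_mat(1))+

lemma e_mult: "ep * ep = ep" "em * em = em" "ep * em = 0\<^sub>m nW nW" "em * ep = 0\<^sub>m nW nW"
proof -
 have "ep * ep = (1/2) *s ((I nW + H) * ep)" "em * em = (1/2) *s ((I nW + (- 1) *s H) * em)"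
  "ep * em = (1/2) *s ((I nW + H) * em)" "em * ep = (1/2) *s ((I nW + (- 1) *s H) * ep)"
  by (simp_all add: ep_def em_def mat_ring)
 thus "ep * ep = ep" "em * em = em" "ep * em = 0\<^sub>m nW nW" "em * ep = 0\<^sub>m nW nW"
  by (simp_all add: mat_ring H_e smult_smult_mat; intro eq_matI; simp del: index_mult_mat(1))+
qed

lemma anti_e: assumes "f * H = (- 1) *s (H * f)" "nr f = nW" "nc f = nW" shows "f * ep = em * f" "f * em = ep * f"
 using assms(2,3) by (simp_all add: ep_def em_def mat_ring assms(1) smult_smult_mat one_smult_mat)

lemma e_ulin: "ulin nW rW nW rW ep" "ulin nW rW nW rW em"
 using ulinD(3)[OF H(1)] by (simp_all add: ulin_def ep_def em_def mat_ring kron_smult_left kron_add_left kron_one)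

end

lemma half_zero_mat: fixes A :: "complex mat" assumes "A = (- 1) *s A" shows "A = 0\<^sub>m (nr A) (nc A)"
proof (rule eq_matI)
 fix i j assume "i < nr (0\<^sub>m (nr A) (nc A) :: complex mat)" "j < nc (0\<^sub>m (nr A) (nc A) :: complex mat)"
 hence ij: "i < nr A" "j < nc A" by simp_all
 have "A $$ (i, j) = ((- 1) *s A) $$ (i, j)" using assms by simp
 thus "A $$ (i, j) = 0\<^sub>m (nr A) (nc A) $$ (i, j)" using ij by simp
qed simp_all

context odd_object
begin

lemma nz: "(I nW :: complex mat) \<noteq> 0\<^sub>m (nr (I nW :: complex mat)) (nc (I nW :: complex mat))"
 using one_mat_neq_zero[OF nW] by simp

lemma H_nz: "H \<noteq> 0\<^sub>m (nr H) (nc H)"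
proof
 assume "H = 0\<^sub>m (nr H) (nc H)"
 hence "H * H = 0\<^sub>m nW nW" by (metis left_mult_zero_mat carrier_matI W_dims(7,8))
 thus False using H(2) one_mat_neq_zero[OF nW] by simp
qed

lemma G_nz: "GW \<noteq> 0\<^sub>m (nr GW) (nc GW)"
proof
 assume "GW = 0\<^sub>m (nr GW) (nc GW)"
 hence "GW * GW = 0\<^sub>m nW nW" by (metis left_mult_zero_mat carrier_matI W_dims(3,4))
 thus False using dgmodD(10)[OF W] one_mat_neq_zero[OF nW] by simp
qed

lemma HG_nz: "H * GW \<noteq> 0\<^sub>m (nr (H * GW)) (nc (H * GW))"
proof
 assume "H * GW = 0\<^sub>m (nr (H * GW)) (nc (H * GW))"
 hence z: "H * GW = 0\<^sub>m nW nW" by simp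
 have "H * (H * GW) = GW" using mult_eq_assoc[OF H(2), of GW] by (simp add: mat_ring)
 thus False using z G_nz by (simp add: mat_ring)
qed

text \<open>N is sent to its space tensored with W, with x acting by N \<otimes> H + 1 \<otimes> XW.
  This squares to zero because N^2 = 0 and \<open>H\<close> anticommutes with \<open>XW\<close>. The
  grading is that of W alone, and x is odd by the oddness of \<open>H\<close> and \<open>XW\<close>,
  so N requires no grading of its own.\<close>

definition "xo N = kron N H + kron (I (nr N)) XW"
definition "fob N = smod (kron (I (nr N)) rW) (xo N) (kron (I (nr N)) GW)"
definition "fmap = (\<lambda>(N, N', f). smarr (fob N) (fob N') (kron f (I nW)))"

lemma fmap [simp]: "fmap (N, N', f) = smarr (fob N) (fob N') (kron f (I nW))" by (simp add: fmap_def)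

lemma dim_xo [simp]: "nr (xo N) = nr N * nW" "nc (xo N) = nr N * nW" by (simp_all add: xo_def)

lemma fob_dgmod: assumes "N : CM" shows "dgmod (nr N * nW) (kron (I (nr N)) rW) (xo N) (kron (I (nr N)) GW)"
proof -
 note ND = CM_D[OF assms]
 note d = dgmodD[OF W]
 note [simp] = ND(1)
 have 1: "gmod (nr N * nW) (kron (I (nr N)) rW) (kron (I (nr N)) GW)"
  by (rule gmod_tensor[OF d(2)]) (simp_all add: mat_ring)
 have 2: "xo N * xo N = 0\<^sub>m (nr N * nW) (nr N * nW)"
  by (simp add: xo_def kron_ring ND(2) H(2,4) d(5) kron_zero_left kron_zero_right kron_smult_right add_smult_self add_self_smult zero_smult_mat)
 have 3: "kron (I (nr N)) GW * xo N = (- 1) *s (xo N * kron (I (nr N)) GW)"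
  by (simp add: xo_def kron_ring H(3) d(6) kron_smult_right)
 have 4: "xo N * kron (I (nr N)) rW = kron (I (nr N)) rW * (kron (xo N) (I a) + kron (kron (I (nr N)) GW) XA)"
  by (simp add: xo_def kron_ring ulinD(3)[OF H(1)] d(7) kron_assoc kron_add_left kron_add_right add_assoc_mat_dim)
 show ?thesis unfolding dgmod_def using 1 2 3 4 by simp
qed

lemma fob_obj: "N : CM ==> fob N : Obj MM" unfolding smod_obj fob_def using fob_dgmod by blast

lemma fmap_arr: assumes "N : CM" "N' : CM" "nr f = nr N'" "nc f = nr N" "f * N = N' * f"
 shows "smarr (fob N) (fob N') (kron f (I nW)) : Arr MM"
proof -
 note [simp] = CM_D(1)[OF assms(1)] CM_D(1)[OF assms(2)] assms(3,4)
 show ?thesis unfolding fob_def smarr_in[OF fob_dgmod[OF assms(1)] fob_dgmod[OF assms(2)]]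
  using ulin_free[OF dgmodD(1)[OF W] assms(3,4)] by (simp add: kron_ring xo_def assms(5))
qed

lemma fob_linear: "linear_functor S0 MM fob fmap"
proof (rule linear_functorI[OF S0_linear S.linear_mod_cat], goal_cases)
 case (1 N) thus ?case using fob_obj by simp
next
 case (2 N) thus ?case using smarr_simps(4) by (simp add: fob_def kron_one del: S.mod_cat_simps)
next
 case (3 f) thus ?case by (cases f) (simp add: fmap_arr del: S.mod_cat_simps)
next
 case (4 f) thus ?case by (cases f) (simp add: smarr_simps del: S.mod_cat_simps)
next
 case (5 f) thus ?case by (cases f) (simp add: smarr_simps del: S.mod_cat_simps)
next
 case (6 f g) thus ?case by (cases f; cases g) (simp add: smarr_simps kron_ring del: S.mod_cat_simps)
next
 case (7 f g) thus ?case by (cases f; cases g) (simp add: smarr_simps kron_add_left del: S.mod_cat_simps)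
next
 case (8 f z) thus ?case by (cases f) (simp add: smarr_simps kron_smult_left del: S.mod_cat_simps)
qed

text \<open>The constraint from (V \<rhd> N) \<otimes> W to V \<otimes> (N \<otimes> W). The grading
  of the first involves only \<open>GW\<close>, that of the second also g on V, so the identity does
  not intertwine them. Applying g where \<open>H\<close> is -1 does, since \<open>GW\<close>
  exchanges the eigenspaces of \<open>H\<close>.\<close>

definition "smat V N = kron (I (nr (fst V))) (kron (I (nr N)) ep) + kron (snd V) (kron (I (nr N)) em)"
definition "sarr V N = smarr (fob (coideal_act V N)) (ActO MM V (fob N)) (smat V N)"

lemma smat_props: assumes V: "(X, G) : SM" and N: "N : CM"
 defines "n \<equiv> nr X" and "k \<equiv> nr N" and "S \<equiv> smat (X, G) N"
 shows "nr S = n * (k * nW)" "nc S = n * (k * nW)" "S * S = I (n * (k * nW))"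
  "S * kron (I (n * k)) GW = kron G (kron (I k) GW) * S"
  "S * xo (coideal_act (X, G) N) = (kron X (I (k * nW)) + kron G (xo N)) * S"
  "ulin (n * (k * nW)) (kron (I (n * k)) rW) (n * (k * nW)) (kron (I n) (kron (I k) rW)) S"
proof -
 note VD = SM_D[OF V]
 have [simp]: "nr X = n" "nc X = n" "nr G = n" "nc G = n" "nr N = k" "nc N = k"
  using VD(1-3) CM_D(1)[OF N] by (simp_all add: n_def k_def)
 have SS: "S = kron (I n) (kron (I k) ep) + kron G (kron (I k) em)" by (simp add: S_def smat_def)
 show "nr S = n * (k * nW)" "nc S = n * (k * nW)" by (simp_all add: SS)
 have GG: "G * G = I n" and GX: "G * X = (- 1) *s (X * G)" using VD(5,6) by simp_all
 note ge = anti_e[OF H(3)] and xe = anti_e[OF H(4)]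
 show "S * S = I (n * (k * nW))"
 proof -
  have "S * S = kron (I n) (kron (I k) (ep + em))"
   by (simp add: SS kron_ring e_mult GG kron_zero_right kron_add_right)
  thus ?thesis by (simp add: e_sum kron_one)
 qed
 show "S * kron (I (n * k)) GW = kron G (kron (I k) GW) * S"
  by (simp add: SS kron_ring kron_one_prod GG ge add_commute_mat_dim[of "kron G (kron (I k) (em * GW))"])
 show "S * xo (coideal_act (X, G) N) = (kron X (I (k * nW)) + kron G (xo N)) * S"
 proof -
  have x: "xo (coideal_act (X, G) N) = kron X (kron (I k) H) + kron G (kron N H) + kron (I n) (kron (I k) XW)"
   by (simp add: xo_def coideal_act_def kron_add_left kron_assoc kron_one_prod)
  have y: "kron X (I (k * nW)) + kron G (xo N) = kron X (kron (I k) (I nW)) + kron G (kron N H) + kron G (kron (I k) XW)"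
   by (simp add: xo_def kron_add_right kron_one add_assoc_mat_dim)
  show ?thesis unfolding x y SS
   by (simp add: kron_ring H_e xe GG GX kron_smult_left kron_smult_right) (intro eq_matI; simp del: index_mult_mat(1))
 qed
 show "ulin (n * (k * nW)) (kron (I (n * k)) rW) (n * (k * nW)) (kron (I n) (kron (I k) rW)) S"
  using ulinD(3)[OF e_ulin(1)] ulinD(3)[OF e_ulin(2)]
  by (simp add: ulin_def SS kron_ring kron_one_prod kron_add_left kron_assoc)
qed

end

lemma coideal_act_modules [simp]: assumes "V : SM" "N : CM"
 shows "coideal_act V N : CM" "nr (coideal_act V N) = sdim V * nr N"
 using assms coideal_act_obj coideal_act_dim by (cases V; blast | cases V; simp)+

lemma coideal_act_tens: assumes "V : SM" "V' : SM" "N : CM"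
 shows "coideal_act (sweedler_tensor V V') N = coideal_act V (coideal_act V' N)"
 using assms coideal_act_tensor by (cases V; cases V') simp

context odd_object
begin

lemma sarr_iso: assumes V: "V : SM" and N: "N : CM"
 shows "iso_arr MM (fob (coideal_act V N)) (ActO MM V (fob N)) (sarr V N)"
proof -
 obtain X G where VV: "V = (X, G)" by (cases V)
 have V': "(X, G) : SM" using V by (simp add: VV)
 note S = smat_props[OF V' N]
 note cN = coideal_act_modules[OF V' N]
 have F: "fob (coideal_act V N) = smod (kron (I (nr X * nr N)) rW) (xo (coideal_act (X, G) N)) (kron (I (nr X * nr N)) GW)"
  unfolding fob_def VV cN(2) by simp
 have D: "dgmod (nr X * (nr N * nW)) (kron (I (nr X * nr N)) rW) (xo (coideal_act (X, G) N)) (kron (I (nr X * nr N)) GW)"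
  using fob_dgmod[OF cN(1)] unfolding cN(2) by (simp add: mult.assoc)
 note A = act_smod[OF V' fob_dgmod[OF N], folded fob_def]
 show ?thesis unfolding sarr_def F unfolding VV A(1) by (rule smarr_iso[OF D A(2) S(6) S(5) S(4) S(1,2,3,3)])
qed

lemma id_act_fob: assumes "V : SM" "N : CM" shows "Lunit MM (fob N) = smarr (fob N) (fob N) (I (nr N * nW))"
  "V' : SM ==> Assoc MM V' V (fob N) = smarr (ActO MM (sweedler_tensor V' V) (fob N)) (ActO MM (sweedler_tensor V' V) (fob N))
   (I (sdim V' * (sdim V * (nr N * nW))))"
 using assms assoc_smod[OF _ _ fob_dgmod[OF assms(2)], of V' V] smarr_simps(7)
 by (simp_all add: fob_def del: S.mod_cat_simps)

lemma odd_module_functor: "module_functor SC S0 MM fob fmap sarr"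
proof (rule module_functorI[OF S0_module_category S.mod_cat_module_category fob_linear], goal_cases)
 case (1 V N) thus ?case by (simp add: sarr_iso del: S.mod_cat_simps)
next
 case (2 f h)
 obtain V V' \<phi> where f: "f = (V, V', \<phi>)" by (cases f)
 obtain N N' \<psi> where h: "h = (N, N', \<psi>)" by (cases h)
 obtain X G where V: "V = (X, G)" by (cases V)
 obtain X' G' where V': "V' = (X', G')" by (cases V')
 have VO: "(X, G) : SM" "(X', G') : SM" and \<phi>: "nr \<phi> = nr X'" "nc \<phi> = nr X" "\<phi> * G = G' * \<phi>"
  using 2(1) by (simp_all add: f V V')
 have NO: "N : CM" "N' : CM" and \<psi>: "nr \<psi> = nr N'" "nc \<psi> = nr N"
  using 2(2) by (simp_all add: h)
 note [simp] = SM_D(1-3)[OF VO(1)] SM_D(1-3)[OF VO(2)] CM_D(1)[OF NO(1)] CM_D(1)[OF NO(2)] \<phi>(1,2) \<psi>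
 have "smat (X', G') N' * kron (kron \<phi> \<psi>) (I nW) = kron \<phi> (kron \<psi> (I nW)) * smat (X, G) N"
  by (simp add: smat_def mat_ring kron_assoc kron_mult \<phi>(3))
 thus ?case by (simp add: f h V V' sarr_def smarr_simps act_smarr del: S.mod_cat_simps)
next
 case (3 V V' N)
 obtain X G where V: "V = (X, G)" by (cases V)
 obtain X' G' where V': "V' = (X', G')" by (cases V')
 have VO: "(X, G) : SM" "(X', G') : SM" and NO: "N : CM" using 3 by (simp_all add: V V')
 note [simp] = SM_D(1-3)[OF VO(1)] SM_D(1-3)[OF VO(2)] CM_D(1)[OF NO]
 \<comment> \<open>g acts on a tensor product by g \<otimes> g, and the orthogonality of
   \<open>ep\<close> and \<open>em\<close> removes the mixed terms.\<close>
 have m: "smat (sweedler_tensor V V') N = kron (I (nr X)) (smat V' N) * smat V (coideal_act V' N)"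
  using coideal_act_modules(2)[OF VO(2) NO] sw.T_dim[OF VO]
  by (simp add: V V' smat_def kron_ring kron_add_right kron_one_prod kron_assoc kron_one sweedler_tensor_pair e_mult kron_zero_right)
 have dd: "nr (smat V' N) = nr X' * (nr N * nW)" "nr (smat V (coideal_act V' N)) = nr X * (nr X' * (nr N * nW))"
  "nc (smat V (coideal_act V' N)) = nr X * (nr X' * (nr N * nW))"
  using smat_props(1,2)[OF VO(2) NO] smat_props(1,2)[OF VO(1) coideal_act_modules(1)[OF VO(2) NO]] coideal_act_modules(2)[OF VO(2) NO]
  by (simp_all add: V V' mult.assoc)
 have t: "coideal_act (sweedler_tensor V V') N = coideal_act V (coideal_act V' N)"
  unfolding V V' by (rule coideal_act_tens[OF VO NO])
 have at: "ActO MM (sweedler_tensor V V') (fob N) = ActO MM V (ActO MM V' (fob N))"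
  using S.act_tensor(1)[of "fob N" V V'] fob_obj[OF NO] VO V V' by simp
 have dz: "nr (coideal_act V (coideal_act V' N)) = nr X * (nr X' * nr N)"
  using coideal_act_modules[OF VO(2) NO] coideal_act_modules(2)[OF VO(1), of "coideal_act V' N"] by (simp add: V V')
 show ?case using id_act_fob(2)[of V' N V] VO NO
  by (simp add: sarr_def smarr_simps act_smarr t[unfolded V V'] at[unfolded V V'] m[unfolded V V'] V V' mat_ring dz[unfolded V V'] dd[unfolded V V'] kron_one mult.assoc del: S.mod_cat_simps)
next
 case (4 N)
 hence NO: "N : CM" by simp
 have at: "ActO MM (0\<^sub>m (Suc 0) (Suc 0), I (Suc 0)) (fob N) = fob N"
  using S.act_tensor(2)[of "fob N" "Unit SC" "Unit SC"] fob_obj[OF NO] by simp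
 have "smat (0\<^sub>m (Suc 0) (Suc 0), I (Suc 0)) N = kron (I (nr N)) (ep + em)"
  by (simp add: smat_def kron_one_left kron_add_right)
 hence m: "smat (0\<^sub>m (Suc 0) (Suc 0), I (Suc 0)) N = I (nr N * nW)" by (simp add: e_sum kron_one)
 show ?case using id_act_fob(1)[OF sweedler_unit_modules NO]
  by (simp add: sarr_def smarr_simps at m coideal_act_unit[OF NO] mat_ring kron_one del: S.mod_cat_simps)
qed

lemma fmap_bij: assumes N: "N : CM" and N': "N' : CM"
 shows "bij_betw fmap (Hom S0 N N') (Hom MM (fob N) (fob N'))" unfolding bij_betw_def
proof
 note [simp] = CM_D(1)[OF N] CM_D(1)[OF N']
 note d = dgmodD[OF W]
 have H0: "h : Hom S0 N N' \<longleftrightarrow> (\<exists>f. h = (N, N', f) \<and> nr f = nr N' \<and> nc f = nr N \<and> f * N = N' * f)" for h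
  using N N' by (cases h) (auto simp: Hom_iff)
 show "inj_on fmap (Hom S0 N N')"
 proof (rule inj_onI)
  fix h h' assume hh: "h : Hom S0 N N'" "h' : Hom S0 N N'" "fmap h = fmap h'"
  obtain f f' where f: "h = (N, N', f)" "h' = (N, N', f')" and [simp]: "nr f = nr N'" "nc f = nr N"
   "nr f' = nr N'" "nc f' = nr N" using hh(1,2) by (auto simp: H0)
  have "kron f (I nW) = kron f' (I nW)" using hh(3) by (simp add: f)
  hence "f = f'" by (rule kron_cancel_right[OF _ _ _ nz]) simp_all
  thus "h = h'" by (simp add: f)
 qed
 show "fmap ` Hom S0 N N' = Hom MM (fob N) (fob N')"
 proof (intro equalityI subsetI)
  fix h assume "h : fmap ` Hom S0 N N'"
  thus "h : Hom MM (fob N) (fob N')" using fob_linear N N' by (auto simp: linear_functor_def)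
 next
  fix h assume "h : Hom MM (fob N) (fob N')"
  then obtain f where h: "h = smarr (fob N) (fob N') f"
   and f: "ulin (nr N * nW) (kron (I (nr N)) rW) (nr N' * nW) (kron (I (nr N')) rW) f"
   "f * xo N = xo N' * f" "f * kron (I (nr N)) GW = kron (I (nr N')) GW * f"
   unfolding fob_def smod_hom[OF fob_dgmod[OF N] fob_dgmod[OF N']] by blast
  obtain F F' where [simp]: "nr F = nr N'" "nc F = nr N" "nr F' = nr N'" "nc F' = nr N"
   and fF: "f = kron F (I nW) + kron F' H" by (rule ulin_free_odd[OF d(1) W_endo _ _ f(1)]) simp_all
  \<comment> \<open>Commuting with the grading kills the coefficient F' of the odd
    \<open>H\<close>.\<close>
  have "kron F GW + kron F' (H * GW) = kron F GW + kron ((- 1) *s F') (H * GW)"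
   using f(3) by (simp add: fF kron_ring H(3) kron_smult_right kron_smult_left)
  hence "kron F' (H * GW) = kron ((- 1) *s F') (H * GW)" by (rule add_left_cancel_mat) simp_all
  hence "F' = (- 1) *s F'" by (rule kron_cancel_right[OF _ _ _ HG_nz]) simp_all
  hence "F' = 0\<^sub>m (nr N') (nr N)" using half_zero_mat[of F'] by simp
  hence fF: "f = kron F (I nW)" using fF by (simp add: kron_zero_left mat_ring)
  \<comment> \<open>In the condition for x, the coefficient of \<open>H\<close> is the intertwining
    condition for N and N'.\<close>
  have "kron F XW + kron (F * N) H = kron F XW + kron (N' * F) H"
   using f(2) by (simp add: fF xo_def kron_ring add_commute_mat_dim[of "kron (F * N) H"] add_commute_mat_dim[of "kron (N' * F) H"])
  hence "kron (F * N) H = kron (N' * F) H" by (rule add_left_cancel_mat) simp_all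
  hence "F * N = N' * F" by (rule kron_cancel_right[OF _ _ _ H_nz]) simp_all
  hence "(N, N', F) : Hom S0 N N'" by (simp add: H0)
  thus "h : fmap ` Hom S0 N N'" by (intro image_eqI[of _ _ "(N, N', F)"]) (simp_all add: h fF)
 qed
qed

text \<open>On a multiple of W the difference of x and 1 \<otimes> XW is linear, hence of the form F
  \<otimes> 1 + N \<otimes> H. Oddness removes F, and x^2 = 0 becomes N^2 = 0, so the module comes
  from the D-module N.\<close>

lemma odd_equivalent:
 assumes cover: "\<And>n r X G. dgmod n r X G ==> \<exists>k \<alpha> \<beta>. ulin (k * nW) (kron (I k) rW) n r \<alpha> \<and> nr \<beta> = k * nW \<and>
  nc \<beta> = n \<and> \<alpha> * \<beta> = I n \<and> \<beta> * \<alpha> = I (k * nW) \<and> \<alpha> * kron (I k) GW = G * \<alpha>"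
 shows "module_equivalent SC S0 MM"
proof -
 note d = dgmodD[OF W]
 have "\<exists>N\<in>Obj S0. \<exists>f. iso_arr MM (fob N) P f" if P: "P : Obj MM" for P
 proof -
  obtain n r X G where PP: "P = smod r X G" and M: "dgmod n r X G" using P smod_obj by blast
  note dM = dgmodD[OF M]
  obtain k \<alpha> \<beta> where \<alpha>: "ulin (k * nW) (kron (I k) rW) n r \<alpha>" and \<beta>: "nr \<beta> = k * nW" "nc \<beta> = n"
   "\<alpha> * \<beta> = I n" "\<beta> * \<alpha> = I (k * nW)" and \<alpha>G: "\<alpha> * kron (I k) GW = G * \<alpha>" using cover[OF M] by blast
  note um = umod_free[OF d(1), of k]
  define X' where "X' = \<beta> * X * \<alpha>"
  note [simp] = dM(3,4,8,9,12,13) ulinD(1,2)[OF \<alpha>] \<beta>(1,2)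
  have "\<beta> * G * \<alpha> = \<beta> * (\<alpha> * kron (I k) GW)" by (simp add: \<alpha>G mat_ring)
  also have "... = kron (I k) GW" by (simp add: mult_eq_assoc[OF \<beta>(4)] mat_ring)
  finally have T: "dgmod (k * nW) (kron (I k) rW) X' (kron (I k) GW)"
   using dgmod_transport[OF M um \<alpha> \<beta>] by (simp add: X'_def)
  note dT = dgmodD[OF T]
  note [simp] = dT(3,4)
  have ul: "ulin (k * nW) (kron (I k) rW) (k * nW) (kron (I k) rW) (X' + (- 1) *s kron (I k) XW)"
  proof -
   have 1: "X' * kron (I k) rW = kron (I k) rW * kron X' (I a) + kron (I k) rW * kron (kron (I k) GW) XA"
    using dT(7) by (simp add: mat_ring)
   have 2: "kron (I k) XW * kron (I k) rW = kron (I k) rW * kron (kron (I k) XW) (I a) + kron (I k) rW * kron (kron (I k) GW) XA"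
    by (simp add: kron_mult d(7) mat_ring kron_assoc kron_add_right)
   have "(X' + (- 1) *s kron (I k) XW) * kron (I k) rW = kron (I k) rW * kron X' (I a) + (- 1) *s (kron (I k) rW * kron (kron (I k) XW) (I a))"
    unfolding mat_ring by (simp add: mat_ring 1 2) (intro eq_matI; simp del: index_mult_mat(1))
   thus ?thesis by (simp add: ulin_def mat_ring kron_add_left kron_smult_left)
  qed
  obtain F N where F: "nr F = k" "nc F = k" "nr N = k" "nc N = k"
   "X' + (- 1) *s kron (I k) XW = kron F (I nW) + kron N H" by (rule ulin_free_odd[OF d(1) W_endo _ _ ul]) simp_all
  note [simp] = F(1-4)
  have Xx: "X' = kron F (I nW) + kron N H + kron (I k) XW" unfolding F(5)[symmetric] by (intro eq_matI; simp del: index_mult_mat(1))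
  have e1: "kron F GW + (- 1) *s kron N (H * GW) + (- 1) *s kron (I k) (XW * GW) =
    (- 1) *s kron F GW + (- 1) *s kron N (H * GW) + (- 1) *s kron (I k) (XW * GW)"
   using dT(6) unfolding Xx by (simp add: kron_ring H(3) d(6) kron_smult_right)
  have "kron F GW = kron ((- 1) *s F) GW"
  proof (rule eq_matI)
   fix i j assume "i < nr (kron ((- 1) *s F) GW)" "j < nc (kron ((- 1) *s F) GW)"
   hence ij: "i < k * nW" "j < k * nW" by simp_all
   show "kron F GW $$ (i, j) = kron ((- 1) *s F) GW $$ (i, j)"
    using arg_cong[OF e1, of "\<lambda>M. M $$ (i, j)"] ij unfolding kron_smult_left by (simp del: index_mult_mat(1))
  qed simp_all
  hence "F = (- 1) *s F" by (rule kron_cancel_right[OF _ _ _ G_nz]) simp_all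
  hence "F = 0\<^sub>m k k" using half_zero_mat[of F] by simp
  hence Xx: "X' = kron N H + kron (I k) XW" using Xx by (simp add: kron_zero_left mat_ring)
  have "kron (N * N) (I nW) = kron (0\<^sub>m k k) (I nW)" using dT(5) unfolding Xx
   by (simp add: kron_ring H(2,4) d(5) kron_smult_right kron_zero_right kron_zero_left add_assoc_mat_dim add_smult_self add_self_smult zero_smult_mat)
  hence "N * N = 0\<^sub>m k k" by (rule kron_cancel_right[OF _ _ _ nz]) simp_all
  hence NO: "N : CM" by (intro CM_I) simp_all
  have xN: "xo N = X'" by (simp add: xo_def Xx)
  have T': "dgmod (k * nW) (kron (I k) rW) (xo N) (kron (I k) GW)" using T by (simp add: xN)
  have "iso_arr MM (fob N) P (smarr (fob N) P \<alpha>)" unfolding fob_def F(3) PP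
  proof (rule smarr_iso[OF T' M \<alpha> _ \<alpha>G \<beta>])
   show "\<alpha> * xo N = X * \<alpha>" unfolding xN by (simp add: X'_def mat_ring mult_eq_assoc[OF \<beta>(3)])
  qed
  thus ?thesis using NO by (intro bexI[of _ N]) (blast, simp)
 qed
 hence "ffes S0 MM fob fmap" unfolding ffes_def using fob_linear fmap_bij by (simp del: S.mod_cat_simps)
 thus ?thesis using module_equivalent_iff[OF S0_module_category S.mod_cat_module_category]
   mod_functorI[OF S0_module_category S.mod_cat_module_category odd_module_functor] by blast
qed

end

text \<open>Pulled back to M, the idempotent would decompose M unless it were zero or the identity,
  and w excludes zero. A category N equivalent to M is allowed because the idempotent is constructed
  on \<open>mod_cat\<close>.\<close>

lemma indecomposable_nat_idem:
 assumes C: "strict_monoidal_category C" and M: "left_module_category C M" and ind: "indecomposable C M"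
  and N: "module_category C N" and F: "mod_functor C M N Fo Fa s" and ff: "ffes M N Fo Fa"
  and e: "linear_category.nat_idem N e"
  and act: "\<And>X p. X : Obj C ==> p : Obj N ==> e (ActO N X p) = ActA N (Id C X) (e p)"
  and w: "w : Obj N" "e w \<noteq> Zero N w w" and q: "q : Obj N" shows "e q = Id N q"
proof -
 interpret F: mod_functor C M N Fo Fa s by (rule F)
 interpret FF: ff_functor M N Fo Fa
  by (rule ff_functorI[OF F.M.M.linear_category_axioms F.N.M.linear_category_axioms ff])
 note eD [simp] = F.N.M.nat_idemD(1-3)[OF e] and en = F.N.M.nat_idemD(5)[OF e]
 obtain E where E: "F.M.M.nat_idem E" and FE: "\<And>X. X : Obj M ==> Fa (E X) = e (Fo X)"
  using FF.pull_nat_idem[OF e] by blast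
 note [simp] = F.M.M.nat_idemD(1-3)[OF E]
 \<comment> \<open>Naturality of e along the module constraint \<open>s\<close>, together with
   faithfulness of F, carries compatibility with the action over to M.\<close>
 have "E (ActO M X p) = ActA M (Id C X) (E p)" if [simp]: "X : Obj C" "p : Obj M" for X p
 proof (rule FF.faithful)
  show "Fa (E (ActO M X p)) = Fa (ActA M (Id C X) (E p))"
  proof (rule F.N.M.iso_cancel_left[OF F.s_iso[of X p]])
   have "Comp N (s X p) (Fa (E (ActO M X p))) = Comp N (e (ActO N X (Fo p))) (s X p)"
    using en[of "s X p"] by (simp add: FE)
   also have "... = Comp N (s X p) (Fa (ActA M (Id C X) (E p)))" using F.s_nat_id[of X "E p"] by (simp add: act FE)
   finally show "Comp N (s X p) (Fa (E (ActO M X p))) = Comp N (s X p) (Fa (ActA M (Id C X) (E p)))" .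
  qed simp_all
 qed simp_all
 hence AI: "act_idem C M E" using C M E by (simp add: act_idem_def act_idem_axioms_def)
 have es: "\<exists>X\<in>Obj M. \<exists>f. iso_arr N (Fo X) P f" if "P : Obj N" for P
  using ff that by (simp add: ffes_def)
 obtain p f where p [simp]: "p : Obj M" and f: "iso_arr N (Fo p) w f" using es[OF w(1)] by blast
 have "E p \<noteq> Zero M p p"
 proof
  assume "E p = Zero M p p"
  hence "e (Fo p) = Zero N (Fo p) (Fo p)" using FE[of p] F.F_zero[of p p] by simp
  hence "Comp N (e w) f = Comp N (Zero N w w) f"
   using en[of f] F.N.M.iso_arrD[OF f] w(1) by (simp add: F.N.M.comp_zero_left F.N.M.comp_zero_right)
  hence "e w = Zero N w w" by (rule F.N.M.iso_cancel_right[OF f]) (simp_all add: w(1))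
  thus False using w(2) by simp
 qed
 hence all: "E q = Id M q" if "q : Obj M" for q using act_idem_decomposes[OF AI p _ that] ind by blast
 obtain p' f' where p' [simp]: "p' : Obj M" and f': "iso_arr N (Fo p') q f'" using es[OF q] by blast
 have "e (Fo p') = Id N (Fo p')" using FE[of p'] all[of p'] by simp
 hence "Comp N (e q) f' = Comp N (Id N q) f'" using en[of f'] F.N.M.iso_arrD[OF f'] q by simp
 thus ?thesis by (rule F.N.M.iso_cancel_right[OF f']) (simp_all add: q)
qed

section \<open>The isotypic idempotent and the classification\<close>

context sweedler_algebra
begin

lemma dgmod_regular: "dgmod a m XA GA" using gmod_regular by (simp add: dgmod_def XA_XA GA_XA XA_mult)

text \<open>\<open>sproj\<close> as an endomorphism in the module category; the nested projections
  extract dimension, action and grading of the object.\<close>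

definition scomp :: "nat => complex mat => smod \<times> sarr => (smod \<times> sarr) \<times> (smod \<times> sarr) \<times> sarr" where
 "scomp n0 r0 N = smarr N N (SOME E. sproj n0 r0 (nr (fst (fst N))) (snd (snd (snd N))) (snd (fst N)) E)"

lemma scomp: assumes S: "usimple n0 r0" and N: "dgmod n r X G"
 obtains E where "scomp n0 r0 (smod r X G) = smarr (smod r X G) (smod r X G) E" "sproj n0 r0 n r G E"
proof -
 have n: "nr X = n" using N by (simp add: dgmod_def)
 have "\<exists>E. sproj n0 r0 n r G E" using sproj_exists[OF S dgmodD(2)[OF N]] by blast
 hence "sproj n0 r0 n r G (SOME E. sproj n0 r0 n r G E)" by (rule someI_ex)
 thus thesis using that by (simp add: scomp_def smod_def n)
qed

lemma smod_arrE: assumes "h : Arr MM"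
 obtains n r X G n' r' X' G' f where "h = smarr (smod r X G) (smod r' X' G') f" "dgmod n r X G" "dgmod n' r' X' G'"
  "ulin n r n' r' f" "f * X = X' * f" "f * G = G' * f" using assms unfolding smod_arr smarr_def fst_smod by blast

lemma scomp_nat_idem: assumes S: "usimple n0 r0" shows "linear_category.nat_idem MM (scomp n0 r0)"
proof -
 interpret L: linear_category MM by (rule S.linear_mod_cat)
 show ?thesis unfolding L.nat_idem_def
 proof (intro conjI ballI)
  fix N assume "N : Obj MM"
  then obtain n r X G where N: "N = smod r X G" and d: "dgmod n r X G" unfolding smod_obj by blast
  obtain E where E: "scomp n0 r0 N = smarr N N E" "sproj n0 r0 n r G E" unfolding N by (rule scomp[OF S d])
  note B = sproj_basic[OF S dgmodD(2)[OF d] E(2)]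
  show "scomp n0 r0 N : Arr MM" unfolding N E(1)[unfolded N] smarr_in[OF d d]
   using B(1,3) sproj_differential[OF S d E(2)] by simp
  show "Dom MM (scomp n0 r0 N) = N" "Cod MM (scomp n0 r0 N) = N" unfolding E(1) smarr_simps by (rule refl)+
  show "Comp MM (scomp n0 r0 N) (scomp n0 r0 N) = scomp n0 r0 N" unfolding E(1) smarr_simps B(2) ..
 next
  fix h assume "h : Arr MM"
  then obtain n r X G n' r' X' G' f where h: "h = smarr (smod r X G) (smod r' X' G') f" and d: "dgmod n r X G" "dgmod n' r' X' G'"
   and f: "ulin n r n' r' f" by (rule smod_arrE)
  obtain E where E: "scomp n0 r0 (smod r X G) = smarr (smod r X G) (smod r X G) E" "sproj n0 r0 n r G E" by (rule scomp[OF S d(1)])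
  obtain E' where E': "scomp n0 r0 (smod r' X' G') = smarr (smod r' X' G') (smod r' X' G') E'" "sproj n0 r0 n' r' G' E'" by (rule scomp[OF S d(2)])
  show "Comp MM h (scomp n0 r0 (Dom MM h)) = Comp MM (scomp n0 r0 (Cod MM h)) h"
   unfolding h smarr_simps E(1) E'(1) sproj_natural[OF S dgmodD(2)[OF d(1)] dgmodD(2)[OF d(2)] E(2) E'(2) f] ..
 qed
qed

lemma scomp_act: assumes S: "usimple n0 r0" and V: "V : SM" and N: "N : Obj MM"
 shows "scomp n0 r0 (ActO MM V N) = ActA MM (Id SC V) (scomp n0 r0 N)"
proof -
 obtain X G where VV: "V = (X, G)" by (cases V)
 have V': "(X, G) : SM" using V by (simp add: VV)
 obtain n r Y K where NN: "N = smod r Y K" and d: "dgmod n r Y K" using N unfolding smod_obj by blast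
 obtain E where E: "scomp n0 r0 N = smarr N N E" "sproj n0 r0 n r K E" unfolding NN by (rule scomp[OF S d])
 note A = act_smod[OF V' d]
 obtain E' where E': "scomp n0 r0 (ActO MM V N) = smarr (ActO MM V N) (ActO MM V N) E'"
  "sproj n0 r0 (nr X * n) (kron (I (nr X)) r) (kron G K) E'" unfolding NN VV A(1) by (rule scomp[OF S A(2)])
 note VD = SM_D[OF V']
 have "E' = kron (I (nr X)) E" by (rule sproj_tensor[OF S dgmodD(2)[OF d] E(2) VD(1,3,5) E'(2)])
 thus ?thesis unfolding E(1) E'(1) by (simp add: act_smarr VV del: S.mod_cat_simps)
qed

lemma trivial_algebra: assumes "a = 0" "N : Obj MM" shows "Id MM N = Zero MM N N"
proof -
 obtain n r X G where N: "N = smod r X G" and d: "dgmod n r X G" using assms(2) unfolding smod_obj by blast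
 have "I n = r * kron (I n) u" using umodD(4)[OF dgmodD(1)[OF d]] by simp
 also have "... = 0\<^sub>m n n" using dgmodD(12,13)[OF d] assms(1) by (intro eq_matI) (auto simp: scalar_prod_def)
 finally have "(I n :: complex mat) = 0\<^sub>m n n" .
 thus ?thesis using dgmodD(3)[OF d] by (simp add: N smod_def)
qed

theorem classification:
 fixes M :: "(smod, sarr, 'o, 'a) modcat" assumes M: "left_module_category SC M" and ind: "indecomposable SC M"
  and eq: "module_equivalent SC M MM" shows "module_equivalent SC M V0 \<or> module_equivalent SC M S0"
proof -
 have Mm: "module_category SC M" by (rule left_imp_module_category[OF sw.monoidal M])
 have Nm: "module_category SC MM" by (rule S.mod_cat_module_category)
 have Vm: "module_category SC V0" unfolding V0_def by (rule regular_module_category[OF sw.monoidal])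
 note Sm = S0_module_category
 obtain Fo Fa s where F: "mod_functor SC M MM Fo Fa s" and ff: "ffes M MM Fo Fa"
  using eq module_equivalent_iff[OF Mm Nm] by blast
 interpret F: mod_functor SC M MM Fo Fa s by (rule F)
 interpret FF: ff_functor M MM Fo Fa
  by (rule ff_functorI[OF F.M.M.linear_category_axioms F.N.M.linear_category_axioms ff])
 \<comment> \<open>Over the zero algebra all modules vanish, against
   \<open>nonzero_category\<close>. So the algebra is nonzero and a simple module exists.\<close>
 have "a \<noteq> 0"
 proof
  assume a: "a = 0"
  obtain q where q: "q : Obj M" "Id M q \<noteq> Zero M q q" using ind by (auto simp: indecomposable_def nonzero_category_def)
  have "Fa (Id M q) = Fa (Zero M q q)" using trivial_algebra[OF a F.F_obj[OF q(1)]] q(1) by (simp add: F.F_zero)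
  hence "Id M q = Zero M q q" by (rule FF.faithful) (simp_all add: q(1))
  thus False using q(2) by simp
 qed
 then obtain n0 r0 where S: "usimple n0 r0" using usimple_exists by auto
 \<comment> \<open>The regular module is the object on which the idempotent is seen to be nonzero;
   indecomposability then makes it the identity everywhere.\<close>
 have "scomp n0 r0 (smod m XA GA) \<noteq> Zero MM (smod m XA GA) (smod m XA GA)"
 proof
  assume z: "scomp n0 r0 (smod m XA GA) = Zero MM (smod m XA GA) (smod m XA GA)"
  obtain E where E: "scomp n0 r0 (smod m XA GA) = smarr (smod m XA GA) (smod m XA GA) E" "sproj n0 r0 a m GA E"
   by (rule scomp[OF S dgmod_regular])
  hence "E = 0\<^sub>m a a" using z by (simp add: smarr_def smod_def)
  thus False using sproj_regular_nonzero[OF S E(2)] by simp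
 qed
 moreover have "smod m XA GA : Obj MM" unfolding smod_obj using dgmod_regular by blast
 ultimately have all: "scomp n0 r0 N = Id MM N" if "N : Obj MM" for N
  using indecomposable_nat_idem[OF sw.monoidal M ind Nm F ff scomp_nat_idem[OF S] scomp_act[OF S] _ _ that] by simp
 have P1: "sproj n0 r0 n r G (I n)" if d: "dgmod n r X G" for n r X G
 proof -
  obtain E where E: "scomp n0 r0 (smod r X G) = smarr (smod r X G) (smod r X G) E" "sproj n0 r0 n r G E" by (rule scomp[OF S d])
  have "smod r X G : Obj MM" unfolding smod_obj using d by blast
  hence "E = I n" using all E(1) dgmodD(3)[OF d] smarr_simps(4)[of r X G] by simp
  thus ?thesis using E(2) by simp
 qed
 have "module_equivalent SC V0 MM \<or> module_equivalent SC S0 MM"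
 proof (cases "selfdual n0 r0")
  case True
  obtain D G0 where W: "even_type n0 r0 D G0" by (rule even_type_exists[OF S True])
  have "module_equivalent SC V0 MM"
  proof (rule even_equivalent[OF W])
   fix n r X G assume d: "dgmod n r X G"
   show "\<exists>k \<alpha> \<beta>. ulin (k * n0) (kron (I k) r0) n r \<alpha> \<and> nr \<beta> = k * n0 \<and> nc \<beta> = n \<and> \<alpha> * \<beta> = I n \<and> \<beta> * \<alpha> = I (k * n0)"
    by (rule even_type_cover[OF S True dgmodD(2)[OF d] P1[OF d]]) blast
  qed
  thus ?thesis ..
 next
  case False
  let ?cover = "\<lambda>nW rW GW n r G. \<exists>k \<alpha> \<beta>. ulin (k * nW) (kron (I k) rW) n r \<alpha> \<and> nr \<beta> = k * nW \<and> nc \<beta> = n \<and>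
    \<alpha> * \<beta> = I n \<and> \<beta> * \<alpha> = I (k * nW) \<and> \<alpha> * kron (I k) GW = G * \<alpha>"
  have "\<exists>nW rW XW GW H. odd_type nW rW XW GW H \<and> (\<forall>n r G. gmod n r G \<longrightarrow> sproj n0 r0 n r G (I n) \<longrightarrow> ?cover nW rW GW n r G)"
  proof (rule odd_type_exists[OF S False])
   fix nW rW XW GW H assume "odd_type nW rW XW GW H" and "\<And>n r G. gmod n r G ==> sproj n0 r0 n r G (I n) ==> ?cover nW rW GW n r G"
   thus ?thesis by blast
  qed
  then obtain nW rW XW GW H where W: "odd_type nW rW XW GW H"
   and cover: "\<And>n r G. gmod n r G ==> sproj n0 r0 n r G (I n) ==> ?cover nW rW GW n r G" by blast
  interpret O: odd_object a m u c XA GA nW rW XW GW H by unfold_locales (rule W)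
  have "module_equivalent SC S0 MM" by (rule O.odd_equivalent) (rule cover[OF dgmodD(2) P1])
  thus ?thesis ..
 qed
 thus ?thesis
  using module_equivalent_sym[OF Vm Nm] module_equivalent_sym[OF Sm Nm] module_equivalent_trans[OF Mm Nm Vm eq]
   module_equivalent_trans[OF Mm Nm Sm eq] by blast
qed

end

section \<open>Algebras realising the two module categories\<close>

interpretation unit_algebra: sweedler_algebra 1 "I 1" "I 1" "I 1" "0\<^sub>m 1 1" "I 1"
 by unfold_locales (simp_all add: kron_one kron_zero_left kron_zero_right mat_ring)

lemma V0_unit_algebra: "module_equivalent SC V0 (mod_cat SC (swalg (I 1) (I 1) (0\<^sub>m 1 1) (I 1)))"
proof (rule unit_algebra.even_equivalent)
 have "f = f $$ (0, 0) *s I 1" if "nr f = 1" "nc f = 1" for f :: "complex mat" using that by (intro eq_matI) auto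
 thus "unit_algebra.even_type 1 (I 1) (0\<^sub>m 1 1) (I 1)"
  using unit_algebra.dgmod_regular unfolding unit_algebra.even_type_def unit_algebra.ulin_def by blast
next
 fix n r X G assume d: "unit_algebra.dgmod n r X G"
 \<comment> \<open>The unit law leaves only one action of the unit object.\<close>
 have r: "r = I n" using unit_algebra.umodD(1,2,4)[OF unit_algebra.dgmodD(1)[OF d]] by (simp add: kron_one mat_ring)
 have "unit_algebra.ulin (n * 1) (kron (I n) (I 1)) n r (I n)"
  unfolding unit_algebra.ulin_def r by (simp add: kron_one mat_ring)
 thus "\<exists>k \<alpha> \<beta>. unit_algebra.ulin (k * 1) (kron (I k) (I 1)) n r \<alpha> \<and>
   nr \<beta> = k * 1 \<and> nc \<beta> = n \<and> \<alpha> * \<beta> = I n \<and> \<beta> * \<alpha> = I (k * 1)"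
  by (intro exI[of _ n] exI[of _ "I n"] conjI) (assumption, simp_all add: mat_ring)
qed

lemma eq_mat2: assumes "nr A = nr B" "nc A = 2" "nc B = 2" "\<And>p. p < 2 ==> A * ecol 2 p = B * ecol 2 p"
 shows "A = B" by (rule eq_mat_by_inner_col[of _ _ 1 2]) (use assms in \<open>simp_all add: kron_one_left\<close>)

lemma eq_mat4: assumes "nr A = nr B" "nc A = 4" "nc B = 4"
  "\<And>p q. p < 2 ==> q < 2 ==> A * kron (ecol 2 p) (ecol 2 q) = B * kron (ecol 2 p) (ecol 2 q)"
 shows "A = B" by (rule eq_mat_by_inner_col2[of _ _ 1 2 2]) (use assms in \<open>simp_all add: kron_one_left\<close>)

text \<open>The Clifford algebra generated by an odd element \<open>h\<close> with \<open>h\<^sup>2 = 1\<close>, on which \<open>x\<close> acts by zero.\<close>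

interpretation clifford: monomial_algebra 2 "\<lambda>p q. (p + q) mod 2" "\<lambda>p q. 1"
proof (standard, goal_cases)
 case (4 p q s)
 thus ?case by (simp add: mod_simps add.assoc)
qed simp_all

text \<open>In the basis 1, h: \<open>sgn2\<close> is the grading, \<open>swap2\<close> is
  multiplication by h, and \<open>cas2\<close> is the separability element (1 \<otimes> 1 + h
  \<otimes> h) / 2.\<close>

definition sgn2 :: "complex mat" where "sgn2 = mat 2 2 (\<lambda>(i, j). if i = j then (- 1) ^ i else 0)"
definition swap2 :: "complex mat" where "swap2 = mat 2 2 (\<lambda>(i, j). if i = j then 0 else 1)"
definition cas2 :: "complex mat" where "cas2 = (1/2) *s (kron (ecol 2 0) (ecol 2 0) + kron (ecol 2 1) (ecol 2 1))"

lemma dims2 [simp]: "nr sgn2 = 2" "nc sgn2 = 2" "nr swap2 = 2" "nc swap2 = 2"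
 "nr cas2 = 4" "nc cas2 = Suc 0" by (simp_all add: sgn2_def swap2_def cas2_def)

lemma sgn2_ecol: "p < 2 ==> sgn2 * ecol 2 p = (- 1) ^ p *s ecol 2 p"
 by (rule eq_matI) (simp_all del: index_mult_mat(1), auto simp: sgn2_def ecol_def)

lemma swap2_ecol: "p < 2 ==> swap2 * ecol 2 p = ecol 2 (1 - p)"
 by (rule eq_matI) (simp_all del: index_mult_mat(1), auto simp: swap2_def ecol_def dest: less2_cases)

lemma sgn2_mult: "sgn2 * sgn2 = I 2"
 by (rule eq_mat2) (auto simp: mat_ring sgn2_ecol smult_smult_mat one_smult_mat power2_eq_square[symmetric] power_mult_distrib[symmetric] simp flip: power_mult)

lemma swap2_mult: "swap2 * swap2 = I 2" by (rule eq_mat2) (auto simp: mat_ring swap2_ecol)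

lemma sgn2_swap2: "sgn2 * swap2 = (- 1) *s (swap2 * sgn2)"
 by (rule eq_mat2) (auto simp: mat_ring swap2_ecol sgn2_ecol smult_smult_mat dest!: less2_cases)

abbreviation "cm \<equiv> clifford.mm"

lemma cm_dims [simp]: "nr cm = 2" "nc cm = 4" using clifford.dim_mm by simp_all

lemma cm_ecol: "p < 2 ==> q < 2 ==> cm * kron (ecol 2 p) (ecol 2 q) = ecol 2 ((p + q) mod 2)"
 using clifford.mm_ecol[of p q] by (simp add: one_smult_mat)

lemma cm_ecol3: assumes "p < 2" "q < 2"
 shows "kron cm (I 2) * kron (ecol 2 p) (kron (ecol 2 q) (ecol 2 s)) = kron (ecol 2 ((p + q) mod 2)) (ecol 2 s)"
  "kron (I 2) cm * kron (ecol 2 s) (kron (ecol 2 p) (ecol 2 q)) = kron (ecol 2 s) (ecol 2 ((p + q) mod 2))"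
proof -
 have "kron cm (I 2) * kron (kron (ecol 2 p) (ecol 2 q)) (ecol 2 s) = kron (ecol 2 ((p + q) mod 2)) (ecol 2 s)"
  by (simp add: kron_mult cm_ecol[OF assms] mat_ring)
 thus "kron cm (I 2) * kron (ecol 2 p) (kron (ecol 2 q) (ecol 2 s)) = kron (ecol 2 ((p + q) mod 2)) (ecol 2 s)"
  by (simp only: kron_assoc)
 show "kron (I 2) cm * kron (ecol 2 s) (kron (ecol 2 p) (ecol 2 q)) = kron (ecol 2 s) (ecol 2 ((p + q) mod 2))"
  by (simp add: kron_mult cm_ecol[OF assms] mat_ring)
qed

lemma kron_row_slide: "nc c = Suc 0 ==> nr A = n ==> kron c (I n) * A = kron c A"
 using kron_mult[of c "I (Suc 0)" "I n" A] by (simp add: mat_ring kron_one_left)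

interpretation clif: sweedler_algebra 2 cm "ecol 2 0" cas2 "0\<^sub>m 2 2" sgn2
proof (unfold_locales, goal_cases)
 case 3
 show ?case by (simp add: cas2_def mat_ring cm_ecol cm_ecol[of 1 1, simplified]) (intro eq_matI; simp del: index_mult_mat(1))
next
 case 4
 show ?case
 proof (rule eq_mat2)
  fix p :: nat assume p: "p < 2"
  have "kron cm (I 2) * kron (I 2) cas2 * ecol 2 p = kron cm (I 2) * kron (ecol 2 p) cas2"
   by (simp add: mat_ring kron_col_slide)
  also have "... = (1/2) *s (kron (ecol 2 p) (ecol 2 0) + kron (ecol 2 ((p + 1) mod 2)) (ecol 2 1))"
   using p by (simp add: cas2_def kron_smult_right kron_add_right mat_ring cm_ecol3(1)[of p 0] cm_ecol3(1)[of p 1, simplified])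
  also have "... = (1/2) *s (kron (ecol 2 0) (ecol 2 p) + kron (ecol 2 1) (ecol 2 ((1 + p) mod 2)))"
   using less2_cases[OF p] by (elim disjE) (simp_all add: add_commute_mat_dim[of "kron (ecol 2 (Suc 0)) (ecol 2 0)"])
  also have "... = kron (I 2) cm * kron cas2 (ecol 2 p)"
   using p by (simp add: cas2_def kron_smult_left kron_add_left mat_ring kron_assoc cm_ecol3(2)[of 0 p] cm_ecol3(2)[of 1 p, simplified])
  also have "... = kron (I 2) cm * kron cas2 (I 2) * ecol 2 p" by (simp add: mat_ring kron_row_slide)
  finally show "kron cm (I 2) * kron (I 2) cas2 * ecol 2 p = kron (I 2) cm * kron cas2 (I 2) * ecol 2 p" .
 qed simp_all
next
 case 12
 show ?case
 proof (rule eq_mat4)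
  fix p q :: nat assume pq: "p < 2" "q < 2"
  have "sgn2 * (cm * kron (ecol 2 p) (ecol 2 q)) = cm * kron (sgn2 * ecol 2 p) (sgn2 * ecol 2 q)"
   using less2_cases[OF pq(1)] less2_cases[OF pq(2)]
   by (elim disjE) (simp_all add: cm_ecol[OF pq] cm_ecol[of 0 0] cm_ecol[of 0 1, simplified] cm_ecol[of 1 0, simplified] cm_ecol[of 1 1, simplified]
     sgn2_ecol kron_smult_left kron_smult_right smult_smult_mat one_smult_mat mat_ring)
  thus "sgn2 * cm * kron (ecol 2 p) (ecol 2 q) = cm * kron sgn2 sgn2 * kron (ecol 2 p) (ecol 2 q)"
   by (simp add: kron_ring)
 qed simp_all
next
 case 15
 show ?case by (simp add: cas2_def kron_ring sgn2_ecol kron_smult_left kron_smult_right smult_smult_mat one_smult_mat)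
qed (simp_all add: sgn2_mult sgn2_ecol one_smult_mat mat_ring kron_zero_left kron_zero_right)

lemma swap2_ulin: "clifford.ulin 2 cm 2 cm swap2"
proof -
 have "swap2 * cm = cm * kron swap2 (I 2)"
 proof (rule eq_mat4)
  fix p q :: nat assume pq: "p < 2" "q < 2"
  have "swap2 * (cm * kron (ecol 2 p) (ecol 2 q)) = cm * kron (swap2 * ecol 2 p) (ecol 2 q)"
   using less2_cases[OF pq(1)] less2_cases[OF pq(2)]
   by (elim disjE) (simp_all add: cm_ecol[OF pq] cm_ecol[of 0 0] cm_ecol[of 0 1, simplified] cm_ecol[of 1 0, simplified] cm_ecol[of 1 1, simplified]
     swap2_ecol)
  thus "swap2 * cm * kron (ecol 2 p) (ecol 2 q) = cm * kron swap2 (I 2) * kron (ecol 2 p) (ecol 2 q)"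
   by (simp add: kron_ring)
 qed simp_all
 thus ?thesis by (simp add: clifford.ulin_def)
qed

text \<open>The regular module serves as W: its endomorphisms are the multiplications by elements of
  the algebra, and that by h is \<open>swap2\<close>.\<close>

interpretation clif: odd_object 2 cm "ecol 2 0" cas2 "0\<^sub>m 2 2" sgn2 2 cm "0\<^sub>m 2 2" sgn2 swap2
proof unfold_locales
 have "\<exists>x y. f = x *s I 2 + y *s swap2" if f: "clifford.ulin 2 cm 2 cm f" for f
 proof -
  note [simp] = clifford.ulinD(1,2)[OF f]
  \<comment> \<open>An endomorphism of the regular module is determined by the image of 1.\<close>
  have fe: "f * ecol 2 0 = f $$ (0, 0) *s ecol 2 0 + f $$ (1, 0) *s ecol 2 1"
   by (rule eq_matI) (auto simp: ecol_def scalar_prod_def numeral_2_eq_2 less_Suc_eq)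
  have "f = f $$ (0, 0) *s I 2 + f $$ (1, 0) *s swap2"
  proof (rule eq_mat2)
   fix p :: nat assume p: "p < 2"
   have "f * ecol 2 p = f * cm * kron (ecol 2 0) (ecol 2 p)" using p by (simp add: mat_ring cm_ecol)
   also have "... = cm * kron (f * ecol 2 0) (ecol 2 p)" by (simp add: clifford.ulinD(3)[OF f] kron_ring)
   also have "... = (f $$ (0, 0) *s I 2 + f $$ (1, 0) *s swap2) * ecol 2 p" unfolding fe using less2_cases[OF p]
    by (elim disjE) (simp_all add: mat_ring kron_add_left kron_smult_left cm_ecol[of 0 0] cm_ecol[of 0 1, simplified] cm_ecol[of 1 0, simplified] cm_ecol[of 1 1, simplified] swap2_ecol)
   finally show "f * ecol 2 p = (f $$ (0, 0) *s I 2 + f $$ (1, 0) *s swap2) * ecol 2 p" .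
  qed simp_all
  thus ?thesis by blast
 qed
 thus "clif.odd_type 2 cm (0\<^sub>m 2 2) sgn2 swap2"
  unfolding clif.odd_type_def using clif.dgmod_regular swap2_ulin swap2_mult sgn2_swap2 by (simp add: mat_ring)
qed

text \<open>A graded module \<open>M\<close> over the Clifford algebra is free on its even part: the odd part of \<open>v\<close> is
 \<open>(v h) h\<close> with \<open>v h\<close> even.\<close>

lemma clifford_free: assumes d: "clif.dgmod n r X G"
 shows "\<exists>k \<alpha> \<beta>. clifford.ulin (k * 2) (kron (I k) cm) n r \<alpha> \<and> nr \<beta> = k * 2 \<and> nc \<beta> = n \<and>
  \<alpha> * \<beta> = I n \<and> \<beta> * \<alpha> = I (k * 2) \<and> \<alpha> * kron (I k) sgn2 = G * \<alpha>"
proof -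
 note D = clif.dgmodD[OF d]
 note [simp] = D(3,4,8,9,12,13)
 define R where "R = r * kron (I n) (ecol 2 1)"
 have [simp]: "nr R = n" "nc R = n" by (simp_all add: R_def)
 have ru: "r * kron (I n) (ecol 2 0) = I n" using clifford.umodD(4)[OF D(1)] .
 have RR: "R * R = I n"
  using clifford.umod_iff[OF D(12,13)] D(1) ru unfolding R_def by (simp add: all_less2 one_smult_mat)
 have GR: "G * R = (- 1) *s (R * G)"
 proof -
  have "G * R = r * (kron G sgn2 * kron (I n) (ecol 2 1))" by (simp add: R_def mult_eq_assoc[OF D(11)] mat_ring)
  also have "... = (- 1) *s (R * G)"
   by (simp add: R_def kron_mult sgn2_ecol[of 1, simplified] kron_smult_right mat_ring kron_col_slide)
  finally show ?thesis .
 qed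
 \<comment> \<open>Projections to the even and the odd part, which the action \<open>R\<close> of h
   exchanges.\<close>
 define p where "p = (1/2) *s (I n + G)"
 define q where "q = (1/2) *s (I n + (- 1) *s G)"
 have [simp]: "nr p = n" "nc p = n" "nr q = n" "nc q = n" by (simp_all add: p_def q_def)
 have Gp: "G * p = p" by (simp add: p_def mat_ring D(10)) (intro eq_matI; simp del: index_mult_mat(1))
 have pp: "p * p = p"
 proof -
  have "p * p = (1/2) *s (p + G * p)" unfolding p_def by (simp add: mat_ring)
  thus ?thesis unfolding Gp by simp (intro eq_matI; simp del: index_mult_mat(1))
 qed
 have pq: "p + q = I n" unfolding p_def q_def by (intro eq_matI; simp add: field_simps del: index_mult_mat(1))
 have Rp: "R * p = q * R" by (simp add: p_def q_def mat_ring GR smult_smult_mat one_smult_mat)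
 have qp: "p * q = 0\<^sub>m n n"
 proof -
  have "p * p + p * q = p * (p + q)" by (simp add: mat_ring)
  also have "... = p * p + 0\<^sub>m n n" unfolding pq pp by (simp add: mat_ring)
  finally have "p * p + p * q = p * p + 0\<^sub>m n n" .
  thus ?thesis by (rule add_left_cancel_mat) simp_all
 qed
 obtain k J P where J [simp]: "nr J = n" "nc J = k" "nr P = k" "nc P = n" and JP: "p = J * P" "P * J = I k"
  by (rule mat_split_idem[OF pp, of n]) simp_all
 have pJ: "p * J = J" by (simp add: JP(1) mat_ring JP(2))
 have Pp: "P * p = P" by (simp add: JP(1) mult_eq_assoc[OF JP(2)] mat_ring)
 have Pq: "P * q = 0\<^sub>m k n" using mult_eq_assoc[OF Pp, of q] by (simp add: qp mat_ring)
 have GJ: "G * J = J" using mult_eq_assoc[OF Gp, of J] by (simp add: pJ)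
 \<comment> \<open>h maps the even part to the odd part, which \<open>P\<close> annihilates.\<close>
 have PRJ: "P * (R * J) = 0\<^sub>m k k"
 proof -
  have "R * J = q * (R * J)" using mult_eq_assoc[OF Rp, of J] by (simp add: mat_ring pJ)
  hence "P * (R * J) = P * q * (R * J)" by (simp add: mat_ring)
  thus ?thesis by (simp add: Pq mat_ring)
 qed
 \<comment> \<open>\<alpha>(w \<otimes> b) = w b for even w. The inverse sends v to (even part of v)
   \<otimes> 1 + (even part of v h) \<otimes> h.\<close>
 define \<alpha> where "\<alpha> = r * kron J (I 2)"
 define \<beta> where "\<beta> = kron P (ecol 2 0) + kron (P * R) (ecol 2 1)"
 have [simp]: "nr \<alpha> = n" "nc \<alpha> = k * 2" "nr \<beta> = k * 2" "nc \<beta> = n" by (simp_all add: \<alpha>_def \<beta>_def)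
 have \<alpha>e: "\<alpha> * kron (I k) (ecol 2 0) = J" "\<alpha> * kron (I k) (ecol 2 1) = R * J"
 proof -
  have "\<alpha> * kron (I k) (ecol 2 0) = r * kron (I n) (ecol 2 0) * J"
   by (simp add: \<alpha>_def kron_ring kron_col_slide)
  thus "\<alpha> * kron (I k) (ecol 2 0) = J" by (simp add: ru mat_ring)
  show "\<alpha> * kron (I k) (ecol 2 1) = R * J" by (simp add: \<alpha>_def R_def kron_ring kron_col_slide)
 qed
 have "clifford.ulin (k * 2) (kron (I k) cm) n r \<alpha>"
 proof -
  have "\<alpha> * kron (I k) cm = r * kron (I n) cm * kron J (I 4)" by (simp add: \<alpha>_def kron_ring)
  also have "... = r * kron \<alpha> (I 2)" unfolding clifford.umodD(3)[OF D(1), symmetric] using kron_one[of 2 2]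
   by (simp add: \<alpha>_def kron_comp_left mat_ring kron_assoc)
  finally show ?thesis by (simp add: clifford.ulin_def)
 qed
 moreover have "\<alpha> * \<beta> = I n"
 proof -
  have "\<alpha> * \<beta> = \<alpha> * kron (I k) (ecol 2 0) * P + \<alpha> * kron (I k) (ecol 2 1) * (P * R)"
   by (simp add: \<beta>_def mat_ring kron_col_slide)
  also have "... = p + R * p * R" unfolding \<alpha>e by (simp add: JP(1) mat_ring)
  also have "... = p + q" unfolding Rp by (simp add: mat_ring RR)
  finally show ?thesis by (simp add: pq)
 qed
 moreover have "\<beta> * \<alpha> = I (k * 2)"
 proof (rule eq_mat_by_inner_col[of _ _ k 2])
  fix i :: nat assume i: "i < 2"
  have 0: "\<beta> * J = kron (I k) (ecol 2 0)"
   using kron_mult[of P J "ecol 2 0" "I (Suc 0)"] kron_mult[of "P * R" J "ecol 2 1" "I (Suc 0)"]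
   by (simp add: \<beta>_def mat_ring kron_one_right JP(2) PRJ kron_zero_left)
  have 1: "\<beta> * (R * J) = kron (I k) (ecol 2 1)"
   using kron_mult[of P "R * J" "ecol 2 0" "I (Suc 0)"] kron_mult[of "P * R" "R * J" "ecol 2 1" "I (Suc 0)"]
   by (simp add: \<beta>_def mat_ring kron_one_right JP(2) PRJ kron_zero_left mult_eq_assoc[OF RR])
  show "\<beta> * \<alpha> * kron (I k) (ecol 2 i) = I (k * 2) * kron (I k) (ecol 2 i)"
  proof -
   have "\<beta> * \<alpha> * kron (I k) (ecol 2 i) = \<beta> * (\<alpha> * kron (I k) (ecol 2 i))" by (simp add: mat_ring)
   also have "... = kron (I k) (ecol 2 i)" using less2_cases[OF i] by (elim disjE) (simp_all only: \<alpha>e 0 1)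
   finally show ?thesis by (simp add: mat_ring)
  qed
 qed simp_all
 moreover have "\<alpha> * kron (I k) sgn2 = G * \<alpha>"
 proof -
  have "G * \<alpha> = r * (kron G sgn2 * kron J (I 2))" by (simp add: \<alpha>_def mult_eq_assoc[OF D(11)] mat_ring)
  thus ?thesis by (simp add: \<alpha>_def kron_ring GJ)
 qed
 ultimately show ?thesis by (intro exI[of _ k] exI[of _ \<alpha>] exI[of _ \<beta>]) simp
qed

lemma S0_clifford_algebra: "module_equivalent SC S0 (mod_cat SC (swalg cm (ecol 2 0) (0\<^sub>m 2 2) sgn2))"
 by (rule clif.odd_equivalent) (rule clifford_free)

section \<open>Indecomposability\<close>

lemma (in left_module_category) act_zero: assumes "X : Obj C" "p : Obj M" "Id C X : Hom C X X"
 shows "ActA M (Id C X) (Zero M p p) = Zero M (ActO M X p) (ActO M X p)"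
proof -
 have z: "Zero M p p : Hom M p p" using assms(2) by (simp add: Hom_iff)
 have "ActA M (Id C X) (Smult M 0 (Zero M p p)) = Smult M 0 (ActA M (Id C X) (Zero M p p))"
  by (rule ActA_Smult_right[OF assms(3) z])
 thus ?thesis
  using zero_smult[of "Zero M p p"] zero_smult[of "ActA M (Id C X) (Zero M p p)"] ActA_Hom[OF assms(3) z] assms(2)
  by (auto simp: Hom_iff)
qed

text \<open>If \<open>w\<close> generates \<open>M\<close> under the action and retracts, its image in one factor of a direct sum
 decomposition vanishes because its only endomorphisms are scalars; hence so does that factor.\<close>

lemma indecomposableI:
 fixes M :: "('x, 'f, 'o, 'a) modcat" assumes C: "strict_monoidal_category C" and M: "module_category C M"
  and w: "w : Obj M" "Id M w \<noteq> Zero M w w"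
  and scalar: "\<And>f. f : Hom M w w ==> \<exists>c. f = Smult M c (Id M w)"
  and gen: "\<And>p. p : Obj M ==> \<exists>X\<in>Obj C. \<exists>i\<in>Hom M p (ActO M X w). \<exists>r\<in>Hom M (ActO M X w) p. Comp M r i = Id M p"
 shows "indecomposable C M" unfolding indecomposable_def
proof (intro conjI notI)
 show "nonzero_category M" using w by (auto simp: nonzero_category_def)
next
 assume "\<exists>(M1 :: ('x, 'f, 'o, 'a) modcat) (M2 :: ('x, 'f, 'o, 'a) modcat). left_module_category C M1 \<and> left_module_category C M2 \<and>
  nonzero_category M1 \<and> nonzero_category M2 \<and> module_equivalent C M (Defs.direct_sum M1 M2)"
 then obtain M1 M2 :: "('x, 'f, 'o, 'a) modcat" where L: "left_module_category C M1" "left_module_category C M2"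
  and nz: "nonzero_category M1" "nonzero_category M2" and eq: "module_equivalent C M (Defs.direct_sum M1 M2)" by blast
 let ?D = "Defs.direct_sum M1 M2"
 interpret M1: left_module_category C M1 by (rule L(1))
 interpret M2: left_module_category C M2 by (rule L(2))
 note m1 = left_imp_module_category[OF C L(1)] and m2 = left_imp_module_category[OF C L(2)]
 note D = direct_sum_module_category[OF m1 m2]
 obtain Fo Fa s where F: "mod_functor C M ?D Fo Fa s" and ff: "ffes M ?D Fo Fa"
  using eq module_equivalent_iff[OF M D] by blast
 interpret F: mod_functor C M ?D Fo Fa s by (rule F)
 interpret FF: ff_functor M ?D Fo Fa
  by (rule ff_functorI[OF F.M.M.linear_category_axioms F.N.M.linear_category_axioms ff])
 obtain w1 w2 where Fw: "Fo w = (w1, w2)" by (cases "Fo w")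
 have wo: "w1 : Obj M1" "w2 : Obj M2" using F.F_obj[OF w(1)] by (simp_all add: Fw)
 \<comment> \<open>The endomorphism that is 1 on the first component of w and 0 on the second; being
   a scalar, it forces one of the components to vanish.\<close>
 obtain f where f: "f : Hom M w w" "Fa f = (Id M1 w1, Zero M2 w2 w2)"
  using FF.full[of "(Id M1 w1, Zero M2 w2 w2)" w w] wo w(1) by (auto simp: Fw Hom_iff)
 obtain z where z: "f = Smult M z (Id M w)" using scalar[OF f(1)] by blast
 have e: "Id M1 w1 = Smult M1 z (Id M1 w1)" "Zero M2 w2 w2 = Smult M2 z (Id M2 w2)"
  using f(2) F.F_smult[of "Id M w" z] w(1) by (simp_all add: z Fw)
 have w0: "Id M1 w1 = Zero M1 w1 w1 \<or> Id M2 w2 = Zero M2 w2 w2"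
 proof (cases "z = 0")
  case True
  thus ?thesis using e(1) M1.zero_smult[of "Id M1 w1"] wo(1) by simp
 next
  case False
  have "Id M2 w2 = Smult M2 (inverse z) (Smult M2 z (Id M2 w2))"
   using M2.smult_smult[of "Id M2 w2" "inverse z" z] M2.smult_one[of "Id M2 w2"] False wo(2) by simp
  also have "... = Smult M2 (inverse z) (Smult M2 0 (Zero M2 w2 w2))"
   unfolding e(2)[symmetric] using M2.zero_smult[of "Zero M2 w2 w2"] wo(2) by simp
  also have "... = Zero M2 w2 w2"
   using M2.smult_smult[of "Zero M2 w2 w2" "inverse z" 0] M2.zero_smult[of "Zero M2 w2 w2"] wo(2) by simp
  finally show ?thesis ..
 qed
 \<comment> \<open>Stated for an abstract projection functor so as to serve both factors. If the
   component of w in K is zero, so is that of every X \<rhd> w and of all retracts of these, hence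
   every object of K.\<close>
 have key: "False" if K: "left_module_category C K" "nonzero_category K" and pr: "linear_functor ?D K \<pi>o \<pi>a"
  and act: "\<And>X p. p : Obj ?D ==> \<pi>o (ActO ?D X p) = ActO K X (\<pi>o p)"
  and sur: "\<And>k. k : Obj K ==> \<exists>p\<in>Obj ?D. \<pi>o p = k"
  and z: "Id K (\<pi>o (Fo w)) = Zero K (\<pi>o (Fo w)) (\<pi>o (Fo w))" for K :: "('x, 'f, 'o, 'a) modcat" and \<pi>o \<pi>a
 proof -
  note direct_sum_simps [simp del]
  interpret K: left_module_category C K by (rule K(1))
  interpret Km: module_category C K by (rule left_imp_module_category[OF C K(1)])
  interpret P: lin_functor ?D K \<pi>o \<pi>a
   by (rule lin_functorI[OF F.N.M.linear_category_axioms K.linear_category_axioms pr])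
  obtain k where k: "k : Obj K" "Id K k \<noteq> Zero K k k" using K(2) by (auto simp: nonzero_category_def)
  obtain d where d: "d : Obj ?D" "\<pi>o d = k" using sur[OF k(1)] by blast
  obtain p g where p [simp]: "p : Obj M" and g: "iso_arr ?D (Fo p) d g" using ff d(1) unfolding ffes_def by blast
  obtain X i r where [simp]: "X : Obj C" and ir: "i : Hom M p (ActO M X w)" "r : Hom M (ActO M X w) p" "Comp M r i = Id M p"
   using gen[OF p] by blast
  have [simp]: "i : Arr M" "Dom M i = p" "Cod M i = ActO M X w" "r : Arr M" "Dom M r = ActO M X w" "Cod M r = p"
   using ir(1,2) by (simp_all add: Hom_iff)
  have zr: "Id K q = Zero K q q" if "j : Arr K" "Dom K j = q" "Cod K j = q'" "t : Arr K" "Dom K t = q'" "Cod K t = q"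
   "Comp K t j = Id K q" "Id K q' = Zero K q' q'" for j t q q'
  proof -
   have [simp]: "q : Obj K" "q' : Obj K" using that K.arr_objs by auto
   have "Id K q = Comp K t (Comp K (Id K q') j)" using that(1-7) by simp
   also have "... = Zero K q q" unfolding that(8) using that(1-6) by (simp add: K.comp_zero_left K.comp_zero_right)
   finally show ?thesis .
  qed
  have w' [simp]: "Fo w : Obj ?D" using w(1) by simp
  have a: "Id K (ActO K X (\<pi>o (Fo w))) = Zero K (ActO K X (\<pi>o (Fo w))) (ActO K X (\<pi>o (Fo w)))"
   using K.act_zero[of X "\<pi>o (Fo w)"] Km.act_id[of X "\<pi>o (Fo w)"] z by (simp add: Hom_iff)
  have "iso_arr K (\<pi>o (Fo (ActO M X w))) (ActO K X (\<pi>o (Fo w))) (\<pi>a (s X w))"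
   using P.F_iso[OF F.s_iso[of X w]] w(1) act[OF w'] by simp
  hence b: "Id K (\<pi>o (Fo (ActO M X w))) = Zero K (\<pi>o (Fo (ActO M X w))) (\<pi>o (Fo (ActO M X w)))"
   by (rule K.iso_arrE) (rule zr[OF _ _ _ _ _ _ _ a])
  have "Id K (\<pi>o (Fo p)) = Zero K (\<pi>o (Fo p)) (\<pi>o (Fo p))"
  proof (rule zr[of "\<pi>a (Fa i)" _ _ "\<pi>a (Fa r)", OF _ _ _ _ _ _ _ b])
   have "Comp K (\<pi>a (Fa r)) (\<pi>a (Fa i)) = \<pi>a (Fa (Comp M r i))" using w(1) by simp
   thus "Comp K (\<pi>a (Fa r)) (\<pi>a (Fa i)) = Id K (\<pi>o (Fo p))" by (simp add: ir(3))
  qed (use w(1) in simp_all)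
  moreover have "iso_arr K (\<pi>o (Fo p)) k (\<pi>a g)" using P.F_iso[OF g] d(2) by simp
  then obtain g' where "\<pi>a g : Arr K" "Dom K (\<pi>a g) = \<pi>o (Fo p)" "Cod K (\<pi>a g) = k" "g' : Arr K" "Dom K g' = k"
   "Cod K g' = \<pi>o (Fo p)" "Comp K (\<pi>a g) g' = Id K k" by (rule K.iso_arrE)
  ultimately have "Id K k = Zero K k k" by (intro zr[of g' k "\<pi>o (Fo p)" "\<pi>a g"])
  thus False using k(2) by simp
 qed
 from w0 show False
 proof
  assume "Id M1 w1 = Zero M1 w1 w1"
  thus False
  proof (intro key[of M1 fst fst, OF L(1) nz(1)])
   show "linear_functor ?D M1 fst fst"
    by (rule linear_functorI[OF F.N.M.linear_category_axioms M1.linear_category_axioms]) auto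
   show "\<exists>p\<in>Obj ?D. fst p = k" if "k : Obj M1" for k using that wo by (intro bexI[of _ "(k, w2)"]) auto
  qed (auto simp: Fw)
 next
  assume "Id M2 w2 = Zero M2 w2 w2"
  thus False
  proof (intro key[of M2 snd snd, OF L(2) nz(2)])
   show "linear_functor ?D M2 snd snd"
    by (rule linear_functorI[OF F.N.M.linear_category_axioms M2.linear_category_axioms]) auto
   show "\<exists>p\<in>Obj ?D. snd p = k" if "k : Obj M2" for k using that wo by (intro bexI[of _ "(w1, k)"]) auto
  qed (auto simp: Fw)
 qed
qed

lemma mat1_scalar: "nr f = Suc 0 ==> nc f = Suc 0 ==> f = f $$ (0, 0) *s I (Suc 0)" for f :: "complex mat"
 by (intro eq_matI) auto

lemma V0_module_category: "module_category SC V0" unfolding V0_def by (rule regular_module_category[OF sw.monoidal])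

text \<open>The unit object generates, as acting on it with p gives p back.\<close>

lemma V0_indecomposable: "indecomposable SC V0"
proof (rule indecomposableI[OF sw.monoidal V0_module_category])
 let ?w = "(0\<^sub>m 1 1, I 1) :: complex mat \<times> complex mat"
 show w: "?w : Obj V0" using sw.I_obj by simp
 show "Id V0 ?w \<noteq> Zero V0 ?w ?w" using one_mat_neq_zero[of 1] by simp
 show "\<exists>z. f = Smult V0 z (Id V0 ?w)" if "f : Hom V0 ?w ?w" for f
  using that mat1_scalar by (cases f) (auto simp: Hom_iff)
 fix p assume p: "p : Obj V0"
 hence "p : SM" by simp
 hence e: "ActO V0 p ?w = p" by simp
 have i: "Id V0 p : Hom V0 p p" using p sw.Id_Hom[of p] by (simp add: Hom_iff)
 have "Comp V0 (Id V0 p) (Id V0 p) = Id V0 p" by (simp add: mat_ring)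
 thus "\<exists>X\<in>Obj SC. \<exists>i\<in>Hom V0 p (ActO V0 X ?w). \<exists>r\<in>Hom V0 (ActO V0 X ?w) p. Comp V0 r i = Id V0 p"
  using p i e by (intro bexI[of _ p] bexI[of _ "Id V0 p"]) simp_all
qed

text \<open>The one-dimensional module with x = 0 generates. The sum of N and -N carries an action
  of Sweedler's algebra in which g exchanges the summands; acting with it on the generator yields
  that sum as a D-module, with N as a summand.\<close>

lemma S0_indecomposable: "indecomposable SC S0"
proof (rule indecomposableI[OF sw.monoidal S0_module_category])
 let ?w = "0\<^sub>m 1 1 :: complex mat"
 show w: "?w : Obj S0" using CM_I[of ?w 1] by (simp add: mat_ring)
 show "Id S0 ?w \<noteq> Zero S0 ?w ?w" using one_mat_neq_zero[of 1] by simp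
 show "\<exists>z. f = Smult S0 z (Id S0 ?w)" if "f : Hom S0 ?w ?w" for f
  using that mat1_scalar by (cases f) (auto simp: Hom_iff)
 fix N assume "N : Obj S0"
 hence N: "N : CM" by simp
 note ND = CM_D[OF N]
 let ?k = "nr N"
 note [simp] = ND(1)
 have V: "(kron sgn2 N, kron swap2 (I ?k)) : SM"
 proof (rule SM_I)
  have "swap2 * sgn2 = (- 1) *s (sgn2 * swap2)" unfolding sgn2_swap2 by (simp add: smult_smult_mat one_smult_mat)
  thus "kron swap2 (I ?k) * kron sgn2 N = (- 1) *s (kron sgn2 N * kron swap2 (I ?k))"
   by (simp add: kron_mult kron_smult_left mat_ring)
 qed (simp_all add: kron_mult ND(2) sgn2_mult swap2_mult kron_zero_right kron_one mat_ring)
 have a: "ActO S0 (kron sgn2 N, kron swap2 (I ?k)) ?w = kron sgn2 N"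
  by (simp add: coideal_act_def kron_one_right kron_zero_right mat_ring)
 have sN: "kron sgn2 N : CM"
  by (rule CM_I[of _ "2 * ?k"]) (simp_all add: kron_mult ND(2) kron_zero_right)
 let ?i = "(N, kron sgn2 N, kron (ecol 2 0) (I ?k))" and ?r = "(kron sgn2 N, N, kron (erow 2 0) (I ?k))"
 have i: "?i : Hom S0 N (kron sgn2 N)"
  using N sN kron_row_slide[of "ecol 2 0" N ?k] by (simp add: Hom_iff kron_mult sgn2_ecol one_smult_mat mat_ring)
 have es: "erow 2 0 * sgn2 = erow 2 0"
  by (rule eq_matI) (auto simp: erow_def sgn2_def scalar_prod_def numeral_2_eq_2 less_Suc_eq)
 have ee: "erow 2 0 * ecol 2 0 = I (Suc 0)"
  by (rule eq_matI) (auto simp: erow_def ecol_def scalar_prod_def numeral_2_eq_2 less_Suc_eq)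
 have r: "?r : Hom S0 (kron sgn2 N) N"
  using N sN kron_mult[of "I (Suc 0)" "erow 2 0" N "I ?k"] by (simp add: Hom_iff kron_mult es mat_ring kron_one_left)
 have ri: "Comp S0 ?r ?i = Id S0 N" by (simp add: kron_mult ee mat_ring kron_one_left)
 have "\<exists>i\<in>Hom S0 N (kron sgn2 N). \<exists>r\<in>Hom S0 (kron sgn2 N) N. Comp S0 r i = Id S0 N"
  using i r ri by blast
 thus "\<exists>X\<in>Obj SC. \<exists>i\<in>Hom S0 N (ActO S0 X ?w). \<exists>r\<in>Hom S0 (ActO S0 X ?w) N. Comp S0 r i = Id S0 N"
  by (intro bexI[of _ "(kron sgn2 N, kron swap2 (I ?k))"]) (simp_all only: a sw.C_simps(1) V)
qed

theorem lemma8p26: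
  shows "(left_module_category sweedler_cat V0 \<and> indecomposable sweedler_cat V0 \<and>
      relatively_projective sweedler_cat V0 \<and> separable sweedler_cat V0) \<and>
    (left_module_category sweedler_cat S0 \<and> indecomposable sweedler_cat S0 \<and>
      relatively_projective sweedler_cat S0 \<and> separable sweedler_cat S0) \<and>
    (\<forall>M :: (smod, sarr, 'o, 'a) modcat.
      left_module_category sweedler_cat M \<and> indecomposable sweedler_cat M \<and>
      relatively_projective sweedler_cat M \<longrightarrow>
      module_equivalent sweedler_cat M V0 \<or> module_equivalent sweedler_cat M S0) \<and>
    (\<forall>M :: (smod, sarr, 'o, 'a) modcat.
      left_module_category sweedler_cat M \<and> indecomposable sweedler_cat M \<and>
      separable sweedler_cat M \<longrightarrow>
      module_equivalent sweedler_cat M V0 \<or> module_equivalent sweedler_cat M S0)"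
proof -
 \<comment> \<open>The two notions agree for each single algebra, so both classification claims
   concern the same module categories.\<close>
 have sep_iff: "relatively_projective_algebra SC A \<longleftrightarrow> separable_algebra SC A"
  if "algebra_in SC A" for A
 proof -
  interpret algebra_object SC A by unfold_locales (rule that)
  show ?thesis using relatively_projective_imp_separable separable_imp_relatively_projective[OF _ sweedler_cat_split_idem] by blast
 qed
 have rp: "relatively_projective SC M \<longleftrightarrow> separable SC M" for M :: "(smod, sarr, 'x, 'y) modcat"
  unfolding relatively_projective_def separable_def using sep_iff by blast
 have "separable SC V0" unfolding separable_def
  using unit_algebra.sweedler_alg unit_algebra.separable V0_unit_algebra by blast
 moreover have "separable SC S0" unfolding separable_def
  using clif.sweedler_alg clif.separable S0_clifford_algebra by blast
 moreover have "module_equivalent SC M V0 \<or> module_equivalent SC M S0"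
  if M: "left_module_category SC M" "indecomposable SC M" and s: "separable SC M"
  for M :: "(smod, sarr, 'o, 'a) modcat"
 proof -
  obtain A where A: "algebra_in SC A" "separable_algebra SC A" "module_equivalent SC M (mod_cat SC A)"
   using s unfolding separable_def by blast
  obtain a m u c X G where "sweedler_algebra a m u c X G" and AA: "A = swalg m u X G"
   by (rule sweedler_algebraE[OF A(1,2)])
  then interpret sweedler_algebra a m u c X G by simp
  show ?thesis by (rule classification[OF M A(3)[unfolded AA]])
 qed
 ultimately show ?thesis
  using V0_left_module_category V0_indecomposable S0_left_module_category S0_indecomposable by (auto simp: rp)
qed

end
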